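(* Let $\Phi$ be a class of lex-weights (with $\mathcal V=\mathbf{Set}$). Then a finitely complete and $\Phi$-lex-cocomplete category $\mathcal C$ is $\Phi$-exact if and only if $\Phi$-lex-colimits are postulated in $\mathcal C$.
   Context: All categories are ordinary locally small categories ($\mathcal V=\mathbf{Set}$); lex means finite-limit-preserving between finitely complete categories. A class of lex-weights $\Phi$ is a collection of functors $\phi:\mathcal K^{op}\to\mathbf{Set}$ with each $\mathcal K$ small and finitely complete; $\Phi[\mathcal K]$ denotes those members with domain $\mathcal K^{op}$. A $\Phi$-lex-colimit is a weighted colimit $\phi\star D$ with $\phi\in\Phi[\mathcal K]$ and $D$ lex with domain $\mathcal K$; $\mathcal C$ is $\Phi$-lex-cocomplete if it is finitely complete and has all $\Phi$-lex-colimits. $\mathcal P\mathcal C$ is the category of small presheaves on $\mathcal C$ (presheaves that are left Kan extensions of their restriction to some small full subcategory), finitely complete if $\mathcal C$ is, and $Y:\mathcal C\to\mathcal P\mathcal C$ is the restricted Yoneda embedding. For finitely complete $\mathcal C$, $\Phi_l\mathcal C$ is the smallest full replete subcategory of $\mathcal P\mathcal C$ containing the representables and closed under finite limits and $\Phi$-lex-colimits, and $W:\mathcal C\to\Phi_l\mathcal C$ is the restricted Yoneda embedding. $\mathcal C$ is $\Phi$-exact if it is finitely complete and $W$ has a finite-limit-preserving left adjoint. Postulatedness: let $\mathcal C$ be finitely complete. A morphism $f:\phi\to\psi$ of $\mathcal P\mathcal C$ is final if every map from $\phi$ to a representable extends uniquely along $f$; it is stably final if all its pullbacks are final. (A map $\phi\to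 YC$ is final just when it exhibits $C$ as the colimit $\phi\star 1_{\mathcal C}$.) The morphism $f:\phi\to\psi$ is postulated if (P1) its image $\mathrm{Im}(f)\rightarrowtail\psi$ is stably final, and (P2) the diagonal $\delta:\phi\rightarrowtail\phi\times_\psi\phi$ is stably final. For $\mathcal C$ finitely complete and $\Phi$-lex-cocomplete, a $\Phi$-lex-colimit morphism is a final morphism of $\mathcal P\mathcal C$ of the form $\mathrm{Lan}_{D^{op}}(\phi)\to Y(\phi\star D)$ for some $\phi\in\Phi[\mathcal K]$ and lex $D:\mathcal K\to\mathcal C$; "$\Phi$-lex-colimits are postulated in $\mathcal C$" means that every $\Phi$-lex-colimit morphism is postulated. *)

theory Defs
  imports "HOL-Library.FuncSet" "HOL-Library.Equipollence"
begin

section \<open>Size\<close>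

text \<open>
  The type \<open>'u\<close> plays the role of the universe: a set (of any type) is \<^emph>\<open>small\<close> if it has
  strictly fewer elements than \<open>'u\<close>. The predicate \<open>universe\<close> says that the cardinality of
  \<open>'u\<close> is strongly inaccessible, so that the small sets form a Grothendieck universe.
\<close>

definition small :: "'u itself \<Rightarrow> 'a set \<Rightarrow> bool" where
  "small _ A \<longleftrightarrow> A \<prec> (UNIV :: 'u set)"

definition universe :: "'u itself \<Rightarrow> bool" where
  "universe U \<longleftrightarrow>
     small U (UNIV :: nat set) \<and>
     (\<forall>A :: 'u set. small U A \<longrightarrow> small U (Pow A)) \<and>
     (\<forall>\<A> :: 'u set set. small U \<A> \<and> (\<forall>A\<in>\<A>. small U A) \<longrightarrow> small U (\<Union>\<A>))"


section \<open>Categories\<close>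

text \<open>
  Homs are indexed by domain and codomain and need not be disjoint; \<open>Cmp C X Y Z g f\<close> is the
  composite of \<open>f : X \<rightarrow> Y\<close> and \<open>g : Y \<rightarrow> Z\<close>. Hence every category with small homs, whatever
  the size of its collection of objects, is isomorphic to one whose homs are sets of elements
  of \<open>'u\<close>.
\<close>

record ('o, 'a) cat =
  Ob :: "'o set"
  Hom :: "'o \<Rightarrow> 'o \<Rightarrow> 'a set"
  Ide :: "'o \<Rightarrow> 'a"
  Cmp :: "'o \<Rightarrow> 'o \<Rightarrow> 'o \<Rightarrow> 'a \<Rightarrow> 'a \<Rightarrow> 'a"

locale category =
  fixes C :: "('o, 'a) cat"
  assumes Hom_Ob: "f \<in> Hom C X Y \<Longrightarrow> X \<in> Ob C \<and> Y \<in> Ob C"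
    and Ide_Hom: "X \<in> Ob C \<Longrightarrow> Ide C X \<in> Hom C X X"
    and Cmp_Hom: "f \<in> Hom C X Y \<Longrightarrow> g \<in> Hom C Y Z \<Longrightarrow> Cmp C X Y Z g f \<in> Hom C X Z"
    and Cmp_Ide_right: "f \<in> Hom C X Y \<Longrightarrow> Cmp C X X Y f (Ide C X) = f"
    and Cmp_Ide_left: "f \<in> Hom C X Y \<Longrightarrow> Cmp C X Y Y (Ide C Y) f = f"
    and Cmp_assoc: "f \<in> Hom C X Y \<Longrightarrow> g \<in> Hom C Y Z \<Longrightarrow> h \<in> Hom C Z W \<Longrightarrow>
      Cmp C X Y W (Cmp C Y Z W h g) f = Cmp C X Z W h (Cmp C X Y Z g f)"

definition locally_small :: "('o, 'u) cat \<Rightarrow> bool" where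
  "locally_small C \<longleftrightarrow> (\<forall>X\<in>Ob C. \<forall>Y\<in>Ob C. small TYPE('u) (Hom C X Y))"

definition opp :: "('o, 'a) cat \<Rightarrow> ('o, 'a) cat" where
  "opp C = \<lparr>Ob = Ob C, Hom = (\<lambda>X Y. Hom C Y X), Ide = Ide C,
            Cmp = (\<lambda>X Y Z g f. Cmp C Z Y X f g)\<rparr>"

definition full_sub :: "('o, 'a) cat \<Rightarrow> 'o set \<Rightarrow> ('o, 'a) cat" where
  "full_sub C S = \<lparr>Ob = Ob C \<inter> S, Hom = (\<lambda>X Y. if X \<in> S \<and> Y \<in> S then Hom C X Y else {}),
                   Ide = Ide C, Cmp = Cmp C\<rparr>"

definition isomorphic :: "('o, 'a) cat \<Rightarrow> 'o \<Rightarrow> 'o \<Rightarrow> bool" where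
  "isomorphic C X Y \<longleftrightarrow> (\<exists>f\<in>Hom C X Y. \<exists>g\<in>Hom C Y X.
     X \<in> Ob C \<and> Y \<in> Ob C \<and> Cmp C X Y X g f = Ide C X \<and> Cmp C Y X Y f g = Ide C Y)"

definition mono_arrow :: "('o, 'a) cat \<Rightarrow> 'o \<Rightarrow> 'o \<Rightarrow> 'a \<Rightarrow> bool" where
  "mono_arrow C X Y m \<longleftrightarrow> m \<in> Hom C X Y \<and>
     (\<forall>Z\<in>Ob C. \<forall>g\<in>Hom C Z X. \<forall>h\<in>Hom C Z X. Cmp C Z X Y m g = Cmp C Z X Y m h \<longrightarrow> g = h)"

text \<open>\<open>m : I \<rightarrow> Y\<close> is the image of \<open>f : X \<rightarrow> Y\<close>: the least subobject of \<open>Y\<close> through which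
  \<open>f\<close> factors.\<close>

definition is_image :: "('o, 'a) cat \<Rightarrow> 'o \<Rightarrow> 'o \<Rightarrow> 'a \<Rightarrow> 'o \<Rightarrow> 'a \<Rightarrow> bool" where
  "is_image C X Y f I m \<longleftrightarrow> f \<in> Hom C X Y \<and> mono_arrow C I Y m \<and>
     (\<exists>e\<in>Hom C X I. Cmp C X I Y m e = f) \<and>
     (\<forall>I' m'. mono_arrow C I' Y m' \<and> (\<exists>e\<in>Hom C X I'. Cmp C X I' Y m' e = f) \<longrightarrow>
        (\<exists>k\<in>Hom C I I'. Cmp C I I' Y m' k = m))"

text \<open>\<open>p : P \<rightarrow> X\<close> and \<open>q : P \<rightarrow> Y\<close> form a pullback of \<open>f : X \<rightarrow> Z\<close> and \<open>g : Y \<rightarrow> Z\<close>.\<close>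

definition is_pullback ::
  "('o, 'a) cat \<Rightarrow> 'o \<Rightarrow> 'o \<Rightarrow> 'o \<Rightarrow> 'a \<Rightarrow> 'a \<Rightarrow> 'o \<Rightarrow> 'a \<Rightarrow> 'a \<Rightarrow> bool" where
  "is_pullback C X Y Z f g P p q \<longleftrightarrow>
     f \<in> Hom C X Z \<and> g \<in> Hom C Y Z \<and> p \<in> Hom C P X \<and> q \<in> Hom C P Y \<and>
     Cmp C P X Z f p = Cmp C P Y Z g q \<and>
     (\<forall>Q\<in>Ob C. \<forall>a\<in>Hom C Q X. \<forall>b\<in>Hom C Q Y. Cmp C Q X Z f a = Cmp C Q Y Z g b \<longrightarrow>
        (\<exists>!h. h \<in> Hom C Q P \<and> Cmp C Q P X p h = a \<and> Cmp C Q P Y q h = b))"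


section \<open>Functors and natural transformations\<close>

text \<open>
  Only the values on objects and arrows of the domain matter: functors which agree there, but
  differ as HOL functions, are isomorphic as objects of the functor category.
\<close>

record ('o, 'a, 'p, 'b) fctr =
  fo :: "'o \<Rightarrow> 'p"
  fa :: "'o \<Rightarrow> 'o \<Rightarrow> 'a \<Rightarrow> 'b"

definition is_functor :: "('o, 'a) cat \<Rightarrow> ('p, 'b) cat \<Rightarrow> ('o, 'a, 'p, 'b) fctr \<Rightarrow> bool" where
  "is_functor C D F \<longleftrightarrow> category C \<and> category D \<and>
     (\<forall>X\<in>Ob C. fo F X \<in> Ob D) \<and>
     (\<forall>X\<in>Ob C. \<forall>Y\<in>Ob C. \<forall>f\<in>Hom C X Y. fa F X Y f \<in> Hom D (fo F X) (fo F Y)) \<and>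
     (\<forall>X\<in>Ob C. fa F X X (Ide C X) = Ide D (fo F X)) \<and>
     (\<forall>X\<in>Ob C. \<forall>Y\<in>Ob C. \<forall>Z\<in>Ob C. \<forall>f\<in>Hom C X Y. \<forall>g\<in>Hom C Y Z.
        fa F X Z (Cmp C X Y Z g f) =
        Cmp D (fo F X) (fo F Y) (fo F Z) (fa F Y Z g) (fa F X Y f))"

definition fcomp :: "('p, 'b, 'q, 'c) fctr \<Rightarrow> ('o, 'a, 'p, 'b) fctr \<Rightarrow> ('o, 'a, 'q, 'c) fctr" where
  "fcomp G F = \<lparr>fo = (\<lambda>X. fo G (fo F X)),
                fa = (\<lambda>X Y f. fa G (fo F X) (fo F Y) (fa F X Y f))\<rparr>"

definition fop :: "('o, 'a, 'p, 'b) fctr \<Rightarrow> ('o, 'a, 'p, 'b) fctr" where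
  "fop F = \<lparr>fo = fo F, fa = (\<lambda>X Y f. fa F Y X f)\<rparr>"

definition inclusion :: "('o, 'a, 'o, 'a) fctr" where
  "inclusion = \<lparr>fo = (\<lambda>X. X), fa = (\<lambda>X Y f. f)\<rparr>"

definition nat_trans ::
  "('o, 'a) cat \<Rightarrow> ('p, 'b) cat \<Rightarrow> ('o, 'a, 'p, 'b) fctr \<Rightarrow> ('o, 'a, 'p, 'b) fctr \<Rightarrow> ('o \<Rightarrow> 'b) \<Rightarrow> bool"
  where
  "nat_trans C D F G t \<longleftrightarrow> is_functor C D F \<and> is_functor C D G \<and>
     (\<forall>X\<in>Ob C. t X \<in> Hom D (fo F X) (fo G X)) \<and>
     (\<forall>X\<in>Ob C. \<forall>Y\<in>Ob C. \<forall>f\<in>Hom C X Y.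
        Cmp D (fo F X) (fo F Y) (fo G Y) (t Y) (fa F X Y f) =
        Cmp D (fo F X) (fo G X) (fo G Y) (fa G X Y f) (t X))"

definition functor_cat ::
  "('o, 'a) cat \<Rightarrow> ('p, 'b) cat \<Rightarrow> (('o, 'a, 'p, 'b) fctr, 'o \<Rightarrow> 'b) cat" where
  "functor_cat C D =
     \<lparr>Ob = {F. is_functor C D F},
      Hom = (\<lambda>F G. {t \<in> extensional (Ob C). nat_trans C D F G t}),
      Ide = (\<lambda>F. \<lambda>X\<in>Ob C. Ide D (fo F X)),
      Cmp = (\<lambda>F G H s t. \<lambda>X\<in>Ob C. Cmp D (fo F X) (fo G X) (fo H X) (s X) (t X))\<rparr>"

text \<open>Naturality of the bijection \<open>C(L X, A) \<cong> D(X, R A)\<close> in both variables is stated at once.\<close>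

definition left_adjoint ::
  "('o, 'a) cat \<Rightarrow> ('p, 'b) cat \<Rightarrow> ('p, 'b, 'o, 'a) fctr \<Rightarrow> ('o, 'a, 'p, 'b) fctr \<Rightarrow> bool" where
  "left_adjoint C D L R \<longleftrightarrow> is_functor D C L \<and> is_functor C D R \<and>
     (\<exists>\<theta>. (\<forall>X\<in>Ob D. \<forall>A\<in>Ob C. bij_betw (\<theta> X A) (Hom C (fo L X) A) (Hom D X (fo R A))) \<and>
          (\<forall>X\<in>Ob D. \<forall>X'\<in>Ob D. \<forall>A\<in>Ob C. \<forall>A'\<in>Ob C.
             \<forall>h\<in>Hom D X' X. \<forall>k\<in>Hom C (fo L X) A. \<forall>g\<in>Hom C A A'.
               \<theta> X' A' (Cmp C (fo L X') A A' g (Cmp C (fo L X') (fo L X) A k (fa L X' X h))) =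
               Cmp D X' (fo R A) (fo R A') (fa R A A' g) (Cmp D X' X (fo R A) (\<theta> X A k) h)))"

text \<open>\<open>(L, \<eta>)\<close> is a left Kan extension of \<open>F : A \<rightarrow> E\<close> along \<open>K : A \<rightarrow> B\<close>.\<close>

definition is_lan ::
  "('o, 'a) cat \<Rightarrow> ('p, 'b) cat \<Rightarrow> ('q, 'c) cat \<Rightarrow> ('o, 'a, 'p, 'b) fctr \<Rightarrow> ('o, 'a, 'q, 'c) fctr \<Rightarrow>
   ('p, 'b, 'q, 'c) fctr \<Rightarrow> ('o \<Rightarrow> 'c) \<Rightarrow> bool" where
  "is_lan A B E K F L \<eta> \<longleftrightarrow>
     is_functor A B K \<and> is_functor B E L \<and> nat_trans A E F (fcomp L K) \<eta> \<and>
     (\<forall>G \<alpha>. is_functor B E G \<and> nat_trans A E F (fcomp G K) \<alpha> \<longrightarrow>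
        (\<exists>!\<beta>. \<beta> \<in> Hom (functor_cat B E) L G \<and>
           (\<forall>a\<in>Ob A. Cmp E (fo F a) (fo L (fo K a)) (fo G (fo K a)) (\<beta> (fo K a)) (\<eta> a) = \<alpha> a)))"


section \<open>Finite limits\<close>

definition finite_category :: "('o, 'a) cat \<Rightarrow> bool" where
  "finite_category J \<longleftrightarrow> category J \<and> finite (Ob J) \<and> (\<forall>i\<in>Ob J. \<forall>j\<in>Ob J. finite (Hom J i j))"

definition is_cone ::
  "('j, 'i) cat \<Rightarrow> ('o, 'a) cat \<Rightarrow> ('j, 'i, 'o, 'a) fctr \<Rightarrow> 'o \<Rightarrow> ('j \<Rightarrow> 'a) \<Rightarrow> bool" where
  "is_cone J C G L \<pi> \<longleftrightarrow> L \<in> Ob C \<and> (\<forall>j\<in>Ob J. \<pi> j \<in> Hom C L (fo G j)) \<and>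
     (\<forall>i\<in>Ob J. \<forall>j\<in>Ob J. \<forall>u\<in>Hom J i j. Cmp C L (fo G i) (fo G j) (fa G i j u) (\<pi> i) = \<pi> j)"

definition is_limit ::
  "('j, 'i) cat \<Rightarrow> ('o, 'a) cat \<Rightarrow> ('j, 'i, 'o, 'a) fctr \<Rightarrow> 'o \<Rightarrow> ('j \<Rightarrow> 'a) \<Rightarrow> bool" where
  "is_limit J C G L \<pi> \<longleftrightarrow> is_cone J C G L \<pi> \<and>
     (\<forall>X \<sigma>. is_cone J C G X \<sigma> \<longrightarrow>
        (\<exists>!h. h \<in> Hom C X L \<and> (\<forall>j\<in>Ob J. Cmp C X L (fo G j) (\<pi> j) h = \<sigma> j)))"

text \<open>Every finite category is isomorphic to one whose objects and arrows are natural numbers.\<close>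

definition finitely_complete :: "('o, 'a) cat \<Rightarrow> bool" where
  "finitely_complete C \<longleftrightarrow> category C \<and>
     (\<forall>(J :: (nat, nat) cat) G. finite_category J \<and> is_functor J C G \<longrightarrow>
        (\<exists>L \<pi>. is_limit J C G L \<pi>))"

definition preserves_finite_limits ::
  "('o, 'a) cat \<Rightarrow> ('p, 'b) cat \<Rightarrow> ('o, 'a, 'p, 'b) fctr \<Rightarrow> bool" where
  "preserves_finite_limits C D F \<longleftrightarrow>
     (\<forall>(J :: (nat, nat) cat) G L \<pi>.
        finite_category J \<and> is_functor J C G \<and> is_limit J C G L \<pi> \<longrightarrow>
        is_limit J D (fcomp F G) (fo F L) (\<lambda>j. fa F L (fo G j) (\<pi> j)))"

definition lex_functor ::
  "('o, 'a) cat \<Rightarrow> ('p, 'b) cat \<Rightarrow> ('o, 'a, 'p, 'b) fctr \<Rightarrow> bool" where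
  "lex_functor C D F \<longleftrightarrow> finitely_complete C \<and> finitely_complete D \<and> is_functor C D F \<and>
     preserves_finite_limits C D F"


section \<open>Small presheaves\<close>

definition Set_cat :: "('u set, 'u \<Rightarrow> 'u) cat" where
  "Set_cat = \<lparr>Ob = {A. small TYPE('u) A},
              Hom = (\<lambda>A B. if small TYPE('u) A \<and> small TYPE('u) B then A \<rightarrow>\<^sub>E B else {}),
              Ide = (\<lambda>A. \<lambda>x\<in>A. x),
              Cmp = (\<lambda>A B D g f. compose A g f)\<rparr>"

text \<open>Contravariance: for \<open>f : X \<rightarrow> Y\<close> in \<open>C\<close> a presheaf \<open>F\<close> acts by
  \<open>fa F Y X f : fo F Y \<rightarrow> fo F X\<close>.\<close>

type_synonym ('o, 'u) presheaf = "('o, 'u, 'u set, 'u \<Rightarrow> 'u) fctr"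

definition small_presheaf :: "('o, 'u) cat \<Rightarrow> ('o, 'u) presheaf \<Rightarrow> bool" where
  "small_presheaf C F \<longleftrightarrow> is_functor (opp C) Set_cat F \<and>
     (\<exists>S. S \<subseteq> Ob C \<and> small TYPE('u) S \<and>
        is_lan (opp (full_sub C S)) (opp C) Set_cat inclusion (fcomp F inclusion) F
          (\<lambda>X. Ide Set_cat (fo F X)))"

definition PSh :: "('o, 'u) cat \<Rightarrow> (('o, 'u) presheaf, 'o \<Rightarrow> 'u \<Rightarrow> 'u) cat" where
  "PSh C = full_sub (functor_cat (opp C) Set_cat) {F. small_presheaf C F}"

definition yoneda :: "('o, 'u) cat \<Rightarrow> ('o, 'u, ('o, 'u) presheaf, 'o \<Rightarrow> 'u \<Rightarrow> 'u) fctr" where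
  "yoneda C =
     \<lparr>fo = (\<lambda>A. \<lparr>fo = (\<lambda>X. Hom C X A), fa = (\<lambda>Y X f. \<lambda>g\<in>Hom C Y A. Cmp C X Y A g f)\<rparr>),
      fa = (\<lambda>A B h. \<lambda>X\<in>Ob C. \<lambda>g\<in>Hom C X A. Cmp C X A B h g)\<rparr>"


section \<open>Lex-weights and lex-colimits\<close>

text \<open>A weight is a pair \<open>(K, \<phi>)\<close> with \<open>\<phi> : K\<^sup>o\<^sup>p \<rightarrow> Set\<close>; up to isomorphism a small category
  has its objects and arrows in \<open>'u\<close>.\<close>

type_synonym 'u weight = "('u, 'u) cat \<times> ('u, 'u) presheaf"

definition lex_weight :: "'u weight \<Rightarrow> bool" where
  "lex_weight = (\<lambda>(K, \<phi>). finitely_complete K \<and> small TYPE('u) (Ob K) \<and> locally_small K \<and>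
     is_functor (opp K) Set_cat \<phi>)"

text \<open>A weighted cocone is a natural transformation \<open>\<sigma> : \<phi> \<rightarrow> C(D-, X)\<close>, and a colimit
  \<open>\<phi> \<star> D\<close> is a representation of \<open>X \<mapsto> [K\<^sup>o\<^sup>p, Set](\<phi>, C(D-, X))\<close>, given by its universal
  element.\<close>

definition weighted_cocone ::
  "('k, 'i) cat \<Rightarrow> ('k, 'i, 'u set, 'u \<Rightarrow> 'u) fctr \<Rightarrow> ('o, 'a) cat \<Rightarrow> ('k, 'i, 'o, 'a) fctr \<Rightarrow>
   'o \<Rightarrow> ('k \<Rightarrow> 'u \<Rightarrow> 'a) \<Rightarrow> bool" where
  "weighted_cocone K \<phi> C D X \<sigma> \<longleftrightarrow> X \<in> Ob C \<and>
     (\<forall>k\<in>Ob K. \<forall>x\<in>fo \<phi> k. \<sigma> k x \<in> Hom C (fo D k) X) \<and>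
     (\<forall>k\<in>Ob K. \<forall>l\<in>Ob K. \<forall>f\<in>Hom K k l. \<forall>x\<in>fo \<phi> l.
        \<sigma> k (fa \<phi> l k f x) = Cmp C (fo D k) (fo D l) X (\<sigma> l x) (fa D k l f))"

definition is_weighted_colimit ::
  "('k, 'i) cat \<Rightarrow> ('k, 'i, 'u set, 'u \<Rightarrow> 'u) fctr \<Rightarrow> ('o, 'a) cat \<Rightarrow> ('k, 'i, 'o, 'a) fctr \<Rightarrow>
   'o \<Rightarrow> ('k \<Rightarrow> 'u \<Rightarrow> 'a) \<Rightarrow> bool" where
  "is_weighted_colimit K \<phi> C D A \<eta> \<longleftrightarrow> weighted_cocone K \<phi> C D A \<eta> \<and>
     (\<forall>X \<sigma>. weighted_cocone K \<phi> C D X \<sigma> \<longrightarrow>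
        (\<exists>!h. h \<in> Hom C A X \<and>
           (\<forall>k\<in>Ob K. \<forall>x\<in>fo \<phi> k. Cmp C (fo D k) A X h (\<eta> k x) = \<sigma> k x)))"

definition lex_cocomplete :: "'u weight set \<Rightarrow> ('o, 'a) cat \<Rightarrow> bool" where
  "lex_cocomplete \<Phi> C \<longleftrightarrow> finitely_complete C \<and>
     (\<forall>(K, \<phi>)\<in>\<Phi>. \<forall>D. lex_functor K C D \<longrightarrow> (\<exists>A \<eta>. is_weighted_colimit K \<phi> C D A \<eta>))"


section \<open>Exactness\<close>

text \<open>The objects of \<open>\<Phi>\<^sub>l C\<close>.\<close>

inductive_set lex_closure :: "'u weight set \<Rightarrow> ('o, 'u) cat \<Rightarrow> ('o, 'u) presheaf set"
  for \<Phi> :: "'u weight set" and C :: "('o, 'u) cat" where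
  representable: "A \<in> Ob C \<Longrightarrow> fo (yoneda C) A \<in> lex_closure \<Phi> C"
| replete: "X \<in> lex_closure \<Phi> C \<Longrightarrow> isomorphic (PSh C) X Y \<Longrightarrow> Y \<in> lex_closure \<Phi> C"
| finite_limit: "finite_category (J :: (nat, nat) cat) \<Longrightarrow> is_functor J (PSh C) G \<Longrightarrow>
    (\<And>j. j \<in> Ob J \<Longrightarrow> fo G j \<in> lex_closure \<Phi> C) \<Longrightarrow> is_limit J (PSh C) G L \<pi> \<Longrightarrow>
    L \<in> lex_closure \<Phi> C"
| lex_colimit: "(K, \<phi>) \<in> \<Phi> \<Longrightarrow> lex_functor K (PSh C) D \<Longrightarrow>
    (\<And>k. k \<in> Ob K \<Longrightarrow> fo D k \<in> lex_closure \<Phi> C) \<Longrightarrow>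
    is_weighted_colimit K \<phi> (PSh C) D X \<eta> \<Longrightarrow> X \<in> lex_closure \<Phi> C"

definition lex_cocompletion ::
  "'u weight set \<Rightarrow> ('o, 'u) cat \<Rightarrow> (('o, 'u) presheaf, 'o \<Rightarrow> 'u \<Rightarrow> 'u) cat" where
  "lex_cocompletion \<Phi> C = full_sub (PSh C) (lex_closure \<Phi> C)"

definition lex_exact :: "'u weight set \<Rightarrow> ('o, 'u) cat \<Rightarrow> bool" where
  "lex_exact \<Phi> C \<longleftrightarrow> finitely_complete C \<and>
     (\<exists>L. left_adjoint C (lex_cocompletion \<Phi> C) L (yoneda C) \<and>
          preserves_finite_limits (lex_cocompletion \<Phi> C) C L)"


section \<open>Postulatedness\<close>

definition final :: "('o, 'u) cat \<Rightarrow> ('o, 'u) presheaf \<Rightarrow> ('o, 'u) presheaf \<Rightarrow> ('o \<Rightarrow> 'u \<Rightarrow> 'u) \<Rightarrow> bool"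
  where
  "final C X Y f \<longleftrightarrow> f \<in> Hom (PSh C) X Y \<and>
     (\<forall>A\<in>Ob C. \<forall>g\<in>Hom (PSh C) X (fo (yoneda C) A).
        \<exists>!h. h \<in> Hom (PSh C) Y (fo (yoneda C) A) \<and> Cmp (PSh C) X Y (fo (yoneda C) A) h f = g)"

definition stably_final ::
  "('o, 'u) cat \<Rightarrow> ('o, 'u) presheaf \<Rightarrow> ('o, 'u) presheaf \<Rightarrow> ('o \<Rightarrow> 'u \<Rightarrow> 'u) \<Rightarrow> bool" where
  "stably_final C X Y f \<longleftrightarrow> f \<in> Hom (PSh C) X Y \<and>
     (\<forall>Z g P p q. is_pullback (PSh C) X Z Y f g P p q \<longrightarrow> final C P Z q)"

definition postulated ::
  "('o, 'u) cat \<Rightarrow> ('o, 'u) presheaf \<Rightarrow> ('o, 'u) presheaf \<Rightarrow> ('o \<Rightarrow> 'u \<Rightarrow> 'u) \<Rightarrow> bool" where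
  "postulated C X Y f \<longleftrightarrow>
     (\<exists>I m. is_image (PSh C) X Y f I m \<and> stably_final C I Y m) \<and>
     (\<exists>R p q \<delta>. is_pullback (PSh C) X X Y f f R p q \<and> \<delta> \<in> Hom (PSh C) X R \<and>
        Cmp (PSh C) X R X p \<delta> = Ide (PSh C) X \<and> Cmp (PSh C) X R X q \<delta> = Ide (PSh C) X \<and>
        stably_final C X R \<delta>)"

definition lex_colimit_morphism ::
  "'u weight set \<Rightarrow> ('o, 'u) cat \<Rightarrow> ('o, 'u) presheaf \<Rightarrow> ('o, 'u) presheaf \<Rightarrow> ('o \<Rightarrow> 'u \<Rightarrow> 'u) \<Rightarrow> bool"
  where
  "lex_colimit_morphism \<Phi> C X Y f \<longleftrightarrow> final C X Y f \<and>
     (\<exists>(K, \<phi>)\<in>\<Phi>. \<exists>D. lex_functor K C D \<and>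
        (\<exists>\<eta>. is_lan (opp K) (opp C) Set_cat (fop D) \<phi> X \<eta>) \<and>
        (\<exists>A \<sigma>. is_weighted_colimit K \<phi> C D A \<sigma> \<and> Y = fo (yoneda C) A))"

definition lex_colimits_postulated :: "'u weight set \<Rightarrow> ('o, 'u) cat \<Rightarrow> bool" where
  "lex_colimits_postulated \<Phi> C \<longleftrightarrow>
     (\<forall>X Y f. lex_colimit_morphism \<Phi> C X Y f \<longrightarrow> postulated C X Y f)"

end

theory Submission
  imports Defs
begin

text \<open>
  Call a morphism of small presheaves bicovering if it is locally surjective and locally injective
  for the canonical topology of \<open>C\<close>. A morphism is postulated if and only if it is bicovering.
  Representables are sheaves, so bicovering morphisms are final; moreover they are closed under
  composition, pullbacks, finite limits and colimits.

  If \<open>\<Phi>\<close>-lex-colimits are postulated, it follows that the presheaves which admit a bicovering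
  morphism to a representable contain \<open>\<Phi>\<^sub>l C\<close>, and that these morphisms are the units of a reflection
  onto the representables which preserves finite limits. Conversely, a lex left adjoint \<open>L\<close> of \<open>W\<close>
  inverts exactly the final morphisms of \<open>\<Phi>\<^sub>l C\<close>, which are therefore stable under pullback in
  \<open>\<Phi>\<^sub>l C\<close>. Pulling back a final morphism and its diagonal along morphisms out of representables
  shows that it is bicovering.

  The site need not be small, so there is no sheafification to appeal to, and closure under colimits
  is proved by lifting zigzags step by step. All limits and images are pointwise, because over a
  finitely complete \<open>C\<close> a presheaf is small if and only if it has a small set of generators and the
  sieve on which any two of its elements agree is generated by a small set.
\<close>

section \<open>Small sets\<close>

text \<open>The proof works with elements because a subobject of a representable is a sieve. (P1)
  and (P2) ask that two monomorphisms be stably final, and a monomorphism of small presheaves is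
  stably final exactly when the sieves which it cuts out at all elements of its codomain are
  universally effective-epimorphic. Hence the canonical topology is the right one. From
  postulatedness to exactness, the obstacle is an induction over \<Phi>_l C whose step for
  \<Phi>-lex-colimits needs more than reflections of the presheaves in the diagram: to apply the
  hypothesis in \<open>C\<close>, the diagram of reflections has to be lex itself. The reflector is
  therefore defined on all presheaves with a bicovering morphism to a representable and shown to be
  lex there, before \<Phi>_l C is known to consist of such presheaves. In the other direction
  finality is stable only under pullbacks inside \<Phi>_l C, whereas (P1) and (P2) quantify over all
  of \<open>PSh C\<close>. Covers mediate between the two, as they are detected by pullbacks along
  maps out of representables.\<close>

lemma small_lepoll: "small U A \<Longrightarrow> B \<lesssim> A \<Longrightarrow> small U B"
  unfolding small_def using lesspoll_trans1 by blast

lemma small_subset: "small U A \<Longrightarrow> B \<subseteq> A \<Longrightarrow> small U B"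
  using small_lepoll subset_imp_lepoll by blast

lemma small_image: "small U A \<Longrightarrow> small U (f ` A)"
  using small_lepoll image_lepoll by blast

lemma small_embedding:
  fixes A :: "'a set"
  assumes "small TYPE('u) A"
  obtains e :: "'a \<Rightarrow> 'u" where "inj_on e A"
  using assms unfolding small_def lesspoll_def lepoll_def by blast

lemma small_finite:
  assumes "universe (U :: 'u itself)" "finite A"
  shows "small U A"
proof -
  have "A \<prec> (UNIV :: nat set)" using finite_lesspoll_infinite[OF infinite_UNIV_nat assms(2)] .
  then show ?thesis using assms(1) unfolding universe_def small_def by (meson lesspoll_trans)
qed

text \<open>\<open>universe\<close> speaks of subsets of \<open>'u\<close> alone, so elements of
  products have to be coded in \<open>'u\<close>. Smallness of the natural numbers makes
  \<open>'u\<close> infinite, and an infinite set is equipollent to its square.\<close>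

lemma universe_pairing:
  assumes "universe TYPE('u)"
  obtains p :: "'u \<times> 'u \<Rightarrow> 'u" where "inj p"
proof -
  have "infinite (UNIV :: 'u set)"
    using assms infinite_le_lepoll lesspoll_imp_lepoll unfolding universe_def small_def by blast
  then have "(UNIV :: 'u set) \<times> (UNIV :: 'u set) \<approx> (UNIV :: 'u set)"
    unfolding eqpoll_iff_card_of_ordIso by (rule card_of_Times_same_infinite)
  then have "\<exists>p :: 'u \<times> 'u \<Rightarrow> 'u. inj p"
    unfolding eqpoll_def UNIV_Times_UNIV bij_betw_def by blast
  then show ?thesis using that by blast
qed

text \<open>The union axiom covers only families of subsets of \<open>'u\<close>. Each fibre is
  therefore coded by pairing a code of its index with a code of its element; the coded fibres form a
  small family of small sets, and the sum injects into their union.\<close>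

lemma small_Sigma:
  fixes A :: "'a set" and B :: "'a \<Rightarrow> 'b set"
  assumes U: "universe TYPE('u)" and A: "small TYPE('u) A" and B: "\<And>a. a \<in> A \<Longrightarrow> small TYPE('u) (B a)"
  shows "small TYPE('u) (Sigma A B)"
proof -
  obtain p :: "'u \<times> 'u \<Rightarrow> 'u" where p: "inj p" using universe_pairing[OF U] .
  obtain g :: "'a \<Rightarrow> 'u" where g: "inj_on g A" using small_embedding[OF A] .
  have "\<exists>h :: 'b \<Rightarrow> 'u. inj_on h (B a)" if "a \<in> A" for a using small_embedding[OF B[OF that]] by blast
  then obtain h :: "'a \<Rightarrow> 'b \<Rightarrow> 'u" where h: "\<And>a. a \<in> A \<Longrightarrow> inj_on (h a) (B a)" by metis
  define F where "F a = (\<lambda>b. p (g a, h a b)) ` B a" for a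
  have "small TYPE('u) (F a)" if "a \<in> A" for a
    unfolding F_def by (intro small_image B that)
  then have "small TYPE('u) (\<Union>(F ` A))"
    using U small_image[OF A, of F] unfolding universe_def by blast
  moreover have "inj_on (\<lambda>(a, b). p (g a, h a b)) (Sigma A B)"
    using g h by (auto simp: inj_on_def inj_eq[OF p])
  moreover have "(\<lambda>(a, b). p (g a, h a b)) ` Sigma A B \<subseteq> \<Union>(F ` A)"
    unfolding F_def by auto
  ultimately show ?thesis
    by (meson lepoll_def small_lepoll)
qed

lemma small_UN:
  assumes "universe TYPE('u)" "small TYPE('u) A" "\<And>a. a \<in> A \<Longrightarrow> small TYPE('u) (B a)"
  shows "small TYPE('u) (\<Union>a\<in>A. B a)"
proof -
  have "(\<Union>a\<in>A. B a) = snd ` Sigma A B" by force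
  then show ?thesis using small_image[OF small_Sigma[OF assms], where f=snd] by simp
qed

lemma small_Times:
  "universe TYPE('u) \<Longrightarrow> small TYPE('u) A \<Longrightarrow> small TYPE('u) B \<Longrightarrow> small TYPE('u) (A \<times> B)"
  by (rule small_Sigma)

lemma small_PiE:
  assumes U: "universe TYPE('u)" and "finite I" "\<And>i. i \<in> I \<Longrightarrow> small TYPE('u) (E i)"
  shows "small TYPE('u) (PiE I E)"
  using assms(2,3)
proof (induction I)
  case empty
  show ?case by (rule small_finite[OF U]) simp
next
  case (insert i I)
  then show ?case by (simp add: PiE_insert_eq small_image small_Times[OF U])
qed

lemma small_Un:
  assumes "universe TYPE('u)" "small TYPE('u) A" "small TYPE('u) B"
  shows "small TYPE('u) (A \<union> B)"
proof -
  have "small TYPE('u) (\<Union>b\<in>{True, False}. if b then A else B)"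
    by (rule small_UN[OF assms(1) small_finite[OF assms(1)]]) (use assms in auto)
  moreover have "(\<Union>b\<in>{True, False}. if b then A else B) = A \<union> B" by auto
  ultimately show ?thesis by simp
qed

section \<open>Categories and functors\<close>

lemma opp_simps [simp]:
  "Ob (opp C) = Ob C" "Hom (opp C) X Y = Hom C Y X" "Ide (opp C) = Ide C"
  "Cmp (opp C) X Y Z g f = Cmp C Z Y X f g"
  by (simp_all add: opp_def)

lemma full_sub_simps [simp]:
  "Ob (full_sub C S) = Ob C \<inter> S"
  "Hom (full_sub C S) X Y = (if X \<in> S \<and> Y \<in> S then Hom C X Y else {})"
  "Ide (full_sub C S) = Ide C" "Cmp (full_sub C S) = Cmp C"
  by (simp_all add: full_sub_def)

lemma full_sub_UNIV [simp]: "full_sub C UNIV = C"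
  by (simp add: full_sub_def)

lemma category_opp: "category C \<Longrightarrow> category (opp C)"
  unfolding category_def by simp

lemma category_full_sub: "category C \<Longrightarrow> category (full_sub C S)"
  unfolding category_def by (auto split: if_splits)

lemma fcomp_simps [simp]:
  "fo (fcomp G F) X = fo G (fo F X)"
  "fa (fcomp G F) X Y f = fa G (fo F X) (fo F Y) (fa F X Y f)"
  by (simp_all add: fcomp_def)

lemma fop_simps [simp]: "fo (fop F) = fo F" "fa (fop F) X Y f = fa F Y X f"
  by (simp_all add: fop_def)

lemma inclusion_simps [simp]: "fo inclusion X = X" "fa inclusion X Y f = f"
  by (simp_all add: inclusion_def)

text \<open>An arrow in a hom-set has its ends among the objects, which removes the quantifiers over
  objects from the arrow clauses of \<open>is_functor\<close>.\<close>

lemma is_functorD: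
  assumes "is_functor C D F"
  shows "category C" "category D" "X \<in> Ob C \<Longrightarrow> fo F X \<in> Ob D"
    "f \<in> Hom C X Y \<Longrightarrow> fa F X Y f \<in> Hom D (fo F X) (fo F Y)"
    "X \<in> Ob C \<Longrightarrow> fa F X X (Ide C X) = Ide D (fo F X)"
    "f \<in> Hom C X Y \<Longrightarrow> g \<in> Hom C Y Z \<Longrightarrow> fa F X Z (Cmp C X Y Z g f) =
       Cmp D (fo F X) (fo F Y) (fo F Z) (fa F Y Z g) (fa F X Y f)"
proof -
  show C: "category C" and D: "category D" using assms unfolding is_functor_def by blast+
  note H = category.Hom_Ob[OF C]
  show "X \<in> Ob C \<Longrightarrow> fo F X \<in> Ob D" "X \<in> Ob C \<Longrightarrow> fa F X X (Ide C X) = Ide D (fo F X)"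
    using assms unfolding is_functor_def by blast+
  show "f \<in> Hom C X Y \<Longrightarrow> fa F X Y f \<in> Hom D (fo F X) (fo F Y)"
    using assms H[of f X Y] unfolding is_functor_def by blast
  show "f \<in> Hom C X Y \<Longrightarrow> g \<in> Hom C Y Z \<Longrightarrow> fa F X Z (Cmp C X Y Z g f) =
       Cmp D (fo F X) (fo F Y) (fo F Z) (fa F Y Z g) (fa F X Y f)"
    using assms H[of f X Y] H[of g Y Z] unfolding is_functor_def by blast
qed

lemma is_functorI:
  assumes "category C" "category D" "\<And>X. X \<in> Ob C \<Longrightarrow> fo F X \<in> Ob D"
    "\<And>X Y f. f \<in> Hom C X Y \<Longrightarrow> fa F X Y f \<in> Hom D (fo F X) (fo F Y)"
    "\<And>X. X \<in> Ob C \<Longrightarrow> fa F X X (Ide C X) = Ide D (fo F X)"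
    "\<And>X Y Z f g. f \<in> Hom C X Y \<Longrightarrow> g \<in> Hom C Y Z \<Longrightarrow> fa F X Z (Cmp C X Y Z g f) =
       Cmp D (fo F X) (fo F Y) (fo F Z) (fa F Y Z g) (fa F X Y f)"
  shows "is_functor C D F"
  using assms unfolding is_functor_def by blast

lemma is_functor_fcomp: "is_functor A B F \<Longrightarrow> is_functor B E G \<Longrightarrow> is_functor A E (fcomp G F)"
  apply (rule is_functorI)
  subgoal by (erule is_functorD)
  subgoal by (rule is_functorD(2)[of B])
  by (simp_all add: is_functorD(3-)[of A B F] is_functorD(3-)[of B E G])

lemma is_functor_fop: "is_functor A B F \<Longrightarrow> is_functor (opp A) (opp B) (fop F)"
  apply (rule is_functorI)
  subgoal by (intro category_opp is_functorD(1)[of A])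
  subgoal by (intro category_opp is_functorD(2)[of A])
  by (simp_all add: is_functorD(3-)[of A B F])

lemma fcomp_inclusion: "fcomp F inclusion = F"
  by (cases F) (simp add: fcomp_def inclusion_def)

lemma fop_inclusion: "fop inclusion = inclusion"
  by (simp add: fop_def inclusion_def)

text \<open>Cones see a diagram only on \<open>J\<close>, while its values elsewhere are arbitrary.
  A composite diagram may agree with the expected one on \<open>J\<close> alone.\<close>

lemma is_limit_cong:
  assumes "category J" "\<And>j. j \<in> Ob J \<Longrightarrow> fo S j = fo S' j" "\<And>i j u. u \<in> Hom J i j \<Longrightarrow> fa S i j u = fa S' i j u"
  shows "is_limit J E S P \<pi> \<longleftrightarrow> is_limit J E S' P \<pi>"
proof -
  have "is_cone J E S X \<sigma> \<longleftrightarrow> is_cone J E S' X \<sigma>" for X \<sigma>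
    unfolding is_cone_def using assms by (simp cong: ball_cong)
  then show ?thesis unfolding is_limit_def using assms(2) by (simp cong: ball_cong)
qed

lemma lex_functor_fcomp:
  assumes F: "lex_functor A B F" and G: "lex_functor B E G"
  shows "lex_functor A E (fcomp G F)"
  unfolding lex_functor_def preserves_finite_limits_def
proof (intro conjI allI impI)
  show "finitely_complete A" "finitely_complete E" "is_functor A E (fcomp G F)"
    using F G is_functor_fcomp unfolding lex_functor_def by blast+
  fix J :: "(nat, nat) cat" and H L \<pi>
  assume a: "finite_category J \<and> is_functor J A H \<and> is_limit J A H L \<pi>"
  then have "is_limit J B (fcomp F H) (fo F L) (\<lambda>j. fa F L (fo H j) (\<pi> j))" "is_functor J B (fcomp F H)"
    using F is_functor_fcomp unfolding lex_functor_def preserves_finite_limits_def by blast+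
  then have "is_limit J E (fcomp G (fcomp F H)) (fo G (fo F L)) (\<lambda>j. fa G (fo F L) (fo (fcomp F H) j) (fa F L (fo H j) (\<pi> j)))"
    using G a unfolding lex_functor_def preserves_finite_limits_def by blast
  then show "is_limit J E (fcomp (fcomp G F) H) (fo (fcomp G F) L) (\<lambda>j. fa (fcomp G F) L (fo H j) (\<pi> j))"
    by (simp add: fcomp_def)
qed

text \<open>Mediating arrows into \<open>N\<close> are those into \<open>M\<close> followed by
  \<open>k'\<close>. This moves a limit chosen in \<open>C\<close> onto the object picked by the
  reflector.\<close>

lemma is_limit_iso:
  assumes E: "category E" and S: "is_functor J E S" and M: "is_limit J E S M \<mu>"
    and k: "k \<in> Hom E N M" "k' \<in> Hom E M N" "Cmp E N M N k' k = Ide E N" "Cmp E M N M k k' = Ide E M"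
  shows "is_limit J E S N (\<lambda>j. Cmp E N M (fo S j) (\<mu> j) k)"
proof -
  note a = category.Cmp_assoc[OF E] and c = category.Cmp_Hom[OF E]
  have cone: "is_cone J E S M \<mu>" and lim: "\<And>X \<sigma>. is_cone J E S X \<sigma> \<Longrightarrow> \<exists>!h. h \<in> Hom E X M \<and> (\<forall>j\<in>Ob J. Cmp E X M (fo S j) (\<mu> j) h = \<sigma> j)"
    using M unfolding is_limit_def by simp_all
  have \<mu>: "\<And>j. j \<in> Ob J \<Longrightarrow> \<mu> j \<in> Hom E M (fo S j)"
    "\<And>i j u. i \<in> Ob J \<Longrightarrow> j \<in> Ob J \<Longrightarrow> u \<in> Hom J i j \<Longrightarrow> Cmp E M (fo S i) (fo S j) (fa S i j u) (\<mu> i) = \<mu> j"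
    using cone unfolding is_cone_def by simp_all
  show ?thesis unfolding is_limit_def
  proof (intro conjI allI impI)
    show "is_cone J E S N (\<lambda>j. Cmp E N M (fo S j) (\<mu> j) k)" unfolding is_cone_def
    proof (intro conjI ballI)
      show "N \<in> Ob E" using category.Hom_Ob[OF E k(1)] by blast
      fix j assume "j \<in> Ob J" then show "Cmp E N M (fo S j) (\<mu> j) k \<in> Hom E N (fo S j)" by (rule c[OF k(1) \<mu>(1)])
    next
      fix i j u assume i: "i \<in> Ob J" "j \<in> Ob J" "u \<in> Hom J i j"
      show "Cmp E N (fo S i) (fo S j) (fa S i j u) (Cmp E N M (fo S i) (\<mu> i) k) = Cmp E N M (fo S j) (\<mu> j) k"
        unfolding a[OF k(1) \<mu>(1)[OF i(1)] is_functorD(4)[OF S i(3)], symmetric] \<mu>(2)[OF i] ..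
    qed
  next
    fix X \<sigma> assume "is_cone J E S X \<sigma>"
    from lim[OF this] obtain h where h: "h \<in> Hom E X M" "\<And>j. j \<in> Ob J \<Longrightarrow> Cmp E X M (fo S j) (\<mu> j) h = \<sigma> j"
      "\<And>g. g \<in> Hom E X M \<Longrightarrow> (\<forall>j\<in>Ob J. Cmp E X M (fo S j) (\<mu> j) g = \<sigma> j) \<Longrightarrow> g = h"
      by (elim ex1E) blast
    show "\<exists>!h. h \<in> Hom E X N \<and> (\<forall>j\<in>Ob J. Cmp E X N (fo S j) (Cmp E N M (fo S j) (\<mu> j) k) h = \<sigma> j)"
    proof (rule ex1I[of _ "Cmp E X M N k' h"])
      have kk: "Cmp E X N M k (Cmp E X M N k' h) = h"
        unfolding a[OF h(1) k(2,1), symmetric] k(4) by (rule category.Cmp_Ide_left[OF E h(1)])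
      show "Cmp E X M N k' h \<in> Hom E X N \<and> (\<forall>j\<in>Ob J. Cmp E X N (fo S j) (Cmp E N M (fo S j) (\<mu> j) k) (Cmp E X M N k' h) = \<sigma> j)"
        using c[OF h(1) k(2)] a[OF c[OF h(1) k(2)] k(1) \<mu>(1)] kk h(2) by simp
      fix g assume g: "g \<in> Hom E X N \<and> (\<forall>j\<in>Ob J. Cmp E X N (fo S j) (Cmp E N M (fo S j) (\<mu> j) k) g = \<sigma> j)"
      then have "Cmp E X N M k g = h"
        using h(3)[OF c[OF conjunct1[OF g] k(1)]] a[OF conjunct1[OF g] k(1) \<mu>(1)] by simp
      then show "g = Cmp E X M N k' h"
        using a[OF conjunct1[OF g] k(1,2)] k(3) category.Cmp_Ide_left[OF E conjunct1[OF g]] by simp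
    qed
  qed
qed

lemma is_functor_full_sub:
  assumes "is_functor J E G" "\<And>j. j \<in> Ob J \<Longrightarrow> fo G j \<in> T"
  shows "is_functor J (full_sub E T) G"
proof (rule is_functorI[OF is_functorD(1)[OF assms(1)] category_full_sub[OF is_functorD(2)[OF assms(1)]]])
  note J = category.Hom_Ob[OF is_functorD(1)[OF assms(1)]]
  fix X Y f assume f: "f \<in> Hom J X Y"
  then show "fa G X Y f \<in> Hom (full_sub E T) (fo G X) (fo G Y)"
    using is_functorD(4)[OF assms(1) f] assms(2) J[OF f] by simp
qed (use is_functorD[OF assms(1)] assms(2) in simp_all)

lemma is_functor_of_full_sub:
  assumes G: "is_functor J (full_sub E T) G" and E: "category E"
  shows "is_functor J E G"
proof (rule is_functorI[OF is_functorD(1)[OF G] E])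
  fix X Y f assume "f \<in> Hom J X Y"
  from is_functorD(4)[OF G this] show "fa G X Y f \<in> Hom E (fo G X) (fo G Y)" by (simp split: if_splits)
qed (use is_functorD[OF G] in simp_all)

section \<open>Finite limits from diagrams on graphs\<close>

text \<open>A graph in which no two edges are composable becomes a category by adding identities, all
  of them called \<open>0\<close>. This covers products, equalizers and pullbacks.\<close>

definition graph_cat :: "nat set \<Rightarrow> (nat \<Rightarrow> nat \<Rightarrow> nat set) \<Rightarrow> (nat, nat) cat" where
  "graph_cat V H = \<lparr>Ob = V, Hom = (\<lambda>i j. if i \<in> V \<and> j \<in> V then if i = j then {0} else H i j else {}),
     Ide = (\<lambda>_. 0), Cmp = (\<lambda>i j k g f. if i = j then g else f)\<rparr>"

definition graph_fctr ::
  "('o, 'a) cat \<Rightarrow> (nat \<Rightarrow> 'o) \<Rightarrow> (nat \<Rightarrow> nat \<Rightarrow> nat \<Rightarrow> 'a) \<Rightarrow> (nat, nat, 'o, 'a) fctr" where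
  "graph_fctr E o' a' = \<lparr>fo = o', fa = (\<lambda>i j e. if i = j then Ide E (o' i) else a' i j e)\<rparr>"

text \<open>Without composable edges every composite has an identity factor, so the category laws
  hold by cases and a cone is a family subject to one equation per edge.\<close>

locale bipartite =
  fixes V :: "nat set" and H :: "nat \<Rightarrow> nat \<Rightarrow> nat set"
  assumes fin: "finite V" "\<And>i j. finite (H i j)"
    and bip: "e \<in> H i j \<Longrightarrow> e' \<notin> H j k"
begin

lemma finite_category_graph: "finite_category (graph_cat V H)"
  unfolding finite_category_def category_def graph_cat_def
  using fin by (auto split: if_splits dest: bip)

lemma is_functor_graph:
  assumes "category E" "\<And>i. i \<in> V \<Longrightarrow> o' i \<in> Ob E"
    "\<And>i j e. i \<in> V \<Longrightarrow> j \<in> V \<Longrightarrow> e \<in> H i j \<Longrightarrow> a' i j e \<in> Hom E (o' i) (o' j)"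
  shows "is_functor (graph_cat V H) E (graph_fctr E o' a')"
proof (rule is_functorI)
  show "category (graph_cat V H)" using finite_category_graph finite_category_def by blast
next
  fix X Y Z f g
  assume "f \<in> Hom (graph_cat V H) X Y" "g \<in> Hom (graph_cat V H) Y Z"
  then show "fa (graph_fctr E o' a') X Z (Cmp (graph_cat V H) X Y Z g f) =
     Cmp E (fo (graph_fctr E o' a') X) (fo (graph_fctr E o' a') Y) (fo (graph_fctr E o' a') Z)
      (fa (graph_fctr E o' a') Y Z g) (fa (graph_fctr E o' a') X Y f)"
    using assms category.Cmp_Ide_left[OF assms(1)] category.Cmp_Ide_right[OF assms(1)]
      category.Ide_Hom[OF assms(1)]
    by (auto simp: graph_cat_def graph_fctr_def split: if_splits dest: bip)
qed (use assms category.Ide_Hom[OF assms(1)] in \<open>auto simp: graph_cat_def graph_fctr_def split: if_splits\<close>)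

lemma is_cone_graph:
  assumes "category E" "\<And>i. i \<in> V \<Longrightarrow> o' i \<in> Ob E"
  shows "is_cone (graph_cat V H) E (graph_fctr E o' a') L \<pi> \<longleftrightarrow> L \<in> Ob E \<and>
     (\<forall>i\<in>V. \<pi> i \<in> Hom E L (o' i)) \<and>
     (\<forall>i\<in>V. \<forall>j\<in>V. i \<noteq> j \<longrightarrow> (\<forall>e\<in>H i j. Cmp E L (o' i) (o' j) (a' i j e) (\<pi> i) = \<pi> j))"
  using category.Cmp_Ide_left[OF assms(1)]
  unfolding is_cone_def graph_cat_def graph_fctr_def by auto

end

text \<open>The graph without edges imposes no equation, so its cones are plain families. The
  universal property is split into existence of mediating arrows and joint monicity of the
  projections.\<close>

lemma finitely_complete_product:
  assumes "finitely_complete E" "finite I" "\<And>i :: nat. i \<in> I \<Longrightarrow> o' i \<in> Ob E"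
  obtains P \<pi> where "P \<in> Ob E" "\<And>i. i \<in> I \<Longrightarrow> \<pi> i \<in> Hom E P (o' i)"
    "\<And>X f. X \<in> Ob E \<Longrightarrow> (\<And>i. i \<in> I \<Longrightarrow> f i \<in> Hom E X (o' i)) \<Longrightarrow>
       \<exists>h\<in>Hom E X P. \<forall>i\<in>I. Cmp E X P (o' i) (\<pi> i) h = f i"
    "\<And>X h h'. h \<in> Hom E X P \<Longrightarrow> h' \<in> Hom E X P \<Longrightarrow>
       (\<And>i. i \<in> I \<Longrightarrow> Cmp E X P (o' i) (\<pi> i) h = Cmp E X P (o' i) (\<pi> i) h') \<Longrightarrow> h = h'"
proof -
  interpret bipartite I "\<lambda>_ _. {}" by standard (use assms in auto)
  let ?J = "graph_cat I (\<lambda>_ _. {})" and ?G = "graph_fctr E o' (\<lambda>_ _ _. undefined)"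
  have E: "category E" using assms finitely_complete_def by blast
  obtain P \<pi> where P: "is_limit ?J E ?G P \<pi>"
    using assms(1) finite_category_graph is_functor_graph[OF E, of o' "\<lambda>_ _ _. undefined"] assms(3)
    unfolding finitely_complete_def by blast
  have cone: "is_cone ?J E ?G L \<sigma> \<longleftrightarrow> L \<in> Ob E \<and> (\<forall>i\<in>I. \<sigma> i \<in> Hom E L (o' i))" for L \<sigma>
    using is_cone_graph[OF E assms(3)] by auto
  have [simp]: "Ob ?J = I" "fo ?G j = o' j" for j by (simp_all add: graph_cat_def graph_fctr_def)
  have lim: "is_cone ?J E ?G X \<sigma> \<Longrightarrow>
        \<exists>!h. h \<in> Hom E X P \<and> (\<forall>j\<in>I. Cmp E X P (o' j) (\<pi> j) h = \<sigma> j)" for X \<sigma>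
    using P unfolding is_limit_def by simp
  have Pc: "P \<in> Ob E" "\<And>i. i \<in> I \<Longrightarrow> \<pi> i \<in> Hom E P (o' i)"
    using P cone unfolding is_limit_def by blast+
  show thesis
  proof (rule that[of P \<pi>])
    fix X h h' assume h: "h \<in> Hom E X P" "h' \<in> Hom E X P"
       "\<And>i. i \<in> I \<Longrightarrow> Cmp E X P (o' i) (\<pi> i) h = Cmp E X P (o' i) (\<pi> i) h'"
    have "is_cone ?J E ?G X (\<lambda>i. Cmp E X P (o' i) (\<pi> i) h')"
      unfolding cone using h Pc category.Cmp_Hom[OF E] category.Hom_Ob[OF E] by blast
    from lim[OF this] obtain k where
      "\<And>g. g \<in> Hom E X P \<Longrightarrow> \<forall>j\<in>I. Cmp E X P (o' j) (\<pi> j) g = Cmp E X P (o' j) (\<pi> j) h' \<Longrightarrow> g = k"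
      by blast
    then show "h = h'" using h by blast
  next
    fix X f assume "X \<in> Ob E" "\<And>i. i \<in> I \<Longrightarrow> f i \<in> Hom E X (o' i)"
    then have "is_cone ?J E ?G X f" unfolding cone by blast
    from lim[OF this] show "\<exists>h\<in>Hom E X P. \<forall>i\<in>I. Cmp E X P (o' i) (\<pi> i) h = f i" by blast
  qed (use Pc in auto)
qed

text \<open>The limit over a parallel pair, whose edges 0 and 1 stand for \<open>f\<close> and
  \<open>g\<close>. The factorization is recorded because it says that the sieve equalizing
  \<open>f\<close> and \<open>g\<close> is generated by the single arrow \<open>e\<close>.\<close>

lemma finitely_complete_equalizer:
  assumes "finitely_complete E" "f \<in> Hom E A B" "g \<in> Hom E A B"
  obtains P e where "e \<in> Hom E P A" "Cmp E P A B f e = Cmp E P A B g e"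
    "\<And>X u. u \<in> Hom E X A \<Longrightarrow> Cmp E X A B f u = Cmp E X A B g u \<Longrightarrow> \<exists>h\<in>Hom E X P. Cmp E X P A e h = u"
proof -
  let ?H = "\<lambda>i j. if i = 0 \<and> j = Suc 0 then {0, 1} else {} :: nat set"
  interpret bipartite "{0, 1}" ?H by standard auto
  define o' where "o' = (\<lambda>i :: nat. if i = 0 then A else B)"
  define a' where "a' = (\<lambda>(i :: nat) (j :: nat) e :: nat. if e = 0 then f else g)"
  let ?J = "graph_cat {0, 1} ?H" and ?G = "graph_fctr E o' a'"
  have E: "category E" using assms finitely_complete_def by blast
  have o': "o' i \<in> Ob E" for i using assms category.Hom_Ob[OF E] unfolding o'_def by auto
  obtain P \<pi> where P: "is_limit ?J E ?G P \<pi>"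
  proof -
    have "is_functor ?J E ?G"
      by (rule is_functor_graph[OF E o']) (use assms(2,3) in \<open>auto simp: o'_def a'_def split: if_splits\<close>)
    then show ?thesis using that assms(1) finite_category_graph unfolding finitely_complete_def by blast
  qed
  have cone: "is_cone ?J E ?G L \<sigma> \<longleftrightarrow> L \<in> Ob E \<and> \<sigma> 0 \<in> Hom E L A \<and> \<sigma> 1 \<in> Hom E L B \<and>
     Cmp E L A B f (\<sigma> 0) = \<sigma> 1 \<and> Cmp E L A B g (\<sigma> 0) = \<sigma> 1" for L \<sigma>
    using is_cone_graph[OF E o', where a'=a' and L=L and \<pi>=\<sigma>] by (auto simp: o'_def a'_def)
  show thesis
  proof (rule that[of "\<pi> 0" P])
    fix X u assume u: "u \<in> Hom E X A" "Cmp E X A B f u = Cmp E X A B g u"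
    have "is_cone ?J E ?G X (\<lambda>i. if i = 0 then u else Cmp E X A B f u)"
      unfolding cone using u assms category.Cmp_Hom[OF E] category.Hom_Ob[OF E] by auto
    then have "\<exists>h. h \<in> Hom E X P \<and> (\<forall>j\<in>Ob ?J. Cmp E X P (fo ?G j) (\<pi> j) h = (if j = 0 then u else Cmp E X A B f u))"
      using P unfolding is_limit_def by blast
    then show "\<exists>h\<in>Hom E X P. Cmp E X P A (\<pi> 0) h = u"
      by (auto simp: o'_def graph_cat_def graph_fctr_def)
  qed (use P cone in \<open>auto simp: is_limit_def\<close>)
qed

text \<open>Vertices 0 and 1 are the feet and 2 is the common codomain; each foot has one edge to
  it, called 0.\<close>

definition cospan :: "(nat, nat) cat" where
  "cospan = graph_cat {0, 1, 2} (\<lambda>i j. if i < 2 \<and> j = 2 then {0} else {})"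

definition cospan_fctr ::
  "('o, 'a) cat \<Rightarrow> 'o \<Rightarrow> 'o \<Rightarrow> 'o \<Rightarrow> 'a \<Rightarrow> 'a \<Rightarrow> (nat, nat, 'o, 'a) fctr" where
  "cospan_fctr E X Y Z f g = graph_fctr E (\<lambda>i. if i = 0 then X else if i = 1 then Y else Z)
      (\<lambda>i j e. if i = 0 then f else g)"

lemma finite_category_cospan: "finite_category cospan"
proof -
  interpret bipartite "{0, 1, 2}" "\<lambda>i j. if i < 2 \<and> j = 2 then {0} else {}" by standard auto
  show ?thesis unfolding cospan_def by (rule finite_category_graph)
qed

lemma is_functor_cospan:
  assumes "category E" "f \<in> Hom E X Z" "g \<in> Hom E Y Z"
  shows "is_functor cospan E (cospan_fctr E X Y Z f g)"
proof -
  interpret bipartite "{0, 1, 2}" "\<lambda>i j. if i < 2 \<and> j = 2 then {0} else {}" by standard auto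
  show ?thesis unfolding cospan_def cospan_fctr_def
    by (rule is_functor_graph) (use assms category.Hom_Ob[OF assms(1)] in \<open>auto split: if_splits\<close>)
qed

lemma cospan_fctr_Ob: "Ob cospan = {0, 1, 2}" "fo (cospan_fctr E X Y Z f g) 0 = X"
   "fo (cospan_fctr E X Y Z f g) 1 = Y" "fo (cospan_fctr E X Y Z f g) (Suc 0) = Y"
   "fo (cospan_fctr E X Y Z f g) 2 = Z"
  by (simp_all add: cospan_def cospan_fctr_def graph_cat_def graph_fctr_def)

lemma is_cone_cospan:
  assumes "category E" "f \<in> Hom E X Z" "g \<in> Hom E Y Z"
  shows "is_cone cospan E (cospan_fctr E X Y Z f g) L \<pi> \<longleftrightarrow> L \<in> Ob E \<and> \<pi> 0 \<in> Hom E L X \<and>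
     \<pi> 1 \<in> Hom E L Y \<and> \<pi> 2 \<in> Hom E L Z \<and> Cmp E L X Z f (\<pi> 0) = \<pi> 2 \<and> Cmp E L Y Z g (\<pi> 1) = \<pi> 2"
proof -
  interpret bipartite "{0, 1, 2}" "\<lambda>i j. if i < 2 \<and> j = 2 then {0} else {}" by standard auto
  show ?thesis unfolding cospan_def cospan_fctr_def
    by (subst is_cone_graph) (use assms category.Hom_Ob[OF assms(1)] in \<open>auto split: if_splits\<close>)
qed

text \<open>The leg at 2 is determined by the leg at 0, so a cone is a commutative square.
  Preservation of finite limits and closure under them are phrased for diagrams; this carries them
  over to \<open>is_pullback\<close>.\<close>

lemma is_limit_cospan:
  assumes E: "category E" and fg: "f \<in> Hom E X Z" "g \<in> Hom E Y Z"
  shows "is_limit cospan E (cospan_fctr E X Y Z f g) P \<pi> \<longleftrightarrow>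
     is_pullback E X Y Z f g P (\<pi> 0) (\<pi> 1) \<and> \<pi> 2 = Cmp E P X Z f (\<pi> 0)" (is "?l \<longleftrightarrow> ?r")
proof
  assume l: ?l
  show ?r unfolding is_pullback_def
  proof (intro conjI ballI impI)
    fix Q a b assume a: "Q \<in> Ob E" "a \<in> Hom E Q X" "b \<in> Hom E Q Y" "Cmp E Q X Z f a = Cmp E Q Y Z g b"
    let ?s = "\<lambda>i :: nat. if i = 0 then a else if i = 1 then b else Cmp E Q X Z f a"
    have "is_cone cospan E (cospan_fctr E X Y Z f g) Q ?s"
      unfolding is_cone_cospan[OF E fg] using a fg category.Cmp_Hom[OF E] by auto
    then have ex: "\<exists>!h. h \<in> Hom E Q P \<and> (\<forall>j\<in>{0,1,2}. Cmp E Q P (fo (cospan_fctr E X Y Z f g) j) (\<pi> j) h = ?s j)"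
      using l unfolding is_limit_def cospan_fctr_Ob by blast
    have p: "\<pi> 0 \<in> Hom E P X" "Cmp E P X Z f (\<pi> 0) = \<pi> 2"
      using l unfolding is_limit_def is_cone_cospan[OF E fg] by auto
    have "(h \<in> Hom E Q P \<and> (\<forall>j\<in>{0,1,2}. Cmp E Q P (fo (cospan_fctr E X Y Z f g) j) (\<pi> j) h = ?s j))
       \<longleftrightarrow> (h \<in> Hom E Q P \<and> Cmp E Q P X (\<pi> 0) h = a \<and> Cmp E Q P Y (\<pi> 1) h = b)" for h
      using p category.Cmp_assoc[OF E _ p(1) fg(1), of h Q] by (auto simp: cospan_fctr_Ob)
    with ex show "\<exists>!h. h \<in> Hom E Q P \<and> Cmp E Q P X (\<pi> 0) h = a \<and> Cmp E Q P Y (\<pi> 1) h = b" by simp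
  qed (use l fg in \<open>auto simp: is_limit_def is_cone_cospan[OF E fg]\<close>)
next
  assume r: ?r
  then have p: "\<pi> 0 \<in> Hom E P X" "\<pi> 1 \<in> Hom E P Y" "Cmp E P X Z f (\<pi> 0) = \<pi> 2"
       "Cmp E P Y Z g (\<pi> 1) = \<pi> 2" "P \<in> Ob E"
    unfolding is_pullback_def using category.Hom_Ob[OF E] by auto
  show ?l unfolding is_limit_def
  proof (intro conjI allI impI)
    show "is_cone cospan E (cospan_fctr E X Y Z f g) P \<pi>"
      unfolding is_cone_cospan[OF E fg] using p fg category.Cmp_Hom[OF E] by metis
    fix Q s assume "is_cone cospan E (cospan_fctr E X Y Z f g) Q s"
    then have s: "Q \<in> Ob E" "s 0 \<in> Hom E Q X" "s 1 \<in> Hom E Q Y" "Cmp E Q X Z f (s 0) = s 2"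
       "Cmp E Q Y Z g (s 1) = s 2" unfolding is_cone_cospan[OF E fg] by auto
    then have ex: "\<exists>!h. h \<in> Hom E Q P \<and> Cmp E Q P X (\<pi> 0) h = s 0 \<and> Cmp E Q P Y (\<pi> 1) h = s 1"
      using r unfolding is_pullback_def by metis
    have "(h \<in> Hom E Q P \<and> (\<forall>j\<in>Ob cospan. Cmp E Q P (fo (cospan_fctr E X Y Z f g) j) (\<pi> j) h = s j))
       \<longleftrightarrow> (h \<in> Hom E Q P \<and> Cmp E Q P X (\<pi> 0) h = s 0 \<and> Cmp E Q P Y (\<pi> 1) h = s 1)" for h
      using p s category.Cmp_assoc[OF E _ p(1) fg(1), of h Q] by (auto simp: cospan_fctr_Ob)
    with ex show "\<exists>!h. h \<in> Hom E Q P \<and> (\<forall>j\<in>Ob cospan. Cmp E Q P (fo (cospan_fctr E X Y Z f g) j) (\<pi> j) h = s j)" by simp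
  qed
qed

section \<open>Presheaves\<close>

lemma Set_cat_simps [simp]:
  "Ob Set_cat = {A. small TYPE('u) (A :: 'u set)}"
  "Ide Set_cat A = (\<lambda>x\<in>A. x)" "Cmp Set_cat A B D g f = compose A g f"
  by (simp_all add: Set_cat_def)

lemma Hom_Set_cat:
  "f \<in> Hom Set_cat A B \<longleftrightarrow> small TYPE('u) (A :: 'u set) \<and> small TYPE('u) B \<and> f \<in> A \<rightarrow>\<^sub>E B"
  by (auto simp: Set_cat_def)

lemma category_Set_cat: "category (Set_cat :: ('u set, 'u \<Rightarrow> 'u) cat)"
proof
  fix f X Y assume "f \<in> Hom Set_cat X (Y :: 'u set)"
  then show "Cmp Set_cat X X Y f (Ide Set_cat X) = f" "Cmp Set_cat X Y Y (Ide Set_cat Y) f = f"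
    by (auto simp: Hom_Set_cat compose_def PiE_iff extensional_def fun_eq_iff)
qed (auto simp: Hom_Set_cat PiE_iff compose_def Pi_iff intro!: restrict_ext)

lemma category_functor_cat:
  assumes "category A" "category B"
  shows "category (functor_cat A B)"
proof -
  interpret B: category B by fact
  have hom: "t \<in> Hom (functor_cat A B) F G \<longleftrightarrow> t \<in> extensional (Ob A) \<and> nat_trans A B F G t" for t F G
    by (simp add: functor_cat_def)
  show ?thesis
  proof
    fix F assume "F \<in> Ob (functor_cat A B)"
    then have F: "is_functor A B F" by (simp add: functor_cat_def)
    note F' = is_functorD[OF F]
    have *: "\<And>X Y f. f \<in> Hom A X Y \<Longrightarrow> X \<in> Ob A \<and> Y \<in> Ob A" using category.Hom_Ob[OF assms(1)] .
    show "Ide (functor_cat A B) F \<in> Hom (functor_cat A B) F F"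
      unfolding hom nat_trans_def
      by (auto simp: functor_cat_def F F'(3) B.Ide_Hom B.Cmp_Ide_left[OF F'(4)] B.Cmp_Ide_right[OF F'(4)])
  next
    fix t F G s H assume ts: "t \<in> Hom (functor_cat A B) F G" "s \<in> Hom (functor_cat A B) G H"
    then have F: "is_functor A B F" "is_functor A B G" "is_functor A B H"
      and t: "\<And>X. X \<in> Ob A \<Longrightarrow> t X \<in> Hom B (fo F X) (fo G X)"
        "\<And>X. X \<in> Ob A \<Longrightarrow> s X \<in> Hom B (fo G X) (fo H X)"
      and n: "\<And>X Y f. X \<in> Ob A \<Longrightarrow> Y \<in> Ob A \<Longrightarrow> f \<in> Hom A X Y \<Longrightarrow>
        Cmp B (fo F X) (fo F Y) (fo G Y) (t Y) (fa F X Y f) = Cmp B (fo F X) (fo G X) (fo G Y) (fa G X Y f) (t X)"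
        "\<And>X Y f. X \<in> Ob A \<Longrightarrow> Y \<in> Ob A \<Longrightarrow> f \<in> Hom A X Y \<Longrightarrow>
        Cmp B (fo G X) (fo G Y) (fo H Y) (s Y) (fa G X Y f) = Cmp B (fo G X) (fo H X) (fo H Y) (fa H X Y f) (s X)"
      unfolding hom nat_trans_def by blast+
    show "Cmp (functor_cat A B) F G H s t \<in> Hom (functor_cat A B) F H"
      unfolding hom nat_trans_def
    proof (intro conjI ballI)
      fix X Y f assume f: "X \<in> Ob A" "Y \<in> Ob A" "f \<in> Hom A X Y"
      note m = f t[OF f(1)] t[OF f(2)] is_functorD(4)[OF F(1) f(3)] is_functorD(4)[OF F(2) f(3)] is_functorD(4)[OF F(3) f(3)]
      show "Cmp B (fo F X) (fo F Y) (fo H Y) (Cmp (functor_cat A B) F G H s t Y) (fa F X Y f) =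
            Cmp B (fo F X) (fo H X) (fo H Y) (fa H X Y f) (Cmp (functor_cat A B) F G H s t X)"
        using f by (simp add: functor_cat_def B.Cmp_assoc[OF m(8,6,7)] n(1)[OF f] n(2)[OF f, symmetric]
          B.Cmp_assoc[OF m(4,9,7), symmetric] B.Cmp_assoc[OF m(4,5,10), symmetric])
    qed (use F t B.Cmp_Hom in \<open>auto simp: functor_cat_def\<close>)
  next
    fix X Y Z W f g h
    assume f: "f \<in> Hom (functor_cat A B) X Y" "g \<in> Hom (functor_cat A B) Y Z" "h \<in> Hom (functor_cat A B) Z W"
    show "Cmp (functor_cat A B) X Y W (Cmp (functor_cat A B) Y Z W h g) f =
        Cmp (functor_cat A B) X Z W h (Cmp (functor_cat A B) X Y Z g f)"
      using f unfolding hom nat_trans_def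
      by (auto simp: functor_cat_def intro!: restrict_ext B.Cmp_assoc)
  next
    fix f X Y assume f: "f \<in> Hom (functor_cat A B) X Y"
    then have e: "f \<in> extensional (Ob A)" and m: "\<And>Z. Z \<in> Ob A \<Longrightarrow> f Z \<in> Hom B (fo X Z) (fo Y Z)"
      unfolding hom nat_trans_def by auto
    show "Cmp (functor_cat A B) X X Y f (Ide (functor_cat A B) X) = f"
      "Cmp (functor_cat A B) X Y Y (Ide (functor_cat A B) Y) f = f"
      by (rule extensionalityI[OF _ e]; simp add: functor_cat_def B.Cmp_Ide_right[OF m] B.Cmp_Ide_left[OF m])+
  qed (auto simp: functor_cat_def nat_trans_def)
qed

section \<open>Presheaves on a finitely complete category, element by element\<close>

locale site =
  fixes C :: "('o, 'u) cat"
  assumes univ: "universe TYPE('u)" and loc_small: "locally_small C" and fin_complete: "finitely_complete C"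
begin

lemma cat: "category C"
  using fin_complete finitely_complete_def by blast

lemmas Hom_ObC = category.Hom_Ob[OF cat] and idC = category.Ide_Hom[OF cat]
  and compC = category.Cmp_Hom[OF cat] and comp_idC = category.Cmp_Ide_right[OF cat]
  and id_compC = category.Cmp_Ide_left[OF cat] and assocC = category.Cmp_assoc[OF cat]

declare idC [simp] compC [simp] comp_idC [simp] id_compC [simp]

lemma dom: "f \<in> Hom C X Y \<Longrightarrow> X \<in> Ob C" and cod: "f \<in> Hom C X Y \<Longrightarrow> Y \<in> Ob C"
  using Hom_ObC by blast+

abbreviation psh :: "('o, 'u) presheaf \<Rightarrow> bool" where
  "psh F \<equiv> is_functor (opp C) Set_cat F"

lemma psh_small: "psh F \<Longrightarrow> A \<in> Ob C \<Longrightarrow> small TYPE('u) (fo F A)"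
  using is_functorD(3)[of "opp C" Set_cat F A] by simp

lemma psh_fun: "psh F \<Longrightarrow> u \<in> Hom C B A \<Longrightarrow> fa F A B u \<in> fo F A \<rightarrow>\<^sub>E fo F B"
  using is_functorD(4)[of "opp C" Set_cat F u A B] by (simp add: Hom_Set_cat)

lemma psh_in: "psh F \<Longrightarrow> u \<in> Hom C B A \<Longrightarrow> x \<in> fo F A \<Longrightarrow> fa F A B u x \<in> fo F B"
  using psh_fun by blast

lemma psh_id: "psh F \<Longrightarrow> A \<in> Ob C \<Longrightarrow> x \<in> fo F A \<Longrightarrow> fa F A A (Ide C A) x = x"
  using is_functorD(5)[of "opp C" Set_cat F A] by simp

lemma psh_comp: "psh F \<Longrightarrow> u \<in> Hom C B A \<Longrightarrow> v \<in> Hom C D B \<Longrightarrow> x \<in> fo F A \<Longrightarrow>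
   fa F A D (Cmp C D B A u v) x = fa F B D v (fa F A B u x)"
  using is_functorD(6)[of "opp C" Set_cat F u A B v D] by (simp add: compose_def)

lemma pshI:
  assumes "\<And>A. A \<in> Ob C \<Longrightarrow> small TYPE('u) (fo F A)"
    "\<And>A B u. u \<in> Hom C B A \<Longrightarrow> fa F A B u \<in> fo F A \<rightarrow>\<^sub>E fo F B"
    "\<And>A x. A \<in> Ob C \<Longrightarrow> x \<in> fo F A \<Longrightarrow> fa F A A (Ide C A) x = x"
    "\<And>A B D u v x. u \<in> Hom C B A \<Longrightarrow> v \<in> Hom C D B \<Longrightarrow> x \<in> fo F A \<Longrightarrow>
      fa F A D (Cmp C D B A u v) x = fa F B D v (fa F A B u x)"
  shows "psh F"
proof (rule is_functorI)
  fix X Y f assume "f \<in> Hom (opp C) X Y"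
  then show "fa F X Y f \<in> Hom Set_cat (fo F X) (fo F Y)"
    using assms(1,2) Hom_ObC by (simp add: Hom_Set_cat)
next
  fix X assume "X \<in> Ob (opp C)"
  then show "fa F X X (Ide (opp C) X) = Ide Set_cat (fo F X)"
    using assms(2)[OF idC, of X] assms(3)
    by (intro extensionalityI[of _ "fo F X"]) (auto simp: PiE_iff)
next
  fix X Y Z f g assume "f \<in> Hom (opp C) X Y" "g \<in> Hom (opp C) Y Z"
  then show "fa F X Z (Cmp (opp C) X Y Z g f) =
     Cmp Set_cat (fo F X) (fo F Y) (fo F Z) (fa F Y Z g) (fa F X Y f)"
    using assms(2)[OF compC, of g Z Y f X] assms(4)
    by (intro extensionalityI[of _ "fo F X"]) (auto simp: compose_def PiE_iff)
qed (use assms cat category_opp category_Set_cat in auto)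

text \<open>Natural transformations are taken in the category of all presheaves, because images,
  limits and Kan extensions are built there first and shown to be small afterwards.\<close>

abbreviation nt :: "('o, 'u) presheaf \<Rightarrow> ('o, 'u) presheaf \<Rightarrow> ('o \<Rightarrow> 'u \<Rightarrow> 'u) \<Rightarrow> bool" where
  "nt F G t \<equiv> t \<in> Hom (functor_cat (opp C) Set_cat) F G"

lemma nt_iff: "nt F G t \<longleftrightarrow> psh F \<and> psh G \<and> t \<in> extensional (Ob C) \<and>
   (\<forall>A\<in>Ob C. t A \<in> fo F A \<rightarrow>\<^sub>E fo G A) \<and>
   (\<forall>A B u x. u \<in> Hom C B A \<longrightarrow> x \<in> fo F A \<longrightarrow> t B (fa F A B u x) = fa G A B u (t A x))" (is "?l \<longleftrightarrow> ?r")
proof -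
  have "compose (fo F A) (t B) (fa F A B u) = compose (fo F A) (fa G A B u) (t A) \<longleftrightarrow>
     (\<forall>x\<in>fo F A. t B (fa F A B u x) = fa G A B u (t A x))" for A B u
    by (auto simp: compose_def fun_eq_iff)
  then show ?thesis
    unfolding functor_cat_def nat_trans_def using psh_small Hom_ObC by (auto simp: Hom_Set_cat)
qed

lemma ntD:
  assumes "nt F G t"
  shows "psh F" "psh G" "t \<in> extensional (Ob C)"
    "A \<in> Ob C \<Longrightarrow> x \<in> fo F A \<Longrightarrow> t A x \<in> fo G A"
    "u \<in> Hom C B A \<Longrightarrow> x \<in> fo F A \<Longrightarrow> t B (fa F A B u x) = fa G A B u (t A x)"
  using assms unfolding nt_iff by blast+

lemma nt_eqI:
  assumes "nt F G s" "nt F G t" "\<And>A x. A \<in> Ob C \<Longrightarrow> x \<in> fo F A \<Longrightarrow> s A x = t A x"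
  shows "s = t"
proof (rule extensionalityI[of _ "Ob C"])
  fix A assume A: "A \<in> Ob C"
  then have "s A \<in> fo F A \<rightarrow>\<^sub>E fo G A" "t A \<in> fo F A \<rightarrow>\<^sub>E fo G A" using assms(1,2) unfolding nt_iff by blast+
  then show "s A = t A" by (rule PiE_ext) (use assms(3)[OF A] in auto)
qed (use assms ntD(3) in auto)

text \<open>Restricted twice: both the family and each of its components must be extensional to be
  an arrow of the functor category into \<open>Set_cat\<close>.\<close>

definition mknt :: "('o, 'u) presheaf \<Rightarrow> ('o \<Rightarrow> 'u \<Rightarrow> 'u) \<Rightarrow> 'o \<Rightarrow> 'u \<Rightarrow> 'u" where
  "mknt F h = (\<lambda>A\<in>Ob C. \<lambda>x\<in>fo F A. h A x)"

lemma mknt_apply [simp]: "A \<in> Ob C \<Longrightarrow> x \<in> fo F A \<Longrightarrow> mknt F h A x = h A x"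
  by (simp add: mknt_def)

lemma nt_mknt:
  assumes "psh F" "psh G" "\<And>A x. A \<in> Ob C \<Longrightarrow> x \<in> fo F A \<Longrightarrow> h A x \<in> fo G A"
    "\<And>A B u x. u \<in> Hom C B A \<Longrightarrow> x \<in> fo F A \<Longrightarrow> h B (fa F A B u x) = fa G A B u (h A x)"
  shows "nt F G (mknt F h)"
  unfolding nt_iff using assms psh_in[OF assms(1)] Hom_ObC by (auto simp: mknt_def)

abbreviation ntcomp where
  "ntcomp F G H s t \<equiv> Cmp (functor_cat (opp C) Set_cat) F G H s t"

lemma category_presheaves: "category (functor_cat (opp C) (Set_cat :: ('u set, 'u \<Rightarrow> 'u) cat))"
  by (intro category_functor_cat category_opp category_Set_cat cat)

lemma nt_comp: "nt F G t \<Longrightarrow> nt G H s \<Longrightarrow> nt F H (ntcomp F G H s t)"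
  by (rule category.Cmp_Hom[OF category_presheaves])

lemma ntcomp_apply [simp]: "A \<in> Ob C \<Longrightarrow> x \<in> fo F A \<Longrightarrow> ntcomp F G H s t A x = s A (t A x)"
  by (simp add: functor_cat_def compose_def)

abbreviation ntid where "ntid F \<equiv> Ide (functor_cat (opp C) Set_cat) F"

lemma ntid_apply [simp]: "A \<in> Ob C \<Longrightarrow> x \<in> fo F A \<Longrightarrow> ntid F A x = x"
  by (simp add: functor_cat_def)

lemma nt_id: "psh F \<Longrightarrow> nt F F (ntid F)"
  using category.Ide_Hom[OF category_presheaves, of F] by (simp add: functor_cat_def)

lemma category_PSh: "category (PSh C)"
  unfolding PSh_def by (intro category_full_sub category_presheaves)

lemma small_presheaf_psh: "small_presheaf C F \<Longrightarrow> psh F"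
  unfolding small_presheaf_def by blast

lemma PSh_simps [simp]:
  "F \<in> Ob (PSh C) \<longleftrightarrow> small_presheaf C F"
  "t \<in> Hom (PSh C) F G \<longleftrightarrow> small_presheaf C F \<and> small_presheaf C G \<and> nt F G t"
  "Ide (PSh C) = Ide (functor_cat (opp C) Set_cat)" "Cmp (PSh C) = Cmp (functor_cat (opp C) Set_cat)"
  using small_presheaf_psh unfolding PSh_def by (auto simp: functor_cat_def)

subsection \<open>Representables\<close>

abbreviation Y :: "'o \<Rightarrow> ('o, 'u) presheaf" where "Y A \<equiv> fo (yoneda C) A"

lemma Y_simps [simp]: "fo (Y A) X = Hom C X A"
  "fa (Y A) Z X v = (\<lambda>g\<in>Hom C Z A. Cmp C X Z A g v)"
  by (simp_all add: yoneda_def)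

lemma psh_Y: "A \<in> Ob C \<Longrightarrow> psh (Y A)"
  by (rule pshI) (use loc_small dom in \<open>auto simp: locally_small_def assocC\<close>)

text \<open>The transformation that corresponds to \<open>x\<close> under the Yoneda lemma.\<close>

definition yo :: "('o, 'u) presheaf \<Rightarrow> 'o \<Rightarrow> 'u \<Rightarrow> 'o \<Rightarrow> 'u \<Rightarrow> 'u" where
  "yo F A x = mknt (Y A) (\<lambda>X u. fa F A X u x)"

lemma yo_apply [simp]: "u \<in> Hom C X A \<Longrightarrow> yo F A x X u = fa F A X u x"
  unfolding yo_def using dom by simp

lemma nt_yo: "psh F \<Longrightarrow> A \<in> Ob C \<Longrightarrow> x \<in> fo F A \<Longrightarrow> nt (Y A) F (yo F A x)"
  unfolding yo_def by (rule nt_mknt) (use psh_Y psh_in psh_comp in auto)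

lemma nt_Y: "A \<in> Ob C \<Longrightarrow> nt (Y A) F t \<Longrightarrow> t = yo F A (t A (Ide C A))"
proof (rule nt_eqI)
  assume A: "A \<in> Ob C" and t: "nt (Y A) F t"
  show "nt (Y A) F (yo F A (t A (Ide C A)))"
    by (rule nt_yo) (use A t ntD[OF t] in auto)
  fix X u assume "X \<in> Ob C" "u \<in> fo (Y A) X"
  then show "t X u = yo F A (t A (Ide C A)) X u"
    using ntD(5)[OF t, of u X A "Ide C A"] A by simp
qed

lemma yoneda_fa: "A \<in> Ob C \<Longrightarrow> h \<in> Hom C A B \<Longrightarrow> fa (yoneda C) A B h = yo (Y B) A h"
  unfolding yo_def mknt_def yoneda_def by (auto intro!: restrict_ext)

lemma nt_yoneda: "h \<in> Hom C A B \<Longrightarrow> nt (Y A) (Y B) (fa (yoneda C) A B h)"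
  using nt_yo[OF psh_Y] yoneda_fa Hom_ObC by simp

lemma yoneda_apply: "h \<in> Hom C A B \<Longrightarrow> u \<in> Hom C X A \<Longrightarrow> fa (yoneda C) A B h X u = Cmp C X A B h u"
  using yoneda_fa[of A h B] Hom_ObC by simp

lemma nt_Y_Y:
  assumes "A \<in> Ob C" "nt (Y A) (Y B) t"
  shows "t A (Ide C A) \<in> Hom C A B" "t = fa (yoneda C) A B (t A (Ide C A))"
proof -
  show h: "t A (Ide C A) \<in> Hom C A B" using ntD(4)[OF assms(2,1), of "Ide C A"] assms by simp
  show "t = fa (yoneda C) A B (t A (Ide C A))"
    using nt_Y[OF assms] yoneda_fa[OF assms(1) h] by simp
qed

lemma yoneda_inj:
  assumes "h \<in> Hom C A B" "h' \<in> Hom C A B" "fa (yoneda C) A B h = fa (yoneda C) A B h'"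
  shows "h = h'"
proof -
  have A: "A \<in> Ob C" using dom[OF assms(1)] .
  have "h = fa (yoneda C) A B h A (Ide C A)"
    unfolding yoneda_apply[OF assms(1) idC[OF A]] comp_idC[OF assms(1)] by (rule refl)
  also have "\<dots> = h'"
    unfolding assms(3) yoneda_apply[OF assms(2) idC[OF A]] comp_idC[OF assms(2)] by (rule refl)
  finally show ?thesis .
qed

subsection \<open>Constructing presheaves\<close>

text \<open>Presheaves take values in sets of elements of \<open>'u\<close>, whereas quotients and
  sets of compatible families have other types. A small set injects into \<open>'u\<close>, and the
  action is transported along chosen injections.\<close>

lemma psh_encode:
  fixes Q :: "'o \<Rightarrow> 'z set" and act :: "'o \<Rightarrow> 'o \<Rightarrow> 'u \<Rightarrow> 'z \<Rightarrow> 'z"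
  assumes Q: "\<And>A. A \<in> Ob C \<Longrightarrow> small TYPE('u) (Q A)"
    and act: "\<And>A B u z. u \<in> Hom C B A \<Longrightarrow> z \<in> Q A \<Longrightarrow> act A B u z \<in> Q B"
      "\<And>A z. A \<in> Ob C \<Longrightarrow> z \<in> Q A \<Longrightarrow> act A A (Ide C A) z = z"
      "\<And>A B D u v z. u \<in> Hom C B A \<Longrightarrow> v \<in> Hom C D B \<Longrightarrow> z \<in> Q A \<Longrightarrow>
         act A D (Cmp C D B A u v) z = act B D v (act A B u z)"
  obtains F e where "psh F" "\<And>A. A \<in> Ob C \<Longrightarrow> bij_betw (e A) (Q A) (fo F A)"
    "\<And>A B u z. u \<in> Hom C B A \<Longrightarrow> z \<in> Q A \<Longrightarrow> fa F A B u (e A z) = e B (act A B u z)"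
proof -
  have "\<exists>e :: 'z \<Rightarrow> 'u. inj_on e (Q A)" if "A \<in> Ob C" for A using small_embedding[OF Q[OF that]] by blast
  then obtain e :: "'o \<Rightarrow> 'z \<Rightarrow> 'u" where e: "\<And>A. A \<in> Ob C \<Longrightarrow> inj_on (e A) (Q A)" by metis
  define F where "F = \<lparr>fo = (\<lambda>A. e A ` Q A), fa = (\<lambda>A B u. \<lambda>x\<in>e A ` Q A. e B (act A B u (inv_into (Q A) (e A) x)))\<rparr>"
  have fa: "fa F A B u (e A z) = e B (act A B u z)" if "u \<in> Hom C B A" "z \<in> Q A" for A B u z
    using that e[of A] Hom_ObC[OF that(1)] by (simp add: F_def)
  have fo: "fo F A = e A ` Q A" for A by (simp add: F_def)
  have "psh F"
  proof (rule pshI)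
    fix A B u assume u: "u \<in> Hom C B A"
    have "fa F A B u \<in> extensional (fo F A)" by (simp add: F_def)
    moreover have "fa F A B u x \<in> fo F B" if "x \<in> fo F A" for x
      using that fa[OF u] act(1)[OF u] by (auto simp: fo)
    ultimately show "fa F A B u \<in> fo F A \<rightarrow>\<^sub>E fo F B" by (simp add: PiE_iff)
  qed (use act Q Hom_ObC in \<open>auto simp: fa fo intro: small_image\<close>)
  then show thesis using that[of F e] e fa by (simp add: fo bij_betw_def)
qed

definition subp :: "('o, 'u) presheaf \<Rightarrow> ('o \<Rightarrow> 'u set) \<Rightarrow> ('o, 'u) presheaf" where
  "subp F I = \<lparr>fo = I, fa = (\<lambda>A B u. \<lambda>x\<in>I A. fa F A B u x)\<rparr>"

definition subfamily :: "('o, 'u) presheaf \<Rightarrow> ('o \<Rightarrow> 'u set) \<Rightarrow> bool" where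
  "subfamily F I \<longleftrightarrow> psh F \<and> (\<forall>A\<in>Ob C. I A \<subseteq> fo F A) \<and>
     (\<forall>A B u x. u \<in> Hom C B A \<longrightarrow> x \<in> I A \<longrightarrow> fa F A B u x \<in> I B)"

lemma subp_simps [simp]: "fo (subp F I) A = I A" "fa (subp F I) A B u = (\<lambda>x\<in>I A. fa F A B u x)"
  by (simp_all add: subp_def)

lemma psh_subp:
  assumes "subfamily F I" shows "psh (subp F I)"
proof -
  have F: "psh F" and I: "\<And>A x. A \<in> Ob C \<Longrightarrow> x \<in> I A \<Longrightarrow> x \<in> fo F A"
    and u: "\<And>A B u x. u \<in> Hom C B A \<Longrightarrow> x \<in> I A \<Longrightarrow> fa F A B u x \<in> I B"
    using assms unfolding subfamily_def by blast+
  show ?thesis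
  proof (rule pshI)
    fix A assume "A \<in> Ob C"
    then show "small TYPE('u) (fo (subp F I) A)" using small_subset[OF psh_small[OF F], of A "I A"] I by auto
  next
    fix A B D u v x assume a: "u \<in> Hom C B A" "v \<in> Hom C D B" "x \<in> fo (subp F I) A"
    then show "fa (subp F I) A D (Cmp C D B A u v) x = fa (subp F I) B D v (fa (subp F I) A B u x)"
      using psh_comp[OF F a(1,2)] u[OF a(1)] I[OF cod[OF a(1)]] by simp
  qed (use u I psh_id[OF F] in auto)
qed

lemma nt_incl: "subfamily F I \<Longrightarrow> nt (subp F I) F (mknt (subp F I) (\<lambda>A x. x))"
  by (rule nt_mknt) (use psh_subp in \<open>auto simp: subfamily_def\<close>)

section \<open>Small generation\<close>

text \<open>\<open>S\<close> is a set of generators, each a pair of a stage \<open>Z\<close> and an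
  element \<open>s\<close> at \<open>Z\<close>. For a sieve on \<open>A\<close>, read as a subfamily
  of \<open>Y A\<close>, this is generation by a small set of arrows.\<close>

definition generated :: "('o, 'u) presheaf \<Rightarrow> ('o \<Rightarrow> 'u set) \<Rightarrow> bool" where
  "generated F R \<longleftrightarrow> (\<exists>S. small TYPE('u) S \<and> (\<forall>Z s. (Z, s) \<in> S \<longrightarrow> Z \<in> Ob C \<and> s \<in> R Z) \<and>
     (\<forall>X\<in>Ob C. \<forall>x\<in>R X. \<exists>Z s. (Z, s) \<in> S \<and> (\<exists>v\<in>Hom C X Z. x = fa F Z X v s)))"

definition sieve :: "'o \<Rightarrow> ('o \<Rightarrow> 'u set) \<Rightarrow> bool" where
  "sieve A R \<longleftrightarrow> A \<in> Ob C \<and> (\<forall>X. R X \<subseteq> Hom C X A) \<and>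
     (\<forall>X W r v. r \<in> R X \<longrightarrow> v \<in> Hom C W X \<longrightarrow> Cmp C W X A r v \<in> R W)"

lemma sieveD:
  assumes "sieve A R"
  shows "A \<in> Ob C" "r \<in> R X \<Longrightarrow> r \<in> Hom C X A" "r \<in> R X \<Longrightarrow> v \<in> Hom C W X \<Longrightarrow> Cmp C W X A r v \<in> R W"
  using assms unfolding sieve_def by blast+

definition pull :: "'o \<Rightarrow> 'o \<Rightarrow> 'u \<Rightarrow> ('o \<Rightarrow> 'u set) \<Rightarrow> 'o \<Rightarrow> 'u set" where
  "pull A B u R X = {v \<in> Hom C X B. Cmp C X B A u v \<in> R X}"

lemma sieve_pull: "sieve A R \<Longrightarrow> u \<in> Hom C B A \<Longrightarrow> sieve B (pull A B u R)"
  unfolding sieve_def pull_def using dom by (auto simp: assocC[symmetric])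

lemma sieve_Int: "sieve A R \<Longrightarrow> sieve A R' \<Longrightarrow> sieve A (\<lambda>X. R X \<inter> R' X)"
  unfolding sieve_def by blast

lemma sieve_max: "A \<in> Ob C \<Longrightarrow> sieve A (\<lambda>X. Hom C X A)"
  unfolding sieve_def by auto

lemma generatedI:
  assumes "small TYPE('u) S" "\<And>Z s. (Z, s) \<in> S \<Longrightarrow> Z \<in> Ob C \<and> s \<in> R Z"
    "\<And>X x. X \<in> Ob C \<Longrightarrow> x \<in> R X \<Longrightarrow> \<exists>Z s. (Z, s) \<in> S \<and> (\<exists>v\<in>Hom C X Z. x = fa F Z X v s)"
  shows "generated F R"
  unfolding generated_def using assms by blast

lemma generated_empty: "generated F (\<lambda>X. {})"
  by (rule generatedI[of "{}"]) (auto intro: small_finite[OF univ])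

lemma generated_sieveD:
  assumes "sieve A R" "generated (Y A) R"
  obtains S where "small TYPE('u) S" "\<And>Z s. (Z, s) \<in> S \<Longrightarrow> s \<in> R Z"
    "\<And>X r. r \<in> R X \<Longrightarrow> \<exists>Z s. (Z, s) \<in> S \<and> (\<exists>v\<in>Hom C X Z. r = Cmp C X Z A s v)"
proof -
  obtain S where S: "small TYPE('u) S" "\<And>Z s. (Z, s) \<in> S \<Longrightarrow> Z \<in> Ob C \<and> s \<in> R Z"
    "\<And>X r. X \<in> Ob C \<Longrightarrow> r \<in> R X \<Longrightarrow> \<exists>Z s. (Z, s) \<in> S \<and> (\<exists>v\<in>Hom C X Z. r = fa (Y A) Z X v s)"
    using assms(2) unfolding generated_def by blast
  show thesis
  proof (rule that[OF S(1)])
    fix X r assume r: "r \<in> R X"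
    then obtain Z s v where "(Z, s) \<in> S" "v \<in> Hom C X Z" "r = fa (Y A) Z X v s"
      using S(3)[of X r] sieveD(2)[OF assms(1) r] dom by blast
    then show "\<exists>Z s. (Z, s) \<in> S \<and> (\<exists>v\<in>Hom C X Z. r = Cmp C X Z A s v)"
      using S(2) sieveD(2)[OF assms(1)] by auto
  qed (use S in blast)
qed

lemma generated_sieveI:
  assumes "sieve A R" "small TYPE('u) S" "\<And>Z s. (Z, s) \<in> S \<Longrightarrow> s \<in> R Z"
    "\<And>X r. r \<in> R X \<Longrightarrow> \<exists>Z s. (Z, s) \<in> S \<and> (\<exists>v\<in>Hom C X Z. r = Cmp C X Z A s v)"
  shows "generated (Y A) R"
proof (rule generatedI[OF assms(2)])
  fix Z s assume "(Z, s) \<in> S"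
  then show "Z \<in> Ob C \<and> s \<in> R Z" using assms(3) sieveD(2)[OF assms(1)] dom by blast
next
  fix X r assume "r \<in> R X"
  then obtain Z s v where "(Z, s) \<in> S" "v \<in> Hom C X Z" "r = Cmp C X Z A s v" using assms(4) by blast
  moreover from this have "s \<in> Hom C Z A" using assms(3) sieveD(2)[OF assms(1)] by blast
  ultimately show "\<exists>Z s. (Z, s) \<in> S \<and> (\<exists>v\<in>Hom C X Z. r = fa (Y A) Z X v s)" by auto
qed

lemma generated_UN:
  assumes I: "small TYPE('u) I" and R: "\<And>i. i \<in> I \<Longrightarrow> generated F (R i)"
  shows "generated F (\<lambda>X. \<Union>i\<in>I. R i X)"
proof -
  have "\<forall>i\<in>I. \<exists>S. small TYPE('u) S \<and> (\<forall>Z s. (Z, s) \<in> S \<longrightarrow> Z \<in> Ob C \<and> s \<in> R i Z) \<and>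
     (\<forall>X\<in>Ob C. \<forall>x\<in>R i X. \<exists>Z s. (Z, s) \<in> S \<and> (\<exists>v\<in>Hom C X Z. x = fa F Z X v s))"
    using R unfolding generated_def by blast
  then obtain S where S: "\<And>i. i \<in> I \<Longrightarrow> small TYPE('u) (S i)"
    "\<And>i Z s. i \<in> I \<Longrightarrow> (Z, s) \<in> S i \<Longrightarrow> Z \<in> Ob C \<and> s \<in> R i Z"
    "\<And>i X x. i \<in> I \<Longrightarrow> X \<in> Ob C \<Longrightarrow> x \<in> R i X \<Longrightarrow> \<exists>Z s. (Z, s) \<in> S i \<and> (\<exists>v\<in>Hom C X Z. x = fa F Z X v s)"
    by metis
  show ?thesis
  proof (rule generatedI)
    show "small TYPE('u) (\<Union>i\<in>I. S i)" by (rule small_UN[OF univ I S(1)])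
  next
    fix Z s assume "(Z, s) \<in> (\<Union>i\<in>I. S i)"
    then show "Z \<in> Ob C \<and> s \<in> (\<Union>i\<in>I. R i Z)" using S(2) by blast
  next
    fix X x assume "X \<in> Ob C" "x \<in> (\<Union>i\<in>I. R i X)"
    then obtain i where i: "i \<in> I" "x \<in> R i X" "X \<in> Ob C" by blast
    from S(3)[OF i(1,3,2)] i(1) show "\<exists>Z s. (Z, s) \<in> (\<Union>i\<in>I. S i) \<and> (\<exists>v\<in>Hom C X Z. x = fa F Z X v s)"
      by blast
  qed
qed

lemma generated_Un: "generated F R \<Longrightarrow> generated F R' \<Longrightarrow> generated F (\<lambda>X. R X \<union> R' X)"
  using generated_UN[of "UNIV :: bool set" F "\<lambda>b. if b then R else R'"] small_finite[OF univ, of "UNIV :: bool set"]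
  by (simp add: UN_bool_eq)

lemma pullbackC:
  assumes "f \<in> Hom C X Z" "g \<in> Hom C W Z"
  obtains P p q where "p \<in> Hom C P X" "q \<in> Hom C P W" "Cmp C P X Z f p = Cmp C P W Z g q"
    "\<And>Q a b. a \<in> Hom C Q X \<Longrightarrow> b \<in> Hom C Q W \<Longrightarrow> Cmp C Q X Z f a = Cmp C Q W Z g b \<Longrightarrow>
       \<exists>h\<in>Hom C Q P. Cmp C Q P X p h = a \<and> Cmp C Q P W q h = b"
proof -
  obtain P \<pi> where "is_limit cospan C (cospan_fctr C X W Z f g) P \<pi>"
    using fin_complete is_functor_cospan[OF cat assms] finite_category_cospan
    unfolding finitely_complete_def by blast
  then have P: "is_pullback C X W Z f g P (\<pi> 0) (\<pi> 1)" using is_limit_cospan[OF cat assms] by blast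
  show thesis
  proof (rule that[of "\<pi> 0" P "\<pi> 1"])
    fix Q a b assume "a \<in> Hom C Q X" "b \<in> Hom C Q W" "Cmp C Q X Z f a = Cmp C Q W Z g b"
    then show "\<exists>h\<in>Hom C Q P. Cmp C Q P X (\<pi> 0) h = a \<and> Cmp C Q P W (\<pi> 1) h = b"
      using P dom unfolding is_pullback_def by blast
  qed (use P in \<open>auto simp: is_pullback_def\<close>)
qed

text \<open>Each generator of \<open>R\<close> is pulled back along \<open>u\<close>, and the
  resulting arrows into \<open>B\<close> generate the pulled back sieve. The pullbacks in
  \<open>C\<close> are what makes small generation stable.\<close>

lemma generated_pull:
  assumes R: "sieve A R" "generated (Y A) R" and u: "u \<in> Hom C B A"
  shows "generated (Y B) (pull A B u R)"
proof -
  obtain S where S: "small TYPE('u) S" "\<And>Z s. (Z, s) \<in> S \<Longrightarrow> s \<in> R Z"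
    "\<And>X r. r \<in> R X \<Longrightarrow> \<exists>Z s. (Z, s) \<in> S \<and> (\<exists>v\<in>Hom C X Z. r = Cmp C X Z A s v)"
    using generated_sieveD[OF R] by metis
  have "\<exists>P p q. p \<in> Hom C P B \<and> q \<in> Hom C P Z \<and> Cmp C P B A u p = Cmp C P Z A s q \<and>
      (\<forall>Q a b. a \<in> Hom C Q B \<longrightarrow> b \<in> Hom C Q Z \<longrightarrow> Cmp C Q B A u a = Cmp C Q Z A s b \<longrightarrow>
         (\<exists>h\<in>Hom C Q P. Cmp C Q P B p h = a))" if "(Z, s) \<in> S" for Z s
  proof -
    have "s \<in> Hom C Z A" using S(2)[OF that] sieveD(2)[OF R(1)] by blast
    from pullbackC[OF u this] show ?thesis by metis
  qed
  \<comment> \<open>The pullback object and its projection to \<open>B\<close> are bundled into one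
    pair, so that a single choice function yields the new generators.\<close>
  then have "\<forall>t\<in>S. \<exists>w. snd w \<in> Hom C (fst w) B \<and> (\<exists>q\<in>Hom C (fst w) (fst t). Cmp C (fst w) B A u (snd w) = Cmp C (fst w) (fst t) A (snd t) q) \<and>
      (\<forall>Q a b. a \<in> Hom C Q B \<longrightarrow> b \<in> Hom C Q (fst t) \<longrightarrow> Cmp C Q B A u a = Cmp C Q (fst t) A (snd t) b \<longrightarrow>
         (\<exists>h\<in>Hom C Q (fst w). Cmp C Q (fst w) B (snd w) h = a))"
    by fastforce
  then obtain w where w: "\<And>t. t \<in> S \<Longrightarrow> snd (w t) \<in> Hom C (fst (w t)) B"
    "\<And>t. t \<in> S \<Longrightarrow> (\<exists>q\<in>Hom C (fst (w t)) (fst t). Cmp C (fst (w t)) B A u (snd (w t)) = Cmp C (fst (w t)) (fst t) A (snd t) q)"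
    "\<And>t Q a b. t \<in> S \<Longrightarrow> a \<in> Hom C Q B \<Longrightarrow> b \<in> Hom C Q (fst t) \<Longrightarrow> Cmp C Q B A u a = Cmp C Q (fst t) A (snd t) b \<Longrightarrow>
         (\<exists>h\<in>Hom C Q (fst (w t)). Cmp C Q (fst (w t)) B (snd (w t)) h = a)"
    by (metis (no_types, lifting))
  show ?thesis
  proof (rule generated_sieveI[OF sieve_pull[OF R(1) u]])
    show "small TYPE('u) (w ` S)" by (rule small_image[OF S(1)])
  next
    fix Z s assume "(Z, s) \<in> w ` S"
    then obtain t where t: "t \<in> S" "w t = (Z, s)" by auto
    obtain q where q: "q \<in> Hom C Z (fst t)" "Cmp C Z B A u s = Cmp C Z (fst t) A (snd t) q"
      using w(2)[OF t(1)] t(2) by auto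
    have "snd t \<in> R (fst t)" using S(2)[of "fst t" "snd t"] t by simp
    then have "Cmp C Z B A u s \<in> R Z" using sieveD(3)[OF R(1) _ q(1)] q(2) by simp
    then show "s \<in> pull A B u R Z" using w(1)[OF t(1)] t(2) by (simp add: pull_def)
  next
    fix X r assume r: "r \<in> pull A B u R X"
    then obtain Z s v where s: "(Z, s) \<in> S" "v \<in> Hom C X Z" "Cmp C X B A u r = Cmp C X Z A s v"
      using S(3) unfolding pull_def by blast
    then obtain h where "h \<in> Hom C X (fst (w (Z, s)))" "Cmp C X (fst (w (Z, s))) B (snd (w (Z, s))) h = r"
      using w(3)[OF s(1), of r X v] r unfolding pull_def by auto
    then show "\<exists>Z s. (Z, s) \<in> w ` S \<and> (\<exists>v\<in>Hom C X Z. r = Cmp C X Z B s v)"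
      using s(1) by (metis image_eqI prod.collapse)
  qed
qed

lemma sieve_image:
  assumes "sieve B R" "u \<in> Hom C B A"
  shows "sieve A (\<lambda>X. Cmp C X B A u ` R X)"
  unfolding sieve_def
proof (intro conjI allI impI)
  fix X W r v assume "r \<in> Cmp C X B A u ` R X" and v: "v \<in> Hom C W X"
  then obtain r' where r': "r' \<in> R X" "r = Cmp C X B A u r'" by blast
  have "Cmp C W X A r v = Cmp C W B A u (Cmp C W X B r' v)"
    using assocC[OF v sieveD(2)[OF assms(1) r'(1)] assms(2)] r'(2) by simp
  then show "Cmp C W X A r v \<in> Cmp C W B A u ` R W" using sieveD(3)[OF assms(1) r'(1) v] by blast
qed (use sieveD(2)[OF assms(1)] assms(2) cod in auto)

lemma generated_image:
  assumes R: "sieve B R" "generated (Y B) R" and u: "u \<in> Hom C B A"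
  shows "generated (Y A) (\<lambda>X. Cmp C X B A u ` R X)"
proof -
  obtain S where S: "small TYPE('u) S" "\<And>Z s. (Z, s) \<in> S \<Longrightarrow> s \<in> R Z"
    "\<And>X r. r \<in> R X \<Longrightarrow> \<exists>Z s. (Z, s) \<in> S \<and> (\<exists>v\<in>Hom C X Z. r = Cmp C X Z B s v)"
    using generated_sieveD[OF R] by metis
  show ?thesis
  proof (rule generated_sieveI[OF sieve_image[OF R(1) u]])
    show "small TYPE('u) ((\<lambda>(Z, s). (Z, Cmp C Z B A u s)) ` S)" by (rule small_image[OF S(1)])
  next
    fix Z s assume "(Z, s) \<in> (\<lambda>(Z, s). (Z, Cmp C Z B A u s)) ` S"
    then show "s \<in> Cmp C Z B A u ` R Z" using S(2) by auto
  next
    fix X r assume "r \<in> Cmp C X B A u ` R X"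
    then obtain r' where "r' \<in> R X" and rr: "r = Cmp C X B A u r'" by blast
    then obtain Z s v where s: "(Z, s) \<in> S" "v \<in> Hom C X Z" "r' = Cmp C X Z B s v" using S(3) by blast
    have "r = Cmp C X Z A (Cmp C Z B A u s) v"
      using assocC[OF s(2) sieveD(2)[OF R(1) S(2)[OF s(1)]] u] rr s(3) by simp
    then show "\<exists>Z s. (Z, s) \<in> (\<lambda>(Z, s). (Z, Cmp C Z B A u s)) ` S \<and> (\<exists>v\<in>Hom C X Z. r = Cmp C X Z A s v)"
      using s by (metis (no_types, lifting) case_prod_conv image_eqI)
  qed
qed

text \<open>An arrow of \<open>R\<close> is a generator \<open>s\<close> of \<open>R\<close>
  composed with some \<open>v\<close>, and it lies in \<open>R'\<close> exactly if \<open>v\<close>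
  lies in the pullback of \<open>R'\<close> along \<open>s\<close>. So the intersection is a small
  union of images of pullbacks.\<close>

lemma generated_Int:
  assumes R: "sieve A R" "generated (Y A) R" and R': "sieve A R'" "generated (Y A) R'"
  shows "generated (Y A) (\<lambda>X. R X \<inter> R' X)"
proof -
  obtain S where S: "small TYPE('u) S" "\<And>Z s. (Z, s) \<in> S \<Longrightarrow> s \<in> R Z"
    "\<And>X r. r \<in> R X \<Longrightarrow> \<exists>Z s. (Z, s) \<in> S \<and> (\<exists>v\<in>Hom C X Z. r = Cmp C X Z A s v)"
    using generated_sieveD[OF R] by metis
  have "generated (Y A) (\<lambda>X. \<Union>t\<in>S. Cmp C X (fst t) A (snd t) ` pull A (fst t) (snd t) R' X)"
  proof (rule generated_UN[OF S(1)])
    fix t assume "t \<in> S"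
    then have s: "snd t \<in> Hom C (fst t) A" using S(2)[of "fst t" "snd t"] sieveD(2)[OF R(1)] by simp
    show "generated (Y A) (\<lambda>X. Cmp C X (fst t) A (snd t) ` pull A (fst t) (snd t) R' X)"
      by (intro generated_image generated_pull sieve_pull R' s)
  qed
  moreover have "(\<Union>t\<in>S. Cmp C X (fst t) A (snd t) ` pull A (fst t) (snd t) R' X) = R X \<inter> R' X" for X
  proof (intro equalityI subsetI)
    fix r assume "r \<in> (\<Union>t\<in>S. Cmp C X (fst t) A (snd t) ` pull A (fst t) (snd t) R' X)"
    then show "r \<in> R X \<inter> R' X" using S(2) sieveD(3)[OF R(1)] unfolding pull_def by fastforce
  next
    fix r assume r: "r \<in> R X \<inter> R' X"
    then obtain Z s v where s: "(Z, s) \<in> S" "v \<in> Hom C X Z" "r = Cmp C X Z A s v" using S(3) by blast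
    then have "v \<in> pull A Z s R' X" using r unfolding pull_def by simp
    then show "r \<in> (\<Union>t\<in>S. Cmp C X (fst t) A (snd t) ` pull A (fst t) (snd t) R' X)"
      using s by (intro UN_I[of "(Z, s)"]) auto
  qed
  ultimately show ?thesis by simp
qed

lemma generated_max: "A \<in> Ob C \<Longrightarrow> generated (Y A) (\<lambda>X. Hom C X A)"
proof (rule generated_sieveI[OF sieve_max])
  assume "A \<in> Ob C"
  show "small TYPE('u) {(A, Ide C A)}" by (rule small_finite[OF univ]) simp
  fix X r assume "r \<in> Hom C X A"
  then show "\<exists>Z s. (Z, s) \<in> {(A, Ide C A)} \<and> (\<exists>v\<in>Hom C X Z. r = Cmp C X Z A s v)" by auto
qed auto

lemma finite_INT_sieve:
  assumes "finite I" "A \<in> Ob C" "\<And>i. i \<in> I \<Longrightarrow> sieve A (R i)"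
  shows "sieve A (\<lambda>X. {u \<in> Hom C X A. \<forall>i\<in>I. u \<in> R i X})"
  using assms(2,3) unfolding sieve_def by auto

lemma generated_finite_INT:
  assumes "finite I" "A \<in> Ob C" "\<And>i. i \<in> I \<Longrightarrow> sieve A (R i)" "\<And>i. i \<in> I \<Longrightarrow> generated (Y A) (R i)"
  shows "generated (Y A) (\<lambda>X. {u \<in> Hom C X A. \<forall>i\<in>I. u \<in> R i X})"
  using assms(1,3,4)
proof (induction I)
  case empty
  then show ?case using generated_max[OF assms(2)] by simp
next
  case (insert i I)
  have "generated (Y A) (\<lambda>X. R i X \<inter> {u \<in> Hom C X A. \<forall>i\<in>I. u \<in> R i X})"
    by (rule generated_Int) (use insert finite_INT_sieve[OF insert(1) assms(2)] in auto)
  moreover have "R i X \<inter> {u \<in> Hom C X A. \<forall>i\<in>I. u \<in> R i X} = {u \<in> Hom C X A. \<forall>i\<in>insert i I. u \<in> R i X}" for X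
    using sieveD(2)[of A "R i"] insert.prems(1) by auto
  ultimately show ?case by simp
qed

section \<open>Equality sieves and small presentations\<close>

definition eq_sieve :: "('o, 'u) presheaf \<Rightarrow> 'o \<Rightarrow> 'u \<Rightarrow> 'u \<Rightarrow> 'o \<Rightarrow> 'u set" where
  "eq_sieve F A x x' X = {u \<in> Hom C X A. fa F A X u x = fa F A X u x'}"

lemma sieve_eq_sieve: "psh F \<Longrightarrow> A \<in> Ob C \<Longrightarrow> x \<in> fo F A \<Longrightarrow> x' \<in> fo F A \<Longrightarrow> sieve A (eq_sieve F A x x')"
  unfolding sieve_def eq_sieve_def by (auto simp: psh_comp)

lemma pull_eq_sieve:
  "psh F \<Longrightarrow> u \<in> Hom C B A \<Longrightarrow> x \<in> fo F A \<Longrightarrow> x' \<in> fo F A \<Longrightarrow>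
    pull A B u (eq_sieve F A x x') = eq_sieve F B (fa F A B u x) (fa F A B u x')"
  unfolding pull_def eq_sieve_def by (auto simp: psh_comp fun_eq_iff)

text \<open>An arrow lies in this sieve if and only if it factors through the equalizer of
  \<open>y\<close> and \<open>y'\<close>, so one generator is enough.\<close>

lemma generated_eq_sieve_Y:
  assumes "y \<in> Hom C A B" "y' \<in> Hom C A B"
  shows "generated (Y A) (eq_sieve (Y B) A y y')"
proof -
  obtain P e where e: "e \<in> Hom C P A" "Cmp C P A B y e = Cmp C P A B y' e"
    "\<And>X u. u \<in> Hom C X A \<Longrightarrow> Cmp C X A B y u = Cmp C X A B y' u \<Longrightarrow> \<exists>h\<in>Hom C X P. Cmp C X P A e h = u"
    using finitely_complete_equalizer[OF fin_complete assms] by metis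
  show ?thesis
  proof (rule generated_sieveI[OF sieve_eq_sieve])
    show "small TYPE('u) {(P, e)}" by (rule small_finite[OF univ]) simp
    fix X r assume "r \<in> eq_sieve (Y B) A y y' X"
    then show "\<exists>Z s. (Z, s) \<in> {(P, e)} \<and> (\<exists>v\<in>Hom C X Z. r = Cmp C X Z A s v)"
      using e(3)[of r X] assms by (auto simp: eq_sieve_def)
  qed (use assms e psh_Y dom cod in \<open>auto simp: eq_sieve_def\<close>)
qed

lemma binary_productC:
  assumes "A \<in> Ob C" "B \<in> Ob C"
  obtains P p q where "p \<in> Hom C P A" "q \<in> Hom C P B"
    "\<And>X a b. a \<in> Hom C X A \<Longrightarrow> b \<in> Hom C X B \<Longrightarrow> \<exists>h\<in>Hom C X P. Cmp C X P A p h = a \<and> Cmp C X P B q h = b"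
proof -
  let ?o = "\<lambda>i :: nat. if i = 0 then A else B"
  have o: "?o i \<in> Ob C" for i using assms by simp
  obtain P \<pi> where P: "\<And>i. i \<in> {0, 1} \<Longrightarrow> \<pi> i \<in> Hom C P (?o i)"
    "\<And>X f. X \<in> Ob C \<Longrightarrow> (\<And>i. i \<in> {0, 1} \<Longrightarrow> f i \<in> Hom C X (?o i)) \<Longrightarrow>
       \<exists>h\<in>Hom C X P. \<forall>i\<in>{0, 1}. Cmp C X P (?o i) (\<pi> i) h = f i"
    by (rule finitely_complete_product[OF fin_complete, of "{0, 1}" ?o]) (simp, rule o, blast)
  show thesis
  proof (rule that[of "\<pi> 0" P "\<pi> 1"])
    fix X a b assume "a \<in> Hom C X A" "b \<in> Hom C X B"
    then show "\<exists>h\<in>Hom C X P. Cmp C X P A (\<pi> 0) h = a \<and> Cmp C X P B (\<pi> 1) h = b"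
      using P(2)[of X "\<lambda>i. if i = 0 then a else b"] dom by auto
  qed (use P(1)[of 0] P(1)[of 1] in auto)
qed

text \<open>A small presentation: a small set of generators, and a small set of relations between
  any two elements of the same stage. Elements of different stages are compared after restriction to
  the product of the stages.\<close>

definition small_generated :: "('o, 'u) presheaf \<Rightarrow> bool" where
  "small_generated F \<longleftrightarrow> psh F \<and> generated F (fo F) \<and>
     (\<forall>A\<in>Ob C. \<forall>x\<in>fo F A. \<forall>x'\<in>fo F A. generated (Y A) (eq_sieve F A x x'))"

lemma small_generated_Y:
  assumes "A \<in> Ob C" shows "small_generated (Y A)"
proof -
  have "fo (Y A) = (\<lambda>X. Hom C X A)" by (auto simp: fun_eq_iff)
  then show ?thesis
    unfolding small_generated_def using psh_Y generated_max generated_eq_sieve_Y assms by simp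
qed

end

section \<open>Left Kan extensions along a functor into \<open>C\<close>\<close>

text \<open>Two kinds of instances share this setting: a lex weight with a lex diagram, and a
  presheaf restricted to a small full subcategory, with the inclusion as \<open>D\<close>. The
  second gives the Kan extensions in the definition of a small presheaf.\<close>

locale weighted_diagram = site C for C :: "('o, 'u) cat" +
  fixes K :: "('k, 'i) cat" and \<phi> :: "('k, 'i, 'u set, 'u \<Rightarrow> 'u) fctr" and D :: "('k, 'i, 'o, 'u) fctr"
  assumes D: "is_functor K C D" and \<phi>: "is_functor (opp K) Set_cat \<phi>"
    and small_Ob: "small TYPE('u) (Ob K)"
    and small_Hom: "k \<in> Ob K \<Longrightarrow> l \<in> Ob K \<Longrightarrow> small TYPE('u) (Hom K k l)"
begin

lemma catK: "category K" using is_functorD(1)[OF D] .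

lemmas D_Ob [simp] = is_functorD(3)[OF D] and D_Hom [simp] = is_functorD(4)[OF D]

lemma domK: "f \<in> Hom K k l \<Longrightarrow> k \<in> Ob K" and codK: "f \<in> Hom K k l \<Longrightarrow> l \<in> Ob K"
  using category.Hom_Ob[OF catK] by blast+

lemma \<phi>_small: "k \<in> Ob K \<Longrightarrow> small TYPE('u) (fo \<phi> k)"
  using is_functorD(3)[OF \<phi>, of k] by simp

lemma \<phi>_in [simp]: "g \<in> Hom K k l \<Longrightarrow> q \<in> fo \<phi> l \<Longrightarrow> fa \<phi> l k g q \<in> fo \<phi> k"
  using is_functorD(4)[OF \<phi>, of g l k] by (auto simp: Hom_Set_cat)

text \<open>A natural transformation from \<open>\<phi>\<close> to the composite of \<open>G\<close>
  with \<open>fop D\<close>, but without extensionality, so that cocones can be written as plain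
  functions; \<open>cocone_restrict\<close> passes between the two forms.\<close>

definition cocone :: "('o, 'u) presheaf \<Rightarrow> ('k \<Rightarrow> 'u \<Rightarrow> 'u) \<Rightarrow> bool" where
  "cocone G \<tau> \<longleftrightarrow> psh G \<and> (\<forall>k\<in>Ob K. \<forall>p\<in>fo \<phi> k. \<tau> k p \<in> fo G (fo D k)) \<and>
     (\<forall>k l g q. g \<in> Hom K k l \<longrightarrow> q \<in> fo \<phi> l \<longrightarrow>
        \<tau> k (fa \<phi> l k g q) = fa G (fo D l) (fo D k) (fa D k l g) (\<tau> l q))"

definition lan :: "('o, 'u) presheaf \<Rightarrow> ('k \<Rightarrow> 'u \<Rightarrow> 'u) \<Rightarrow> bool" where
  "lan Z \<epsilon> \<longleftrightarrow> cocone Z \<epsilon> \<and> (\<forall>G \<tau>. cocone G \<tau> \<longrightarrow>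
     (\<exists>!t. nt Z G t \<and> (\<forall>k\<in>Ob K. \<forall>p\<in>fo \<phi> k. t (fo D k) (\<epsilon> k p) = \<tau> k p)))"

section \<open>Agreement with the general notion of Kan extension\<close>

lemma cocone_iff:
  assumes "psh G"
  shows "nat_trans (opp K) Set_cat \<phi> (fcomp G (fop D)) \<alpha> \<longleftrightarrow>
    cocone G \<alpha> \<and> (\<forall>k\<in>Ob K. \<alpha> k \<in> extensional (fo \<phi> k))"
proof -
  have "compose (fo \<phi> l) (\<alpha> k) (fa \<phi> l k g) = compose (fo \<phi> l) (fa G (fo D l) (fo D k) (fa D k l g)) (\<alpha> l) \<longleftrightarrow>
     (\<forall>q\<in>fo \<phi> l. \<alpha> k (fa \<phi> l k g q) = fa G (fo D l) (fo D k) (fa D k l g) (\<alpha> l q))" for k l g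
    by (auto simp: compose_def fun_eq_iff)
  moreover have "is_functor (opp K) Set_cat (fcomp G (fop D))"
    by (rule is_functor_fcomp[OF is_functor_fop[OF D] assms])
  ultimately show ?thesis
    unfolding nat_trans_def cocone_def using assms \<phi> \<phi>_small psh_small[OF assms] domK codK
    by (auto simp: Hom_Set_cat PiE_iff)
qed

lemma is_lan_commutes_iff:
  assumes "psh Z" "cocone Z \<epsilon>" "cocone G \<tau>" "\<And>k. k \<in> Ob K \<Longrightarrow> \<tau> k \<in> extensional (fo \<phi> k)"
  shows "(\<forall>a\<in>Ob (opp K). Cmp Set_cat (fo \<phi> a) (fo Z (fo (fop D) a)) (fo G (fo (fop D) a)) (t (fo (fop D) a)) (\<epsilon> a) = \<tau> a)
    \<longleftrightarrow> (\<forall>k\<in>Ob K. \<forall>p\<in>fo \<phi> k. t (fo D k) (\<epsilon> k p) = \<tau> k p)"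
proof -
  have "compose (fo \<phi> k) (t (fo D k)) (\<epsilon> k) = \<tau> k \<longleftrightarrow> (\<forall>p\<in>fo \<phi> k. t (fo D k) (\<epsilon> k p) = \<tau> k p)" if "k \<in> Ob K" for k
    using assms(4)[OF that] by (auto simp: compose_def fun_eq_iff extensional_def)
  then show ?thesis by simp
qed

lemma cocone_restrict: "cocone G (\<lambda>k. \<lambda>p\<in>fo \<phi> k. \<tau> k p) \<longleftrightarrow> cocone G \<tau>"
  unfolding cocone_def using domK codK by auto

lemma is_lan_imp_lan:
  assumes "is_lan (opp K) (opp C) Set_cat (fop D) \<phi> Z \<eta>"
  shows "lan Z \<eta>"
  unfolding lan_def
proof (intro conjI allI impI)
  have Z: "psh Z" and \<eta>: "cocone Z \<eta>"
    using assms cocone_iff unfolding is_lan_def by blast+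
  show "cocone Z \<eta>" by fact
  fix G \<tau> assume \<tau>: "cocone G \<tau>"
  let ?\<tau> = "\<lambda>k. \<lambda>p\<in>fo \<phi> k. \<tau> k p"
  have c: "cocone G ?\<tau>" using \<tau> cocone_restrict by blast
  then have G: "psh G" "nat_trans (opp K) Set_cat \<phi> (fcomp G (fop D)) ?\<tau>"
    using cocone_iff[of G ?\<tau>] by (auto simp: cocone_def)
  have "\<exists>!t. nt Z G t \<and> (\<forall>k\<in>Ob K. \<forall>p\<in>fo \<phi> k. t (fo D k) (\<eta> k p) = ?\<tau> k p)"
    using assms G unfolding is_lan_def by (subst is_lan_commutes_iff[OF Z \<eta> c, symmetric]) auto
  then show "\<exists>!t. nt Z G t \<and> (\<forall>k\<in>Ob K. \<forall>p\<in>fo \<phi> k. t (fo D k) (\<eta> k p) = \<tau> k p)" by simp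
qed

lemma lan_imp_is_lan:
  assumes "lan Z \<epsilon>" and \<epsilon>_ext: "\<And>k. k \<in> Ob K \<Longrightarrow> \<epsilon> k \<in> extensional (fo \<phi> k)"
  shows "is_lan (opp K) (opp C) Set_cat (fop D) \<phi> Z \<epsilon>"
proof -
  have Z: "psh Z" and \<epsilon>: "cocone Z \<epsilon>" using assms unfolding lan_def cocone_def by blast+
  have "\<exists>!\<beta>. nt Z G \<beta> \<and> (\<forall>a\<in>Ob (opp K). Cmp Set_cat (fo \<phi> a) (fo Z (fo (fop D) a)) (fo G (fo (fop D) a)) (\<beta> (fo (fop D) a)) (\<epsilon> a) = \<alpha> a)"
    if "psh G" "nat_trans (opp K) Set_cat \<phi> (fcomp G (fop D)) \<alpha>" for G \<alpha>
  proof -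
    have \<alpha>: "cocone G \<alpha>" "\<And>k. k \<in> Ob K \<Longrightarrow> \<alpha> k \<in> extensional (fo \<phi> k)" using that cocone_iff by blast+
    have "(\<lambda>\<beta>. nt Z G \<beta> \<and> (\<forall>a\<in>Ob (opp K). Cmp Set_cat (fo \<phi> a) (fo Z (fo (fop D) a)) (fo G (fo (fop D) a)) (\<beta> (fo (fop D) a)) (\<epsilon> a) = \<alpha> a))
      = (\<lambda>t. nt Z G t \<and> (\<forall>k\<in>Ob K. \<forall>p\<in>fo \<phi> k. t (fo D k) (\<epsilon> k p) = \<alpha> k p))"
      by (intro ext arg_cong2[where f="(\<and>)"] refl) (rule is_lan_commutes_iff[OF Z \<epsilon> \<alpha>])
    moreover have "\<exists>!t. nt Z G t \<and> (\<forall>k\<in>Ob K. \<forall>p\<in>fo \<phi> k. t (fo D k) (\<epsilon> k p) = \<alpha> k p)"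
      using assms(1) \<alpha>(1) by (simp only: lan_def)
    ultimately show ?thesis by (simp only:)
  qed
  then show ?thesis
    unfolding is_lan_def
  proof (intro conjI allI impI is_functor_fop[OF D] Z)
    show "nat_trans (opp K) Set_cat \<phi> (fcomp Z (fop D)) \<epsilon>" using \<epsilon> \<epsilon>_ext cocone_iff[OF Z] by blast
  qed (elim conjE, assumption)
qed

lemma lan_unique:
  assumes "lan Z \<epsilon>" "nt Z G s" "nt Z G t"
    "\<And>k p. k \<in> Ob K \<Longrightarrow> p \<in> fo \<phi> k \<Longrightarrow> s (fo D k) (\<epsilon> k p) = t (fo D k) (\<epsilon> k p)"
  shows "s = t"
proof -
  have \<epsilon>: "cocone Z \<epsilon>" using assms(1) unfolding lan_def by blast
  have "cocone G (\<lambda>k p. t (fo D k) (\<epsilon> k p))"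
    using \<epsilon> ntD(2)[OF assms(3)] ntD(4,5)[OF assms(3)] domK codK unfolding cocone_def by simp
  then have "\<exists>!u. nt Z G u \<and> (\<forall>k\<in>Ob K. \<forall>p\<in>fo \<phi> k. u (fo D k) (\<epsilon> k p) = t (fo D k) (\<epsilon> k p))"
    using assms(1) by (simp only: lan_def)
  then obtain w where w: "\<And>u. nt Z G u \<Longrightarrow> \<forall>k\<in>Ob K. \<forall>p\<in>fo \<phi> k. u (fo D k) (\<epsilon> k p) = t (fo D k) (\<epsilon> k p) \<Longrightarrow> u = w"
    by (elim ex1E) blast
  show ?thesis using w[OF assms(2)] w[OF assms(3)] assms(4) by blast
qed

lemma lan_map:
  assumes "lan Z \<epsilon>" "cocone G \<tau>"
  obtains t where "nt Z G t" "\<And>k p. k \<in> Ob K \<Longrightarrow> p \<in> fo \<phi> k \<Longrightarrow> t (fo D k) (\<epsilon> k p) = \<tau> k p"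
  using assms unfolding lan_def by blast

subsection \<open>The coend formula\<close>

text \<open>Representatives of the elements at \<open>X\<close> of the coend, over \<open>k\<close>,
  of the product of \<open>fo \<phi> k\<close> and \<open>Hom C X (fo D k)\<close>.\<close>

definition triples :: "'o \<Rightarrow> ('k \<times> 'u \<times> 'u) set" where
  "triples X = (SIGMA k : Ob K. fo \<phi> k \<times> Hom C X (fo D k))"

definition act :: "'o \<Rightarrow> 'o \<Rightarrow> 'u \<Rightarrow> 'k \<times> 'u \<times> 'u \<Rightarrow> 'k \<times> 'u \<times> 'u" where
  "act X W v = (\<lambda>(k, p, y). (k, p, Cmp C W X (fo D k) y v))"

text \<open>The generating relation of the coend, with \<open>g\<close> moved across from
  \<open>\<phi>\<close> to \<open>D\<close>. It is kept directed because a lift of the source of a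
  step is also a lift of its target, as is used when zigzags are lifted.\<close>

definition step :: "'o \<Rightarrow> 'k \<times> 'u \<times> 'u \<Rightarrow> 'k \<times> 'u \<times> 'u \<Rightarrow> bool" where
  "step X = (\<lambda>(k, p, y) (l, q, z). y \<in> Hom C X (fo D k) \<and> q \<in> fo \<phi> l \<and>
     (\<exists>g\<in>Hom K k l. p = fa \<phi> l k g q \<and> z = Cmp C X (fo D k) (fo D l) (fa D k l g) y))"

definition symstep :: "'o \<Rightarrow> 'k \<times> 'u \<times> 'u \<Rightarrow> 'k \<times> 'u \<times> 'u \<Rightarrow> bool" where
  "symstep X s t \<longleftrightarrow> step X s t \<or> step X t s"

definition zigzag :: "'o \<Rightarrow> 'k \<times> 'u \<times> 'u \<Rightarrow> 'k \<times> 'u \<times> 'u \<Rightarrow> bool" where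
  "zigzag X = (symstep X)\<^sup>*\<^sup>*"

lemma step_triples: "step X s t \<Longrightarrow> s \<in> triples X" "step X s t \<Longrightarrow> t \<in> triples X"
  unfolding step_def triples_def using domK codK by auto

lemma act_triples: "t \<in> triples X \<Longrightarrow> v \<in> Hom C W X \<Longrightarrow> act X W v t \<in> triples W"
  unfolding act_def triples_def by auto

lemma step_act: "step X s t \<Longrightarrow> v \<in> Hom C W X \<Longrightarrow> step W (act X W v s) (act X W v t)"
  unfolding step_def act_def by (auto simp: assocC)

lemma symstep_act: "symstep X s t \<Longrightarrow> v \<in> Hom C W X \<Longrightarrow> symstep W (act X W v s) (act X W v t)"
  unfolding symstep_def using step_act by blast

lemma zigzag_act: "zigzag X s t \<Longrightarrow> v \<in> Hom C W X \<Longrightarrow> zigzag W (act X W v s) (act X W v t)"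
  unfolding zigzag_def by (induction rule: rtranclp_induct) (auto intro: rtranclp.rtrancl_into_rtrancl symstep_act)

lemma relpow_act: "(symstep X ^^ n) s t \<Longrightarrow> v \<in> Hom C W X \<Longrightarrow> (symstep W ^^ n) (act X W v s) (act X W v t)"
proof (induction n arbitrary: t)
  case (Suc n)
  from Suc.prems(1) obtain r where "(symstep X ^^ n) s r" "symstep X r t" by (rule relpowp_Suc_E)
  then show ?case using Suc.IH Suc.prems(2) symstep_act by (meson relpowp_Suc_I)
qed simp

lemma zigzag_sym: "zigzag X s t \<Longrightarrow> zigzag X t s"
  unfolding zigzag_def symstep_def
  by (metis (mono_tags, lifting) sympI sympD symp_rtranclp)

lemma zigzag_step: "step X s t \<Longrightarrow> zigzag X s t"
  unfolding zigzag_def symstep_def by auto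

lemma zigzag_refl: "zigzag X s s" unfolding zigzag_def by simp

lemma zigzag_trans: "zigzag X s t \<Longrightarrow> zigzag X t r \<Longrightarrow> zigzag X s r"
  unfolding zigzag_def by simp

lemma act_id: "t \<in> triples X \<Longrightarrow> X \<in> Ob C \<Longrightarrow> act X X (Ide C X) t = t"
  unfolding act_def triples_def by auto

lemma act_comp: "t \<in> triples X \<Longrightarrow> u \<in> Hom C W X \<Longrightarrow> v \<in> Hom C V W \<Longrightarrow>
   act X V (Cmp C V W X u v) t = act W V v (act X W u t)"
  unfolding act_def triples_def by (auto simp: assocC)

lemma small_triples: "X \<in> Ob C \<Longrightarrow> small TYPE('u) (triples X)"
  unfolding triples_def using loc_small
  by (intro small_Sigma[OF univ] small_Times[OF univ] small_Ob \<phi>_small) (auto simp: locally_small_def)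

text \<open>A presentation of \<open>Z\<close> by triples modulo zigzags. It is a property of
  \<open>e\<close> rather than a construction because, Kan extensions being unique up to
  isomorphism, each of them has such an \<open>e\<close>.\<close>

definition coend :: "('o, 'u) presheaf \<Rightarrow> ('o \<Rightarrow> 'k \<times> 'u \<times> 'u \<Rightarrow> 'u) \<Rightarrow> bool" where
  "coend Z e \<longleftrightarrow> psh Z \<and> (\<forall>X\<in>Ob C. fo Z X = e X ` triples X \<and>
     (\<forall>s\<in>triples X. \<forall>t\<in>triples X. e X s = e X t \<longleftrightarrow> zigzag X s t)) \<and>
     (\<forall>X W v t. v \<in> Hom C W X \<longrightarrow> t \<in> triples X \<longrightarrow> fa Z X W v (e X t) = e W (act X W v t))"

text \<open>Classes of triples are sets, on which the action is defined through chosen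
  representatives; \<open>psh_encode\<close> then turns the set of classes into a set of elements of
  \<open>'u\<close>.\<close>

lemma coend_exists: obtains Z e where "coend Z e"
proof -
  define cl where "cl X s = {t \<in> triples X. zigzag X s t}" for X s
  define rep where "rep X c = (SOME s. s \<in> triples X \<and> cl X s = c)" for X c
  define ac where "ac X W v c = cl W (act X W v (rep X c))" for X W v c
  have cl: "cl X s = cl X t \<longleftrightarrow> zigzag X s t" if "s \<in> triples X" "t \<in> triples X" for X s t
    unfolding cl_def using zigzag_refl[of X] zigzag_sym[of X] zigzag_trans[of X] that by blast
  have rep: "rep X (cl X s) \<in> triples X \<and> cl X (rep X (cl X s)) = cl X s" if "s \<in> triples X" for X s
    unfolding rep_def by (rule someI[of _ s]) (use that in simp)
  have ac: "ac X W v (cl X s) = cl W (act X W v s)" if s: "s \<in> triples X" and v: "v \<in> Hom C W X" for X W v s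
  proof -
    have "zigzag X (rep X (cl X s)) s" using cl rep[OF s] s by blast
    then have "zigzag W (act X W v (rep X (cl X s))) (act X W v s)" using v zigzag_act by blast
    then show ?thesis unfolding ac_def using cl act_triples rep[OF s] s v by blast
  qed
  let ?Q = "\<lambda>X. cl X ` triples X"
  obtain F e where F: "psh F" "\<And>A. A \<in> Ob C \<Longrightarrow> bij_betw (e A) (?Q A) (fo F A)"
    "\<And>A B u z. u \<in> Hom C B A \<Longrightarrow> z \<in> ?Q A \<Longrightarrow> fa F A B u (e A z) = e B (ac A B u z)"
  proof (rule psh_encode[of ?Q ac])
    fix A B u z assume "u \<in> Hom C B A" "z \<in> ?Q A"
    then show "ac A B u z \<in> ?Q B" using ac act_triples by auto
  next
    fix A z assume "A \<in> Ob C" "z \<in> ?Q A"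
    then obtain s where s: "s \<in> triples A" "z = cl A s" "A \<in> Ob C" by blast
    show "ac A A (Ide C A) z = z" unfolding s(2) ac[OF s(1) idC[OF s(3)]] act_id[OF s(1,3)] ..
  next
    fix A B D u v z assume "u \<in> Hom C B A" "v \<in> Hom C D B" "z \<in> ?Q A"
    then obtain s where s: "s \<in> triples A" "z = cl A s" and u: "u \<in> Hom C B A" "v \<in> Hom C D B" by blast
    have "ac A D (Cmp C D B A u v) z = cl D (act B D v (act A B u s))"
      unfolding s(2) ac[OF s(1) compC[OF u(2,1)]] act_comp[OF s(1) u] ..
    also have "\<dots> = ac B D v (ac A B u z)"
      unfolding s(2) ac[OF s(1) u(1)] ac[OF act_triples[OF s(1) u(1)] u(2)] ..
    finally show "ac A D (Cmp C D B A u v) z = ac B D v (ac A B u z)" .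
  qed (auto intro: small_image small_triples)
  have "coend F (\<lambda>X t. e X (cl X t))" unfolding coend_def
  proof (intro conjI ballI allI impI F(1))
    fix X assume X: "X \<in> Ob C"
    show "fo F X = (\<lambda>t. e X (cl X t)) ` triples X" using F(2)[OF X] unfolding bij_betw_def by auto
    fix s t assume st: "s \<in> triples X" "t \<in> triples X"
    then have "e X (cl X s) = e X (cl X t) \<longleftrightarrow> cl X s = cl X t"
      using F(2)[OF X] unfolding bij_betw_def by (auto simp: inj_on_eq_iff)
    then show "e X (cl X s) = e X (cl X t) \<longleftrightarrow> zigzag X s t" using cl st by simp
  qed (use F(3) ac in auto)
  then show thesis by (rule that)
qed

lemma triple_in: "k \<in> Ob K \<Longrightarrow> p \<in> fo \<phi> k \<Longrightarrow> (k, p, Ide C (fo D k)) \<in> triples (fo D k)"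
  unfolding triples_def by simp

lemma triples_act_unit:
  "(k, p, y) \<in> triples X \<Longrightarrow> (k, p, y) = act (fo D k) X y (k, p, Ide C (fo D k))"
  unfolding triples_def act_def by simp

text \<open>A transformation that restricts to a cocone \<open>\<tau>\<close> must send the class of
  \<open>(k, p, y)\<close> to the restriction of \<open>\<tau> k p\<close> along \<open>y\<close>.
  The cocone equation says that this value is constant along steps, hence on classes.\<close>

lemma coend_lan:
  assumes "coend Z e"
  shows "lan Z (\<lambda>k p. e (fo D k) (k, p, Ide C (fo D k)))" (is "lan Z ?\<epsilon>")
proof -
  have Z: "psh Z" "\<And>X. X \<in> Ob C \<Longrightarrow> fo Z X = e X ` triples X"
    "\<And>X s t. X \<in> Ob C \<Longrightarrow> s \<in> triples X \<Longrightarrow> t \<in> triples X \<Longrightarrow> e X s = e X t \<longleftrightarrow> zigzag X s t"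
    "\<And>X W v t. v \<in> Hom C W X \<Longrightarrow> t \<in> triples X \<Longrightarrow> fa Z X W v (e X t) = e W (act X W v t)"
    using assms unfolding coend_def by blast+
  have c: "cocone Z ?\<epsilon>" unfolding cocone_def
  proof (intro conjI ballI allI impI Z(1))
    fix k p assume "k \<in> Ob K" "p \<in> fo \<phi> k"
    then show "?\<epsilon> k p \<in> fo Z (fo D k)" using Z(2) triple_in by simp
  next
    fix k l g q assume g: "g \<in> Hom K k l" "q \<in> fo \<phi> l"
    then have kl: "k \<in> Ob K" "l \<in> Ob K" using domK codK by blast+
    have "step (fo D k) (k, fa \<phi> l k g q, Ide C (fo D k)) (l, q, fa D k l g)"
      unfolding step_def using g kl by auto
    then have "e (fo D k) (k, fa \<phi> l k g q, Ide C (fo D k)) = e (fo D k) (l, q, fa D k l g)"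
      using Z(3)[OF D_Ob[OF kl(1)]] step_triples zigzag_step by blast
    also have "\<dots> = fa Z (fo D l) (fo D k) (fa D k l g) (e (fo D l) (l, q, Ide C (fo D l)))"
      using Z(4)[OF D_Hom[OF g(1)] triple_in[OF kl(2) g(2)]] g kl by (simp add: act_def)
    finally show "?\<epsilon> k (fa \<phi> l k g q) = fa Z (fo D l) (fo D k) (fa D k l g) (?\<epsilon> l q)" .
  qed
  have gen: "\<exists>k p y. k \<in> Ob K \<and> p \<in> fo \<phi> k \<and> y \<in> Hom C X (fo D k) \<and> x = e X (k, p, y) \<and>
     x = fa Z (fo D k) X y (?\<epsilon> k p)" if X: "X \<in> Ob C" "x \<in> fo Z X" for X x
  proof -
    have "x \<in> e X ` triples X" using X(2) Z(2)[OF X(1)] by simp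
    then obtain k p y where t: "(k, p, y) \<in> triples X" "x = e X (k, p, y)" by auto
    then have *: "k \<in> Ob K" "p \<in> fo \<phi> k" "y \<in> Hom C X (fo D k)" unfolding triples_def by auto
    have "x = fa Z (fo D k) X y (?\<epsilon> k p)"
      using Z(4)[OF *(3) triple_in[OF *(1,2)]] triples_act_unit[OF t(1)] t(2) by simp
    then show ?thesis using * t by blast
  qed
  show ?thesis unfolding lan_def
  proof (intro conjI allI impI c)
    fix G \<tau> assume \<tau>: "cocone G \<tau>"
    then have G: "psh G" and \<tau>: "\<And>k p. k \<in> Ob K \<Longrightarrow> p \<in> fo \<phi> k \<Longrightarrow> \<tau> k p \<in> fo G (fo D k)"
      "\<And>k l g q. g \<in> Hom K k l \<Longrightarrow> q \<in> fo \<phi> l \<Longrightarrow>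
        \<tau> k (fa \<phi> l k g q) = fa G (fo D l) (fo D k) (fa D k l g) (\<tau> l q)"
      unfolding cocone_def by blast+
    define h where "h X t = (case t of (k, p, y) \<Rightarrow> fa G (fo D k) X y (\<tau> k p))" for X t
    have h_in: "h X t \<in> fo G X" if "t \<in> triples X" for X t
      using that \<tau>(1) psh_in[OF G] unfolding h_def triples_def by auto
    have h_step: "h X s = h X t" if "step X s t" for X s t
      using that \<tau>(2) psh_comp[OF G D_Hom _ \<tau>(1)] codK unfolding h_def step_def by auto
    have h_zz: "h X s = h X t" if "zigzag X s t" for X s t
      using that unfolding zigzag_def by (induction rule: rtranclp_induct) (auto simp: symstep_def h_step)
    have h_act: "h W (act X W v t) = fa G X W v (h X t)" if "t \<in> triples X" "v \<in> Hom C W X" for X W v t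
      using that psh_comp[OF G] \<tau>(1) unfolding h_def act_def triples_def by auto
    define t where "t = mknt Z (\<lambda>X x. h X (SOME s. s \<in> triples X \<and> e X s = x))"
    have te: "h X (SOME s. s \<in> triples X \<and> e X s = e X a) = h X a" if "X \<in> Ob C" "a \<in> triples X" for X a
    proof -
      have "(SOME s. s \<in> triples X \<and> e X s = e X a) \<in> triples X \<and> e X (SOME s. s \<in> triples X \<and> e X s = e X a) = e X a"
        by (rule someI[of _ a]) (use that in simp)
      then show ?thesis using Z(3) that h_zz by blast
    qed
    have nt: "nt Z G t" unfolding t_def
    proof (rule nt_mknt[OF Z(1) G])
      fix A x assume "A \<in> Ob C" "x \<in> fo Z A"
      then show "h A (SOME s. s \<in> triples A \<and> e A s = x) \<in> fo G A" using Z(2) te h_in by auto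
    next
      fix A B u x assume u: "u \<in> Hom C B A" and x: "x \<in> fo Z A"
      then obtain a where "a \<in> triples A" "x = e A a" using Z(2)[OF cod[OF u]] by blast
      then show "h B (SOME s. s \<in> triples B \<and> e B s = fa Z A B u x) = fa G A B u (h A (SOME s. s \<in> triples A \<and> e A s = x))"
        using Z(4)[OF u] te h_act act_triples u dom cod by simp
    qed
    have comm: "t (fo D k) (?\<epsilon> k p) = \<tau> k p" if "k \<in> Ob K" "p \<in> fo \<phi> k" for k p
    proof -
      have "?\<epsilon> k p \<in> fo Z (fo D k)" using Z(2) triple_in that by simp
      then show ?thesis unfolding t_def using te[OF _ triple_in[OF that]] that \<tau>(1) psh_id[OF G] by (simp add: h_def)
    qed
    show "\<exists>!t. nt Z G t \<and> (\<forall>k\<in>Ob K. \<forall>p\<in>fo \<phi> k. t (fo D k) (?\<epsilon> k p) = \<tau> k p)"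
    proof (rule ex1I[of _ t])
      fix s assume s: "nt Z G s \<and> (\<forall>k\<in>Ob K. \<forall>p\<in>fo \<phi> k. s (fo D k) (?\<epsilon> k p) = \<tau> k p)"
      show "s = t"
      proof (rule nt_eqI[where F=Z and G=G])
        fix X x assume X: "X \<in> Ob C" "x \<in> fo Z X"
        obtain k p y where k: "k \<in> Ob K" "p \<in> fo \<phi> k" "y \<in> Hom C X (fo D k)" "x = fa Z (fo D k) X y (?\<epsilon> k p)"
          using gen[OF X] by blast
        have \<epsilon>: "?\<epsilon> k p \<in> fo Z (fo D k)" using Z(2) triple_in k by simp
        show "s X x = t X x"
          unfolding k(4) ntD(5)[OF nt k(3) \<epsilon>] ntD(5)[OF conjunct1[OF s] k(3) \<epsilon>] using s comm k by simp
      qed (use s nt in auto)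
    qed (use nt comm in auto)
  qed
qed

text \<open>A Kan extension is determined up to isomorphism, so that each of them is given by the coend
  formula.\<close>

lemma lan_coend:
  assumes F: "lan F \<epsilon>"
  obtains e where "coend F e" "\<And>X k p y. (k, p, y) \<in> triples X \<Longrightarrow> e X (k, p, y) = fa F (fo D k) X y (\<epsilon> k p)"
proof -
  obtain Z e where Z: "coend Z e" by (rule coend_exists)
  let ?\<epsilon> = "\<lambda>k p. e (fo D k) (k, p, Ide C (fo D k))"
  have L: "lan Z ?\<epsilon>" by (rule coend_lan[OF Z])
  have cF: "cocone F \<epsilon>" and cZ: "cocone Z ?\<epsilon>" using F L unfolding lan_def by blast+
  then have \<epsilon>: "\<And>k p. k \<in> Ob K \<Longrightarrow> p \<in> fo \<phi> k \<Longrightarrow> \<epsilon> k p \<in> fo F (fo D k)"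
     "\<And>k p. k \<in> Ob K \<Longrightarrow> p \<in> fo \<phi> k \<Longrightarrow> ?\<epsilon> k p \<in> fo Z (fo D k)" unfolding cocone_def by blast+
  obtain t where t: "nt F Z t" "\<And>k p. k \<in> Ob K \<Longrightarrow> p \<in> fo \<phi> k \<Longrightarrow> t (fo D k) (\<epsilon> k p) = ?\<epsilon> k p"
    using lan_map[OF F cZ] by blast
  obtain s where s: "nt Z F s" "\<And>k p. k \<in> Ob K \<Longrightarrow> p \<in> fo \<phi> k \<Longrightarrow> s (fo D k) (?\<epsilon> k p) = \<epsilon> k p"
    using lan_map[OF L cF] by blast
  have F': "psh F" and Z': "psh Z" using ntD[OF t(1)] by blast+
  have st: "ntcomp F Z F s t = ntid F"
    by (rule lan_unique[OF F nt_comp[OF t(1) s(1)] nt_id[OF F']]) (simp add: \<epsilon> s t)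
  have ts: "ntcomp Z F Z t s = ntid Z"
    by (rule lan_unique[OF L nt_comp[OF s(1) t(1)] nt_id[OF Z']]) (simp add: \<epsilon> s t)
  have st': "s X (t X x) = x" if "X \<in> Ob C" "x \<in> fo F X" for X x
    using fun_cong[OF fun_cong[OF st, of X], of x] that by simp
  have ts': "t X (s X x) = x" if "X \<in> Ob C" "x \<in> fo Z X" for X x
    using fun_cong[OF fun_cong[OF ts, of X], of x] that by simp
  have Zp: "\<And>X. X \<in> Ob C \<Longrightarrow> fo Z X = e X ` triples X"
    "\<And>X s t. X \<in> Ob C \<Longrightarrow> s \<in> triples X \<Longrightarrow> t \<in> triples X \<Longrightarrow> e X s = e X t \<longleftrightarrow> zigzag X s t"
    "\<And>X W v t. v \<in> Hom C W X \<Longrightarrow> t \<in> triples X \<Longrightarrow> fa Z X W v (e X t) = e W (act X W v t)"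
    using Z unfolding coend_def by blast+
  have e_in: "e X a \<in> fo Z X" if "X \<in> Ob C" "a \<in> triples X" for X a using Zp(1) that by blast
  \<comment> \<open>The presentation of the coend is carried over to \<open>F\<close> by the
    isomorphism \<open>s\<close>.\<close>
  define e' where "e' X a = s X (e X a)" for X a
  have "coend F e'" unfolding coend_def
  proof (intro conjI ballI allI impI F')
    fix X assume X: "X \<in> Ob C"
    show "fo F X = e' X ` triples X"
    proof (intro equalityI subsetI)
      fix x assume "x \<in> fo F X"
      then have "x = s X (t X x)" "t X x \<in> fo Z X" using st' X ntD(4)[OF t(1)] by auto
      then show "x \<in> e' X ` triples X" using Zp(1)[OF X] unfolding e'_def by auto
    qed (use e_in[OF X] ntD(4)[OF s(1) X] in \<open>auto simp: e'_def\<close>)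
    fix a b assume "a \<in> triples X" "b \<in> triples X"
    moreover from this have "e' X a = e' X b \<longleftrightarrow> e X a = e X b"
      unfolding e'_def using ts' X e_in by metis
    ultimately show "e' X a = e' X b \<longleftrightarrow> zigzag X a b" using Zp(2)[OF X] by simp
  next
    fix X W v a assume v: "v \<in> Hom C W X" "a \<in> triples X"
    show "fa F X W v (e' X a) = e' W (act X W v a)"
      unfolding e'_def using ntD(5)[OF s(1) v(1) e_in[OF cod[OF v(1)] v(2)]] Zp(3)[OF v] by simp
  qed
  moreover have "e' X (k, p, y) = fa F (fo D k) X y (\<epsilon> k p)" if a: "(k, p, y) \<in> triples X" for X k p y
  proof -
    have *: "k \<in> Ob K" "p \<in> fo \<phi> k" "y \<in> Hom C X (fo D k)" using a unfolding triples_def by auto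
    have "e X (k, p, y) = fa Z (fo D k) X y (?\<epsilon> k p)"
      using Zp(3)[OF *(3) triple_in[OF *(1,2)]] triples_act_unit[OF a] by simp
    then show ?thesis unfolding e'_def using ntD(5)[OF s(1) *(3) \<epsilon>(2)[OF *(1,2)]] s(2) * by simp
  qed
  ultimately show thesis by (rule that)
qed

text \<open>The sieve on which \<open>s\<close> and \<open>t\<close> become joined by a zigzag of
  exactly \<open>n\<close> steps. Fixing the length allows an induction; the union over all
  \<open>n\<close> is an equality sieve of the coend.\<close>

definition zigs :: "nat \<Rightarrow> 'o \<Rightarrow> 'k \<times> 'u \<times> 'u \<Rightarrow> 'k \<times> 'u \<times> 'u \<Rightarrow> 'o \<Rightarrow> 'u set" where
  "zigs n X s t W = {u \<in> Hom C W X. (symstep W ^^ n) (act X W u s) (act X W u t)}"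

lemma sieve_zigs: "X \<in> Ob C \<Longrightarrow> s \<in> triples X \<Longrightarrow> t \<in> triples X \<Longrightarrow> sieve X (zigs n X s t)"
  unfolding sieve_def zigs_def by (auto simp: act_comp relpow_act)

text \<open>Write \<open>s = (k, p, y)\<close> and \<open>t = (l, q, z)\<close>. For a fixed
  \<open>g\<close> with \<open>p = fa \<phi> l k g q\<close>, the restrictions along
  \<open>u\<close> form a step by \<open>g\<close> exactly if \<open>u\<close> equalizes
  \<open>z\<close> and the composite of \<open>fa D k l g\<close> with \<open>y\<close>. The sieve
  is the union of these equality sieves over a small set of \<open>g\<close>.\<close>

lemma generated_step:
  assumes X: "X \<in> Ob C" and s: "s \<in> triples X" and t: "t \<in> triples X"
  shows "generated (Y X) (\<lambda>W. {u \<in> Hom C W X. step W (act X W u s) (act X W u t)})"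
proof -
  obtain k p y where s': "s = (k, p, y)" and y: "k \<in> Ob K" "p \<in> fo \<phi> k" "y \<in> Hom C X (fo D k)"
    using s unfolding triples_def by blast
  obtain l q z where t': "t = (l, q, z)" and z: "l \<in> Ob K" "q \<in> fo \<phi> l" "z \<in> Hom C X (fo D l)"
    using t unfolding triples_def by blast
  let ?G = "{g \<in> Hom K k l. p = fa \<phi> l k g q}"
  let ?E = "\<lambda>g. eq_sieve (Y (fo D l)) X z (Cmp C X (fo D k) (fo D l) (fa D k l g) y)"
  have "generated (Y X) (\<lambda>W. \<Union>g\<in>?G. ?E g W)"
  proof (rule generated_UN)
    show "small TYPE('u) ?G" by (rule small_subset[OF small_Hom[OF y(1) z(1)]]) blast
    fix g assume "g \<in> ?G"
    then show "generated (Y X) (?E g)" using y z by (intro generated_eq_sieve_Y) auto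
  qed
  moreover have "(\<Union>g\<in>?G. ?E g W) = {u \<in> Hom C W X. step W (act X W u s) (act X W u t)}" for W
    unfolding s' t' step_def act_def eq_sieve_def using y z
    by (auto simp: assocC)
  ultimately show ?thesis by simp
qed

lemma generated_symstep:
  assumes "X \<in> Ob C" "s \<in> triples X" "t \<in> triples X"
  shows "generated (Y X) (zigs 1 X s t)"
proof -
  have "zigs 1 X s t = (\<lambda>W. {u \<in> Hom C W X. step W (act X W u s) (act X W u t)} \<union>
      {u \<in> Hom C W X. step W (act X W u t) (act X W u s)})"
    unfolding zigs_def symstep_def by (auto simp: fun_eq_iff)
  then show ?thesis using generated_Un generated_step assms by simp
qed

text \<open>Induction on the length. Over \<open>W\<close>, the last intermediate triple of a zigzag
  is some \<open>(m, r, w)\<close>; together \<open>w\<close> and \<open>u\<close> factor through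
  the product of \<open>X\<close> and \<open>fo D m\<close>. So the sieve is the union, over the
  small set of pairs \<open>(m, r)\<close>, of the images under the projection to \<open>X\<close>
  of the sieves where \<open>s\<close> and \<open>t\<close> are joined through
  \<open>(m, r, q m)\<close>, with \<open>q m\<close> the second projection.\<close>

lemma generated_zigs:
  assumes "X \<in> Ob C" "s \<in> triples X" "t \<in> triples X"
  shows "generated (Y X) (zigs n X s t)"
  using assms
proof (induction n arbitrary: X s t)
  case (0 X s t)
  obtain k p y where s': "s = (k, p, y)" and y: "k \<in> Ob K" "p \<in> fo \<phi> k" "y \<in> Hom C X (fo D k)"
    using "0.prems"(2) unfolding triples_def by blast
  obtain l q z where t': "t = (l, q, z)" and z: "l \<in> Ob K" "q \<in> fo \<phi> l" "z \<in> Hom C X (fo D l)"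
    using "0.prems"(3) unfolding triples_def by blast
  show ?case
  \<comment> \<open>Restriction acts on the third component only, so the sieve for length 0 is
    either an equality sieve of arrows or empty.\<close>
  proof (cases "k = l \<and> p = q")
    case True
    then have "zigs 0 X s t = eq_sieve (Y (fo D k)) X y z"
      unfolding zigs_def eq_sieve_def s' t' act_def using y z by (auto simp: fun_eq_iff)
    then show ?thesis using generated_eq_sieve_Y y z True by simp
  next
    case False
    then have "zigs 0 X s t = (\<lambda>W. {})"
      unfolding zigs_def s' t' act_def by (auto simp: fun_eq_iff)
    then show ?thesis using generated_empty by simp
  qed
next
  case (Suc n X s t)
  define I where "I = (SIGMA m : Ob K. fo \<phi> m)"
  have I: "small TYPE('u) I" unfolding I_def by (intro small_Sigma univ small_Ob \<phi>_small)
  have "\<exists>P p q. p \<in> Hom C P X \<and> q \<in> Hom C P (fo D m) \<and>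
     (\<forall>Z a b. a \<in> Hom C Z X \<longrightarrow> b \<in> Hom C Z (fo D m) \<longrightarrow> (\<exists>h\<in>Hom C Z P. Cmp C Z P X p h = a \<and> Cmp C Z P (fo D m) q h = b))"
    if "m \<in> Ob K" for m
    using binary_productC[OF Suc.prems(1) D_Ob[OF that]] by metis
  then obtain P p q where P: "\<And>m. m \<in> Ob K \<Longrightarrow> p m \<in> Hom C (P m) X" "\<And>m. m \<in> Ob K \<Longrightarrow> q m \<in> Hom C (P m) (fo D m)"
    "\<And>m Z a b. m \<in> Ob K \<Longrightarrow> a \<in> Hom C Z X \<Longrightarrow> b \<in> Hom C Z (fo D m) \<Longrightarrow>
       \<exists>h\<in>Hom C Z (P m). Cmp C Z (P m) X (p m) h = a \<and> Cmp C Z (P m) (fo D m) (q m) h = b"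
    by metis
  define R where "R m r = (\<lambda>W. zigs n (P m) (act X (P m) (p m) s) (m, r, q m) W \<inter>
      zigs 1 (P m) (m, r, q m) (act X (P m) (p m) t) W)" for m r
  have tr: "act X (P m) (p m) s \<in> triples (P m)" "act X (P m) (p m) t \<in> triples (P m)" "(m, r, q m) \<in> triples (P m)"
     "P m \<in> Ob C" if "(m, r) \<in> I" for m r
    using that Suc.prems P(1,2)[of m] act_triples dom unfolding I_def triples_def by auto
  have R: "sieve (P m) (R m r) \<and> generated (Y (P m)) (R m r)" if "(m, r) \<in> I" for m r
    unfolding R_def using tr[OF that]
    by (intro conjI sieve_Int generated_Int sieve_zigs generated_symstep Suc.IH)
  have "generated (Y X) (\<lambda>W. \<Union>i\<in>I. Cmp C W (P (fst i)) X (p (fst i)) ` R (fst i) (snd i) W)"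
    by (rule generated_UN[OF I]) (use R P(1) I_def in \<open>auto intro!: generated_image\<close>)
  moreover have "(\<Union>i\<in>I. Cmp C W (P (fst i)) X (p (fst i)) ` R (fst i) (snd i) W) = zigs (Suc n) X s t W" for W
  proof (intro equalityI subsetI)
    fix u assume "u \<in> (\<Union>i\<in>I. Cmp C W (P (fst i)) X (p (fst i)) ` R (fst i) (snd i) W)"
    then obtain m r h where m: "(m, r) \<in> I" "h \<in> R m r W" "u = Cmp C W (P m) X (p m) h" by auto
    have h: "h \<in> Hom C W (P m)" using m(2) unfolding R_def zigs_def by auto
    have p: "p m \<in> Hom C (P m) X" using P(1) m(1) unfolding I_def by blast
    show "u \<in> zigs (Suc n) X s t W"
      using m(2) p h unfolding m(3) R_def zigs_def
      by (auto simp: act_comp[OF Suc.prems(2) p h] act_comp[OF Suc.prems(3) p h])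
  next
    fix u assume "u \<in> zigs (Suc n) X s t W"
    then have u: "u \<in> Hom C W X" "(symstep W ^^ Suc n) (act X W u s) (act X W u t)" unfolding zigs_def by auto
    then obtain mid where mid: "(symstep W ^^ n) (act X W u s) mid" "symstep W mid (act X W u t)"
      by (meson relpowp_Suc_E)
    have "mid \<in> triples W" using mid(2) step_triples unfolding symstep_def by blast
    then obtain m r w where m: "mid = (m, r, w)" "m \<in> Ob K" "r \<in> fo \<phi> m" "w \<in> Hom C W (fo D m)"
      unfolding triples_def by blast
    obtain h where h: "h \<in> Hom C W (P m)" "Cmp C W (P m) X (p m) h = u" "Cmp C W (P m) (fo D m) (q m) h = w"
      using P(3)[OF m(2) u(1) m(4)] by blast
    have "act (P m) W h (m, r, q m) = mid" unfolding act_def m(1) using h(3) by simp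
    then have "h \<in> R m r W"
      unfolding R_def zigs_def using mid h
      by (auto simp: act_comp[OF Suc.prems(2) P(1)[OF m(2)] h(1), symmetric] act_comp[OF Suc.prems(3) P(1)[OF m(2)] h(1), symmetric])
    then show "u \<in> (\<Union>i\<in>I. Cmp C W (P (fst i)) X (p (fst i)) ` R (fst i) (snd i) W)"
      using h(2) m(2,3) unfolding I_def by (intro UN_I[of "(m, r)"]) auto
  qed
  ultimately show ?case by (simp add: fun_eq_iff)
qed

text \<open>The classes of triples with an identity as third component generate. Two classes become
  equal along \<open>u\<close> if and only if \<open>u\<close> lies in \<open>zigs n\<close> for
  some \<open>n\<close>, so their equality sieve is a countable union of sieves with small
  generating sets.\<close>

lemma coend_small_generated:
  assumes "coend F e"
  shows "small_generated F"
  unfolding small_generated_def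
proof (intro conjI ballI)
  have F: "psh F" "\<And>X. X \<in> Ob C \<Longrightarrow> fo F X = e X ` triples X"
    "\<And>X s t. X \<in> Ob C \<Longrightarrow> s \<in> triples X \<Longrightarrow> t \<in> triples X \<Longrightarrow> e X s = e X t \<longleftrightarrow> zigzag X s t"
    "\<And>X W v t. v \<in> Hom C W X \<Longrightarrow> t \<in> triples X \<Longrightarrow> fa F X W v (e X t) = e W (act X W v t)"
    using assms unfolding coend_def by blast+
  show "psh F" by fact
  show "generated F (fo F)"
  proof (rule generatedI)
    show "small TYPE('u) ((\<lambda>(k, p). (fo D k, e (fo D k) (k, p, Ide C (fo D k)))) ` (SIGMA k : Ob K. fo \<phi> k))"
      by (intro small_image small_Sigma univ small_Ob \<phi>_small)
  next
    fix Z s assume "(Z, s) \<in> (\<lambda>(k, p). (fo D k, e (fo D k) (k, p, Ide C (fo D k)))) ` (SIGMA k : Ob K. fo \<phi> k)"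
    then show "Z \<in> Ob C \<and> s \<in> fo F Z" using F(2) triple_in by auto
  next
    fix X x assume X: "X \<in> Ob C" "x \<in> fo F X"
    have "x \<in> e X ` triples X" using F(2)[OF X(1)] X(2) by simp
    then obtain k p y where t: "(k, p, y) \<in> triples X" "x = e X (k, p, y)" by auto
    then have k: "k \<in> Ob K" "p \<in> fo \<phi> k" "y \<in> Hom C X (fo D k)" unfolding triples_def by auto
    have "x = fa F (fo D k) X y (e (fo D k) (k, p, Ide C (fo D k)))"
      using F(4)[OF k(3) triple_in[OF k(1,2)]] triples_act_unit[OF t(1)] t(2) by simp
    then show "\<exists>Z s. (Z, s) \<in> (\<lambda>(k, p). (fo D k, e (fo D k) (k, p, Ide C (fo D k)))) ` (SIGMA k : Ob K. fo \<phi> k) \<and>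
       (\<exists>v\<in>Hom C X Z. x = fa F Z X v s)" using k by force
  qed
  fix X x x' assume X: "X \<in> Ob C" "x \<in> fo F X" "x' \<in> fo F X"
  then have "x \<in> e X ` triples X" "x' \<in> e X ` triples X" using F(2)[OF X(1)] by auto
  then obtain s t where st: "s \<in> triples X" "t \<in> triples X" "x = e X s" "x' = e X t" by blast
  have "generated (Y X) (\<lambda>W. \<Union>n\<in>(UNIV :: nat set). zigs n X s t W)"
    using univ by (intro generated_UN generated_zigs X st) (simp add: universe_def)
  moreover have "(\<lambda>W. \<Union>n\<in>(UNIV :: nat set). zigs n X s t W) = eq_sieve F X x x'"
  proof (rule ext)
    fix W
    have "(\<exists>n. (symstep W ^^ n) (act X W u s) (act X W u t)) \<longleftrightarrow> fa F X W u x = fa F X W u x'"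
      if u: "u \<in> Hom C W X" for u
      unfolding st(3,4) F(4)[OF u st(1)] F(4)[OF u st(2)]
        F(3)[OF dom[OF u] act_triples[OF st(1) u] act_triples[OF st(2) u]] zigzag_def
      by (simp add: rtranclp_power)
    then show "(\<Union>n\<in>(UNIV :: nat set). zigs n X s t W) = eq_sieve F X x x' W"
      unfolding zigs_def eq_sieve_def by auto
  qed
  ultimately show "generated (Y X) (eq_sieve F X x x')" by simp
qed

end

section \<open>Small presheaves are those with a small presentation\<close>

context site
begin

lemma weighted_diagram_restriction:
  assumes "psh F" "S \<subseteq> Ob C" "small TYPE('u) S"
  shows "weighted_diagram C (full_sub C S) (fcomp F inclusion) inclusion"
proof -
  have i: "is_functor (full_sub C S) C inclusion"
    apply (rule is_functorI[OF category_full_sub[OF cat] cat])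
    subgoal by simp
    subgoal by (simp split: if_splits)
    by simp_all
  have j: "is_functor (opp (full_sub C S)) Set_cat (fcomp F (fop inclusion))"
    by (rule is_functor_fcomp[OF is_functor_fop[OF i] assms(1)])
  have k:  "is_functor (opp (full_sub C S)) Set_cat (fcomp F inclusion)"
    using j unfolding fop_inclusion .
  have l: "small TYPE('u) (Ob (full_sub C S))" by (rule small_subset[OF assms(3)]) simp
  show ?thesis
  proof (rule weighted_diagram.intro[OF site_axioms weighted_diagram_axioms.intro[OF i k l]])
    fix k l assume "k \<in> Ob (full_sub C S)" "l \<in> Ob (full_sub C S)"
    then show "small TYPE('u) (Hom (full_sub C S) k l)" using loc_small by (simp add: locally_small_def)
  qed
qed

lemma small_presheaf_iff_lan:
  "small_presheaf C F \<longleftrightarrow> psh F \<and> (\<exists>S. S \<subseteq> Ob C \<and> small TYPE('u) S \<and>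
     weighted_diagram.lan C (full_sub C S) (fcomp F inclusion) inclusion F (\<lambda>X. \<lambda>x\<in>fo F X. x))"
proof -
  have "is_lan (opp (full_sub C S)) (opp C) Set_cat inclusion (fcomp F inclusion) F (\<lambda>X. Ide Set_cat (fo F X)) \<longleftrightarrow>
     weighted_diagram.lan C (full_sub C S) (fcomp F inclusion) inclusion F (\<lambda>X. \<lambda>x\<in>fo F X. x)"
    if "psh F" "S \<subseteq> Ob C" "small TYPE('u) S" for S
  proof -
    interpret weighted_diagram C "full_sub C S" "fcomp F inclusion" inclusion
      by (rule weighted_diagram_restriction[OF that])
    have e: "(\<lambda>X. Ide Set_cat (fo F X)) = (\<lambda>X. \<lambda>x\<in>fo F X. x)" by simp
    show ?thesis unfolding e
    proof
      assume "is_lan (opp (full_sub C S)) (opp C) Set_cat inclusion (fcomp F inclusion) F (\<lambda>X. \<lambda>x\<in>fo F X. x)"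
      then show "lan F (\<lambda>X. \<lambda>x\<in>fo F X. x)" by (intro is_lan_imp_lan) (simp only: fop_inclusion)
    next
      assume "lan F (\<lambda>X. \<lambda>x\<in>fo F X. x)"
      from lan_imp_is_lan[OF this]
      show "is_lan (opp (full_sub C S)) (opp C) Set_cat inclusion (fcomp F inclusion) F (\<lambda>X. \<lambda>x\<in>fo F X. x)"
        unfolding fop_inclusion by simp
    qed
  qed
  then show ?thesis unfolding small_presheaf_def by (intro conj_cong ex_cong1 refl) simp_all
qed

text \<open>A small presheaf is by definition a Kan extension from a small full subcategory, so it
  has a presentation by triples modulo zigzags.\<close>

lemma small_presheaf_imp_small_generated:
  assumes "small_presheaf C F"
  shows "small_generated F"
proof -
  obtain S where S: "psh F" "S \<subseteq> Ob C" "small TYPE('u) S" and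
    l: "weighted_diagram.lan C (full_sub C S) (fcomp F inclusion) inclusion F (\<lambda>X. \<lambda>x\<in>fo F X. x)"
    using assms small_presheaf_iff_lan by blast
  interpret weighted_diagram C "full_sub C S" "fcomp F inclusion" inclusion
    by (rule weighted_diagram_restriction[OF S])
  show ?thesis by (rule lan_coend[OF l]) (rule coend_small_generated)
qed

text \<open>Spans \<open>(f, g)\<close> that identify \<open>s\<close> and \<open>t\<close> are
  arrows into the product of \<open>A\<close> and \<open>B\<close> in the equality sieve of the two
  restrictions, and this sieve has a small set of generators. At the domains of these generators
  every coincidence of \<open>s\<close> and \<open>t\<close> is already visible.\<close>

lemma small_generated_span:
  assumes F: "small_generated F" and s: "A \<in> Ob C" "s \<in> fo F A" and t: "B \<in> Ob C" "t \<in> fo F B"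
  obtains O' where "small TYPE('u) O'" "O' \<subseteq> Ob C"
    "\<And>X f g. f \<in> Hom C X A \<Longrightarrow> g \<in> Hom C X B \<Longrightarrow> fa F A X f s = fa F B X g t \<Longrightarrow>
      \<exists>Z\<in>O'. \<exists>a\<in>Hom C Z A. \<exists>b\<in>Hom C Z B. \<exists>w\<in>Hom C X Z. fa F A Z a s = fa F B Z b t \<and>
        f = Cmp C X Z A a w \<and> g = Cmp C X Z B b w"
proof -
  have psh: "psh F" using F unfolding small_generated_def by blast
  obtain P p q where P: "p \<in> Hom C P A" "q \<in> Hom C P B"
    "\<And>X a b. a \<in> Hom C X A \<Longrightarrow> b \<in> Hom C X B \<Longrightarrow> \<exists>h\<in>Hom C X P. Cmp C X P A p h = a \<and> Cmp C X P B q h = b"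
    using binary_productC[OF s(1) t(1)] by metis
  let ?x = "fa F A P p s" and ?y = "fa F B P q t"
  have xy: "?x \<in> fo F P" "?y \<in> fo F P" using psh_in[OF psh] P s t by blast+
  have "sieve P (eq_sieve F P ?x ?y)" "generated (Y P) (eq_sieve F P ?x ?y)"
    using sieve_eq_sieve[OF psh dom[OF P(1)] xy] F dom[OF P(1)] xy unfolding small_generated_def by blast+
  then obtain T where T: "small TYPE('u) T" "\<And>Z r. (Z, r) \<in> T \<Longrightarrow> r \<in> eq_sieve F P ?x ?y Z"
    "\<And>X r. r \<in> eq_sieve F P ?x ?y X \<Longrightarrow> \<exists>Z r'. (Z, r') \<in> T \<and> (\<exists>v\<in>Hom C X Z. r = Cmp C X Z P r' v)"
    using generated_sieveD by metis
  show thesis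
  proof (rule that[of "fst ` T"])
    show "small TYPE('u) (fst ` T)" by (rule small_image[OF T(1)])
    show "fst ` T \<subseteq> Ob C" using T(2) dom unfolding eq_sieve_def by fastforce
    fix X f g assume f: "f \<in> Hom C X A" "g \<in> Hom C X B" "fa F A X f s = fa F B X g t"
    obtain h where h: "h \<in> Hom C X P" "Cmp C X P A p h = f" "Cmp C X P B q h = g" using P(3)[OF f(1,2)] by blast
    have "h \<in> eq_sieve F P ?x ?y X"
      unfolding eq_sieve_def using h psh_comp[OF psh P(1) h(1) s(2)] psh_comp[OF psh P(2) h(1) t(2)] f(3) by simp
    then obtain Z r v where r: "(Z, r) \<in> T" "v \<in> Hom C X Z" "h = Cmp C X Z P r v" using T(3) by blast
    then have r': "r \<in> Hom C Z P" "fa F P Z r ?x = fa F P Z r ?y" using T(2) unfolding eq_sieve_def by blast+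
    let ?a = "Cmp C Z P A p r" and ?b = "Cmp C Z P B q r"
    have "?a \<in> Hom C Z A" "?b \<in> Hom C Z B" using P r' by auto
    moreover have "fa F A Z ?a s = fa F B Z ?b t"
      using psh_comp[OF psh P(1) r'(1) s(2)] psh_comp[OF psh P(2) r'(1) t(2)] r'(2) by simp
    moreover have "f = Cmp C X Z A ?a v" "g = Cmp C X Z B ?b v"
      using h r(3) assocC[OF r(2) r'(1) P(1)] assocC[OF r(2) r'(1) P(2)] by simp_all
    ultimately show "\<exists>Z\<in>fst ` T. \<exists>a\<in>Hom C Z A. \<exists>b\<in>Hom C Z B. \<exists>w\<in>Hom C X Z. fa F A Z a s = fa F B Z b t \<and>
        f = Cmp C X Z A a w \<and> g = Cmp C X Z B b w" using r(1,2) by force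
  qed
qed

text \<open>The small subcategory consists of the stages of the generators and of the spans that
  witness their relations. A cocone on it has a value at each generator and respects all
  coincidences between restricted generators, so it extends uniquely.\<close>

lemma small_generated_imp_small_presheaf:
  assumes F: "small_generated F"
  shows "small_presheaf C F"
proof -
  have psh: "psh F" and "generated F (fo F)" using F unfolding small_generated_def by blast+
  then obtain S where S: "small TYPE('u) S" "\<And>Z s. (Z, s) \<in> S \<Longrightarrow> Z \<in> Ob C \<and> s \<in> fo F Z"
     "\<And>X x. X \<in> Ob C \<Longrightarrow> x \<in> fo F X \<Longrightarrow> \<exists>Z s. (Z, s) \<in> S \<and> (\<exists>v\<in>Hom C X Z. x = fa F Z X v s)"
    unfolding generated_def by metis
  define good where "good i j O' \<longleftrightarrow> small TYPE('u) O' \<and> O' \<subseteq> Ob C \<and>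
    (\<forall>X f g. f \<in> Hom C X (fst i) \<longrightarrow> g \<in> Hom C X (fst j) \<longrightarrow> fa F (fst i) X f (snd i) = fa F (fst j) X g (snd j) \<longrightarrow>
      (\<exists>Z\<in>O'. \<exists>a\<in>Hom C Z (fst i). \<exists>b\<in>Hom C Z (fst j). \<exists>w\<in>Hom C X Z. fa F (fst i) Z a (snd i) = fa F (fst j) Z b (snd j) \<and>
        f = Cmp C X Z (fst i) a w \<and> g = Cmp C X Z (fst j) b w))" for i j O'
  have "\<exists>O'. good i j O'" if "i \<in> S" "j \<in> S" for i j
  proof -
    have i: "fst i \<in> Ob C" "snd i \<in> fo F (fst i)" "fst j \<in> Ob C" "snd j \<in> fo F (fst j)"
      using S(2)[of "fst i" "snd i"] S(2)[of "fst j" "snd j"] that by auto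
    show ?thesis unfolding good_def by (rule small_generated_span[OF F i]) blast
  qed
  then obtain O' where "\<And>i j. i \<in> S \<Longrightarrow> j \<in> S \<Longrightarrow> good i j (O' i j)" by metis
  then have O': "\<And>i j. i \<in> S \<Longrightarrow> j \<in> S \<Longrightarrow> small TYPE('u) (O' i j)"
    "\<And>i j. i \<in> S \<Longrightarrow> j \<in> S \<Longrightarrow> O' i j \<subseteq> Ob C"
    "\<And>i j X f g. i \<in> S \<Longrightarrow> j \<in> S \<Longrightarrow> f \<in> Hom C X (fst i) \<Longrightarrow> g \<in> Hom C X (fst j) \<Longrightarrow> fa F (fst i) X f (snd i) = fa F (fst j) X g (snd j) \<Longrightarrow>
      (\<exists>Z\<in>O' i j. \<exists>a\<in>Hom C Z (fst i). \<exists>b\<in>Hom C Z (fst j). \<exists>w\<in>Hom C X Z. fa F (fst i) Z a (snd i) = fa F (fst j) Z b (snd j) \<and>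
        f = Cmp C X Z (fst i) a w \<and> g = Cmp C X Z (fst j) b w)"
    unfolding good_def by simp_all
  define T where "T = fst ` S \<union> (\<Union>i\<in>S. \<Union>j\<in>S. O' i j)"
  have T_small: "small TYPE('u) T"
    unfolding T_def by (intro small_Un small_UN univ small_image S(1) O'(1))
  have T_Ob: "T \<subseteq> Ob C" unfolding T_def using S(2) O'(2) by fastforce
  interpret weighted_diagram C "full_sub C T" "fcomp F inclusion" inclusion
    by (rule weighted_diagram_restriction[OF psh T_Ob T_small])
  have "lan F (\<lambda>X. \<lambda>x\<in>fo F X. x)" unfolding lan_def
  proof (intro conjI allI impI)
    show "cocone F (\<lambda>X. \<lambda>x\<in>fo F X. x)"
      unfolding cocone_def using psh psh_in[OF psh] by (auto split: if_splits)
    fix G \<tau> assume "cocone G \<tau>"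
    then have G: "psh G" "\<And>A x. A \<in> T \<Longrightarrow> x \<in> fo F A \<Longrightarrow> \<tau> A x \<in> fo G A"
      "\<And>A B f x. A \<in> T \<Longrightarrow> B \<in> T \<Longrightarrow> f \<in> Hom C B A \<Longrightarrow> x \<in> fo F A \<Longrightarrow> \<tau> B (fa F A B f x) = fa G A B f (\<tau> A x)"
      unfolding cocone_def using T_Ob by auto
    \<comment> \<open>The coincidence comes from one at a stage \<open>Z\<close> in
      \<open>T\<close>, where the cocone equation applies to both legs of the span.\<close>
    have wd: "fa G A X f (\<tau> A s) = fa G B X g (\<tau> B t)"
      if st: "(A, s) \<in> S" "(B, t) \<in> S" and f: "f \<in> Hom C X A" "g \<in> Hom C X B" "fa F A X f s = fa F B X g t"
      for A s B t X f g
    proof -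
      obtain Z a b w where Z: "Z \<in> O' (A, s) (B, t)" "a \<in> Hom C Z A" "b \<in> Hom C Z B" "w \<in> Hom C X Z"
        "fa F A Z a s = fa F B Z b t" "f = Cmp C X Z A a w" "g = Cmp C X Z B b w"
        using O'(3)[OF st, unfolded fst_conv snd_conv, OF f] by (elim bexE conjE) rule
      have T: "A \<in> T" "B \<in> T" "Z \<in> T" "s \<in> fo F A" "t \<in> fo F B" using st Z(1) S(2) unfolding T_def by force+
      have "fa G A X f (\<tau> A s) = fa G Z X w (\<tau> Z (fa F A Z a s))"
        unfolding Z(6) using psh_comp[OF G(1) Z(2,4) G(2)[OF T(1,4)]] G(3)[OF T(1,3) Z(2) T(4)] by simp
      also have "\<dots> = fa G B X g (\<tau> B t)"
        unfolding Z(5,7) using psh_comp[OF G(1) Z(3,4) G(2)[OF T(2,5)]] G(3)[OF T(2,3) Z(3) T(5)] by simp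
      finally show ?thesis .
    qed
    \<comment> \<open>The graph of the extension: \<open>y\<close> is the value forced by writing
      \<open>x\<close> as a restricted generator.\<close>
    define R where "R X x y \<longleftrightarrow> (\<exists>A s f. (A, s) \<in> S \<and> f \<in> Hom C X A \<and> x = fa F A X f s \<and> y = fa G A X f (\<tau> A s))" for X x y
    have R_ex: "\<exists>y. R X x y" if "X \<in> Ob C" "x \<in> fo F X" for X x
      unfolding R_def using S(3)[OF that] by blast
    have R_un: "R X x y \<Longrightarrow> R X x y' \<Longrightarrow> y = y'" for X x y y'
      unfolding R_def using wd by metis
    have S_T: "s \<in> fo F A \<and> A \<in> T" if "(A, s) \<in> S" for A s
      using S(2)[OF that] image_eqI[of A fst "(A, s)" S] that unfolding T_def by simp
    have R_in: "y \<in> fo G X" if R: "R X x y" for X x y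
    proof -
      obtain A s f where "(A, s) \<in> S" "f \<in> Hom C X A" "y = fa G A X f (\<tau> A s)"
        using R unfolding R_def by blast
      then show ?thesis using S_T G(2) psh_in[OF G(1)] by simp
    qed
    have R_nat: "R B (fa F A B u x) (fa G A B u y)" if R: "R A x y" and u: "u \<in> Hom C B A" for A B u x y
    proof -
      obtain D s f where *: "(D, s) \<in> S" "f \<in> Hom C A D" "x = fa F D A f s" "y = fa G D A f (\<tau> D s)"
        using R unfolding R_def by blast
      have s: "s \<in> fo F D" "D \<in> T" using S_T[OF *(1)] by blast+
      show ?thesis unfolding R_def *(3,4) psh_comp[OF psh *(2) u s(1), symmetric]
          psh_comp[OF G(1) *(2) u G(2)[OF s(2,1)], symmetric]
        using *(1) compC[OF u *(2)] by (intro exI[of _ D] exI[of _ s] exI[of _ "Cmp C B A D f u"]) simp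
    qed
    have R_\<tau>: "R X x (\<tau> X x)" if X: "X \<in> T" "x \<in> fo F X" for X x
    proof -
      obtain A s f where *: "(A, s) \<in> S" "f \<in> Hom C X A" "x = fa F A X f s" using S(3) X T_Ob by blast
      have s: "s \<in> fo F A" "A \<in> T" using S_T[OF *(1)] by blast+
      show ?thesis unfolding R_def using G(3)[OF s(2) X(1) *(2) s(1)] *
        by (intro exI[of _ A] exI[of _ s] exI[of _ f]) simp
    qed
    define h where "h X x = (SOME y. R X x y)" for X x
    have hR: "R X x (h X x)" if "X \<in> Ob C" "x \<in> fo F X" for X x
      unfolding h_def using someI_ex[OF R_ex[OF that]] .
    define t where "t = mknt F h"
    have t: "nt F G t" unfolding t_def
    proof (rule nt_mknt[OF psh G(1)])
      fix A x assume "A \<in> Ob C" "x \<in> fo F A"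
      then show "h A x \<in> fo G A" using hR R_in by blast
    next
      fix A B u x assume u: "u \<in> Hom C B A" "x \<in> fo F A"
      show "h B (fa F A B u x) = fa G A B u (h A x)"
        using R_un[OF hR[OF dom[OF u(1)] psh_in[OF psh u]] R_nat[OF hR[OF cod[OF u(1)] u(2)] u(1)]] .
    qed
    have t\<tau>: "t X x = \<tau> X x" if "X \<in> T" "x \<in> fo F X" for X x
    proof -
      have X: "X \<in> Ob C" using that T_Ob by blast
      show ?thesis unfolding t_def mknt_apply[OF X that(2), of h] using R_un[OF hR[OF X that(2)] R_\<tau>[OF that]] .
    qed
    show "\<exists>!t. nt F G t \<and> (\<forall>k\<in>Ob (full_sub C T). \<forall>p\<in>fo (fcomp F inclusion) k.
        t (fo inclusion k) ((\<lambda>x\<in>fo F k. x) p) = \<tau> k p)"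
    proof (rule ex1I[of _ t])
      fix t' assume t': "nt F G t' \<and> (\<forall>k\<in>Ob (full_sub C T). \<forall>p\<in>fo (fcomp F inclusion) k.
        t' (fo inclusion k) ((\<lambda>x\<in>fo F k. x) p) = \<tau> k p)"
      then have t'\<tau>: "t' X x = \<tau> X x" if "X \<in> T" "x \<in> fo F X" for X x using that T_Ob by auto
      show "t' = t"
      proof (rule nt_eqI[OF conjunct1[OF t'] t])
        fix X x assume X: "X \<in> Ob C" "x \<in> fo F X"
        obtain A s f where *: "(A, s) \<in> S" "f \<in> Hom C X A" "x = fa F A X f s" using S(3) X by blast
        have s: "s \<in> fo F A" "A \<in> T" using S_T[OF *(1)] by blast+
        show "t' X x = t X x"
          unfolding *(3) ntD(5)[OF t *(2) s(1)] ntD(5)[OF conjunct1[OF t'] *(2) s(1)] t'\<tau>[OF s(2,1)] t\<tau>[OF s(2,1)] ..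
      qed
    qed (use t t\<tau> in auto)
  qed
  then show ?thesis unfolding small_presheaf_iff_lan using psh T_Ob T_small by blast
qed

lemma small_presheaf_iff: "small_presheaf C F \<longleftrightarrow> small_generated F"
  using small_presheaf_imp_small_generated small_generated_imp_small_presheaf by blast

lemma small_presheaf_Y: "A \<in> Ob C \<Longrightarrow> small_presheaf C (Y A)"
  using small_presheaf_iff small_generated_Y by blast

end

lemma (in weighted_diagram) lan_small_presheaf:
  assumes "lan Z \<epsilon>"
  shows "small_presheaf C Z"
  unfolding small_presheaf_iff by (rule lan_coend[OF assms]) (rule coend_small_generated)

context site
begin

section \<open>Finite limits of small presheaves\<close>

text \<open>Limits are needed in \<open>PSh C\<close>, in \<open>lex_cocompletion \<Phi> C\<close>
  and on the presheaves bicovered by a representable, so they are treated for the full subcategory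
  on any \<open>T\<close>; \<open>T = UNIV\<close> gives \<open>PSh C\<close>.\<close>

abbreviation subPSh where "subPSh T \<equiv> full_sub (PSh C) T"

lemma Hom_subPSh: "t \<in> Hom (subPSh T) F G \<longleftrightarrow>
    F \<in> T \<and> G \<in> T \<and> small_presheaf C F \<and> small_presheaf C G \<and> nt F G t"
  by auto

lemma category_subPSh: "category (subPSh T)"
  by (rule category_full_sub[OF category_PSh])

text \<open>A limit computed pointwise: the last two clauses identify the elements of
  \<open>P\<close> at \<open>A\<close> with the compatible families. Smallness and bicovering
  morphisms are tested on elements, which makes this the convenient form.\<close>

definition plim ::
  "('j, 'i) cat \<Rightarrow> ('j, 'i, ('o, 'u) presheaf, 'o \<Rightarrow> 'u \<Rightarrow> 'u) fctr \<Rightarrow> ('o, 'u) presheaf \<Rightarrow> ('j \<Rightarrow> 'o \<Rightarrow> 'u \<Rightarrow> 'u) \<Rightarrow> bool"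
  where
  "plim J G P \<pi> \<longleftrightarrow> psh P \<and> (\<forall>j\<in>Ob J. nt P (fo G j) (\<pi> j)) \<and>
     (\<forall>i j u A x. u \<in> Hom J i j \<longrightarrow> A \<in> Ob C \<longrightarrow> x \<in> fo P A \<longrightarrow> fa G i j u A (\<pi> i A x) = \<pi> j A x) \<and>
     (\<forall>A x. A \<in> Ob C \<longrightarrow> (\<forall>j\<in>Ob J. x j \<in> fo (fo G j) A) \<longrightarrow>
       (\<forall>i j u. u \<in> Hom J i j \<longrightarrow> fa G i j u A (x i) = x j) \<longrightarrow> (\<exists>y\<in>fo P A. \<forall>j\<in>Ob J. \<pi> j A y = x j)) \<and>
     (\<forall>A y y'. A \<in> Ob C \<longrightarrow> y \<in> fo P A \<longrightarrow> y' \<in> fo P A \<longrightarrow> (\<forall>j\<in>Ob J. \<pi> j A y = \<pi> j A y') \<longrightarrow> y = y')"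

lemma plimD:
  assumes "plim J G P \<pi>"
  shows "psh P" "j \<in> Ob J \<Longrightarrow> nt P (fo G j) (\<pi> j)"
    "u \<in> Hom J i j \<Longrightarrow> A \<in> Ob C \<Longrightarrow> x \<in> fo P A \<Longrightarrow> fa G i j u A (\<pi> i A x) = \<pi> j A x"
    "A \<in> Ob C \<Longrightarrow> (\<And>j. j \<in> Ob J \<Longrightarrow> z j \<in> fo (fo G j) A) \<Longrightarrow>
       (\<And>i j u. u \<in> Hom J i j \<Longrightarrow> fa G i j u A (z i) = z j) \<Longrightarrow> \<exists>y\<in>fo P A. \<forall>j\<in>Ob J. \<pi> j A y = z j"
    "A \<in> Ob C \<Longrightarrow> y \<in> fo P A \<Longrightarrow> y' \<in> fo P A \<Longrightarrow> (\<And>j. j \<in> Ob J \<Longrightarrow> \<pi> j A y = \<pi> j A y') \<Longrightarrow> y = y'"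
  using assms unfolding plim_def by simp_all

text \<open>The mediating element is chosen pointwise, and joint injectivity of the
  \<open>\<pi> j\<close> makes the choice natural.\<close>

lemma plim_map:
  assumes P: "plim J G P \<pi>" and X: "psh X" and \<sigma>: "\<And>j. j \<in> Ob J \<Longrightarrow> nt X (fo G j) (\<sigma> j)"
    "\<And>i j u A x. u \<in> Hom J i j \<Longrightarrow> A \<in> Ob C \<Longrightarrow> x \<in> fo X A \<Longrightarrow> fa G i j u A (\<sigma> i A x) = \<sigma> j A x"
  obtains h where "nt X P h" "\<And>j A x. j \<in> Ob J \<Longrightarrow> A \<in> Ob C \<Longrightarrow> x \<in> fo X A \<Longrightarrow> \<pi> j A (h A x) = \<sigma> j A x"
proof -
  note PD = plimD[OF P]
  define h where "h A x = (SOME y. y \<in> fo P A \<and> (\<forall>j\<in>Ob J. \<pi> j A y = \<sigma> j A x))" for A x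
  have h: "h A x \<in> fo P A \<and> (\<forall>j\<in>Ob J. \<pi> j A (h A x) = \<sigma> j A x)" if A: "A \<in> Ob C" "x \<in> fo X A" for A x
  proof -
    have "\<exists>y\<in>fo P A. \<forall>j\<in>Ob J. \<pi> j A y = \<sigma> j A x"
    proof (rule PD(4)[OF A(1)])
      fix j assume j: "j \<in> Ob J"
      show "\<sigma> j A x \<in> fo (fo G j) A" by (rule ntD(4)[OF \<sigma>(1)[OF j] A])
    qed (rule \<sigma>(2)[OF _ A])
    then have "\<exists>y. y \<in> fo P A \<and> (\<forall>j\<in>Ob J. \<pi> j A y = \<sigma> j A x)" by blast
    then show ?thesis unfolding h_def by (rule someI_ex)
  qed
  have "nt X P (mknt X h)"
  proof (rule nt_mknt[OF X PD(1)])
    fix A x assume "A \<in> Ob C" "x \<in> fo X A"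
    then show "h A x \<in> fo P A" using h by blast
  next
    fix A B u x assume u: "u \<in> Hom C B A" and x: "x \<in> fo X A"
    note B = dom[OF u] and A = cod[OF u]
    note ux = psh_in[OF X u x]
    show "h B (fa X A B u x) = fa P A B u (h A x)"
    proof (rule PD(5)[OF B])
      show "h B (fa X A B u x) \<in> fo P B" using h[OF B ux] by blast
      show "fa P A B u (h A x) \<in> fo P B" using h[OF A x] psh_in[OF PD(1) u] by blast
      fix j assume j: "j \<in> Ob J"
      have "\<pi> j B (fa P A B u (h A x)) = fa (fo G j) A B u (\<sigma> j A x)"
        using ntD(5)[OF PD(2)[OF j] u] h[OF A x] j by auto
      also have "\<dots> = \<pi> j B (h B (fa X A B u x))"
        using ntD(5)[OF \<sigma>(1)[OF j] u x] h[OF B ux] j by auto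
      finally show "\<pi> j B (h B (fa X A B u x)) = \<pi> j B (fa P A B u (h A x))" by simp
    qed
  qed
  then show thesis using h by (intro that[of "mknt X h"]) auto
qed

text \<open>Elements at \<open>A\<close> are maps out of \<open>Y A\<close>, so a compatible family
  is a cone with vertex \<open>Y A\<close>. As \<open>T\<close> contains the representables, such
  cones may be tested inside \<open>T\<close>.\<close>

lemma limit_imp_plim:
  assumes G: "is_functor J (subPSh T) G" and L: "is_limit J (subPSh T) G P \<pi>"
    and T: "\<And>A. A \<in> Ob C \<Longrightarrow> Y A \<in> T"
  shows "plim J G P \<pi>"
proof -
  have Go: "psh (fo G j)" "small_presheaf C (fo G j)" "fo G j \<in> T" if "j \<in> Ob J" for j
    using is_functorD(3)[OF G that] small_presheaf_psh by auto
  have Ga: "nt (fo G i) (fo G j) (fa G i j u)" "i \<in> Ob J" "j \<in> Ob J" if "u \<in> Hom J i j" for i j u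
    using is_functorD(4)[OF G that] category.Hom_Ob[OF is_functorD(1)[OF G] that] by (auto split: if_splits)
  have cone: "is_cone J (subPSh T) G P \<pi>" using L unfolding is_limit_def by blast
  then have \<pi>: "nt P (fo G j) (\<pi> j)" if "j \<in> Ob J" for j
    using that Hom_subPSh unfolding is_cone_def by blast
  have Ps: "small_presheaf C P" "P \<in> T" using cone unfolding is_cone_def by auto
  have \<pi>_cone: "fa G i j u A (\<pi> i A x) = \<pi> j A x" if "u \<in> Hom J i j" "A \<in> Ob C" "x \<in> fo P A" for i j u A x
  proof -
    have "ntcomp P (fo G i) (fo G j) (fa G i j u) (\<pi> i) = \<pi> j"
      using cone Ga(2,3)[OF that(1)] that(1) unfolding is_cone_def by simp
    then show ?thesis using ntcomp_apply[OF that(2,3)] by metis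
  qed
  have yc: "is_cone J (subPSh T) G (Y A) (\<lambda>j. yo (fo G j) A (x j))"
    if A: "A \<in> Ob C" and x: "\<And>j. j \<in> Ob J \<Longrightarrow> x j \<in> fo (fo G j) A"
      "\<And>i j u. u \<in> Hom J i j \<Longrightarrow> fa G i j u A (x i) = x j" for A x
    unfolding is_cone_def
  proof (intro conjI ballI)
    show "Y A \<in> Ob (subPSh T)" using A T small_presheaf_Y by simp
    fix j assume j: "j \<in> Ob J"
    show "yo (fo G j) A (x j) \<in> Hom (subPSh T) (Y A) (fo G j)"
      unfolding Hom_subPSh using A T small_presheaf_Y Go[OF j] x(1)[OF j] nt_yo by blast
  next
    fix i j u assume ij: "i \<in> Ob J" "j \<in> Ob J" "u \<in> Hom J i j"
    have "ntcomp (Y A) (fo G i) (fo G j) (fa G i j u) (yo (fo G i) A (x i)) = yo (fo G j) A (x j)"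
    proof (rule nt_eqI)
      show "nt (Y A) (fo G j) (ntcomp (Y A) (fo G i) (fo G j) (fa G i j u) (yo (fo G i) A (x i)))"
        by (rule nt_comp[OF nt_yo[OF Go(1)[OF ij(1)] A x(1)[OF ij(1)]] Ga(1)[OF ij(3)]])
      show "nt (Y A) (fo G j) (yo (fo G j) A (x j))" by (rule nt_yo[OF Go(1)[OF ij(2)] A x(1)[OF ij(2)]])
      fix X v assume v: "X \<in> Ob C" "v \<in> fo (Y A) X"
      then have v': "v \<in> Hom C X A" by simp
      show "ntcomp (Y A) (fo G i) (fo G j) (fa G i j u) (yo (fo G i) A (x i)) X v = yo (fo G j) A (x j) X v"
        using ntD(5)[OF Ga(1)[OF ij(3)] v' x(1)[OF ij(1)]] x(2)[OF ij(3)] v v' by simp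
    qed
    then show "Cmp (subPSh T) (Y A) (fo G i) (fo G j) (fa G i j u) (yo (fo G i) A (x i)) = yo (fo G j) A (x j)" by simp
  qed
  have univ': "\<exists>!h. h \<in> Hom (subPSh T) X P \<and> (\<forall>j\<in>Ob J. ntcomp X P (fo G j) (\<pi> j) h = \<sigma> j)"
    if "is_cone J (subPSh T) G X \<sigma>" for X \<sigma>
    using L that unfolding is_limit_def by simp
  show ?thesis unfolding plim_def
  proof (intro conjI allI impI ballI)
    show "psh P" using Ps small_presheaf_psh by blast
    fix A x assume A: "A \<in> Ob C" and x: "\<forall>j\<in>Ob J. x j \<in> fo (fo G j) A"
      "\<forall>i j u. u \<in> Hom J i j \<longrightarrow> fa G i j u A (x i) = x j"
    have "is_cone J (subPSh T) G (Y A) (\<lambda>j. yo (fo G j) A (x j))" by (rule yc) (use A x in auto)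
    from univ'[OF this] obtain h where h: "nt (Y A) P h" "\<And>j. j \<in> Ob J \<Longrightarrow> ntcomp (Y A) P (fo G j) (\<pi> j) h = yo (fo G j) A (x j)"
      unfolding Hom_subPSh by blast
    show "\<exists>y\<in>fo P A. \<forall>j\<in>Ob J. \<pi> j A y = x j"
    proof (intro bexI ballI)
      show "h A (Ide C A) \<in> fo P A" using ntD(4)[OF h(1) A] A by simp
      fix j assume j: "j \<in> Ob J"
      have "\<pi> j A (h A (Ide C A)) = yo (fo G j) A (x j) A (Ide C A)"
        unfolding h(2)[OF j, symmetric] using A by simp
      then show "\<pi> j A (h A (Ide C A)) = x j" using psh_id[OF Go(1)[OF j] A] x(1) j A by simp
    qed
  next
    fix A y y' assume A: "A \<in> Ob C" and y: "y \<in> fo P A" "y' \<in> fo P A" "\<forall>j\<in>Ob J. \<pi> j A y = \<pi> j A y'"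
    have psP: "psh P" using Ps small_presheaf_psh by blast
    have "is_cone J (subPSh T) G (Y A) (\<lambda>j. yo (fo G j) A (\<pi> j A y))"
      by (rule yc[OF A]) (use \<pi> ntD(4)[OF \<pi> A] y \<pi>_cone A in auto)
    note u = univ'[OF this]
    have f: "yo P A z \<in> Hom (subPSh T) (Y A) P \<and> (\<forall>j\<in>Ob J. ntcomp (Y A) P (fo G j) (\<pi> j) (yo P A z) = yo (fo G j) A (\<pi> j A y))"
      if z: "z \<in> fo P A" "\<forall>j\<in>Ob J. \<pi> j A z = \<pi> j A y" for z
    proof (intro conjI ballI)
      show "yo P A z \<in> Hom (subPSh T) (Y A) P"
        unfolding Hom_subPSh using A T small_presheaf_Y Ps nt_yo[OF psP A z(1)] by blast
      fix j assume j: "j \<in> Ob J"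
      show "ntcomp (Y A) P (fo G j) (\<pi> j) (yo P A z) = yo (fo G j) A (\<pi> j A y)"
      proof (rule nt_eqI)
        show "nt (Y A) (fo G j) (ntcomp (Y A) P (fo G j) (\<pi> j) (yo P A z))"
          by (rule nt_comp[OF nt_yo[OF psP A z(1)] \<pi>[OF j]])
        show "nt (Y A) (fo G j) (yo (fo G j) A (\<pi> j A y))"
          by (rule nt_yo[OF Go(1)[OF j] A ntD(4)[OF \<pi>[OF j] A y(1)]])
        fix X v assume v: "X \<in> Ob C" "v \<in> fo (Y A) X"
        then have v': "v \<in> Hom C X A" by simp
        show "ntcomp (Y A) P (fo G j) (\<pi> j) (yo P A z) X v = yo (fo G j) A (\<pi> j A y) X v"
          using ntD(5)[OF \<pi>[OF j] v' z(1)] z(2) j v v' by simp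
      qed
    qed
    obtain w where w: "\<And>h. h \<in> Hom (subPSh T) (Y A) P \<and>
        (\<forall>j\<in>Ob J. ntcomp (Y A) P (fo G j) (\<pi> j) h = yo (fo G j) A (\<pi> j A y)) \<Longrightarrow> h = w"
      using u by (elim ex1E) blast
    have "yo P A y = yo P A y'"
      using w[OF f[OF y(1)]] w[OF f[OF y(2)]] y(3) by simp
    then have "yo P A y A (Ide C A) = yo P A y' A (Ide C A)" by simp
    then show "y = y'" using A psh_id[OF psP A] y by simp
  qed (use \<pi> \<pi>_cone in auto)
qed

lemma plim_imp_limit:
  assumes G: "is_functor J (subPSh T) G" and P: "plim J G P \<pi>" "small_presheaf C P" "P \<in> T"
  shows "is_limit J (subPSh T) G P \<pi>"
proof -
  note PD = plimD[OF P(1)]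
  have Go: "psh (fo G j)" "small_presheaf C (fo G j)" "fo G j \<in> T" if "j \<in> Ob J" for j
    using is_functorD(3)[OF G that] small_presheaf_psh by auto
  have Ga: "nt (fo G i) (fo G j) (fa G i j u)" "i \<in> Ob J" "j \<in> Ob J" if "u \<in> Hom J i j" for i j u
    using is_functorD(4)[OF G that] category.Hom_Ob[OF is_functorD(1)[OF G] that] by (auto split: if_splits)
  show ?thesis unfolding is_limit_def
  proof (intro conjI allI impI)
    show "is_cone J (subPSh T) G P \<pi>" unfolding is_cone_def
    proof (intro conjI ballI)
      fix j assume "j \<in> Ob J" then show "\<pi> j \<in> Hom (subPSh T) P (fo G j)"
        unfolding Hom_subPSh using Go PD(2) P(2,3) by blast
    next
      fix i j u assume ij: "i \<in> Ob J" "j \<in> Ob J" "u \<in> Hom J i j"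
      have "ntcomp P (fo G i) (fo G j) (fa G i j u) (\<pi> i) = \<pi> j"
        by (rule nt_eqI[OF nt_comp[OF PD(2)[OF ij(1)] Ga(1)[OF ij(3)]] PD(2)[OF ij(2)]]) (simp add: PD(3)[OF ij(3)])
      then show "Cmp (subPSh T) P (fo G i) (fo G j) (fa G i j u) (\<pi> i) = \<pi> j" by simp
    qed (use P in simp)
  next
    fix X \<sigma> assume c: "is_cone J (subPSh T) G X \<sigma>"
    have X: "small_presheaf C X" "X \<in> T" "psh X" using c small_presheaf_psh unfolding is_cone_def by auto
    have \<sigma>: "nt X (fo G j) (\<sigma> j)" if "j \<in> Ob J" for j
      using c that Hom_subPSh unfolding is_cone_def by blast
    have \<sigma>': "fa G i j u A (\<sigma> i A x) = \<sigma> j A x" if "u \<in> Hom J i j" "A \<in> Ob C" "x \<in> fo X A" for i j u A x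
    proof -
      have "ntcomp X (fo G i) (fo G j) (fa G i j u) (\<sigma> i) = \<sigma> j"
        using c Ga(2,3)[OF that(1)] that(1) unfolding is_cone_def by simp
      then show ?thesis using ntcomp_apply[OF that(2,3)] by metis
    qed
    obtain h where h: "nt X P h" "\<And>j A x. j \<in> Ob J \<Longrightarrow> A \<in> Ob C \<Longrightarrow> x \<in> fo X A \<Longrightarrow> \<pi> j A (h A x) = \<sigma> j A x"
      using plim_map[OF P(1) X(3) \<sigma> \<sigma>'] by metis
    show "\<exists>!h. h \<in> Hom (subPSh T) X P \<and> (\<forall>j\<in>Ob J. Cmp (subPSh T) X P (fo G j) (\<pi> j) h = \<sigma> j)"
    proof (rule ex1I[of _ h])
      show "h \<in> Hom (subPSh T) X P \<and> (\<forall>j\<in>Ob J. Cmp (subPSh T) X P (fo G j) (\<pi> j) h = \<sigma> j)"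
      proof (intro conjI ballI)
        show "h \<in> Hom (subPSh T) X P" unfolding Hom_subPSh using X P h by blast
        fix j assume j: "j \<in> Ob J"
        have "ntcomp X P (fo G j) (\<pi> j) h = \<sigma> j"
          by (rule nt_eqI[OF nt_comp[OF h(1) PD(2)[OF j]] \<sigma>[OF j]]) (simp add: h(2)[OF j])
        then show "Cmp (subPSh T) X P (fo G j) (\<pi> j) h = \<sigma> j" by simp
      qed
      fix h' assume h': "h' \<in> Hom (subPSh T) X P \<and> (\<forall>j\<in>Ob J. Cmp (subPSh T) X P (fo G j) (\<pi> j) h' = \<sigma> j)"
      then have n: "nt X P h'" unfolding Hom_subPSh by blast
      show "h' = h"
      proof (rule nt_eqI[OF n h(1)])
        fix A x assume A: "A \<in> Ob C" "x \<in> fo X A"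
        show "h' A x = h A x"
        proof (rule PD(5)[OF A(1) ntD(4)[OF n A] ntD(4)[OF h(1) A]])
          fix j assume j: "j \<in> Ob J"
          have "ntcomp X P (fo G j) (\<pi> j) h' = \<sigma> j" using h' j by simp
          then have "\<pi> j A (h' A x) = \<sigma> j A x" using ntcomp_apply[OF A] by metis
          then show "\<pi> j A (h' A x) = \<pi> j A (h A x)" using h(2)[OF j A] by simp
        qed
      qed
    qed
  qed
qed

text \<open>The compatible families themselves, coded in \<open>'u\<close>; finiteness of
  \<open>J\<close> keeps the set of families small.\<close>

lemma plim_exists:
  assumes J: "finite_category J" and G: "is_functor J (PSh C) G"
  obtains P \<pi> where "plim J G P \<pi>"
proof -
  have fin: "finite (Ob J)" using J unfolding finite_category_def by blast
  have Go: "psh (fo G j)" if "j \<in> Ob J" for j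
    using is_functorD(3)[OF G that] small_presheaf_psh by auto
  have Ga: "nt (fo G i) (fo G j) (fa G i j u)" "i \<in> Ob J" "j \<in> Ob J" if "u \<in> Hom J i j" for i j u
    using is_functorD(4)[OF G that] category.Hom_Ob[OF is_functorD(1)[OF G] that] by auto
  define Q where "Q A = {x \<in> PiE (Ob J) (\<lambda>j. fo (fo G j) A). \<forall>i j u. u \<in> Hom J i j \<longrightarrow> fa G i j u A (x i) = x j}" for A
  define ac where "ac A B u x = (\<lambda>j\<in>Ob J. fa (fo G j) A B u (x j))" for A B u x
  have Qi: "x j \<in> fo (fo G j) A" if "x \<in> Q A" "j \<in> Ob J" for x j A
    using that unfolding Q_def by auto
  have ac_Q: "ac A B u x \<in> Q B" if u: "u \<in> Hom C B A" and x: "x \<in> Q A" for A B u x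
    unfolding Q_def
  proof (intro CollectI conjI allI impI)
    show "ac A B u x \<in> PiE (Ob J) (\<lambda>j. fo (fo G j) B)"
      unfolding ac_def using psh_in[OF Go u Qi[OF x]] by auto
    fix i j v assume v: "v \<in> Hom J i j"
    have "fa G i j v B (fa (fo G i) A B u (x i)) = fa (fo G j) A B u (fa G i j v A (x i))"
      using ntD(5)[OF Ga(1)[OF v] u Qi[OF x Ga(2)[OF v]]] .
    also have "fa G i j v A (x i) = x j" using x v unfolding Q_def by blast
    finally show "fa G i j v B (ac A B u x i) = ac A B u x j" unfolding ac_def using Ga(2,3)[OF v] by simp
  qed
  obtain P e where P: "psh P" "\<And>A. A \<in> Ob C \<Longrightarrow> bij_betw (e A) (Q A) (fo P A)"
    "\<And>A B u z. u \<in> Hom C B A \<Longrightarrow> z \<in> Q A \<Longrightarrow> fa P A B u (e A z) = e B (ac A B u z)"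
  proof (rule psh_encode[of Q ac])
    fix A assume A: "A \<in> Ob C"
    have "small TYPE('u) (PiE (Ob J) (\<lambda>j. fo (fo G j) A))"
      by (rule small_PiE[OF univ fin]) (use psh_small[OF Go A] in auto)
    then show "small TYPE('u) (Q A)" by (rule small_subset) (auto simp: Q_def)
  next
    fix A B u x assume "u \<in> Hom C B A" "x \<in> Q A"
    then show "ac A B u x \<in> Q B" by (rule ac_Q)
  next
    fix A x assume A: "A \<in> Ob C" "x \<in> Q A"
    have e: "x \<in> extensional (Ob J)" using A unfolding Q_def by (auto simp: PiE_iff)
    show "ac A A (Ide C A) x = x"
      by (rule extensionalityI[OF _ e]) (use psh_id[OF Go A(1) Qi[OF A(2)]] in \<open>auto simp: ac_def\<close>)
  next
    fix A B D u v x assume u: "u \<in> Hom C B A" "v \<in> Hom C D B" "x \<in> Q A"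
    show "ac A D (Cmp C D B A u v) x = ac B D v (ac A B u x)"
      unfolding ac_def using psh_comp[OF Go u(1,2) Qi[OF u(3)]] by (auto intro!: restrict_ext)
  qed blast
  define d where "d A = inv_into (Q A) (e A)" for A
  have d: "d A y \<in> Q A" "e A (d A y) = y" if "A \<in> Ob C" "y \<in> fo P A" for A y
    using P(2)[OF that(1)] that(2) unfolding d_def bij_betw_def by (auto simp: inv_into_into f_inv_into_f)
  have de: "d A (e A x) = x" if "A \<in> Ob C" "x \<in> Q A" for A x
    using P(2)[OF that(1)] that(2) unfolding d_def bij_betw_def by simp
  have e_in: "e A x \<in> fo P A" if "A \<in> Ob C" "x \<in> Q A" for A x
    using P(2)[OF that(1)] that(2) unfolding bij_betw_def by blast
  define \<pi> where "\<pi> j = mknt P (\<lambda>A y. d A y j)" for j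
  have \<pi>: "\<pi> j A y = d A y j" if "A \<in> Ob C" "y \<in> fo P A" for j A y using that unfolding \<pi>_def by simp
  have d_act: "d B (fa P A B u y) = ac A B u (d A y)" if u: "u \<in> Hom C B A" "y \<in> fo P A" for A B u y
  proof -
    have "fa P A B u y = e B (ac A B u (d A y))" using P(3)[OF u(1) d(1)[OF cod[OF u(1)] u(2)]] d(2)[OF cod[OF u(1)] u(2)] by simp
    moreover have "e B (ac A B u (d A y)) \<in> fo P B" using psh_in[OF P(1) u] calculation by simp
    moreover have "ac A B u (d A y) \<in> Q B" by (rule ac_Q[OF u(1) d(1)[OF cod[OF u(1)] u(2)]])
    ultimately show ?thesis using de[OF dom[OF u(1)]] by simp
  qed
  have "plim J G P \<pi>" unfolding plim_def
  proof (intro conjI allI impI ballI P(1))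
    fix j assume j: "j \<in> Ob J"
    show "nt P (fo G j) (\<pi> j)" unfolding \<pi>_def
    proof (rule nt_mknt[OF P(1) Go[OF j]])
      fix A x assume "A \<in> Ob C" "x \<in> fo P A"
      then show "d A x j \<in> fo (fo G j) A" using d(1) Qi j by blast
    next
      fix A B u x assume "u \<in> Hom C B A" "x \<in> fo P A"
      then show "d B (fa P A B u x) j = fa (fo G j) A B u (d A x j)" using d_act j by (simp add: ac_def)
    qed
  next
    fix i j u A x assume u: "u \<in> Hom J i j" "A \<in> Ob C" "x \<in> fo P A"
    have "fa G i j u A (d A x i) = d A x j" using d(1)[OF u(2,3)] u(1) unfolding Q_def by blast
    then show "fa G i j u A (\<pi> i A x) = \<pi> j A x" using \<pi>[OF u(2,3)] by simp
  next
    fix A x assume A: "A \<in> Ob C" and x: "\<forall>j\<in>Ob J. x j \<in> fo (fo G j) A"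
      "\<forall>i j u. u \<in> Hom J i j \<longrightarrow> fa G i j u A (x i) = x j"
    let ?x = "\<lambda>j\<in>Ob J. x j"
    have "?x \<in> Q A" unfolding Q_def using x Ga(2,3) by auto
    then show "\<exists>y\<in>fo P A. \<forall>j\<in>Ob J. \<pi> j A y = x j"
      using e_in[OF A] de[OF A] \<pi>[OF A] by (intro bexI[of _ "e A ?x"]) auto
  next
    fix A y y' assume A: "A \<in> Ob C" and y: "y \<in> fo P A" "y' \<in> fo P A" "\<forall>j\<in>Ob J. \<pi> j A y = \<pi> j A y'"
    have "d A y = d A y'"
    proof (rule extensionalityI[of _ "Ob J"])
      show "d A y \<in> extensional (Ob J)" "d A y' \<in> extensional (Ob J)"
        using d(1)[OF A y(1)] d(1)[OF A y(2)] unfolding Q_def by (auto simp: PiE_iff)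
      show "\<And>j. j \<in> Ob J \<Longrightarrow> d A y j = d A y' j" using \<pi>[OF A y(1)] \<pi>[OF A y(2)] y(3) by simp
    qed
    then show "y = y'" using d(2)[OF A y(1)] d(2)[OF A y(2)] by metis
  qed
  then show thesis by (rule that)
qed

text \<open>The components of an element of the limit are restrictions of generators, one for each
  \<open>j\<close>; the possible choices form a finite product of small sets. For each choice, let
  \<open>Q\<close> be the product in \<open>C\<close> of the stages. The sieve on \<open>Q\<close>
  where the restricted generators become compatible is a finite intersection of equality sieves, and
  its generators give elements of \<open>P\<close> from which all elements with that choice
  arise.\<close>

lemma plim_small_generated:
  fixes J :: "(nat, nat) cat"
  assumes J: "finite_category J" and G: "is_functor J (PSh C) G" and P: "plim J G P \<pi>"
  shows "small_generated P"
proof -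
  note PD = plimD[OF P]
  have fin: "finite (Ob J)" "\<And>i j. i \<in> Ob J \<Longrightarrow> j \<in> Ob J \<Longrightarrow> finite (Hom J i j)"
    using J unfolding finite_category_def by blast+
  have Gs: "small_generated (fo G j)" if "j \<in> Ob J" for j
    using is_functorD(3)[OF G that] small_presheaf_iff by simp
  then have Go: "psh (fo G j)" "generated (fo G j) (fo (fo G j))"
    "\<And>A x x'. A \<in> Ob C \<Longrightarrow> x \<in> fo (fo G j) A \<Longrightarrow> x' \<in> fo (fo G j) A \<Longrightarrow> generated (Y A) (eq_sieve (fo G j) A x x')"
    if "j \<in> Ob J" for j
    using that unfolding small_generated_def by blast+
  have Ga: "nt (fo G i) (fo G j) (fa G i j u)" "i \<in> Ob J" "j \<in> Ob J" if "u \<in> Hom J i j" for i j u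
    using is_functorD(4)[OF G that] category.Hom_Ob[OF is_functorD(1)[OF G] that] by auto
  show ?thesis unfolding small_generated_def
  proof (intro conjI ballI PD(1))
    fix A x x' assume A: "A \<in> Ob C" and x: "x \<in> fo P A" "x' \<in> fo P A"
    have "generated (Y A) (\<lambda>X. {u \<in> Hom C X A. \<forall>j\<in>Ob J. u \<in> eq_sieve (fo G j) A (\<pi> j A x) (\<pi> j A x') X})"
    proof (rule generated_finite_INT[OF fin(1) A])
      fix j assume j: "j \<in> Ob J"
      have "\<pi> j A x \<in> fo (fo G j) A" "\<pi> j A x' \<in> fo (fo G j) A" using ntD(4)[OF PD(2)[OF j] A] x by blast+
      then show "sieve A (eq_sieve (fo G j) A (\<pi> j A x) (\<pi> j A x'))" "generated (Y A) (eq_sieve (fo G j) A (\<pi> j A x) (\<pi> j A x'))"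
        using sieve_eq_sieve[OF Go(1)[OF j] A] Go(3)[OF j A] by blast+
    qed
    moreover have "fa P A X u x = fa P A X u x' \<longleftrightarrow> (\<forall>j\<in>Ob J. u \<in> eq_sieve (fo G j) A (\<pi> j A x) (\<pi> j A x') X)"
      if u: "u \<in> Hom C X A" for X u
    proof -
      have "fa P A X u x = fa P A X u x' \<longleftrightarrow> (\<forall>j\<in>Ob J. \<pi> j X (fa P A X u x) = \<pi> j X (fa P A X u x'))"
        using PD(5)[OF dom[OF u] psh_in[OF PD(1) u x(1)] psh_in[OF PD(1) u x(2)]] by auto
      also have "\<dots> \<longleftrightarrow> (\<forall>j\<in>Ob J. u \<in> eq_sieve (fo G j) A (\<pi> j A x) (\<pi> j A x') X)"
        unfolding eq_sieve_def using ntD(5)[OF PD(2) u x(1)] ntD(5)[OF PD(2) u x(2)] u by simp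
      finally show ?thesis .
    qed
    then have "(\<lambda>X. {u \<in> Hom C X A. \<forall>j\<in>Ob J. u \<in> eq_sieve (fo G j) A (\<pi> j A x) (\<pi> j A x') X}) = eq_sieve P A x x'"
      unfolding eq_sieve_def[of P] by (intro ext Collect_cong conj_cong refl) simp
    ultimately show "generated (Y A) (eq_sieve P A x x')" by simp
  next
    have "\<exists>S. small TYPE('u) S \<and> (\<forall>Z s. (Z, s) \<in> S \<longrightarrow> Z \<in> Ob C \<and> s \<in> fo (fo G j) Z) \<and>
       (\<forall>X\<in>Ob C. \<forall>x\<in>fo (fo G j) X. \<exists>Z s. (Z, s) \<in> S \<and> (\<exists>v\<in>Hom C X Z. x = fa (fo G j) Z X v s))" if "j \<in> Ob J" for j
      using Go(2)[OF that] unfolding generated_def .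
    then obtain E where E: "\<And>j. j \<in> Ob J \<Longrightarrow> small TYPE('u) (E j)"
      "\<And>j Z s. j \<in> Ob J \<Longrightarrow> (Z, s) \<in> E j \<Longrightarrow> Z \<in> Ob C \<and> s \<in> fo (fo G j) Z"
      "\<And>j X x. j \<in> Ob J \<Longrightarrow> X \<in> Ob C \<Longrightarrow> x \<in> fo (fo G j) X \<Longrightarrow> \<exists>Z s. (Z, s) \<in> E j \<and> (\<exists>v\<in>Hom C X Z. x = fa (fo G j) Z X v s)"
      by metis
    \<comment> \<open>\<open>T\<close> is a small set of elements of \<open>P\<close> that generates
      all those whose components are restrictions of the generators chosen by
      \<open>e\<close>.\<close>
    define lifts where "lifts e T \<longleftrightarrow> small TYPE('u) T \<and> (\<forall>Z y. (Z, y) \<in> T \<longrightarrow> Z \<in> Ob C \<and> y \<in> fo P Z) \<and>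
      (\<forall>X x v. X \<in> Ob C \<longrightarrow> x \<in> fo P X \<longrightarrow> (\<forall>j\<in>Ob J. v j \<in> Hom C X (fst (e j)) \<and> \<pi> j X x = fa (fo G j) (fst (e j)) X (v j) (snd (e j))) \<longrightarrow>
        (\<exists>Z y. (Z, y) \<in> T \<and> (\<exists>w\<in>Hom C X Z. x = fa P Z X w y)))" for e T
    have "\<exists>T. lifts e T" if e: "e \<in> PiE (Ob J) E" for e
    proof -
      let ?A = "\<lambda>j. fst (e j)" and ?s = "\<lambda>j. snd (e j)"
      have s: "?A j \<in> Ob C" "?s j \<in> fo (fo G j) (?A j)" if "j \<in> Ob J" for j
        using E(2)[OF that, of "?A j" "?s j"] PiE_mem[OF e that] by simp_all
      obtain Q \<rho> where Q: "Q \<in> Ob C" "\<And>j. j \<in> Ob J \<Longrightarrow> \<rho> j \<in> Hom C Q (?A j)"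
        "\<And>X f. X \<in> Ob C \<Longrightarrow> (\<And>i. i \<in> Ob J \<Longrightarrow> f i \<in> Hom C X (?A i)) \<Longrightarrow>
           \<exists>h\<in>Hom C X Q. \<forall>i\<in>Ob J. Cmp C X Q (?A i) (\<rho> i) h = f i"
        by (rule finitely_complete_product[OF fin_complete fin(1), of ?A]) (erule s(1), blast)
      define x0 where "x0 j = fa (fo G j) (?A j) Q (\<rho> j) (?s j)" for j
      have x0: "x0 j \<in> fo (fo G j) Q" if "j \<in> Ob J" for j
        unfolding x0_def by (rule psh_in[OF Go(1)[OF that] Q(2)[OF that] s(2)[OF that]])
      define I where "I = (SIGMA i : Ob J. SIGMA j : Ob J. Hom J i j)"
      have finI: "finite I" unfolding I_def using fin by (intro finite_SigmaI) auto
      \<comment> \<open>One equality sieve for each arrow of \<open>J\<close>: the place where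
        \<open>x0\<close> becomes compatible with that arrow.\<close>
      define R0 where "R0 t = (case t of (i, j, u) \<Rightarrow> eq_sieve (fo G j) Q (fa G i j u Q (x0 i)) (x0 j))" for t
      have R0: "sieve Q (R0 t)" "generated (Y Q) (R0 t)" if "t \<in> I" for t
      proof -
        obtain i j u where t: "t = (i, j, u)" "i \<in> Ob J" "j \<in> Ob J" "u \<in> Hom J i j"
          using \<open>t \<in> I\<close> unfolding I_def by blast
        have "fa G i j u Q (x0 i) \<in> fo (fo G j) Q" using ntD(4)[OF Ga(1)[OF t(4)] Q(1) x0[OF t(2)]] .
        then show "sieve Q (R0 t)" "generated (Y Q) (R0 t)"
          unfolding R0_def t(1) using sieve_eq_sieve[OF Go(1)[OF t(3)] Q(1)] Go(3)[OF t(3) Q(1)] x0[OF t(3)] by auto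
      qed
      define R where "R X = {u \<in> Hom C X Q. \<forall>t\<in>I. u \<in> R0 t X}" for X
      have R: "sieve Q R" "generated (Y Q) R"
        unfolding R_def using finite_INT_sieve[OF finI Q(1) R0(1)] generated_finite_INT[OF finI Q(1) R0] by auto
      have R_iff: "h \<in> R X \<longleftrightarrow> (\<forall>i j u. u \<in> Hom J i j \<longrightarrow>
          fa G i j u X (fa (fo G i) Q X h (x0 i)) = fa (fo G j) Q X h (x0 j))" if h: "h \<in> Hom C X Q" for X h
      proof -
        have "fa (fo G j) Q X h (fa G i j u Q (x0 i)) = fa G i j u X (fa (fo G i) Q X h (x0 i))"
          if u: "u \<in> Hom J i j" for i j u
          using ntD(5)[OF Ga(1)[OF u] h x0[OF Ga(2)[OF u]]] by simp
        then show ?thesis unfolding R_def R0_def I_def eq_sieve_def using h Ga(2,3) by auto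
      qed
      obtain S where S: "small TYPE('u) S" "\<And>Z r. (Z, r) \<in> S \<Longrightarrow> r \<in> R Z"
        "\<And>X r. r \<in> R X \<Longrightarrow> \<exists>Z r'. (Z, r') \<in> S \<and> (\<exists>v\<in>Hom C X Z. r = Cmp C X Z Q r' v)"
        using generated_sieveD[OF R] by metis
      have RH: "r \<in> Hom C Z Q" if "r \<in> R Z" for Z r using that unfolding R_def by simp
      define y where "y Z r = (SOME y. y \<in> fo P Z \<and> (\<forall>j\<in>Ob J. \<pi> j Z y = fa (fo G j) Q Z r (x0 j)))" for Z r
      have y: "y Z r \<in> fo P Z \<and> (\<forall>j\<in>Ob J. \<pi> j Z (y Z r) = fa (fo G j) Q Z r (x0 j))" if r: "r \<in> R Z" for Z r
      proof -
        have "\<exists>y\<in>fo P Z. \<forall>j\<in>Ob J. \<pi> j Z y = fa (fo G j) Q Z r (x0 j)"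
        proof (rule PD(4)[OF dom[OF RH[OF r]]])
          fix j assume "j \<in> Ob J"
          then show "fa (fo G j) Q Z r (x0 j) \<in> fo (fo G j) Z" using psh_in[OF Go(1) RH[OF r] x0] by blast
        next
          fix i j u assume "u \<in> Hom J i j"
          then show "fa G i j u Z (fa (fo G i) Q Z r (x0 i)) = fa (fo G j) Q Z r (x0 j)"
            using R_iff[OF RH[OF r]] r by blast
        qed
        then have "\<exists>y. y \<in> fo P Z \<and> (\<forall>j\<in>Ob J. \<pi> j Z y = fa (fo G j) Q Z r (x0 j))" by blast
        then show ?thesis unfolding y_def by (rule someI_ex)
      qed
      have "lifts e ((\<lambda>(Z, r). (Z, y Z r)) ` S)" unfolding lifts_def
      proof (intro conjI allI impI)
        show "small TYPE('u) ((\<lambda>(Z, r). (Z, y Z r)) ` S)" by (rule small_image[OF S(1)])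
        fix Z z assume "(Z, z) \<in> (\<lambda>(Z, r). (Z, y Z r)) ` S"
        then obtain r where "(Z, r) \<in> S" "z = y Z r" by auto
        then show "Z \<in> Ob C" "z \<in> fo P Z" using y S(2) dom[OF RH] by blast+
      next
        fix X x v assume X: "X \<in> Ob C" and x: "x \<in> fo P X"
          and v: "\<forall>j\<in>Ob J. v j \<in> Hom C X (?A j) \<and> \<pi> j X x = fa (fo G j) (?A j) X (v j) (?s j)"
        obtain h where h: "h \<in> Hom C X Q" "\<forall>j\<in>Ob J. Cmp C X Q (?A j) (\<rho> j) h = v j"
          using Q(3)[OF X, of v] v by blast
        have hx: "fa (fo G j) Q X h (x0 j) = \<pi> j X x" if j: "j \<in> Ob J" for j
          unfolding x0_def psh_comp[OF Go(1)[OF j] Q(2)[OF j] h(1) s(2)[OF j], symmetric] using h(2) v j by simp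
        have "h \<in> R X" unfolding R_iff[OF h(1)] using hx Ga(2,3) PD(3)[OF _ X x] by simp
        then obtain Z r w where r: "(Z, r) \<in> S" "w \<in> Hom C X Z" "h = Cmp C X Z Q r w" using S(3) by blast
        note rR = S(2)[OF r(1)]
        have yZ: "y Z r \<in> fo P Z" using y[OF rR] by blast
        have "x = fa P Z X w (y Z r)"
        proof (rule PD(5)[OF X x psh_in[OF PD(1) r(2) yZ]])
          fix j assume j: "j \<in> Ob J"
          have "\<pi> j X (fa P Z X w (y Z r)) = fa (fo G j) Z X w (fa (fo G j) Q Z r (x0 j))"
            using ntD(5)[OF PD(2)[OF j] r(2) yZ] y[OF rR] j by simp
          also have "\<dots> = fa (fo G j) Q X h (x0 j)"
            unfolding r(3) psh_comp[OF Go(1)[OF j] RH[OF rR] r(2) x0[OF j]] ..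
          finally show "\<pi> j X x = \<pi> j X (fa P Z X w (y Z r))" using hx[OF j] by simp
        qed
        then show "\<exists>Z z. (Z, z) \<in> (\<lambda>(Z, r). (Z, y Z r)) ` S \<and> (\<exists>w\<in>Hom C X Z. x = fa P Z X w z)"
          using r(1,2) by force
      qed
      then show ?thesis by blast
    qed
    then obtain T where L: "\<And>e. e \<in> PiE (Ob J) E \<Longrightarrow> lifts e (T e)" by metis
    then have T: "\<And>e. e \<in> PiE (Ob J) E \<Longrightarrow> small TYPE('u) (T e)"
      "\<And>e Z y. e \<in> PiE (Ob J) E \<Longrightarrow> (Z, y) \<in> T e \<Longrightarrow> Z \<in> Ob C \<and> y \<in> fo P Z"
      unfolding lifts_def by simp_all
    show "generated P (fo P)"
    proof (rule generatedI)
      show "small TYPE('u) (\<Union>e\<in>PiE (Ob J) E. T e)"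
        by (intro small_UN univ small_PiE fin(1) E(1) T(1))
      fix Z y assume "(Z, y) \<in> (\<Union>e\<in>PiE (Ob J) E. T e)"
      then show "Z \<in> Ob C \<and> y \<in> fo P Z" using T(2) by blast
    next
      fix X x assume X: "X \<in> Ob C" "x \<in> fo P X"
      have "\<exists>ev. fst ev \<in> E j \<and> snd ev \<in> Hom C X (fst (fst ev)) \<and>
          \<pi> j X x = fa (fo G j) (fst (fst ev)) X (snd ev) (snd (fst ev))" if j: "j \<in> Ob J" for j
      proof -
        obtain Z s v where "(Z, s) \<in> E j" "v \<in> Hom C X Z" "\<pi> j X x = fa (fo G j) Z X v s"
          using E(3)[OF j X(1) ntD(4)[OF PD(2)[OF j] X]] by blast
        then show ?thesis by (intro exI[of _ "((Z, s), v)"]) simp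
      qed
      then obtain ev where ev: "\<And>j. j \<in> Ob J \<Longrightarrow> fst (ev j) \<in> E j \<and> snd (ev j) \<in> Hom C X (fst (fst (ev j))) \<and>
          \<pi> j X x = fa (fo G j) (fst (fst (ev j))) X (snd (ev j)) (snd (fst (ev j)))"
        by metis
      let ?e = "\<lambda>j\<in>Ob J. fst (ev j)"
      have e: "?e \<in> PiE (Ob J) E" using ev by auto
      have "\<forall>j\<in>Ob J. snd (ev j) \<in> Hom C X (fst (?e j)) \<and> \<pi> j X x = fa (fo G j) (fst (?e j)) X (snd (ev j)) (snd (?e j))"
        using ev by simp
      then have "\<exists>Z y. (Z, y) \<in> T ?e \<and> (\<exists>w\<in>Hom C X Z. x = fa P Z X w y)"
        using L[OF e, unfolded lifts_def, THEN conjunct2, THEN conjunct2,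
          THEN spec[of _ X], THEN spec[of _ x], THEN spec[of _ "\<lambda>j. snd (ev j)"], THEN mp, OF X(1), THEN mp, OF X(2)]
        by (rule rev_mp)
      then obtain Z y w where "(Z, y) \<in> T ?e" "w \<in> Hom C X Z" "x = fa P Z X w y" by blast
      then show "\<exists>Z s. (Z, s) \<in> (\<Union>e\<in>PiE (Ob J) E. T e) \<and> (\<exists>v\<in>Hom C X Z. x = fa P Z X v s)"
        using e by blast
    qed
  qed
qed

lemma finitely_complete_PSh: "finitely_complete (PSh C)"
  unfolding finitely_complete_def
proof (intro conjI allI impI category_PSh)
  fix J :: "(nat, nat) cat" and G assume J: "finite_category J \<and> is_functor J (PSh C) G"
  obtain P \<pi> where P: "plim J G P \<pi>" using plim_exists J by blast
  have "small_presheaf C P" using plim_small_generated[OF _ _ P] J small_presheaf_iff by blast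
  then have "is_limit J (subPSh UNIV) G P \<pi>"
    using plim_imp_limit[of J UNIV G P \<pi>] J P by simp
  then show "\<exists>P. Ex (is_limit J (PSh C) G P)" by auto
qed

section \<open>The Yoneda embedding is lex\<close>

lemma is_functor_yoneda:
  assumes "\<And>A. A \<in> Ob C \<Longrightarrow> Y A \<in> T"
  shows "is_functor C (subPSh T) (yoneda C)"
proof (rule is_functorI[OF cat category_subPSh])
  fix X assume X: "X \<in> Ob C"
  then show "Y X \<in> Ob (subPSh T)" using assms small_presheaf_Y by simp
  have "fa (yoneda C) X X (Ide C X) = ntid (Y X)"
    by (rule nt_eqI[OF nt_yoneda[OF idC[OF X]] nt_id[OF psh_Y[OF X]]]) (simp add: yoneda_apply[OF idC[OF X]])
  then show "fa (yoneda C) X X (Ide C X) = Ide (subPSh T) (Y X)" by simp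
next
  fix X Z f assume f: "f \<in> Hom C X Z"
  then show "fa (yoneda C) X Z f \<in> Hom (subPSh T) (Y X) (Y Z)"
    unfolding Hom_subPSh using assms small_presheaf_Y nt_yoneda dom[OF f] cod[OF f] by blast
next
  fix X Z W f g assume f: "f \<in> Hom C X Z" "g \<in> Hom C Z W"
  have "fa (yoneda C) X W (Cmp C X Z W g f) = ntcomp (Y X) (Y Z) (Y W) (fa (yoneda C) Z W g) (fa (yoneda C) X Z f)"
  proof (rule nt_eqI[OF nt_yoneda[OF compC[OF f]] nt_comp[OF nt_yoneda[OF f(1)] nt_yoneda[OF f(2)]]])
    fix A x assume A: "A \<in> Ob C" and x: "x \<in> fo (Y X) A"
    then have x': "x \<in> Hom C A X" by simp
    show "fa (yoneda C) X W (Cmp C X Z W g f) A x = ntcomp (Y X) (Y Z) (Y W) (fa (yoneda C) Z W g) (fa (yoneda C) X Z f) A x"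
      unfolding ntcomp_apply[where F="Y X", OF A x] yoneda_apply[OF compC[OF f] x'] yoneda_apply[OF f(1) x']
        yoneda_apply[OF f(2) compC[OF x' f(1)]] by (rule assocC[OF x' f])
  qed
  then show "fa (yoneda C) X W (Cmp C X Z W g f) =
     Cmp (subPSh T) (Y X) (Y Z) (Y W) (fa (yoneda C) Z W g) (fa (yoneda C) X Z f)" by simp
qed

lemma is_functor_yoneda_PSh: "is_functor C (PSh C) (yoneda C)"
  using is_functor_yoneda[of UNIV] by simp

text \<open>An element of \<open>Y L\<close> at \<open>A\<close> is an arrow from \<open>A\<close>
  to \<open>L\<close>, so the universal property of \<open>L\<close> is already the pointwise
  one.\<close>

lemma limit_yoneda_plim:
  assumes G: "is_functor J C G" and L: "is_limit J C G L \<pi>"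
  shows "plim J (fcomp (yoneda C) G) (Y L) (\<lambda>j. fa (yoneda C) L (fo G j) (\<pi> j))"
proof -
  have c: "L \<in> Ob C" "\<And>j. j \<in> Ob J \<Longrightarrow> \<pi> j \<in> Hom C L (fo G j)"
    "\<And>i j u. u \<in> Hom J i j \<Longrightarrow> Cmp C L (fo G i) (fo G j) (fa G i j u) (\<pi> i) = \<pi> j"
    using L category.Hom_Ob[OF is_functorD(1)[OF G]] unfolding is_limit_def is_cone_def by blast+
  have l: "\<exists>!h. h \<in> Hom C X L \<and> (\<forall>j\<in>Ob J. Cmp C X L (fo G j) (\<pi> j) h = \<sigma> j)" if "is_cone J C G X \<sigma>" for X \<sigma>
    using L that unfolding is_limit_def by blast
  note Ga = is_functorD(4)[OF G]
  have J: "i \<in> Ob J" "j \<in> Ob J" if "u \<in> Hom J i j" for i j u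
    using category.Hom_Ob[OF is_functorD(1)[OF G] that] by auto
  have ap: "fa (yoneda C) L (fo G j) (\<pi> j) A x = Cmp C A L (fo G j) (\<pi> j) x" if "j \<in> Ob J" "x \<in> Hom C A L" for j A x
    by (rule yoneda_apply[OF c(2)[OF that(1)] that(2)])
  show ?thesis unfolding plim_def
  proof (intro conjI allI impI ballI psh_Y c(1))
    fix j assume "j \<in> Ob J"
    then show "nt (Y L) (fo (fcomp (yoneda C) G) j) (fa (yoneda C) L (fo G j) (\<pi> j))"
      using nt_yoneda[OF c(2)] by simp
  next
    fix i j u A x assume u: "u \<in> Hom J i j" "A \<in> Ob C" "x \<in> fo (Y L) A"
    then have x: "x \<in> Hom C A L" by simp
    note i = J[OF u(1)]
    have "fa (yoneda C) (fo G i) (fo G j) (fa G i j u) A (Cmp C A L (fo G i) (\<pi> i) x) = Cmp C A L (fo G j) (\<pi> j) x"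
      unfolding yoneda_apply[OF Ga[OF u(1)] compC[OF x c(2)[OF i(1)]]] assocC[OF x c(2)[OF i(1)] Ga[OF u(1)], symmetric] c(3)[OF u(1)] ..
    then show "fa (fcomp (yoneda C) G) i j u A (fa (yoneda C) L (fo G i) (\<pi> i) A x) = fa (yoneda C) L (fo G j) (\<pi> j) A x"
      using ap i x by simp
  next
    fix A x assume A: "A \<in> Ob C" and x: "\<forall>j\<in>Ob J. x j \<in> fo (fo (fcomp (yoneda C) G) j) A"
      "\<forall>i j u. u \<in> Hom J i j \<longrightarrow> fa (fcomp (yoneda C) G) i j u A (x i) = x j"
    have xj: "x j \<in> Hom C A (fo G j)" if "j \<in> Ob J" for j using x(1) that by simp
    have "is_cone J C G A x" unfolding is_cone_def
    proof (intro conjI ballI A xj)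
      fix i j u assume u: "i \<in> Ob J" "j \<in> Ob J" "u \<in> Hom J i j"
      show "Cmp C A (fo G i) (fo G j) (fa G i j u) (x i) = x j"
        using x(2) u yoneda_apply[OF Ga[OF u(3)] xj[OF u(1)]] by simp
    qed
    from l[OF this] obtain h where h: "h \<in> Hom C A L" "\<forall>j\<in>Ob J. Cmp C A L (fo G j) (\<pi> j) h = x j" by blast
    then show "\<exists>y\<in>fo (Y L) A. \<forall>j\<in>Ob J. fa (yoneda C) L (fo G j) (\<pi> j) A y = x j"
      using ap by (intro bexI[of _ h]) auto
  next
    fix A y y' assume A: "A \<in> Ob C" and y: "y \<in> fo (Y L) A" "y' \<in> fo (Y L) A"
      and e: "\<forall>j\<in>Ob J. fa (yoneda C) L (fo G j) (\<pi> j) A y = fa (yoneda C) L (fo G j) (\<pi> j) A y'"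
    have y': "y \<in> Hom C A L" "y' \<in> Hom C A L" using y by simp_all
    have "is_cone J C G A (\<lambda>j. Cmp C A L (fo G j) (\<pi> j) y)" unfolding is_cone_def
    proof (intro conjI ballI A)
      fix j assume "j \<in> Ob J" then show "Cmp C A L (fo G j) (\<pi> j) y \<in> Hom C A (fo G j)" by (rule compC[OF y'(1) c(2)])
    next
      fix i j u assume u: "i \<in> Ob J" "j \<in> Ob J" "u \<in> Hom J i j"
      show "Cmp C A (fo G i) (fo G j) (fa G i j u) (Cmp C A L (fo G i) (\<pi> i) y) = Cmp C A L (fo G j) (\<pi> j) y"
        unfolding assocC[OF y'(1) c(2)[OF u(1)] Ga[OF u(3)], symmetric] c(3)[OF u(3)] ..
    qed
    from l[OF this] obtain w where w: "\<And>h. h \<in> Hom C A L \<Longrightarrow>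
        (\<forall>j\<in>Ob J. Cmp C A L (fo G j) (\<pi> j) h = Cmp C A L (fo G j) (\<pi> j) y) \<Longrightarrow> h = w"
      by (elim ex1E) blast
    show "y = y'" using w[OF y'(1)] w[OF y'(2)] e ap y' by simp
  qed
qed

lemma preserves_yoneda: "preserves_finite_limits C (PSh C) (yoneda C)"
  unfolding preserves_finite_limits_def
proof (intro allI impI)
  fix J :: "(nat, nat) cat" and G L \<pi>
  assume a: "finite_category J \<and> is_functor J C G \<and> is_limit J C G L \<pi>"
  then have L: "L \<in> Ob C" unfolding is_limit_def is_cone_def by blast
  have "is_limit J (subPSh UNIV) (fcomp (yoneda C) G) (Y L) (\<lambda>j. fa (yoneda C) L (fo G j) (\<pi> j))"
    by (rule plim_imp_limit[OF _ limit_yoneda_plim])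
      (use a is_functor_fcomp[OF _ is_functor_yoneda_PSh] small_presheaf_Y[OF L] in auto)
  then show "is_limit J (PSh C) (fcomp (yoneda C) G) (fo (yoneda C) L) (\<lambda>j. fa (yoneda C) L (fo G j) (\<pi> j))" by simp
qed

lemma lex_yoneda: "lex_functor C (PSh C) (yoneda C)"
  unfolding lex_functor_def using fin_complete finitely_complete_PSh is_functor_yoneda_PSh preserves_yoneda by blast

section \<open>The canonical topology\<close>

definition matching :: "('o \<Rightarrow> 'u set) \<Rightarrow> 'o \<Rightarrow> 'o \<Rightarrow> ('o \<Rightarrow> 'u \<Rightarrow> 'u) \<Rightarrow> bool" where
  "matching R A D g \<longleftrightarrow> (\<forall>X r. r \<in> R X \<longrightarrow> g X r \<in> Hom C X D) \<and>
     (\<forall>X W r v. r \<in> R X \<longrightarrow> v \<in> Hom C W X \<longrightarrow> g W (Cmp C W X A r v) = Cmp C W X D (g X r) v)"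

text \<open>An effective-epimorphic sieve: every representable satisfies the sheaf condition for
  \<open>R\<close>.\<close>

definition effective :: "'o \<Rightarrow> ('o \<Rightarrow> 'u set) \<Rightarrow> bool" where
  "effective A R \<longleftrightarrow> (\<forall>D\<in>Ob C. \<forall>g. matching R A D g \<longrightarrow>
     (\<exists>!h. h \<in> Hom C A D \<and> (\<forall>X r. r \<in> R X \<longrightarrow> Cmp C X A D h r = g X r)))"

text \<open>Universally effective-epimorphic sieves, that is, the covering sieves of the largest
  topology for which all representables are sheaves.\<close>

definition cover :: "'o \<Rightarrow> ('o \<Rightarrow> 'u set) \<Rightarrow> bool" where
  "cover A R \<longleftrightarrow> sieve A R \<and> (\<forall>B u. u \<in> Hom C B A \<longrightarrow> effective B (pull A B u R))"

lemma cover_sieve: "cover A R \<Longrightarrow> sieve A R" unfolding cover_def by blast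

lemma pull_id: "sieve A R \<Longrightarrow> pull A A (Ide C A) R = R"
  using sieveD(2)[of A R] unfolding pull_def by (auto simp: fun_eq_iff)

lemma pull_pull:
  assumes "u \<in> Hom C B A" "v \<in> Hom C D B"
  shows "pull B D v (pull A B u R) = pull A D (Cmp C D B A u v) R"
proof (intro ext equalityI subsetI)
  fix X w assume "w \<in> pull B D v (pull A B u R) X"
  then show "w \<in> pull A D (Cmp C D B A u v) R X" unfolding pull_def using assocC[OF _ assms(2,1)] by auto
next
  fix X w assume "w \<in> pull A D (Cmp C D B A u v) R X"
  then show "w \<in> pull B D v (pull A B u R) X"
    unfolding pull_def using assocC[OF _ assms(2,1)] compC[OF _ assms(2)] by auto
qed

lemma cover_effective: "cover A R \<Longrightarrow> effective A R"
  unfolding cover_def using pull_id[of A R] idC[OF sieveD(1)[of A R]] by metis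

lemma cover_pull: "cover A R \<Longrightarrow> u \<in> Hom C B A \<Longrightarrow> cover B (pull A B u R)"
  unfolding cover_def using sieve_pull by (auto simp: pull_pull)

lemma cover_glue:
  assumes "cover A R" "D \<in> Ob C" "matching R A D g"
  obtains h where "h \<in> Hom C A D" "\<And>X r. r \<in> R X \<Longrightarrow> Cmp C X A D h r = g X r"
  using cover_effective[OF assms(1)] assms(2,3) unfolding effective_def by blast

text \<open>Both arrows glue the matching family of restrictions of \<open>h'\<close>.\<close>

lemma cover_unique:
  assumes R: "cover A R" and h: "h \<in> Hom C A D" "h' \<in> Hom C A D"
    and e: "\<And>X r. r \<in> R X \<Longrightarrow> Cmp C X A D h r = Cmp C X A D h' r"
  shows "h = h'"
proof -
  note s = sieveD[OF cover_sieve[OF R]]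
  have m: "matching R A D (\<lambda>X r. Cmp C X A D h' r)"
    unfolding matching_def using s(2) h(2) compC[OF s(2) h(2)] assocC[OF _ s(2) h(2)] by simp
  obtain w where "\<And>h. h \<in> Hom C A D \<and> (\<forall>X r. r \<in> R X \<longrightarrow> Cmp C X A D h r = Cmp C X A D h' r) \<Longrightarrow> h = w"
    using cover_effective[OF R, unfolded effective_def, THEN bspec, OF cod[OF h(1)], THEN spec, THEN mp, OF m]
    by (elim ex1E) blast
  from this[of h] this[of h'] show ?thesis using h e by simp
qed

text \<open>A matching family \<open>g\<close> on \<open>R\<close> is glued in two stages: over each
  \<open>t\<close> in \<open>T\<close> along the pullback of \<open>R\<close>, giving
  \<open>d X t\<close>, and then along \<open>T\<close>, giving \<open>h\<close>. Uniqueness of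
  gluing shows that the \<open>d X t\<close> match and that \<open>h\<close> restricts to
  \<open>g\<close> on all of \<open>R\<close>.\<close>

lemma effective_local:
  assumes R: "sieve A R" and T: "cover A T" and TR: "\<And>X t. t \<in> T X \<Longrightarrow> cover X (pull A X t R)"
  shows "effective A R"
  unfolding effective_def
proof (intro ballI allI impI)
  fix D g assume D: "D \<in> Ob C" and g: "matching R A D g"
  note sR = sieveD[OF R] and sT = sieveD[OF cover_sieve[OF T]]
  have gm: "matching (pull A X t R) X D (\<lambda>W v. g W (Cmp C W X A t v))" if t: "t \<in> T X" for X t
    unfolding matching_def
  proof (intro conjI allI impI)
    fix W v assume "v \<in> pull A X t R W"
    then show "g W (Cmp C W X A t v) \<in> Hom C W D" using g unfolding matching_def pull_def by blast
  next
    fix Z W r v assume r: "r \<in> pull A X t R Z" and v: "v \<in> Hom C W Z"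
    then have "r \<in> Hom C Z X" "Cmp C Z X A t r \<in> R Z" unfolding pull_def by blast+
    then show "g W (Cmp C W X A t (Cmp C W Z X r v)) = Cmp C W Z D (g Z (Cmp C Z X A t r)) v"
      using g v assocC[OF v _ sT(2)[OF t]] unfolding matching_def by metis
  qed
  have "\<exists>d. d \<in> Hom C X D \<and> (\<forall>W v. v \<in> pull A X t R W \<longrightarrow> Cmp C W X D d v = g W (Cmp C W X A t v))"
    if t: "t \<in> T X" for X t
    using cover_glue[OF TR[OF t] D gm[OF t]] by metis
  note ex = someI_ex[OF this]
  define d where "d X t = (SOME d. d \<in> Hom C X D \<and>
      (\<forall>W v. v \<in> pull A X t R W \<longrightarrow> Cmp C W X D d v = g W (Cmp C W X A t v)))" for X t
  have d: "\<And>X t. t \<in> T X \<Longrightarrow> d X t \<in> Hom C X D"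
    "\<And>X t W v. t \<in> T X \<Longrightarrow> v \<in> Hom C W X \<Longrightarrow> Cmp C W X A t v \<in> R W \<Longrightarrow> Cmp C W X D (d X t) v = g W (Cmp C W X A t v)"
    using ex[folded d_def] unfolding pull_def by simp_all
  have "matching T A D d" unfolding matching_def
  proof (intro conjI allI impI d(1))
    fix X W t w assume t: "t \<in> T X" and w: "w \<in> Hom C W X"
    note tw = sT(3)[OF t w]
    show "d W (Cmp C W X A t w) = Cmp C W X D (d X t) w"
    proof (rule cover_unique[OF TR[OF tw] d(1)[OF tw] compC[OF w d(1)[OF t]]])
      fix Z v assume "v \<in> pull A W (Cmp C W X A t w) R Z"
      then have v: "v \<in> Hom C Z W" "Cmp C Z W A (Cmp C W X A t w) v \<in> R Z" unfolding pull_def by blast+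
      have e: "Cmp C Z W A (Cmp C W X A t w) v = Cmp C Z X A t (Cmp C Z W X w v)"
        by (rule assocC[OF v(1) w sT(2)[OF t]])
      have "Cmp C Z W D (Cmp C W X D (d X t) w) v = Cmp C Z X D (d X t) (Cmp C Z W X w v)"
        by (rule assocC[OF v(1) w d(1)[OF t]])
      also have "\<dots> = g Z (Cmp C Z X A t (Cmp C Z W X w v))"
        using d(2)[OF t compC[OF v(1) w]] v(2) unfolding e by simp
      also have "\<dots> = Cmp C Z W D (d W (Cmp C W X A t w)) v"
        using d(2)[OF tw v] unfolding e by simp
      finally show "Cmp C Z W D (d W (Cmp C W X A t w)) v = Cmp C Z W D (Cmp C W X D (d X t) w) v" by simp
    qed
  qed
  then obtain h where h: "h \<in> Hom C A D" "\<And>X t. t \<in> T X \<Longrightarrow> Cmp C X A D h t = d X t"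
    using cover_glue[OF T D] by metis
  have hR: "Cmp C X A D h r = g X r" if r: "r \<in> R X" for X r
  proof -
    have gr: "g X r \<in> Hom C X D" using g r unfolding matching_def by blast
    \<comment> \<open>Since \<open>r\<close> may lie outside \<open>T\<close>, the equation is
      checked on the pullback of \<open>T\<close> along \<open>r\<close>.\<close>
    show ?thesis
    proof (rule cover_unique[OF cover_pull[OF T sR(2)[OF r]] compC[OF sR(2)[OF r] h(1)] gr])
      fix W s assume "s \<in> pull A X r T W"
      then have s: "s \<in> Hom C W X" "Cmp C W X A r s \<in> T W" unfolding pull_def by blast+
      have "Cmp C W X D (Cmp C X A D h r) s = Cmp C W A D h (Cmp C W X A r s)"
        by (rule assocC[OF s(1) sR(2)[OF r] h(1)])
      also have "\<dots> = d W (Cmp C W X A r s)" by (rule h(2)[OF s(2)])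
      also have "\<dots> = g W (Cmp C W X A r s)"
        using d(2)[OF s(2) idC[OF dom[OF s(1)]]] sR(3)[OF r s(1)] d(1)[OF s(2)] sT(2)[OF s(2)] by simp
      also have "\<dots> = Cmp C W X D (g X r) s" using g r s(1) unfolding matching_def by blast
      finally show "Cmp C W X D (Cmp C X A D h r) s = Cmp C W X D (g X r) s" .
    qed
  qed
  show "\<exists>!h. h \<in> Hom C A D \<and> (\<forall>X r. r \<in> R X \<longrightarrow> Cmp C X A D h r = g X r)"
  proof (rule ex1I[of _ h])
    fix h' assume h': "h' \<in> Hom C A D \<and> (\<forall>X r. r \<in> R X \<longrightarrow> Cmp C X A D h' r = g X r)"
    show "h' = h"
    proof (rule cover_unique[OF T _ h(1)])
      show "h' \<in> Hom C A D" using h' by blast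
      fix X t assume t: "t \<in> T X"
      note t' = sT(2)[OF t]
      show "Cmp C X A D h' t = Cmp C X A D h t"
      proof (rule cover_unique[OF TR[OF t] compC[OF t'] compC[OF t' h(1)]])
        fix W v assume "v \<in> pull A X t R W"
        then have v: "v \<in> Hom C W X" "Cmp C W X A t v \<in> R W" unfolding pull_def by blast+
        show "Cmp C W X D (Cmp C X A D h' t) v = Cmp C W X D (Cmp C X A D h t) v"
          using assocC[OF v(1) t' h(1)] assocC[OF v(1) t', of h' D] h' hR[OF v(2)] v(2) by simp
      qed (use h' in blast)
    qed
  qed (use h hR in blast)
qed

text \<open>The transitivity axiom of a topology, from which monotonicity and closure under
  intersections are deduced.\<close>

lemma cover_local:
  assumes R: "sieve A R" and T: "cover A T" and TR: "\<And>X t. t \<in> T X \<Longrightarrow> cover X (pull A X t R)"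
  shows "cover A R"
  unfolding cover_def
proof (intro conjI allI impI R)
  fix B u assume u: "u \<in> Hom C B A"
  show "effective B (pull A B u R)"
  proof (rule effective_local[OF sieve_pull[OF R u] cover_pull[OF T u]])
    fix X t assume "t \<in> pull A B u T X"
    then have t: "t \<in> Hom C X B" "Cmp C X B A u t \<in> T X" unfolding pull_def by blast+
    show "cover X (pull B X t (pull A B u R))" unfolding pull_pull[OF u t(1)] by (rule TR[OF t(2)])
  qed
qed

text \<open>Such a sieve is maximal, and a matching family on a maximal sieve is determined by its
  value at the identity.\<close>

lemma cover_of_id:
  assumes "sieve A R" "Ide C A \<in> R A" shows "cover A R"
proof -
  have R: "R X = Hom C X A" for X
    using sieveD(2)[OF assms(1)] sieveD(3)[OF assms(1,2)] by auto
  have A: "A \<in> Ob C" by (rule sieveD(1)[OF assms(1)])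
  have "effective B (pull A B u R)" if u: "u \<in> Hom C B A" for B u
    unfolding effective_def
  proof (intro ballI allI impI)
    fix D g assume g: "matching (pull A B u R) B D g"
    have p: "pull A B u R X = Hom C X B" for X unfolding pull_def R using u by auto
    note B = dom[OF u]
    show "\<exists>!h. h \<in> Hom C B D \<and> (\<forall>X r. r \<in> pull A B u R X \<longrightarrow> Cmp C X B D h r = g X r)"
    proof (rule ex1I[of _ "g B (Ide C B)"])
      show "g B (Ide C B) \<in> Hom C B D \<and> (\<forall>X r. r \<in> pull A B u R X \<longrightarrow> Cmp C X B D (g B (Ide C B)) r = g X r)"
      proof (intro conjI allI impI)
        show "g B (Ide C B) \<in> Hom C B D" using g B unfolding matching_def p by auto
        fix X r assume "r \<in> pull A B u R X"
        then have r: "r \<in> Hom C X B" unfolding p .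
        have "g X (Cmp C X B B (Ide C B) r) = Cmp C X B D (g B (Ide C B)) r"
          using g idC[OF B] r unfolding matching_def p by blast
        then show "Cmp C X B D (g B (Ide C B)) r = g X r" using r by simp
      qed
      fix h assume h: "h \<in> Hom C B D \<and> (\<forall>X r. r \<in> pull A B u R X \<longrightarrow> Cmp C X B D h r = g X r)"
      then have "Cmp C B B D h (Ide C B) = g B (Ide C B)" using idC[OF B] unfolding p by blast
      then show "h = g B (Ide C B)" using h by simp
    qed
  qed
  then show ?thesis unfolding cover_def using assms by blast
qed

lemma cover_max: "A \<in> Ob C \<Longrightarrow> cover A (\<lambda>X. Hom C X A)"
  by (rule cover_of_id[OF sieve_max]) auto

text \<open>For \<open>t\<close> in \<open>T\<close> the pullback of \<open>R\<close> along
  \<open>t\<close> contains the identity, so \<open>R\<close> covers locally on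
  \<open>T\<close>.\<close>

lemma cover_mono:
  assumes "cover A T" "sieve A R" "\<And>X t. t \<in> T X \<Longrightarrow> t \<in> R X"
  shows "cover A R"
proof (rule cover_local[OF assms(2,1)])
  fix X t assume t: "t \<in> T X"
  have t': "t \<in> Hom C X A" by (rule sieveD(2)[OF cover_sieve[OF assms(1)] t])
  show "cover X (pull A X t R)"
    by (rule cover_of_id[OF sieve_pull[OF assms(2) t']])
      (use assms(3)[OF t] t' dom[OF t'] in \<open>simp add: pull_def\<close>)
qed

lemma cover_Int:
  assumes "cover A R" "cover A R'"
  shows "cover A (\<lambda>X. R X \<inter> R' X)"
proof (rule cover_local[OF sieve_Int[OF assms[THEN cover_sieve]] assms(1)])
  note sR = sieveD[OF cover_sieve[OF assms(1)]]
  fix X t assume t: "t \<in> R X"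
  have s: "sieve X (pull A X t (\<lambda>X. R X \<inter> R' X))"
    by (rule sieve_pull[OF sieve_Int[OF assms[THEN cover_sieve]] sR(2)[OF t]])
  show "cover X (pull A X t (\<lambda>X. R X \<inter> R' X))"
    by (rule cover_mono[OF cover_pull[OF assms(2) sR(2)[OF t]] s]) (use sR(3)[OF t] in \<open>auto simp: pull_def\<close>)
qed

lemma cover_finite_INT:
  assumes "finite I" "A \<in> Ob C" "\<And>i. i \<in> I \<Longrightarrow> cover A (R i)"
  shows "cover A (\<lambda>X. {u \<in> Hom C X A. \<forall>i\<in>I. u \<in> R i X})"
  using assms(1,3)
proof (induction I)
  case empty
  then show ?case using cover_max[OF assms(2)] by simp
next
  case (insert i I)
  have "cover A (\<lambda>X. R i X \<inter> {u \<in> Hom C X A. \<forall>i\<in>I. u \<in> R i X})"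
    by (rule cover_Int) (use insert in auto)
  moreover have "R i X \<inter> {u \<in> Hom C X A. \<forall>i\<in>I. u \<in> R i X} = {u \<in> Hom C X A. \<forall>i\<in>insert i I. u \<in> R i X}" for X
    using sieveD(2)[OF cover_sieve[OF insert.prems(1)[of i]]] by auto
  ultimately show ?case by simp
qed

section \<open>Bicovering morphisms\<close>

text \<open>Under the Yoneda lemma this is the image of the pullback of \<open>f\<close> along the
  map from \<open>Y A\<close> to \<open>G\<close> given by \<open>y\<close>, which is how finality
  gives information about it.\<close>

definition im_sieve ::
  "('o, 'u) presheaf \<Rightarrow> ('o, 'u) presheaf \<Rightarrow> ('o \<Rightarrow> 'u \<Rightarrow> 'u) \<Rightarrow> 'o \<Rightarrow> 'u \<Rightarrow> 'o \<Rightarrow> 'u set" where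
  "im_sieve F G f A y W = {u \<in> Hom C W A. fa G A W u y \<in> f W ` fo F W}"

lemma sieve_im_sieve:
  assumes f: "nt F G f" and A: "A \<in> Ob C" and y: "y \<in> fo G A"
  shows "sieve A (im_sieve F G f A y)"
  unfolding sieve_def
proof (intro conjI allI impI A)
  fix X show "im_sieve F G f A y X \<subseteq> Hom C X A" unfolding im_sieve_def by blast
next
  fix X W r v assume r: "r \<in> im_sieve F G f A y X" and v: "v \<in> Hom C W X"
  then obtain x where x: "r \<in> Hom C X A" "fa G A X r y = f X x" "x \<in> fo F X" unfolding im_sieve_def by blast
  have "fa G A W (Cmp C W X A r v) y = f W (fa F X W v x)"
    unfolding psh_comp[OF ntD(2)[OF f] x(1) v y] x(2) ntD(5)[OF f v x(3)] ..
  then show "Cmp C W X A r v \<in> im_sieve F G f A y W"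
    unfolding im_sieve_def using x(1) v psh_in[OF ntD(1)[OF f] v x(3)] by auto
qed

definition bicovering :: "('o, 'u) presheaf \<Rightarrow> ('o, 'u) presheaf \<Rightarrow> ('o \<Rightarrow> 'u \<Rightarrow> 'u) \<Rightarrow> bool" where
  "bicovering F G f \<longleftrightarrow> nt F G f \<and> (\<forall>A\<in>Ob C. \<forall>y\<in>fo G A. cover A (im_sieve F G f A y)) \<and>
     (\<forall>A\<in>Ob C. \<forall>x\<in>fo F A. \<forall>x'\<in>fo F A. f A x = f A x' \<longrightarrow> cover A (eq_sieve F A x x'))"

lemma bicoveringD:
  assumes "bicovering F G f"
  shows "nt F G f" "A \<in> Ob C \<Longrightarrow> y \<in> fo G A \<Longrightarrow> cover A (im_sieve F G f A y)"
    "A \<in> Ob C \<Longrightarrow> x \<in> fo F A \<Longrightarrow> x' \<in> fo F A \<Longrightarrow> f A x = f A x' \<Longrightarrow> cover A (eq_sieve F A x x')"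
  using assms unfolding bicovering_def by simp_all

lemma bicovering_id: "psh F \<Longrightarrow> bicovering F F (ntid F)"
  unfolding bicovering_def
proof (intro conjI ballI impI nt_id)
  fix A y assume F: "psh F" and y: "A \<in> Ob C" "y \<in> fo F A"
  show "cover A (im_sieve F F (ntid F) A y)"
  proof (rule cover_of_id[OF sieve_im_sieve[OF nt_id[OF F] y]])
    have "ntid F A y = y" using y by simp
    then show "Ide C A \<in> im_sieve F F (ntid F) A y A" unfolding im_sieve_def using y psh_id[OF F y] idC by force
  qed
next
  fix A x x' assume F: "psh F" and x: "A \<in> Ob C" "x \<in> fo F A" "x' \<in> fo F A" "ntid F A x = ntid F A x'"
  then show "cover A (eq_sieve F A x x')" using cover_of_id[OF sieve_eq_sieve[OF F x(1-3)]] by (simp add: eq_sieve_def)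
qed

text \<open>Lifts along \<open>g\<close> exist on a cover, and each of them lifts along
  \<open>f\<close> on a further cover. Likewise an equality after both maps holds in
  \<open>G\<close> on a cover, and in \<open>F\<close> on a further one.\<close>

lemma bicovering_comp:
  assumes f: "bicovering F G f" and g: "bicovering G H g"
  shows "bicovering F H (ntcomp F G H g f)"
  unfolding bicovering_def
proof (intro conjI ballI impI)
  note fD = bicoveringD[OF f] and gD = bicoveringD[OF g]
  note nf = ntD[OF fD(1)] and ng = ntD[OF gD(1)]
  show n: "nt F H (ntcomp F G H g f)" by (rule nt_comp[OF fD(1) gD(1)])
  fix A z assume A: "A \<in> Ob C" and z: "z \<in> fo H A"
  show "cover A (im_sieve F H (ntcomp F G H g f) A z)"
  proof (rule cover_local[OF sieve_im_sieve[OF n A z] gD(2)[OF A z]])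
    fix X t assume "t \<in> im_sieve G H g A z X"
    then obtain y where t: "t \<in> Hom C X A" "fa H A X t z = g X y" "y \<in> fo G X" unfolding im_sieve_def by blast
    show "cover X (pull A X t (im_sieve F H (ntcomp F G H g f) A z))"
    proof (rule cover_mono[OF fD(2)[OF dom[OF t(1)] t(3)] sieve_pull[OF sieve_im_sieve[OF n A z] t(1)]])
      fix W u assume "u \<in> im_sieve F G f X y W"
      then obtain x where u: "u \<in> Hom C W X" "fa G X W u y = f W x" "x \<in> fo F W" unfolding im_sieve_def by blast
      have "fa H A W (Cmp C W X A t u) z = g W (f W x)"
        unfolding psh_comp[OF ng(2) t(1) u(1) z] t(2) ng(5)[OF u(1) t(3), symmetric] u(2) ..
      then show "u \<in> pull A X t (im_sieve F H (ntcomp F G H g f) A z) W"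
        unfolding pull_def im_sieve_def using u t dom[OF u(1)] by auto
    qed
  qed
next
  note fD = bicoveringD[OF f] and gD = bicoveringD[OF g]
  note nf = ntD[OF fD(1)] and ng = ntD[OF gD(1)]
  fix A x x' assume A: "A \<in> Ob C" and x: "x \<in> fo F A" "x' \<in> fo F A" "ntcomp F G H g f A x = ntcomp F G H g f A x'"
  have fx: "f A x \<in> fo G A" "f A x' \<in> fo G A" "g A (f A x) = g A (f A x')"
    using nf(4)[OF A] x A by simp_all
  show "cover A (eq_sieve F A x x')"
  proof (rule cover_local[OF sieve_eq_sieve[OF nf(1) A x(1,2)] gD(3)[OF A fx]])
    fix X t assume "t \<in> eq_sieve G A (f A x) (f A x') X"
    then have t: "t \<in> Hom C X A" "fa G A X t (f A x) = fa G A X t (f A x')" unfolding eq_sieve_def by blast+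
    have "f X (fa F A X t x) = f X (fa F A X t x')" using t nf(5)[OF t(1)] x by simp
    then show "cover X (pull A X t (eq_sieve F A x x'))"
      unfolding pull_eq_sieve[OF nf(1) t(1) x(1,2)]
      using fD(3)[OF dom[OF t(1)]] psh_in[OF nf(1) t(1)] x by simp
  qed
qed

section \<open>Bicovering morphisms are final\<close>

lemma final_iff: "final C F G f \<longleftrightarrow> small_presheaf C F \<and> small_presheaf C G \<and> nt F G f \<and>
   (\<forall>D\<in>Ob C. \<forall>g. nt F (Y D) g \<longrightarrow> (\<exists>!h. nt G (Y D) h \<and> ntcomp F G (Y D) h f = g))"
proof -
  have "(\<forall>g\<in>Hom (PSh C) F (Y D). \<exists>!h. h \<in> Hom (PSh C) G (Y D) \<and> Cmp (PSh C) F G (Y D) h f = g) \<longleftrightarrow>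
      (\<forall>g. nt F (Y D) g \<longrightarrow> (\<exists>!h. nt G (Y D) h \<and> ntcomp F G (Y D) h f = g))"
    if "D \<in> Ob C" "small_presheaf C F" "small_presheaf C G" for D
    unfolding Ball_def using that small_presheaf_Y by simp
  then show ?thesis unfolding final_def by (simp cong: conj_cong ball_cong)
qed

text \<open>Local injectivity makes \<open>g\<close> constant on the fibres of \<open>f\<close>, so
  \<open>g\<close> is defined on the image of \<open>f\<close>. Local surjectivity says that the
  restrictions of \<open>y\<close> meeting the image form a cover, along which the values of
  \<open>g\<close> glue to an arrow into \<open>D\<close>.\<close>

lemma bicovering_extend:
  assumes f: "bicovering F G f" and D: "D \<in> Ob C" and g: "nt F (Y D) g"
  shows "\<exists>!h. nt G (Y D) h \<and> ntcomp F G (Y D) h f = g"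
proof -
  note fD = bicoveringD[OF f] and nf = ntD[OF bicoveringD(1)[OF f]] and ng = ntD[OF g]
  have wd: "g A x = g A x'" if A: "A \<in> Ob C" and x: "x \<in> fo F A" "x' \<in> fo F A" "f A x = f A x'" for A x x'
  proof (rule cover_unique[OF fD(3)[OF A x]])
    show "g A x \<in> Hom C A D" "g A x' \<in> Hom C A D" using ng(4)[OF A] x by simp_all
    fix X r assume "r \<in> eq_sieve F A x x' X"
    then have r: "r \<in> Hom C X A" "fa F A X r x = fa F A X r x'" unfolding eq_sieve_def by blast+
    show "Cmp C X A D (g A x) r = Cmp C X A D (g A x') r"
      using ng(5)[OF r(1) x(1)] ng(5)[OF r(1) x(2)] r(2) ng(4)[OF A] x by simp
  qed
  \<comment> \<open>By \<open>wd\<close> the value of \<open>g\<close> at a preimage does not depend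
    on the preimage chosen here.\<close>
  define pre where "pre W y = (SOME x. x \<in> fo F W \<and> f W x = y)" for W y
  have pre: "pre W y \<in> fo F W \<and> f W (pre W y) = y" if "y \<in> f W ` fo F W" for W y
    unfolding pre_def by (rule someI_ex) (use that in blast)
  have pre_g: "g W (pre W (f W x)) = g W x" if "W \<in> Ob C" "x \<in> fo F W" for W x
    using wd[OF that(1) _ that(2)] pre[of "f W x" W] that(2) by blast
  have m: "matching (im_sieve F G f A y) A D (\<lambda>W u. g W (pre W (fa G A W u y)))" if A: "A \<in> Ob C" and y: "y \<in> fo G A" for A y
    unfolding matching_def
  proof (intro conjI allI impI)
    fix X r assume "r \<in> im_sieve F G f A y X"
    then have "r \<in> Hom C X A" "pre X (fa G A X r y) \<in> fo F X" using pre unfolding im_sieve_def by blast+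
    then show "g X (pre X (fa G A X r y)) \<in> Hom C X D" using ng(4)[OF dom] by simp
  next
    fix X W r v assume r: "r \<in> im_sieve F G f A y X" and v: "v \<in> Hom C W X"
    then obtain x where x: "r \<in> Hom C X A" "fa G A X r y = f X x" "x \<in> fo F X" unfolding im_sieve_def by blast
    have "fa G A W (Cmp C W X A r v) y = f W (fa F X W v x)"
      unfolding psh_comp[OF ntD(2)[OF fD(1)] x(1) v y] x(2) nf(5)[OF v x(3)] ..
    then show "g W (pre W (fa G A W (Cmp C W X A r v) y)) = Cmp C W X D (g X (pre X (fa G A X r y))) v"
      using x pre_g[OF dom[OF v] psh_in[OF nf(1) v x(3)]] pre_g[OF dom[OF x(1)] x(3)] ng(5)[OF v x(3)] ng(4)[OF dom[OF x(1)] x(3)] by simp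
  qed
  have "\<exists>h. h \<in> Hom C A D \<and> (\<forall>W u. u \<in> im_sieve F G f A y W \<longrightarrow> Cmp C W A D h u = g W (pre W (fa G A W u y)))"
    if A: "A \<in> Ob C" and y: "y \<in> fo G A" for A y
    using cover_glue[OF fD(2)[OF A y] D m[OF A y]] by metis
  note ex = someI_ex[OF this]
  define h where "h A y = (SOME h. h \<in> Hom C A D \<and>
      (\<forall>W u. u \<in> im_sieve F G f A y W \<longrightarrow> Cmp C W A D h u = g W (pre W (fa G A W u y))))" for A y
  have h: "\<And>A y. A \<in> Ob C \<Longrightarrow> y \<in> fo G A \<Longrightarrow> h A y \<in> Hom C A D"
    "\<And>A y W u. A \<in> Ob C \<Longrightarrow> y \<in> fo G A \<Longrightarrow> u \<in> im_sieve F G f A y W \<Longrightarrow> Cmp C W A D (h A y) u = g W (pre W (fa G A W u y))"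
    using ex[folded h_def] by simp_all
  have hx: "Cmp C W A D (h A y) u = g W x" if "A \<in> Ob C" "y \<in> fo G A" "u \<in> Hom C W A" "x \<in> fo F W" "fa G A W u y = f W x" for A y W u x
    using h(2)[OF that(1,2), of u W] that pre_g[OF dom[OF that(3)] that(4)] unfolding im_sieve_def by auto
  have nh: "nt G (Y D) (mknt G h)"
  proof (rule nt_mknt[OF nf(2) psh_Y[OF D]])
    fix A x assume "A \<in> Ob C" "x \<in> fo G A"
    then show "h A x \<in> fo (Y D) A" using h(1) by simp
  next
    fix A B u y assume u: "u \<in> Hom C B A" and y: "y \<in> fo G A"
    note A = cod[OF u] and B = dom[OF u] and uy = psh_in[OF nf(2) u y]
    have "h B (fa G A B u y) = Cmp C B A D (h A y) u"
    proof (rule cover_unique[OF fD(2)[OF B uy] h(1)[OF B uy] compC[OF u h(1)[OF A y]]])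
      fix X r assume "r \<in> im_sieve F G f B (fa G A B u y) X"
      then obtain x where x: "r \<in> Hom C X B" "fa G B X r (fa G A B u y) = f X x" "x \<in> fo F X" unfolding im_sieve_def by blast
      have "fa G A X (Cmp C X B A u r) y = f X x" unfolding psh_comp[OF nf(2) u x(1) y] x(2) ..
      then have "Cmp C X A D (h A y) (Cmp C X B A u r) = g X x" using hx[OF A y compC[OF x(1) u] x(3)] by simp
      then show "Cmp C X B D (h B (fa G A B u y)) r = Cmp C X B D (Cmp C B A D (h A y) u) r"
        using hx[OF B uy x(1,3,2)] assocC[OF x(1) u h(1)[OF A y]] by simp
    qed
    then show "h B (fa G A B u y) = fa (Y D) A B u (h A y)" using h(1)[OF A y] by simp
  qed
  show ?thesis
  proof (rule ex1I[of _ "mknt G h"])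
    have "ntcomp F G (Y D) (mknt G h) f = g"
    proof (rule nt_eqI[OF nt_comp[OF fD(1) nh] g])
      fix A x assume A: "A \<in> Ob C" "x \<in> fo F A"
      have fx: "f A x \<in> fo G A" using nf(4)[OF A] .
      have "Cmp C A A D (h A (f A x)) (Ide C A) = g A x"
        by (rule hx[OF A(1) fx idC[OF A(1)] A(2) psh_id[OF nf(2) A(1) fx]])
      then show "ntcomp F G (Y D) (mknt G h) f A x = g A x" using A fx h(1)[OF A(1) fx] by simp
    qed
    then show "nt G (Y D) (mknt G h) \<and> ntcomp F G (Y D) (mknt G h) f = g" using nh by blast
    fix k assume k: "nt G (Y D) k \<and> ntcomp F G (Y D) k f = g"
    then have nk: "nt G (Y D) k" by blast
    have kf: "k W (f W x) = g W x" if "W \<in> Ob C" "x \<in> fo F W" for W x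
    proof -
      have "ntcomp F G (Y D) k f W x = g W x" using k by simp
      then show ?thesis using that by simp
    qed
    show "k = mknt G h"
    proof (rule nt_eqI[OF nk nh])
      fix A y assume A: "A \<in> Ob C" "y \<in> fo G A"
      have kA: "k A y \<in> Hom C A D" using ntD(4)[OF nk A] by simp
      have "k A y = h A y"
      proof (rule cover_unique[OF fD(2)[OF A] kA h(1)[OF A]])
        fix X r assume "r \<in> im_sieve F G f A y X"
        then obtain x where x: "r \<in> Hom C X A" "fa G A X r y = f X x" "x \<in> fo F X" unfolding im_sieve_def by blast
        have "Cmp C X A D (k A y) r = k X (f X x)" using ntD(5)[OF nk x(1) A(2)] x(2) kA by simp
        then show "Cmp C X A D (k A y) r = Cmp C X A D (h A y) r"
          using kf[OF dom[OF x(1)] x(3)] hx[OF A x(1,3,2)] by simp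
      qed
      then show "k A y = mknt G h A y" using A by simp
    qed
  qed
qed

lemma bicovering_imp_final:
  "bicovering F G f \<Longrightarrow> small_presheaf C F \<Longrightarrow> small_presheaf C G \<Longrightarrow> final C F G f"
  unfolding final_iff using bicoveringD(1) bicovering_extend by blast

subsection \<open>Pullbacks\<close>

text \<open>The pullback in terms of elements; smallness of the presheaves is tracked
  separately.\<close>

definition pullback ::
  "('o, 'u) presheaf \<Rightarrow> ('o, 'u) presheaf \<Rightarrow> ('o \<Rightarrow> 'u \<Rightarrow> 'u) \<Rightarrow> ('o \<Rightarrow> 'u \<Rightarrow> 'u) \<Rightarrow>
   ('o, 'u) presheaf \<Rightarrow> ('o \<Rightarrow> 'u \<Rightarrow> 'u) \<Rightarrow> ('o \<Rightarrow> 'u \<Rightarrow> 'u) \<Rightarrow> bool" where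
  "pullback F H f g P p q \<longleftrightarrow> nt P F p \<and> nt P H q \<and>
     (\<forall>A z. A \<in> Ob C \<longrightarrow> z \<in> fo P A \<longrightarrow> f A (p A z) = g A (q A z)) \<and>
     (\<forall>A x y. A \<in> Ob C \<longrightarrow> x \<in> fo F A \<longrightarrow> y \<in> fo H A \<longrightarrow> f A x = g A y \<longrightarrow>
        (\<exists>z\<in>fo P A. p A z = x \<and> q A z = y)) \<and>
     (\<forall>A z z'. A \<in> Ob C \<longrightarrow> z \<in> fo P A \<longrightarrow> z' \<in> fo P A \<longrightarrow> p A z = p A z' \<longrightarrow> q A z = q A z' \<longrightarrow> z = z')"

lemma pullbackD:
  assumes "pullback F H f g P p q"
  shows "nt P F p" "nt P H q" "A \<in> Ob C \<Longrightarrow> z \<in> fo P A \<Longrightarrow> f A (p A z) = g A (q A z)"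
    "A \<in> Ob C \<Longrightarrow> x \<in> fo F A \<Longrightarrow> y \<in> fo H A \<Longrightarrow> f A x = g A y \<Longrightarrow> \<exists>z\<in>fo P A. p A z = x \<and> q A z = y"
    "A \<in> Ob C \<Longrightarrow> z \<in> fo P A \<Longrightarrow> z' \<in> fo P A \<Longrightarrow> p A z = p A z' \<Longrightarrow> q A z = q A z' \<Longrightarrow> z = z'"
  using assms unfolding pullback_def by simp_all

lemma cospan_Hom: "u \<in> Hom cospan i j \<longleftrightarrow> i \<in> {0, 1, 2} \<and> j \<in> {0, 1, 2} \<and> u = 0 \<and> (i = j \<or> i < 2 \<and> j = 2)"
  unfolding cospan_def graph_cat_def by auto

lemma cospan_fctr_fa:
  "fa (cospan_fctr E X W Z f g) i i u = Ide E (fo (cospan_fctr E X W Z f g) i)"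
  "fa (cospan_fctr E X W Z f g) 0 2 u = f" "fa (cospan_fctr E X W Z f g) 1 2 u = g"
  by (simp_all add: cospan_fctr_def graph_fctr_def)

lemma plim_cospan_iff:
  assumes f: "nt F G f" "nt H G g"
  shows "plim cospan (cospan_fctr (subPSh T) F H G f g) P \<pi> \<longleftrightarrow>
    pullback F H f g P (\<pi> 0) (\<pi> 1) \<and> nt P G (\<pi> 2) \<and> (\<forall>A\<in>Ob C. \<forall>z\<in>fo P A. \<pi> 2 A z = f A (\<pi> 0 A z))"
  (is "?l \<longleftrightarrow> ?r")
proof -
  let ?S = "cospan_fctr (subPSh T) F H G f g"
  have E: "(\<forall>j\<in>Ob cospan. Q j) \<longleftrightarrow> Q 0 \<and> Q 1 \<and> Q (2 :: nat)" for Q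
    by (auto simp: cospan_fctr_Ob)
  have Hm: "(\<forall>i j u. u \<in> Hom cospan i j \<longrightarrow> Q i j u) \<longleftrightarrow> (Q 0 0 0 \<and> Q 1 1 0 \<and> Q 2 2 0) \<and> Q 0 2 0 \<and> Q 1 2 (0 :: nat)" for Q
    unfolding cospan_Hom by auto
  have idn: "fa ?S i i u A w = w" if "A \<in> Ob C" "w \<in> fo (fo ?S i) A" for i u A w
    using that by (simp add: cospan_fctr_fa)
  have catc: "category cospan" using finite_category_cospan finite_category_def by blast
  show ?thesis
  proof
    assume l: ?l
    note L = plimD[OF l]
    have n: "nt P F (\<pi> 0)" "nt P H (\<pi> 1)" "nt P G (\<pi> 2)"
      using L(2)[of 0] L(2)[of 1] L(2)[of 2] by (simp_all add: cospan_fctr_Ob)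
    have c: "f A (\<pi> 0 A z) = \<pi> 2 A z" "g A (\<pi> 1 A z) = \<pi> 2 A z" if "A \<in> Ob C" "z \<in> fo P A" for A z
      using L(3)[of 0 0 2 A z] L(3)[of 0 1 2 A z] that by (simp_all add: cospan_Hom cospan_fctr_fa del: One_nat_def)
    have "\<exists>z\<in>fo P A. \<pi> 0 A z = x \<and> \<pi> 1 A z = y"
      if A: "A \<in> Ob C" and x: "x \<in> fo F A" "y \<in> fo H A" "f A x = g A y" for A x y
    proof -
      let ?z = "\<lambda>i :: nat. if i = 0 then x else if i = 1 then y else f A x"
      have z: "?z j \<in> fo (fo ?S j) A" if "j \<in> Ob cospan" for j
        using that x ntD(4)[OF f(1) A x(1)] by (auto simp: cospan_fctr_Ob)
      have "\<exists>z\<in>fo P A. \<forall>j\<in>Ob cospan. \<pi> j A z = ?z j"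
      proof (rule L(4)[OF A z])
        fix i j u assume u: "u \<in> Hom cospan i j"
        show "fa ?S i j u A (?z i) = ?z j"
        proof (cases "i = j")
          case True
          have "j \<in> Ob cospan" using u category.Hom_Ob[OF catc] by blast
          then show ?thesis unfolding True by (rule idn[OF A z])
        next
          case False
          then have "(i = 0 \<or> i = 1) \<and> j = 2" using u unfolding cospan_Hom by auto
          then show ?thesis using x(3) by (auto simp: cospan_fctr_fa[unfolded One_nat_def])
        qed
      qed
      then show ?thesis by (auto simp: E)
    qed
    moreover have "z = z'" if "A \<in> Ob C" "z \<in> fo P A" "z' \<in> fo P A" "\<pi> 0 A z = \<pi> 0 A z'" "\<pi> 1 A z = \<pi> 1 A z'" for A z z'
    proof (rule L(5)[OF that(1-3)])
      fix j assume "j \<in> Ob cospan"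
      then have "j = 0 \<or> j = 1 \<or> j = 2" by (auto simp: cospan_fctr_Ob)
      then show "\<pi> j A z = \<pi> j A z'" using that c(1)[OF that(1,2)] c(1)[OF that(1,3)] by metis
    qed
    ultimately show ?r unfolding pullback_def using n c by simp
  next
    assume r: ?r
    then have P: "pullback F H f g P (\<pi> 0) (\<pi> 1)" and p2: "nt P G (\<pi> 2)"
      and e: "\<And>A z. A \<in> Ob C \<Longrightarrow> z \<in> fo P A \<Longrightarrow> \<pi> 2 A z = f A (\<pi> 0 A z)" by blast+
    note D = pullbackD[OF P]
    have n: "nt P (fo ?S j) (\<pi> j)" if "j \<in> Ob cospan" for j
      using that D(1,2) p2 by (auto simp: cospan_fctr_Ob)
    show ?l unfolding plim_def
    proof (intro conjI allI impI ballI)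
      show "psh P" using ntD(1)[OF p2] .
      fix i j u A x assume u: "u \<in> Hom cospan i j" and A: "A \<in> Ob C" "x \<in> fo P A"
      show "fa ?S i j u A (\<pi> i A x) = \<pi> j A x"
      proof (cases "i = j")
        case True
        then have "\<pi> j A x \<in> fo (fo ?S j) A" using ntD(4)[OF n A] u by (simp add: cospan_Hom cospan_fctr_Ob)
        then show ?thesis using True A by (simp add: cospan_fctr_fa)
      next
        case False
        then have "(i = 0 \<or> i = 1) \<and> j = 2" using u unfolding cospan_Hom by auto
        then show ?thesis using e[OF A] D(3)[OF A] by (auto simp: cospan_fctr_fa[unfolded One_nat_def])
      qed
    next
      fix A x assume A: "A \<in> Ob C" and x: "\<forall>j\<in>Ob cospan. x j \<in> fo (fo ?S j) A"
        and c: "\<forall>i j u. u \<in> Hom cospan i j \<longrightarrow> fa ?S i j u A (x i) = x j"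
      have x': "x 0 \<in> fo F A" "x 1 \<in> fo H A" using x by (auto simp: cospan_fctr_Ob)
      have c': "f A (x 0) = x 2" "g A (x 1) = x 2" using c unfolding Hm by (simp_all add: cospan_fctr_fa del: One_nat_def)
      obtain z where "z \<in> fo P A" "\<pi> 0 A z = x 0" "\<pi> 1 A z = x 1" using D(4)[OF A x'] c' by auto
      then show "\<exists>z\<in>fo P A. \<forall>j\<in>Ob cospan. \<pi> j A z = x j"
        using e[OF A] c' unfolding E by (intro bexI[of _ z]) auto
    next
      fix A z z' assume "A \<in> Ob C" "z \<in> fo P A" "z' \<in> fo P A" "\<forall>j\<in>Ob cospan. \<pi> j A z = \<pi> j A z'"
      then show "z = z'" using D(5) unfolding E by blast
    qed (rule n)
  qed
qed

lemma is_pullback_imp_pullback: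
  assumes T: "\<And>A. A \<in> Ob C \<Longrightarrow> Y A \<in> T" and P: "is_pullback (subPSh T) F H G f g P p q"
  shows "pullback F H f g P p q"
proof -
  have f: "f \<in> Hom (subPSh T) F G" "g \<in> Hom (subPSh T) H G" using P unfolding is_pullback_def by blast+
  then have n: "nt F G f" "nt H G g" unfolding Hom_subPSh by blast+
  let ?\<pi> = "\<lambda>i :: nat. if i = 0 then p else if i = 1 then q else ntcomp P F G f p"
  have "is_limit cospan (subPSh T) (cospan_fctr (subPSh T) F H G f g) P ?\<pi>"
    unfolding is_limit_cospan[OF category_subPSh f] using P by simp
  from limit_imp_plim[OF is_functor_cospan[OF category_subPSh f] this T]
  show ?thesis unfolding plim_cospan_iff[OF n] by simp
qed

lemma pullback_imp_is_pullback:
  assumes P: "pullback F H f g P p q" "small_presheaf C P" "P \<in> T"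
    and f: "f \<in> Hom (subPSh T) F G" "g \<in> Hom (subPSh T) H G"
  shows "is_pullback (subPSh T) F H G f g P p q"
proof -
  have n: "nt F G f" "nt H G g" using f unfolding Hom_subPSh by blast+
  let ?\<pi> = "\<lambda>i :: nat. if i = 0 then p else if i = 1 then q else ntcomp P F G f p"
  have "plim cospan (cospan_fctr (subPSh T) F H G f g) P ?\<pi>"
    unfolding plim_cospan_iff[OF n] using P nt_comp[OF pullbackD(1)[OF P(1)] n(1)] by simp
  from plim_imp_limit[OF is_functor_cospan[OF category_subPSh f] this P(2,3)]
  show ?thesis unfolding is_limit_cospan[OF category_subPSh f] by simp
qed

lemma is_pullback_iff:
  assumes "small_presheaf C F" "small_presheaf C H" "small_presheaf C G" "small_presheaf C P" "nt F G f" "nt H G g"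
  shows "is_pullback (PSh C) F H G f g P p q \<longleftrightarrow> pullback F H f g P p q"
  using is_pullback_imp_pullback[of UNIV F H G f g P p q] pullback_imp_is_pullback[of F H f g P p q UNIV G] assms
  by (auto simp: Hom_subPSh)

lemma pullback_exists:
  assumes "small_presheaf C F" "small_presheaf C H" "small_presheaf C G" and f: "nt F G f" "nt H G g"
  obtains P p q where "small_presheaf C P" "pullback F H f g P p q"
proof -
  let ?S = "cospan_fctr (subPSh UNIV) F H G f g"
  have S: "is_functor cospan (PSh C) ?S"
    using is_functor_cospan[OF category_PSh, of f F G g H] assms by simp
  obtain P \<pi> where P: "plim cospan ?S P \<pi>" using plim_exists[OF finite_category_cospan S] by blast
  have "small_presheaf C P" using plim_small_generated[OF finite_category_cospan S P] small_presheaf_iff by blast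
  then show thesis using that P unfolding plim_cospan_iff[OF f] by blast
qed

text \<open>Lifts along \<open>f\<close> of restrictions of \<open>g A y\<close> give lifts of the
  same restrictions of \<open>y\<close> along \<open>q\<close>. Two elements of \<open>P\<close>
  with equal images under \<open>q\<close> agree wherever their images under \<open>p\<close>
  do.\<close>

lemma bicovering_pullback:
  assumes f: "bicovering F G f" and g: "nt H G g" and P: "pullback F H f g P p q"
  shows "bicovering P H q"
  unfolding bicovering_def
proof (intro conjI ballI impI)
  note D = pullbackD[OF P] and fD = bicoveringD[OF f]
  show "nt P H q" by (rule D(2))
  note nf = ntD[OF fD(1)] and ng = ntD[OF g] and nq = ntD[OF D(2)] and np = ntD[OF D(1)]
  fix A y assume A: "A \<in> Ob C" and y: "y \<in> fo H A"
  show "cover A (im_sieve P H q A y)"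
  proof (rule cover_mono[OF fD(2)[OF A ng(4)[OF A y]] sieve_im_sieve[OF D(2) A y]])
    fix X u assume "u \<in> im_sieve F G f A (g A y) X"
    then obtain x where u: "u \<in> Hom C X A" "fa G A X u (g A y) = f X x" "x \<in> fo F X" unfolding im_sieve_def by blast
    have "f X x = g X (fa H A X u y)" using u(2) ng(5)[OF u(1) y] by simp
    then obtain z where "z \<in> fo P X" "q X z = fa H A X u y"
      using D(4)[OF dom[OF u(1)] u(3) psh_in[OF ng(1) u(1) y]] by blast
    then show "u \<in> im_sieve P H q A y X" unfolding im_sieve_def using u(1) by force
  qed
next
  note D = pullbackD[OF P] and fD = bicoveringD[OF f]
  note nq = ntD[OF D(2)] and np = ntD[OF D(1)]
  fix A z z' assume A: "A \<in> Ob C" and z: "z \<in> fo P A" "z' \<in> fo P A" "q A z = q A z'"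
  have e: "f A (p A z) = f A (p A z')" using D(3)[OF A] z by simp
  show "cover A (eq_sieve P A z z')"
  proof (rule cover_mono[OF fD(3)[OF A np(4)[OF A z(1)] np(4)[OF A z(2)] e] sieve_eq_sieve[OF np(1) A z(1,2)]])
    fix X u assume "u \<in> eq_sieve F A (p A z) (p A z') X"
    then have u: "u \<in> Hom C X A" "fa F A X u (p A z) = fa F A X u (p A z')" unfolding eq_sieve_def by blast+
    have "fa P A X u z = fa P A X u z'"
    proof (rule D(5)[OF dom[OF u(1)] psh_in[OF np(1) u(1) z(1)] psh_in[OF np(1) u(1) z(2)]])
      show "p X (fa P A X u z) = p X (fa P A X u z')" using np(5)[OF u(1)] z u(2) by simp
      show "q X (fa P A X u z) = q X (fa P A X u z')" using nq(5)[OF u(1)] z by simp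
    qed
    then show "u \<in> eq_sieve P A z z' X" unfolding eq_sieve_def using u by blast
  qed
qed

lemma bicovering_stably_final:
  assumes "bicovering F G f" "small_presheaf C F" "small_presheaf C G"
  shows "stably_final C F G f"
  unfolding stably_final_def
proof (intro conjI allI impI)
  have n: "nt F G f" by (rule bicoveringD(1)[OF assms(1)])
  show "f \<in> Hom (PSh C) F G" using assms n by simp
  fix Z g P p q assume P: "is_pullback (PSh C) F Z G f g P p q"
  then have g: "nt Z G g" "small_presheaf C Z" "small_presheaf C P" unfolding is_pullback_def by auto
  have "pullback F Z f g P p q" using P is_pullback_iff[OF assms(2) g(2) assms(3) g(3) n g(1)] by blast
  then show "final C P Z q" using bicovering_imp_final[OF bicovering_pullback[OF assms(1) g(1)]] g by blast
qed

text \<open>A matching family on the image \<open>R\<close> of \<open>q\<close>, composed with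
  \<open>q\<close>, is a map from \<open>P\<close> to a representable. Its extension along
  \<open>q\<close> to \<open>Y A\<close> is, by the Yoneda lemma, the glued arrow.\<close>

lemma effective_of_final:
  assumes q: "final C P (Y A) q" and A: "A \<in> Ob C" and R: "\<And>W. W \<in> Ob C \<Longrightarrow> R W = q W ` fo P W" "sieve A R"
  shows "effective A R"
  unfolding effective_def
proof (intro ballI allI impI)
  have n: "nt P (Y A) q" and ex: "\<And>D k. D \<in> Ob C \<Longrightarrow> nt P (Y D) k \<Longrightarrow> \<exists>!h. nt (Y A) (Y D) h \<and> ntcomp P (Y A) (Y D) h q = k"
    using q unfolding final_iff by blast+
  note nq = ntD[OF n]
  fix D g assume D: "D \<in> Ob C" and g: "matching R A D g"
  have qR: "q W z \<in> R W" if "W \<in> Ob C" "z \<in> fo P W" for W z using R(1) that by blast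
  have qA: "q W z \<in> Hom C W A" if "W \<in> Ob C" "z \<in> fo P W" for W z using nq(4) that by simp
  let ?k = "mknt P (\<lambda>W z. g W (q W z))"
  have k: "nt P (Y D) ?k"
  proof (rule nt_mknt[OF nq(1) psh_Y[OF D]])
    fix W z assume "W \<in> Ob C" "z \<in> fo P W"
    then show "g W (q W z) \<in> fo (Y D) W" using g qR unfolding matching_def by simp
  next
    fix W X u z assume u: "u \<in> Hom C X W" and z: "z \<in> fo P W"
    note W = cod[OF u]
    have "q X (fa P W X u z) = Cmp C X W A (q W z) u" using nq(5)[OF u z] qA[OF W z] by simp
    then show "g X (q X (fa P W X u z)) = fa (Y D) W X u (g W (q W z))"
      using g qR[OF W z] u unfolding matching_def by simp
  qed
  have iff: "nt (Y A) (Y D) (fa (yoneda C) A D h) \<and> ntcomp P (Y A) (Y D) (fa (yoneda C) A D h) q = ?k \<longleftrightarrow>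
     (\<forall>X r. r \<in> R X \<longrightarrow> Cmp C X A D h r = g X r)" if h: "h \<in> Hom C A D" for h
  proof
    assume l: "nt (Y A) (Y D) (fa (yoneda C) A D h) \<and> ntcomp P (Y A) (Y D) (fa (yoneda C) A D h) q = ?k"
    show "\<forall>X r. r \<in> R X \<longrightarrow> Cmp C X A D h r = g X r"
    proof (intro allI impI)
      fix X r assume r: "r \<in> R X"
      have X: "X \<in> Ob C" using dom[OF sieveD(2)[OF R(2) r]] .
      then obtain z where z: "z \<in> fo P X" "r = q X z" using r R(1) by blast
      have "fa (yoneda C) A D h X (q X z) = g X (q X z)"
        using fun_cong[OF fun_cong[OF conjunct2[OF l], of X], of z] X z by simp
      then show "Cmp C X A D h r = g X r" unfolding z(2) using yoneda_apply[OF h qA[OF X z(1)]] by simp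
    qed
  next
    assume r: "\<forall>X r. r \<in> R X \<longrightarrow> Cmp C X A D h r = g X r"
    have "ntcomp P (Y A) (Y D) (fa (yoneda C) A D h) q = ?k"
      by (rule nt_eqI[OF nt_comp[OF n nt_yoneda[OF h]] k]) (use r qR in \<open>simp add: yoneda_apply[OF h qA]\<close>)
    then show "nt (Y A) (Y D) (fa (yoneda C) A D h) \<and> ntcomp P (Y A) (Y D) (fa (yoneda C) A D h) q = ?k"
      using nt_yoneda[OF h] by blast
  qed
  from ex[OF D k] obtain h0 where h0: "nt (Y A) (Y D) h0 \<and> ntcomp P (Y A) (Y D) h0 q = ?k"
    "\<And>h. nt (Y A) (Y D) h \<and> ntcomp P (Y A) (Y D) h q = ?k \<Longrightarrow> h = h0"
    by (elim ex1E) blast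
  let ?h = "h0 A (Ide C A)"
  have h: "?h \<in> Hom C A D" "fa (yoneda C) A D ?h = h0" using nt_Y_Y[OF A conjunct1[OF h0(1)]] by simp_all
  show "\<exists>!h. h \<in> Hom C A D \<and> (\<forall>X r. r \<in> R X \<longrightarrow> Cmp C X A D h r = g X r)"
  proof (rule ex1I[of _ ?h])
    show "?h \<in> Hom C A D \<and> (\<forall>X r. r \<in> R X \<longrightarrow> Cmp C X A D ?h r = g X r)"
      using iff[OF h(1)] h h0(1) by simp
    fix h' assume h': "h' \<in> Hom C A D \<and> (\<forall>X r. r \<in> R X \<longrightarrow> Cmp C X A D h' r = g X r)"
    then have "fa (yoneda C) A D h' = h0" using iff h0(2) by blast
    then show "h' = ?h" using yoneda_inj[OF conjunct1[OF h'] h(1)] h(2) by simp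
  qed
qed

lemma pull_im_sieve:
  assumes f: "nt F G f" and u: "u \<in> Hom C B A" and y: "y \<in> fo G A"
  shows "pull A B u (im_sieve F G f A y) = im_sieve F G f B (fa G A B u y)"
  unfolding pull_def im_sieve_def using psh_comp[OF ntD(2)[OF f] u _ y] u by (auto simp: fun_eq_iff)

text \<open>The image of the pullback of \<open>f\<close> along \<open>yo G B y\<close> is the image
  sieve at \<open>y\<close>, and pulling this sieve back amounts to restricting \<open>y\<close>. As
  all pullbacks here are along maps out of representables, the criterion can be used inside a class
  of presheaves that contains these and is closed under pullbacks.\<close>

lemma cover_im_sieveI:
  assumes f: "nt F G f" "small_presheaf C F" "small_presheaf C G"
    and fin: "\<And>B y P p q. B \<in> Ob C \<Longrightarrow> y \<in> fo G B \<Longrightarrow> pullback F (Y B) f (yo G B y) P p q \<Longrightarrow>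
      small_presheaf C P \<Longrightarrow> final C P (Y B) q"
    and A: "A \<in> Ob C" and y: "y \<in> fo G A"
  shows "cover A (im_sieve F G f A y)"
proof -
  have eff: "effective B (im_sieve F G f B y)" if B: "B \<in> Ob C" and y: "y \<in> fo G B" for B y
  proof -
    note G = ntD(2)[OF f(1)]
    have n: "nt (Y B) G (yo G B y)" by (rule nt_yo[OF G B y])
    obtain P p q where P: "small_presheaf C P" "pullback F (Y B) f (yo G B y) P p q"
      by (rule pullback_exists[OF f(2) small_presheaf_Y[OF B] f(3) f(1) n])
    note D = pullbackD[OF P(2)]
    show ?thesis
    proof (rule effective_of_final[OF fin[OF B y P(2,1)] B _ sieve_im_sieve[OF f(1) B y]])
      fix W assume W: "W \<in> Ob C"
      show "im_sieve F G f B y W = q W ` fo P W"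
      proof (intro equalityI subsetI)
        fix u assume "u \<in> im_sieve F G f B y W"
        then obtain x where u: "u \<in> Hom C W B" "fa G B W u y = f W x" "x \<in> fo F W" unfolding im_sieve_def by blast
        have "\<exists>z\<in>fo P W. p W z = x \<and> q W z = u" by (rule D(4)[OF W u(3)]) (use u in simp_all)
        then show "u \<in> q W ` fo P W" by blast
      next
        fix u assume "u \<in> q W ` fo P W"
        then obtain z where z: "z \<in> fo P W" "u = q W z" by blast
        have u: "u \<in> Hom C W B" using ntD(4)[OF D(2) W z(1)] z(2) by simp
        have "fa G B W u y = f W (p W z)" using D(3)[OF W z(1)] z(2) u by simp
        then show "u \<in> im_sieve F G f B y W" unfolding im_sieve_def using u ntD(4)[OF D(1) W z(1)] by blast
      qed
    qed
  qed
  show ?thesis unfolding cover_def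
  proof (intro conjI allI impI sieve_im_sieve[OF f(1) A y])
    fix B u assume u: "u \<in> Hom C B A"
    show "effective B (pull A B u (im_sieve F G f A y))"
      unfolding pull_im_sieve[OF f(1) u y] by (rule eff[OF dom[OF u] psh_in[OF ntD(2)[OF f(1)] u y]])
  qed
qed

lemma stably_final_cover:
  assumes f: "stably_final C F G f" and A: "A \<in> Ob C" "y \<in> fo G A"
  shows "cover A (im_sieve F G f A y)"
proof -
  have n: "nt F G f" "small_presheaf C F" "small_presheaf C G" using f unfolding stably_final_def by auto
  show ?thesis
  proof (rule cover_im_sieveI[OF n _ A])
    fix B y P p q assume B: "B \<in> Ob C" "y \<in> fo G B" and P: "pullback F (Y B) f (yo G B y) P p q" "small_presheaf C P"
    have "is_pullback (PSh C) F (Y B) G f (yo G B y) P p q"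
      unfolding is_pullback_iff[OF n(2) small_presheaf_Y[OF B(1)] n(3) P(2) n(1) nt_yo[OF ntD(2)[OF n(1)] B]] by (rule P(1))
    then show "final C P (Y B) q" using f unfolding stably_final_def by blast
  qed
qed

subsection \<open>Postulated morphisms\<close>

text \<open>Representables are small presheaves, so monomorphisms of \<open>PSh C\<close> can be
  tested on the maps out of \<open>Y A\<close> that name \<open>x\<close> and
  \<open>x'\<close>.\<close>

lemma mono_arrow_inj:
  assumes m: "mono_arrow (PSh C) F G m" and A: "A \<in> Ob C" and x: "x \<in> fo F A" "x' \<in> fo F A" "m A x = m A x'"
  shows "x = x'"
proof -
  have n: "nt F G m" "small_presheaf C F" using m unfolding mono_arrow_def by auto
  note nm = ntD[OF n(1)]
  have y: "yo F A x \<in> Hom (PSh C) (Y A) F" "yo F A x' \<in> Hom (PSh C) (Y A) F"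
    using n(2) small_presheaf_Y[OF A] nt_yo[OF nm(1) A] x by simp_all
  have "ntcomp (Y A) F G m (yo F A x) = ntcomp (Y A) F G m (yo F A x')"
  proof (rule nt_eqI[OF nt_comp nt_comp])
    fix X u assume X: "X \<in> Ob C" and u: "u \<in> fo (Y A) X"
    then have "u \<in> Hom C X A" by simp
    then show "ntcomp (Y A) F G m (yo F A x) X u = ntcomp (Y A) F G m (yo F A x') X u"
      unfolding ntcomp_apply[where F="Y A", OF X u] using nm(5) x by simp
  qed (use y n in auto)
  then have "yo F A x = yo F A x'"
    using m y small_presheaf_Y[OF A] unfolding mono_arrow_def by (metis PSh_simps(1,4))
  then have "yo F A x A (Ide C A) = yo F A x' A (Ide C A)" by simp
  then show ?thesis using A psh_id[OF nm(1) A] x by simp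
qed

section \<open>Images of small presheaves are pointwise\<close>

definition image_of ::
  "('o, 'u) presheaf \<Rightarrow> ('o, 'u) presheaf \<Rightarrow> ('o \<Rightarrow> 'u \<Rightarrow> 'u) \<Rightarrow> ('o, 'u) presheaf" where
  "image_of F G f = subp G (\<lambda>A. f A ` fo F A)"

lemma subfamily_image: "nt F G f \<Longrightarrow> subfamily G (\<lambda>A. f A ` fo F A)"
  unfolding subfamily_def
proof (intro conjI ballI allI impI)
  assume f: "nt F G f"
  note n = ntD[OF f]
  show "psh G" by (rule n(2))
  show "f A ` fo F A \<subseteq> fo G A" if "A \<in> Ob C" for A using n(4)[OF that] by blast
  fix A B u x assume u: "u \<in> Hom C B A" and "x \<in> f A ` fo F A"
  then obtain z where "z \<in> fo F A" "x = f A z" by blast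
  then show "fa G A B u x \<in> f B ` fo F B" using n(5)[OF u, of z] psh_in[OF n(1) u, of z] by (metis imageI)
qed

lemma generated_image_nt:
  assumes f: "nt F G f" and F: "generated F (fo F)"
  shows "generated G (\<lambda>A. f A ` fo F A)"
proof -
  obtain S where S: "small TYPE('u) S" "\<And>Z s. (Z, s) \<in> S \<Longrightarrow> Z \<in> Ob C \<and> s \<in> fo F Z"
    "\<And>X x. X \<in> Ob C \<Longrightarrow> x \<in> fo F X \<Longrightarrow> \<exists>Z s. (Z, s) \<in> S \<and> (\<exists>v\<in>Hom C X Z. x = fa F Z X v s)"
    using F unfolding generated_def by metis
  show ?thesis
  proof (rule generatedI)
    show "small TYPE('u) ((\<lambda>(Z, s). (Z, f Z s)) ` S)" by (rule small_image[OF S(1)])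
    fix Z s assume "(Z, s) \<in> (\<lambda>(Z, s). (Z, f Z s)) ` S"
    then show "Z \<in> Ob C \<and> s \<in> f Z ` fo F Z" using S(2) by auto
  next
    fix X y assume X: "X \<in> Ob C" and "y \<in> f X ` fo F X"
    then obtain x where x: "x \<in> fo F X" "y = f X x" by blast
    obtain Z s v where s: "(Z, s) \<in> S" "v \<in> Hom C X Z" "x = fa F Z X v s" using S(3)[OF X x(1)] by blast
    have "y = fa G Z X v (f Z s)"
      unfolding x(2) s(3) by (rule ntD(5)[OF f s(2) conjunct2[OF S(2)[OF s(1)]]])
    then show "\<exists>Z s. (Z, s) \<in> (\<lambda>(Z, s). (Z, f Z s)) ` S \<and> (\<exists>v\<in>Hom C X Z. y = fa G Z X v s)"
      using s(1,2) by force
  qed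
qed

text \<open>Relations between elements of a subpresheaf are those in \<open>F\<close>, so the
  generators are the only issue.\<close>

lemma small_subp:
  assumes I: "subfamily F I" and F: "small_presheaf C F" and gen: "generated F I"
  shows "small_presheaf C (subp F I)"
  unfolding small_presheaf_iff small_generated_def
proof (intro conjI ballI psh_subp[OF I])
  obtain S where S: "small TYPE('u) S" "\<And>Z s. (Z, s) \<in> S \<Longrightarrow> Z \<in> Ob C \<and> s \<in> I Z"
    "\<And>X x. X \<in> Ob C \<Longrightarrow> x \<in> I X \<Longrightarrow> \<exists>Z s. (Z, s) \<in> S \<and> (\<exists>v\<in>Hom C X Z. x = fa F Z X v s)"
    using gen unfolding generated_def by metis
  show "generated (subp F I) (fo (subp F I))"
  proof (rule generatedI[OF S(1)])
    fix X x assume "X \<in> Ob C" "x \<in> fo (subp F I) X"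
    then obtain Z s v where "(Z, s) \<in> S" "v \<in> Hom C X Z" "x = fa F Z X v s" using S(3) by fastforce
    then show "\<exists>Z s. (Z, s) \<in> S \<and> (\<exists>v\<in>Hom C X Z. x = fa (subp F I) Z X v s)" using S(2) by force
  qed (use S(2) in simp)
  fix A x x' assume A: "A \<in> Ob C" and x: "x \<in> fo (subp F I) A" "x' \<in> fo (subp F I) A"
  have "eq_sieve (subp F I) A x x' = eq_sieve F A x x'" unfolding eq_sieve_def using x by (auto simp: fun_eq_iff)
  moreover have "x \<in> fo F A" "x' \<in> fo F A" using x A I unfolding subfamily_def by auto
  ultimately show "generated (Y A) (eq_sieve (subp F I) A x x')"
    using F A unfolding small_presheaf_iff small_generated_def by simp
qed

lemma small_image_of:
  assumes f: "nt F G f" "small_presheaf C F" "small_presheaf C G"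
  shows "small_presheaf C (image_of F G f)"
proof -
  have "generated F (fo F)" using f(2) unfolding small_presheaf_iff small_generated_def by blast
  then show ?thesis
    unfolding image_of_def by (intro small_subp subfamily_image generated_image_nt f)
qed

text \<open>A competing monomorphism is injective on elements, so each element of the pointwise
  image has a unique preimage under it, and these preimages form the comparison map.\<close>

lemma is_image_image_of:
  assumes f: "nt F G f" "small_presheaf C F" "small_presheaf C G"
  shows "is_image (PSh C) F G f (image_of F G f) (mknt (image_of F G f) (\<lambda>A x. x))"
    (is "is_image _ F G f ?I ?m")
proof -
  note n = ntD[OF f(1)]
  have fo: "fo ?I A = f A ` fo F A" for A unfolding image_of_def by simp
  have fa: "fa ?I A B u x = fa G A B u x" if "x \<in> fo ?I A" for A B u x using that unfolding image_of_def by simp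
  have I: "small_presheaf C ?I" by (rule small_image_of[OF f])
  have m: "nt ?I G ?m" unfolding image_of_def by (rule nt_incl[OF subfamily_image[OF f(1)]])
  have psI: "psh ?I" by (rule ntD(1)[OF m])
  have mono: "mono_arrow (PSh C) ?I G ?m" unfolding mono_arrow_def
  proof (intro conjI ballI impI)
    show "?m \<in> Hom (PSh C) ?I G" using I f m by simp
    fix Z g h assume g: "g \<in> Hom (PSh C) Z ?I" "h \<in> Hom (PSh C) Z ?I"
      and e: "Cmp (PSh C) Z ?I G ?m g = Cmp (PSh C) Z ?I G ?m h"
    then have ng: "nt Z ?I g" "nt Z ?I h" by simp_all
    show "g = h"
    proof (rule nt_eqI[OF ng])
      fix A x assume A: "A \<in> Ob C" "x \<in> fo Z A"
      have "ntcomp Z ?I G ?m g A x = ntcomp Z ?I G ?m h A x" using e by simp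
      then show "g A x = h A x" using A ntD(4)[OF ng(1) A] ntD(4)[OF ng(2) A] by simp
    qed
  qed
  have e: "nt F ?I (mknt F f)"
  proof (rule nt_mknt[OF n(1) psI])
    fix A B u x assume "u \<in> Hom C B A" "x \<in> fo F A"
    then show "f B (fa F A B u x) = fa ?I A B u (f A x)" using n(5) fa fo by simp
  qed (simp add: fo)
  have me: "ntcomp F ?I G ?m (mknt F f) = f"
    by (rule nt_eqI[OF nt_comp[OF e m] f(1)]) (simp add: fo)
  show ?thesis unfolding is_image_def
  proof (intro conjI allI impI mono)
    show "f \<in> Hom (PSh C) F G" using f by simp
    show "\<exists>e\<in>Hom (PSh C) F ?I. Cmp (PSh C) F ?I G ?m e = f" using e me f I by auto
    fix I' m' assume "mono_arrow (PSh C) I' G m' \<and> (\<exists>e\<in>Hom (PSh C) F I'. Cmp (PSh C) F I' G m' e = f)"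
    then obtain e' where m': "mono_arrow (PSh C) I' G m'" and e': "e' \<in> Hom (PSh C) F I'" "Cmp (PSh C) F I' G m' e' = f"
      by blast
    have n': "nt I' G m'" "small_presheaf C I'" "nt F I' e'" using m' e' unfolding mono_arrow_def by auto
    have fe: "f A x = m' A (e' A x)" if "A \<in> Ob C" "x \<in> fo F A" for A x
      using fun_cong[OF fun_cong[OF e'(2), of A], of x] that by simp
    define k where "k A y = (SOME z. z \<in> fo I' A \<and> m' A z = y)" for A y
    have k: "k A y \<in> fo I' A \<and> m' A (k A y) = y" if A: "A \<in> Ob C" "y \<in> fo ?I A" for A y
    proof -
      obtain x where "x \<in> fo F A" "y = m' A (e' A x)" using A fe unfolding fo by blast
      then have "\<exists>z. z \<in> fo I' A \<and> m' A z = y" using ntD(4)[OF n'(3) A(1)] by blast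
      then show ?thesis unfolding k_def by (rule someI_ex)
    qed
    have nk: "nt ?I I' (mknt ?I k)"
    proof (rule nt_mknt[OF psI ntD(1)[OF n'(1)]])
      fix A x assume "A \<in> Ob C" "x \<in> fo ?I A"
      then show "k A x \<in> fo I' A" using k by blast
    next
      fix A B u x assume u: "u \<in> Hom C B A" and x: "x \<in> fo ?I A"
      note kx = k[OF cod[OF u] x] and kux = k[OF dom[OF u] psh_in[OF psI u x]]
      show "k B (fa ?I A B u x) = fa I' A B u (k A x)"
      proof (rule mono_arrow_inj[OF m' dom[OF u]])
        show "k B (fa ?I A B u x) \<in> fo I' B" using kux by blast
        show "fa I' A B u (k A x) \<in> fo I' B" using psh_in[OF ntD(1)[OF n'(1)] u] kx by blast
        show "m' B (k B (fa ?I A B u x)) = m' B (fa I' A B u (k A x))"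
          using ntD(5)[OF n'(1) u conjunct1[OF kx]] kx kux fa[OF x] by simp
      qed
    qed
    have "ntcomp ?I I' G m' (mknt ?I k) = ?m"
      by (rule nt_eqI[OF nt_comp[OF nk n'(1)] m]) (simp add: k)
    then show "\<exists>k\<in>Hom (PSh C) ?I I'. Cmp (PSh C) ?I I' G m' k = ?m" using nk I n' by (intro bexI[of _ "mknt ?I k"]) auto
  qed
qed

text \<open>\<open>is_image\<close> determines the image up to isomorphism only; comparison with the
  pointwise image shows that its elements are still those hit by \<open>f\<close>.\<close>

lemma is_image_image:
  assumes f: "nt F G f" "small_presheaf C F" "small_presheaf C G"
    and I: "is_image (PSh C) F G f I m" and A: "A \<in> Ob C"
  shows "m A ` fo I A = f A ` fo F A"
proof (intro equalityI subsetI)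
  let ?I = "image_of F G f" and ?m = "mknt (image_of F G f) (\<lambda>A x. x)"
  have "is_image (PSh C) F G f ?I ?m" by (rule is_image_image_of[OF f])
  then have "\<exists>k\<in>Hom (PSh C) I ?I. Cmp (PSh C) I ?I G ?m k = m"
    using I unfolding is_image_def by blast
  then obtain k where k: "nt I ?I k" "ntcomp I ?I G ?m k = m" by auto
  fix y assume "y \<in> m A ` fo I A"
  then obtain z where z: "z \<in> fo I A" "y = m A z" by blast
  have kz: "k A z \<in> fo ?I A" using ntD(4)[OF k(1) A z(1)] .
  have "y = k A z" unfolding z(2) k(2)[symmetric] using A z kz by simp
  then show "y \<in> f A ` fo F A" using kz unfolding image_of_def by simp
next
  obtain e where e: "nt F I e" "ntcomp F I G m e = f" using I unfolding is_image_def by auto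
  fix y assume "y \<in> f A ` fo F A"
  then obtain x where x: "x \<in> fo F A" "y = f A x" by blast
  have "y = m A (e A x)" unfolding x(2) e(2)[symmetric] using A x by simp
  then show "y \<in> m A ` fo I A" using ntD(4)[OF e(1) A x(1)] by blast
qed

text \<open>An element \<open>r\<close> of the kernel pair amounts to the pair of
  \<open>p A r\<close> and \<open>q A r\<close>, and its restriction along \<open>u\<close> lies on
  the diagonal if and only if \<open>u\<close> identifies the two. This turns (P2) into local
  injectivity.\<close>

lemma diagonal_im_sieve:
  assumes R: "pullback F F f f R p q" and \<delta>: "nt F R \<delta>"
    "\<And>A x. A \<in> Ob C \<Longrightarrow> x \<in> fo F A \<Longrightarrow> p A (\<delta> A x) = x" "\<And>A x. A \<in> Ob C \<Longrightarrow> x \<in> fo F A \<Longrightarrow> q A (\<delta> A x) = x"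
    and A: "A \<in> Ob C" and r: "r \<in> fo R A"
  shows "im_sieve F R \<delta> A r = eq_sieve F A (p A r) (q A r)"
proof (intro ext equalityI subsetI)
  note D = pullbackD[OF R]
  note np = ntD[OF D(1)] and nq = ntD[OF D(2)]
  fix W u assume "u \<in> im_sieve F R \<delta> A r W"
  then obtain x where u: "u \<in> Hom C W A" "fa R A W u r = \<delta> W x" "x \<in> fo F W" unfolding im_sieve_def by blast
  have "fa F A W u (p A r) = x" "fa F A W u (q A r) = x"
    using np(5)[OF u(1) r] nq(5)[OF u(1) r] \<delta>(2,3)[OF dom[OF u(1)] u(3)] u(2) by simp_all
  then show "u \<in> eq_sieve F A (p A r) (q A r) W" unfolding eq_sieve_def using u by simp
next
  note D = pullbackD[OF R]
  note np = ntD[OF D(1)] and nq = ntD[OF D(2)]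
  fix W u assume "u \<in> eq_sieve F A (p A r) (q A r) W"
  then have u: "u \<in> Hom C W A" "fa F A W u (p A r) = fa F A W u (q A r)" unfolding eq_sieve_def by blast+
  let ?x = "fa F A W u (p A r)"
  have x: "?x \<in> fo F W" by (rule psh_in[OF np(2) u(1) np(4)[OF A r]])
  note W = dom[OF u(1)]
  have "fa R A W u r = \<delta> W ?x"
  proof (rule D(5)[OF W psh_in[OF np(1) u(1) r] ntD(4)[OF \<delta>(1) W x]])
    show "p W (fa R A W u r) = p W (\<delta> W ?x)" using np(5)[OF u(1) r] \<delta>(2)[OF W x] by simp
    show "q W (fa R A W u r) = q W (\<delta> W ?x)" using nq(5)[OF u(1) r] \<delta>(3)[OF W x] u(2) by simp
  qed
  then show "u \<in> im_sieve F R \<delta> A r W" unfolding im_sieve_def using u(1) x by blast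
qed

text \<open>By (P1) the image sieves are covers, since they depend on \<open>f\<close> only through
  its image; by (P2) so are the equality sieves of pairs identified by \<open>f\<close>.\<close>

lemma postulated_imp_bicovering:
  assumes f: "nt F G f" "small_presheaf C F" "small_presheaf C G" and p: "postulated C F G f"
  shows "bicovering F G f"
proof -
  obtain I m R p q \<delta> where I: "is_image (PSh C) F G f I m" "stably_final C I G m"
    and R: "is_pullback (PSh C) F F G f f R p q" "\<delta> \<in> Hom (PSh C) F R"
      "Cmp (PSh C) F R F p \<delta> = Ide (PSh C) F" "Cmp (PSh C) F R F q \<delta> = Ide (PSh C) F" "stably_final C F R \<delta>"
    using p unfolding postulated_def by blast
  have R': "pullback F F f f R p q" by (rule is_pullback_imp_pullback[of UNIV F F G f f R p q]) (use R(1) in simp_all)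
  have n\<delta>: "nt F R \<delta>" using R(2) by simp
  have \<delta>: "p A (\<delta> A x) = x" "q A (\<delta> A x) = x" if "A \<in> Ob C" "x \<in> fo F A" for A x
    using fun_cong[OF fun_cong[OF R(3), of A], of x] fun_cong[OF fun_cong[OF R(4), of A], of x] that by simp_all
  show ?thesis unfolding bicovering_def
  proof (intro conjI ballI impI f(1))
    fix A y assume A: "A \<in> Ob C" "y \<in> fo G A"
    have "im_sieve F G f A y W = im_sieve I G m A y W" for W
      unfolding im_sieve_def using is_image_image[OF f I(1)] dom by (intro Collect_cong conj_cong refl) simp
    then have "im_sieve F G f A y = im_sieve I G m A y" by (rule ext)
    then show "cover A (im_sieve F G f A y)" using stably_final_cover[OF I(2) A] by simp
  next
    fix A x x' assume A: "A \<in> Ob C" and x: "x \<in> fo F A" "x' \<in> fo F A" "f A x = f A x'"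
    obtain r where r: "r \<in> fo R A" "p A r = x" "q A r = x'" using pullbackD(4)[OF R' A x] by blast
    show "cover A (eq_sieve F A x x')"
      using stably_final_cover[OF R(5) A r(1)] diagonal_im_sieve[OF R' n\<delta> \<delta> A r(1)] r(2,3) by simp
  qed
qed

lemma injective_bicovering:
  assumes m: "nt F G m" and inj: "\<And>A x x'. A \<in> Ob C \<Longrightarrow> x \<in> fo F A \<Longrightarrow> x' \<in> fo F A \<Longrightarrow> m A x = m A x' \<Longrightarrow> x = x'"
    and surj: "\<And>A y. A \<in> Ob C \<Longrightarrow> y \<in> fo G A \<Longrightarrow> cover A (im_sieve F G m A y)"
  shows "bicovering F G m"
  unfolding bicovering_def
proof (intro conjI ballI impI m surj)
  fix A x x' assume A: "A \<in> Ob C" and x: "x \<in> fo F A" "x' \<in> fo F A" "m A x = m A x'"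
  have "x = x'" by (rule inj[OF A x])
  then show "cover A (eq_sieve F A x x')"
    using cover_of_id[OF sieve_eq_sieve[OF ntD(1)[OF m] A x(1,2)]] A by (simp add: eq_sieve_def)
qed

text \<open>The image inclusion and the diagonal are injective, hence bicovering once their image
  sieves are covers, and these are the image sieves and equality sieves of \<open>f\<close>.\<close>

lemma bicovering_imp_postulated:
  assumes b: "bicovering F G f" and f: "small_presheaf C F" "small_presheaf C G"
  shows "postulated C F G f"
proof -
  note bD = bicoveringD[OF b]
  have n: "nt F G f" by (rule bD(1))
  let ?I = "image_of F G f" and ?m = "mknt (image_of F G f) (\<lambda>A x. x)"
  have I: "small_presheaf C ?I" by (rule small_image_of[OF n f])
  have fo: "fo ?I A = f A ` fo F A" for A unfolding image_of_def by simp
  have m: "nt ?I G ?m" unfolding image_of_def by (rule nt_incl[OF subfamily_image[OF n]])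
  have "bicovering ?I G ?m"
  proof (rule injective_bicovering[OF m])
    fix A y assume A: "A \<in> Ob C" "y \<in> fo G A"
    have "?m W ` fo ?I W = f W ` fo F W" if "W \<in> Ob C" for W using that fo by (auto simp: image_iff)
    then have "im_sieve ?I G ?m A y W = im_sieve F G f A y W" for W
      unfolding im_sieve_def using dom by (intro Collect_cong conj_cong refl) simp
    then have "im_sieve ?I G ?m A y = im_sieve F G f A y" by (rule ext)
    then show "cover A (im_sieve ?I G ?m A y)" using bD(2)[OF A] by simp
  qed simp
  then have P1: "stably_final C ?I G ?m" by (rule bicovering_stably_final[OF _ I f(2)])
  obtain R p q where R: "small_presheaf C R" "pullback F F f f R p q" by (rule pullback_exists[OF f(1,1,2) n n])
  note D = pullbackD[OF R(2)]
  have isR: "is_pullback (PSh C) F F G f f R p q" unfolding is_pullback_iff[OF f(1,1,2) R(1) n n] by (rule R(2))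
  have "ntid F \<in> Hom (PSh C) F F" using f nt_id[OF ntD(1)[OF n]] by simp
  then have "\<exists>\<delta>. \<delta> \<in> Hom (PSh C) F R \<and> Cmp (PSh C) F R F p \<delta> = ntid F \<and> Cmp (PSh C) F R F q \<delta> = ntid F"
    using isR f(1) unfolding is_pullback_def by (metis PSh_simps(1))
  then obtain \<delta> where \<delta>: "nt F R \<delta>" "ntcomp F R F p \<delta> = ntid F" "ntcomp F R F q \<delta> = ntid F" by auto
  have \<delta>': "p A (\<delta> A x) = x" "q A (\<delta> A x) = x" if "A \<in> Ob C" "x \<in> fo F A" for A x
    using fun_cong[OF fun_cong[OF \<delta>(2), of A], of x] fun_cong[OF fun_cong[OF \<delta>(3), of A], of x] that by simp_all
  have "bicovering F R \<delta>"
  proof (rule injective_bicovering[OF \<delta>(1)])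
    fix A x x' assume A: "A \<in> Ob C" and x: "x \<in> fo F A" "x' \<in> fo F A" "\<delta> A x = \<delta> A x'"
    show "x = x'" using arg_cong[OF x(3), of "p A"] unfolding \<delta>'(1)[OF A x(1)] \<delta>'(1)[OF A x(2)] .
  next
    fix A r assume A: "A \<in> Ob C" and r: "r \<in> fo R A"
    have "im_sieve F R \<delta> A r = eq_sieve F A (p A r) (q A r)"
      by (rule diagonal_im_sieve[OF R(2) \<delta>(1) \<delta>' A r])
    then show "cover A (im_sieve F R \<delta> A r)"
      using bD(3)[OF A ntD(4)[OF D(1) A r] ntD(4)[OF D(2) A r] D(3)[OF A r]] by simp
  qed
  then have P2: "stably_final C F R \<delta>" by (rule bicovering_stably_final[OF _ f(1) R(1)])
  show ?thesis unfolding postulated_def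
    using is_image_image_of[OF n f] P1 isR \<delta> P2 R(1) f(1) by (metis PSh_simps(2,3,4))
qed

subsection \<open>Finite limits of bicovering morphisms\<close>

text \<open>The components of \<open>m\<close> lift on a common cover because \<open>J\<close> is
  finite, but the lifts are compatible only after applying the \<open>t j\<close>. Local injectivity
  gives, for each of the finitely many arrows of \<open>J\<close>, a cover on which compatibility
  holds; on the intersection of these covers the lifts form an element of \<open>P\<close>.\<close>

lemma bicovering_plim:
  assumes J: "finite_category J" and G: "is_functor J (PSh C) G" and H: "is_functor J (PSh C) H"
    and t: "\<And>j. j \<in> Ob J \<Longrightarrow> bicovering (fo G j) (fo H j) (t j)"
    and nat: "\<And>i j u A x. u \<in> Hom J i j \<Longrightarrow> A \<in> Ob C \<Longrightarrow> x \<in> fo (fo G i) A \<Longrightarrow>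
        t j A (fa G i j u A x) = fa H i j u A (t i A x)"
    and P: "plim J G P \<pi>" and M: "plim J H M \<mu>" and h: "nt P M h"
    and hc: "\<And>j A x. j \<in> Ob J \<Longrightarrow> A \<in> Ob C \<Longrightarrow> x \<in> fo P A \<Longrightarrow> \<mu> j A (h A x) = t j A (\<pi> j A x)"
  shows "bicovering P M h"
proof -
  note PD = plimD[OF P] and MD = plimD[OF M] and nh = ntD[OF h]
  have fin: "finite (Ob J)" "\<And>i j. i \<in> Ob J \<Longrightarrow> j \<in> Ob J \<Longrightarrow> finite (Hom J i j)"
    using J unfolding finite_category_def by blast+
  have Ga: "nt (fo G i) (fo G j) (fa G i j u)" "i \<in> Ob J" "j \<in> Ob J" if "u \<in> Hom J i j" for i j u
    using is_functorD(4)[OF G that] category.Hom_Ob[OF is_functorD(1)[OF G] that] by auto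
  note tD = bicoveringD[OF t] and nt = ntD[OF bicoveringD(1)[OF t]]
  show ?thesis unfolding bicovering_def
  proof (intro conjI ballI impI h)
    fix A m assume A: "A \<in> Ob C" and m: "m \<in> fo M A"
    have mj: "\<mu> j A m \<in> fo (fo H j) A" if "j \<in> Ob J" for j by (rule ntD(4)[OF MD(2)[OF that] A m])
    define T where "T X = {u \<in> Hom C X A. \<forall>j\<in>Ob J. u \<in> im_sieve (fo G j) (fo H j) (t j) A (\<mu> j A m) X}" for X
    have T: "cover A T" unfolding T_def
      by (rule cover_finite_INT[OF fin(1) A]) (use tD(2) A mj in blast)
    show "cover A (im_sieve P M h A m)"
    proof (rule cover_local[OF sieve_im_sieve[OF h A m] T])
      fix X u assume "u \<in> T X"
      then have u: "u \<in> Hom C X A" "\<forall>j\<in>Ob J. \<exists>x. x \<in> fo (fo G j) X \<and> fa (fo H j) A X u (\<mu> j A m) = t j X x"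
        unfolding T_def im_sieve_def by blast+
      from bchoice[OF u(2)] obtain x where x: "\<And>j. j \<in> Ob J \<Longrightarrow> x j \<in> fo (fo G j) X"
        "\<And>j. j \<in> Ob J \<Longrightarrow> fa (fo H j) A X u (\<mu> j A m) = t j X (x j)" by blast
      note X = dom[OF u(1)]
      have um: "fa M A X u m \<in> fo M X" by (rule psh_in[OF MD(1) u(1) m])
      have \<mu>u: "\<mu> j X (fa M A X u m) = t j X (x j)" if "j \<in> Ob J" for j
        using ntD(5)[OF MD(2)[OF that] u(1) m] x(2)[OF that] by simp
      define I where "I = (SIGMA i : Ob J. SIGMA j : Ob J. Hom J i j)"
      have finI: "finite I" unfolding I_def using fin by (intro finite_SigmaI) auto
      define S where "S W = {v \<in> Hom C W X. \<forall>a\<in>I. v \<in> (case a of (i, j, \<alpha>) \<Rightarrow> eq_sieve (fo G j) X (fa G i j \<alpha> X (x i)) (x j) W)}" for W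
      have S: "cover X S" unfolding S_def
      proof (rule cover_finite_INT[OF finI X])
        fix a assume "a \<in> I"
        then obtain i j \<alpha> where a: "a = (i, j, \<alpha>)" "i \<in> Ob J" "j \<in> Ob J" "\<alpha> \<in> Hom J i j" unfolding I_def by blast
        have "t j X (fa G i j \<alpha> X (x i)) = fa H i j \<alpha> X (\<mu> i X (fa M A X u m))"
          using nat[OF a(4) X x(1)[OF a(2)]] \<mu>u[OF a(2)] by simp
        also have "\<dots> = t j X (x j)" using MD(3)[OF a(4) X um] \<mu>u[OF a(3)] by simp
        finally show "cover X (\<lambda>W. case a of (i, j, \<alpha>) \<Rightarrow> eq_sieve (fo G j) X (fa G i j \<alpha> X (x i)) (x j) W)"
          unfolding a(1) prod.case using tD(3)[OF a(3) X ntD(4)[OF Ga(1)[OF a(4)] X x(1)[OF a(2)]] x(1)[OF a(3)]] by simp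
      qed
      show "cover X (pull A X u (im_sieve P M h A m))" unfolding pull_im_sieve[OF h u(1) m]
      proof (rule cover_mono[OF S sieve_im_sieve[OF h X um]])
        fix W v assume vS: "v \<in> S W"
        then have v: "v \<in> Hom C W X" unfolding S_def by blast
        note W = dom[OF v]
        have "\<exists>y\<in>fo P W. \<forall>j\<in>Ob J. \<pi> j W y = fa (fo G j) X W v (x j)"
        proof (rule PD(4)[OF W])
          fix j assume j: "j \<in> Ob J"
          show "fa (fo G j) X W v (x j) \<in> fo (fo G j) W" by (rule psh_in[OF nt(1)[OF j] v x(1)[OF j]])
        next
          fix i j \<alpha> assume \<alpha>: "\<alpha> \<in> Hom J i j"
          have "(i, j, \<alpha>) \<in> I" unfolding I_def using \<alpha> Ga(2,3)[OF \<alpha>] by blast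
          then have "fa (fo G j) X W v (fa G i j \<alpha> X (x i)) = fa (fo G j) X W v (x j)"
            using vS unfolding S_def eq_sieve_def by fastforce
          then show "fa G i j \<alpha> W (fa (fo G i) X W v (x i)) = fa (fo G j) X W v (x j)"
            using ntD(5)[OF Ga(1)[OF \<alpha>] v x(1)[OF Ga(2)[OF \<alpha>]]] by simp
        qed
        then obtain y where y: "y \<in> fo P W" "\<And>j. j \<in> Ob J \<Longrightarrow> \<pi> j W y = fa (fo G j) X W v (x j)" by blast
        have "fa M X W v (fa M A X u m) = h W y"
        proof (rule MD(5)[OF W psh_in[OF MD(1) v um] nh(4)[OF W y(1)]])
          fix j assume j: "j \<in> Ob J"
          have "\<mu> j W (fa M X W v (fa M A X u m)) = fa (fo H j) X W v (t j X (x j))"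
            using ntD(5)[OF MD(2)[OF j] v um] \<mu>u[OF j] by simp
          also have "\<dots> = t j W (\<pi> j W y)" using nt(5)[OF j v x(1)[OF j]] y(2)[OF j] by simp
          also have "\<dots> = \<mu> j W (h W y)" using hc[OF j W y(1)] by simp
          finally show "\<mu> j W (fa M X W v (fa M A X u m)) = \<mu> j W (h W y)" .
        qed
        then show "v \<in> im_sieve P M h X (fa M A X u m) W" unfolding im_sieve_def using v y(1) by blast
      qed
    qed
  next
    fix A x x' assume A: "A \<in> Ob C" and x: "x \<in> fo P A" "x' \<in> fo P A" "h A x = h A x'"
    have xj: "\<pi> j A x \<in> fo (fo G j) A" "\<pi> j A x' \<in> fo (fo G j) A" "t j A (\<pi> j A x) = t j A (\<pi> j A x')" if j: "j \<in> Ob J" for j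
      using ntD(4)[OF PD(2)[OF j] A] x hc[OF j A x(1)] hc[OF j A x(2)] by simp_all
    have "cover A (\<lambda>X. {u \<in> Hom C X A. \<forall>j\<in>Ob J. u \<in> eq_sieve (fo G j) A (\<pi> j A x) (\<pi> j A x') X})"
      by (rule cover_finite_INT[OF fin(1) A]) (rule tD(3)[OF _ A xj])
    then show "cover A (eq_sieve P A x x')"
    proof (rule cover_mono[OF _ sieve_eq_sieve[OF PD(1) A x(1,2)]])
      fix X u assume "u \<in> {u \<in> Hom C X A. \<forall>j\<in>Ob J. u \<in> eq_sieve (fo G j) A (\<pi> j A x) (\<pi> j A x') X}"
      then have u: "u \<in> Hom C X A" "\<And>j. j \<in> Ob J \<Longrightarrow> fa (fo G j) A X u (\<pi> j A x) = fa (fo G j) A X u (\<pi> j A x')"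
        unfolding eq_sieve_def by blast+
      have "fa P A X u x = fa P A X u x'"
      proof (rule PD(5)[OF dom[OF u(1)] psh_in[OF PD(1) u(1) x(1)] psh_in[OF PD(1) u(1) x(2)]])
        fix j assume j: "j \<in> Ob J"
        show "\<pi> j X (fa P A X u x) = \<pi> j X (fa P A X u x')"
          using ntD(5)[OF PD(2)[OF j] u(1)] x u(2)[OF j] by simp
      qed
      then show "u \<in> eq_sieve P A x x' X" unfolding eq_sieve_def using u(1) by blast
    qed
  qed
qed

subsection \<open>Final morphisms\<close>

lemma final_ex: "final C F G f \<Longrightarrow> D \<in> Ob C \<Longrightarrow> nt F (Y D) g \<Longrightarrow> \<exists>h. nt G (Y D) h \<and> ntcomp F G (Y D) h f = g"
  unfolding final_iff by blast

lemma final_unique: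
  assumes "final C F G f" "D \<in> Ob C" "nt G (Y D) h" "nt G (Y D) h'" "ntcomp F G (Y D) h f = ntcomp F G (Y D) h' f"
  shows "h = h'"
proof -
  have "nt F (Y D) (ntcomp F G (Y D) h' f)" using nt_comp assms(1,4) unfolding final_iff by blast
  then have "\<exists>!k. nt G (Y D) k \<and> ntcomp F G (Y D) k f = ntcomp F G (Y D) h' f"
    using assms(1,2) unfolding final_iff by blast
  then show ?thesis using assms(3-5) by blast
qed

lemma finalI:
  assumes "small_presheaf C F" "small_presheaf C G" "nt F G f"
    "\<And>D g. D \<in> Ob C \<Longrightarrow> nt F (Y D) g \<Longrightarrow> \<exists>h. nt G (Y D) h \<and> ntcomp F G (Y D) h f = g"
    "\<And>D h h'. D \<in> Ob C \<Longrightarrow> nt G (Y D) h \<Longrightarrow> nt G (Y D) h' \<Longrightarrow> ntcomp F G (Y D) h f = ntcomp F G (Y D) h' f \<Longrightarrow> h = h'"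
  shows "final C F G f"
  unfolding final_iff
proof (intro conjI ballI allI impI assms(1-3))
  fix D g assume D: "D \<in> Ob C" and g: "nt F (Y D) g"
  obtain h where h: "nt G (Y D) h" "ntcomp F G (Y D) h f = g" using assms(4)[OF D g] by blast
  show "\<exists>!h. nt G (Y D) h \<and> ntcomp F G (Y D) h f = g"
    by (rule ex1I[of _ h]) (use h assms(5)[OF D] in auto)
qed

lemma finalD: "final C F G f \<Longrightarrow> small_presheaf C F" "final C F G f \<Longrightarrow> small_presheaf C G" "final C F G f \<Longrightarrow> nt F G f"
  unfolding final_iff by blast+

lemmas ntassoc = category.Cmp_assoc[OF category_presheaves]

text \<open>Finality of \<open>f\<close> says that composition with \<open>f\<close> is a bijection
  between maps to each representable. Hence final morphisms have the two-out-of-three property, of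
  which this is the first part.\<close>

lemma final_comp:
  assumes f: "final C F G f" and g: "final C G H g"
  shows "final C F H (ntcomp F G H g f)"
proof (rule finalI[OF finalD(1)[OF f] finalD(2)[OF g] nt_comp[OF finalD(3)[OF f] finalD(3)[OF g]]])
  note n = finalD(3)[OF f] finalD(3)[OF g]
  fix D k assume D: "D \<in> Ob C" and k: "nt F (Y D) k"
  obtain h where h: "nt G (Y D) h" "ntcomp F G (Y D) h f = k" using final_ex[OF f D k] by blast
  obtain h' where h': "nt H (Y D) h'" "ntcomp G H (Y D) h' g = h" using final_ex[OF g D h(1)] by blast
  show "\<exists>h. nt H (Y D) h \<and> ntcomp F H (Y D) h (ntcomp F G H g f) = k"
    using h' h ntassoc[OF n(1,2) h'(1)] by metis
next
  note n = finalD(3)[OF f] finalD(3)[OF g]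
  fix D h h' assume D: "D \<in> Ob C" and h: "nt H (Y D) h" "nt H (Y D) h'"
    and e: "ntcomp F H (Y D) h (ntcomp F G H g f) = ntcomp F H (Y D) h' (ntcomp F G H g f)"
  have "ntcomp G H (Y D) h g = ntcomp G H (Y D) h' g"
    using final_unique[OF f D nt_comp[OF n(2) h(1)] nt_comp[OF n(2) h(2)]] e ntassoc[OF n(1,2)] h by simp
  then show "h = h'" by (rule final_unique[OF g D h])
qed

lemma final_cancel_left:
  assumes f: "nt F G f" "small_presheaf C F" and g: "final C G H g" and gf: "final C F H (ntcomp F G H g f)"
  shows "final C F G f"
proof (rule finalI[OF f(2) finalD(1)[OF g] f(1)])
  note ng = finalD(3)[OF g]
  fix D k assume D: "D \<in> Ob C" and k: "nt F (Y D) k"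
  obtain h where h: "nt H (Y D) h" "ntcomp F H (Y D) h (ntcomp F G H g f) = k" using final_ex[OF gf D k] by blast
  show "\<exists>h. nt G (Y D) h \<and> ntcomp F G (Y D) h f = k"
    using h nt_comp[OF ng h(1)] ntassoc[OF f(1) ng h(1)] by metis
next
  note ng = finalD(3)[OF g]
  fix D h h' assume D: "D \<in> Ob C" and h: "nt G (Y D) h" "nt G (Y D) h'"
    and e: "ntcomp F G (Y D) h f = ntcomp F G (Y D) h' f"
  obtain m where m: "nt H (Y D) m" "ntcomp G H (Y D) m g = h" using final_ex[OF g D h(1)] by blast
  obtain m' where m': "nt H (Y D) m'" "ntcomp G H (Y D) m' g = h'" using final_ex[OF g D h(2)] by blast
  have "m = m'"
    by (rule final_unique[OF gf D m(1) m'(1)])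
      (use e m m' ntassoc[OF f(1) ng m(1)] ntassoc[OF f(1) ng m'(1)] in simp)
  then show "h = h'" using m m' by simp
qed

lemma final_cancel_right:
  assumes g: "nt G H g" "small_presheaf C H" and f: "final C F G f" and gf: "final C F H (ntcomp F G H g f)"
  shows "final C G H g"
proof (rule finalI[OF finalD(2)[OF f] g(2,1)])
  note nf = finalD(3)[OF f]
  fix D k assume D: "D \<in> Ob C" and k: "nt G (Y D) k"
  obtain m where m: "nt H (Y D) m" "ntcomp F H (Y D) m (ntcomp F G H g f) = ntcomp F G (Y D) k f"
    using final_ex[OF gf D nt_comp[OF nf k]] by blast
  have "ntcomp G H (Y D) m g = k"
    by (rule final_unique[OF f D nt_comp[OF g(1) m(1)] k]) (use m(2) ntassoc[OF nf g(1) m(1)] in simp)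
  then show "\<exists>h. nt H (Y D) h \<and> ntcomp G H (Y D) h g = k" using m(1) by blast
next
  note nf = finalD(3)[OF f]
  fix D h h' assume D: "D \<in> Ob C" and h: "nt H (Y D) h" "nt H (Y D) h'"
    and e: "ntcomp G H (Y D) h g = ntcomp G H (Y D) h' g"
  show "h = h'"
    by (rule final_unique[OF gf D h]) (use e ntassoc[OF nf g(1) h(1)] ntassoc[OF nf g(1) h(2)] in simp)
qed

section \<open>Final morphisms between representables are isomorphisms\<close>

lemma yoneda_comp: "f \<in> Hom C A B \<Longrightarrow> g \<in> Hom C B D \<Longrightarrow>
   fa (yoneda C) A D (Cmp C A B D g f) = ntcomp (Y A) (Y B) (Y D) (fa (yoneda C) B D g) (fa (yoneda C) A B f)"
  using is_functorD(6)[OF is_functor_yoneda_PSh] by simp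

lemma yoneda_id: "A \<in> Ob C \<Longrightarrow> fa (yoneda C) A A (Ide C A) = ntid (Y A)"
  using is_functorD(5)[OF is_functor_yoneda_PSh] by simp

definition iso :: "'o \<Rightarrow> 'o \<Rightarrow> 'u \<Rightarrow> bool" where
  "iso A B h \<longleftrightarrow> h \<in> Hom C A B \<and> (\<exists>k\<in>Hom C B A. Cmp C A B A k h = Ide C A \<and> Cmp C B A B h k = Ide C B)"

lemma ntid_comp: "nt F G f \<Longrightarrow> ntcomp F G G (ntid G) f = f" "nt F G f \<Longrightarrow> ntcomp F F G f (ntid F) = f"
  using category.Cmp_Ide_left[OF category_presheaves] category.Cmp_Ide_right[OF category_presheaves] by blast+

text \<open>Extending the identity of \<open>Y A\<close> along a final morphism gives a one-sided
  inverse, and uniqueness of extensions makes it two-sided.\<close>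

lemma final_yoneda_iff:
  assumes h: "h \<in> Hom C A B"
  shows "final C (Y A) (Y B) (fa (yoneda C) A B h) \<longleftrightarrow> iso A B h"
proof
  note A = dom[OF h] and B = cod[OF h]
  note nh = nt_yoneda[OF h]
  assume f: "final C (Y A) (Y B) (fa (yoneda C) A B h)"
  obtain k' where k': "nt (Y B) (Y A) k'" "ntcomp (Y A) (Y B) (Y A) k' (fa (yoneda C) A B h) = ntid (Y A)"
    using final_ex[OF f A nt_id[OF psh_Y[OF A]]] by blast
  obtain k where k: "k \<in> Hom C B A" "k' = fa (yoneda C) B A k" using nt_Y_Y[OF B k'(1)] by blast
  have kh: "Cmp C A B A k h = Ide C A"
  proof (rule yoneda_inj[OF compC[OF h k(1)] idC[OF A]])
    show "fa (yoneda C) A A (Cmp C A B A k h) = fa (yoneda C) A A (Ide C A)"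
      using k' k yoneda_comp[OF h k(1)] yoneda_id[OF A] by simp
  qed
  have "fa (yoneda C) B B (Cmp C B A B h k) = fa (yoneda C) B B (Ide C B)"
  proof (rule final_unique[OF f B nt_yoneda[OF compC[OF k(1) h]] nt_yoneda[OF idC[OF B]]])
    have "Cmp C A B B (Cmp C B A B h k) h = Cmp C A B B (Ide C B) h"
      using assocC[OF h k(1) h] kh comp_idC[OF h] id_compC[OF h] by simp
    then show "ntcomp (Y A) (Y B) (Y B) (fa (yoneda C) B B (Cmp C B A B h k)) (fa (yoneda C) A B h) =
       ntcomp (Y A) (Y B) (Y B) (fa (yoneda C) B B (Ide C B)) (fa (yoneda C) A B h)"
      using yoneda_comp[OF h compC[OF k(1) h]] yoneda_comp[OF h idC[OF B]] by simp
  qed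
  then have "Cmp C B A B h k = Ide C B" by (rule yoneda_inj[OF compC[OF k(1) h] idC[OF B]])
  then show "iso A B h" unfolding iso_def using h k kh by blast
next
  note A = dom[OF h] and B = cod[OF h]
  note nh = nt_yoneda[OF h]
  assume "iso A B h"
  then obtain k where k: "k \<in> Hom C B A" "Cmp C A B A k h = Ide C A" "Cmp C B A B h k = Ide C B"
    unfolding iso_def by blast
  note nk = nt_yoneda[OF k(1)]
  have kh: "ntcomp (Y A) (Y B) (Y A) (fa (yoneda C) B A k) (fa (yoneda C) A B h) = ntid (Y A)"
    using yoneda_comp[OF h k(1)] k(2) yoneda_id[OF A] by simp
  have hk: "ntcomp (Y B) (Y A) (Y B) (fa (yoneda C) A B h) (fa (yoneda C) B A k) = ntid (Y B)"
    using yoneda_comp[OF k(1) h] k(3) yoneda_id[OF B] by simp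
  show "final C (Y A) (Y B) (fa (yoneda C) A B h)"
  proof (rule finalI[OF small_presheaf_Y[OF A] small_presheaf_Y[OF B] nh])
    fix D g assume g: "nt (Y A) (Y D) g"
    have "ntcomp (Y A) (Y B) (Y D) (ntcomp (Y B) (Y A) (Y D) g (fa (yoneda C) B A k)) (fa (yoneda C) A B h) = g"
      using ntassoc[OF nh nk g] kh ntid_comp(2)[OF g] by simp
    then show "\<exists>m. nt (Y B) (Y D) m \<and> ntcomp (Y A) (Y B) (Y D) m (fa (yoneda C) A B h) = g"
      using nt_comp[OF nk g] by blast
  next
    fix D m m' assume m: "nt (Y B) (Y D) m" "nt (Y B) (Y D) m'"
      and e: "ntcomp (Y A) (Y B) (Y D) m (fa (yoneda C) A B h) = ntcomp (Y A) (Y B) (Y D) m' (fa (yoneda C) A B h)"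
    have "m = ntcomp (Y B) (Y A) (Y D) (ntcomp (Y A) (Y B) (Y D) m (fa (yoneda C) A B h)) (fa (yoneda C) B A k)"
      using ntassoc[OF nk nh m(1)] hk ntid_comp(2)[OF m(1)] by simp
    also have "\<dots> = m'" unfolding e using ntassoc[OF nk nh m(2)] hk ntid_comp(2)[OF m(2)] by simp
    finally show "m = m'" .
  qed
qed

lemma iso_pullback:
  assumes P: "is_pullback C A B D f g P p q" and f: "iso A D f"
  shows "iso P B q"
proof -
  have h: "f \<in> Hom C A D" "g \<in> Hom C B D" "p \<in> Hom C P A" "q \<in> Hom C P B"
    "Cmp C P A D f p = Cmp C P B D g q" using P unfolding is_pullback_def by blast+
  have u: "\<exists>!h. h \<in> Hom C Q P \<and> Cmp C Q P A p h = a \<and> Cmp C Q P B q h = b"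
    if "a \<in> Hom C Q A" "b \<in> Hom C Q B" "Cmp C Q A D f a = Cmp C Q B D g b" for Q a b
    using P that dom[OF that(1)] unfolding is_pullback_def by blast
  obtain k where k: "k \<in> Hom C D A" "Cmp C A D A k f = Ide C A" "Cmp C D A D f k = Ide C D"
    using f unfolding iso_def by blast
  note B = dom[OF h(2)]
  have kg: "Cmp C B D A k g \<in> Hom C B A" using k(1) h(2) by simp
  have fkg: "Cmp C B A D f (Cmp C B D A k g) = Cmp C B B D g (Ide C B)"
    using assocC[OF h(2) k(1) h(1)] k(3) id_compC[OF h(2)] comp_idC[OF h(2)] by simp
  from u[OF kg idC[OF B] fkg] obtain s where s: "s \<in> Hom C B P" "Cmp C B P A p s = Cmp C B D A k g" "Cmp C B P B q s = Ide C B"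
    by blast
  from u[OF h(3,4,5)] obtain w where w: "\<And>h. h \<in> Hom C P P \<Longrightarrow> Cmp C P P A p h = p \<Longrightarrow> Cmp C P P B q h = q \<Longrightarrow> h = w"
    by (elim ex1E) blast
  have "Cmp C P P A p (Cmp C P B P s q) = p"
  proof -
    have "Cmp C P P A p (Cmp C P B P s q) = Cmp C P B A (Cmp C B D A k g) q" using assocC[OF h(4) s(1) h(3)] s(2) by simp
    also have "\<dots> = Cmp C P D A k (Cmp C P A D f p)" using assocC[OF h(4,2) k(1)] h(5) by simp
    also have "\<dots> = p" using assocC[OF h(3,1) k(1)] k(2) id_compC[OF h(3)] by simp
    finally show ?thesis .
  qed
  moreover have "Cmp C P P B q (Cmp C P B P s q) = q"
    using assocC[OF h(4) s(1) h(4)] s(3) id_compC[OF h(4)] by simp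
  ultimately have "Cmp C P B P s q = w" using w compC[OF h(4) s(1)] by blast
  moreover have "Ide C P = w" using w[OF idC[OF dom[OF h(3)]]] comp_idC[OF h(3)] comp_idC[OF h(4)] by blast
  ultimately show ?thesis unfolding iso_def using h(4) s by auto
qed

section \<open>Exactness implies postulatedness\<close>

text \<open>A final morphism is inverted by the lex reflector, hence so are its pullbacks and its diagonal.\<close>

lemma lex_reflector_final_bicovering:
  assumes T: "\<And>A. A \<in> Ob C \<Longrightarrow> Y A \<in> T"
    and Tlim: "\<And>F H G f g P p q. F \<in> T \<Longrightarrow> H \<in> T \<Longrightarrow> G \<in> T \<Longrightarrow> is_pullback (PSh C) F H G f g P p q \<Longrightarrow> P \<in> T"
    and adj: "left_adjoint C (subPSh T) L (yoneda C)"
    and lex: "preserves_finite_limits (subPSh T) C L"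
    and f: "final C F G f" "F \<in> T" "G \<in> T"
  shows "bicovering F G f"
proof -
  have L: "is_functor (subPSh T) C L" using adj unfolding left_adjoint_def by blast
  note LD = is_functorD[OF L]
  have C': "Cmp (subPSh T) = Cmp (functor_cat (opp C) Set_cat)" by simp
  obtain \<theta> where \<theta>': "\<forall>X\<in>Ob (subPSh T). \<forall>A\<in>Ob C. bij_betw (\<theta> X A) (Hom C (fo L X) A) (Hom (subPSh T) X (Y A))"
    "\<forall>X\<in>Ob (subPSh T). \<forall>X'\<in>Ob (subPSh T). \<forall>A\<in>Ob C. \<forall>A'\<in>Ob C.
       \<forall>h\<in>Hom (subPSh T) X' X. \<forall>k\<in>Hom C (fo L X) A. \<forall>g\<in>Hom C A A'.
       \<theta> X' A' (Cmp C (fo L X') A A' g (Cmp C (fo L X') (fo L X) A k (fa L X' X h))) =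
       ntcomp X' (Y A) (Y A') (fa (yoneda C) A A' g) (ntcomp X' X (Y A) (\<theta> X A k) h)"
    using adj unfolding left_adjoint_def C' by (elim conjE exE) rule
  have \<theta>: "\<And>X A. X \<in> Ob (subPSh T) \<Longrightarrow> A \<in> Ob C \<Longrightarrow> bij_betw (\<theta> X A) (Hom C (fo L X) A) (Hom (subPSh T) X (Y A))"
    "\<And>X X' A A' h k g. X \<in> Ob (subPSh T) \<Longrightarrow> X' \<in> Ob (subPSh T) \<Longrightarrow> A \<in> Ob C \<Longrightarrow> A' \<in> Ob C \<Longrightarrow>
       h \<in> Hom (subPSh T) X' X \<Longrightarrow> k \<in> Hom C (fo L X) A \<Longrightarrow> g \<in> Hom C A A' \<Longrightarrow>
       \<theta> X' A' (Cmp C (fo L X') A A' g (Cmp C (fo L X') (fo L X) A k (fa L X' X h))) =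
       ntcomp X' (Y A) (Y A') (fa (yoneda C) A A' g) (ntcomp X' X (Y A) (\<theta> X A k) h)"
    using \<theta>' by blast+
  \<comment> \<open>The unit is the transpose of the identity; by naturality \<open>\<theta>\<close>
    is composition with it.\<close>
  define \<eta> where "\<eta> X = \<theta> X (fo L X) (Ide C (fo L X))" for X
  have ob: "X \<in> Ob (subPSh T)" "fo L X \<in> Ob C" if "X \<in> T" "small_presheaf C X" for X
    using that LD(3)[of X] by auto
  have n\<eta>: "nt X (Y (fo L X)) (\<eta> X)" if X: "X \<in> T" "small_presheaf C X" for X
  proof -
    have "\<eta> X \<in> Hom (subPSh T) X (Y (fo L X))"
      unfolding \<eta>_def by (rule bij_betw_apply[OF \<theta>(1)[OF ob[OF X]] idC[OF ob(2)[OF X]]])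
    then show ?thesis unfolding Hom_subPSh by blast
  qed
  have \<eta>nat: "ntcomp X' (Y (fo L X')) (Y (fo L X)) (fa (yoneda C) (fo L X') (fo L X) (fa L X' X h)) (\<eta> X') = ntcomp X' X (Y (fo L X)) (\<eta> X) h"
    if h: "h \<in> Hom (subPSh T) X' X" for X X' h
  proof -
    have X: "X \<in> T" "small_presheaf C X" "X' \<in> T" "small_presheaf C X'" "nt X' X h" using h unfolding Hom_subPSh by blast+
    note o = ob[OF X(1,2)] and o' = ob[OF X(3,4)]
    note Lh = LD(4)[OF h]
    have i: "ntid X' \<in> Hom (subPSh T) X' X'" using category.Ide_Hom[OF category_subPSh o'(1)] by simp
    have "\<theta> X' (fo L X) (fa L X' X h) = ntcomp X' (Y (fo L X)) (Y (fo L X)) (ntid (Y (fo L X))) (ntcomp X' X (Y (fo L X)) (\<eta> X) h)"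
      using \<theta>(2)[OF o(1) o'(1) o(2) o(2) h idC[OF o(2)] idC[OF o(2)]] id_compC[OF Lh] yoneda_id[OF o(2)] unfolding \<eta>_def by simp
    also have "\<dots> = ntcomp X' X (Y (fo L X)) (\<eta> X) h" by (rule ntid_comp(1)[OF nt_comp[OF X(5) n\<eta>[OF X(1,2)]]])
    finally have 1: "\<theta> X' (fo L X) (fa L X' X h) = ntcomp X' X (Y (fo L X)) (\<eta> X) h" .
    have "\<theta> X' (fo L X) (fa L X' X h) = ntcomp X' (Y (fo L X')) (Y (fo L X)) (fa (yoneda C) (fo L X') (fo L X) (fa L X' X h)) (\<eta> X')"
      using \<theta>(2)[OF o'(1) o'(1) o'(2) o(2) i idC[OF o'(2)] Lh] LD(5)[OF o'(1)] idC[OF o'(2)] comp_idC[OF idC[OF o'(2)]] comp_idC[OF Lh]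
        ntid_comp(2)[OF n\<eta>[OF X(3,4)]] unfolding \<eta>_def by simp
    then show ?thesis using 1 by simp
  qed
  have \<theta>\<eta>: "\<theta> X A k = ntcomp X (Y (fo L X)) (Y A) (fa (yoneda C) (fo L X) A k) (\<eta> X)"
    if X: "X \<in> T" "small_presheaf C X" and k: "k \<in> Hom C (fo L X) A" for X A k
  proof -
    note o = ob[OF X]
    have i: "ntid X \<in> Hom (subPSh T) X X" using category.Ide_Hom[OF category_subPSh o(1)] by simp
    show ?thesis
      using \<theta>(2)[OF o(1) o(1) o(2) cod[OF k] i idC[OF o(2)] k] LD(5)[OF o(1)] comp_idC[OF idC[OF o(2)]] comp_idC[OF k]
        ntid_comp(2)[OF n\<eta>[OF X]] unfolding \<eta>_def by simp
  qed
  \<comment> \<open>Finality of the unit is the bijectivity of transposition.\<close>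
  have final_\<eta>: "final C X (Y (fo L X)) (\<eta> X)" if X: "X \<in> T" "small_presheaf C X" for X
  proof (rule finalI[OF X(2) small_presheaf_Y[OF ob(2)[OF X]] n\<eta>[OF X]])
    note o = ob[OF X]
    fix D g assume D: "D \<in> Ob C" and g: "nt X (Y D) g"
    have "g \<in> Hom (subPSh T) X (Y D)" unfolding Hom_subPSh using X g T[OF D] small_presheaf_Y[OF D] by blast
    then obtain k where k: "k \<in> Hom C (fo L X) D" "g = \<theta> X D k"
      using \<theta>(1)[OF o(1) D] unfolding bij_betw_def by blast
    then show "\<exists>h. nt (Y (fo L X)) (Y D) h \<and> ntcomp X (Y (fo L X)) (Y D) h (\<eta> X) = g"
      using \<theta>\<eta>[OF X k(1)] nt_yoneda[OF k(1)] by metis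
  next
    note o = ob[OF X]
    fix D h h' assume D: "D \<in> Ob C" and h: "nt (Y (fo L X)) (Y D) h" "nt (Y (fo L X)) (Y D) h'"
      and e: "ntcomp X (Y (fo L X)) (Y D) h (\<eta> X) = ntcomp X (Y (fo L X)) (Y D) h' (\<eta> X)"
    obtain k k' where k: "k \<in> Hom C (fo L X) D" "h = fa (yoneda C) (fo L X) D k"
      "k' \<in> Hom C (fo L X) D" "h' = fa (yoneda C) (fo L X) D k'" using nt_Y_Y[OF o(2)] h by metis
    have "\<theta> X D k = \<theta> X D k'" using e k \<theta>\<eta>[OF X] by simp
    then have "k = k'" using \<theta>(1)[OF o(1) D] k unfolding bij_betw_def inj_on_def by blast
    then show "h = h'" using k by simp
  qed
  \<comment> \<open>Both units in the naturality square are final, so by two-out-of-three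
    \<open>h\<close> is final exactly if its reflection is, and a morphism of representables is
    final exactly if it is invertible.\<close>
  have L_iso: "final C X X' h \<longleftrightarrow> iso (fo L X) (fo L X') (fa L X X' h)" if h: "h \<in> Hom (subPSh T) X X'" for X X' h
  proof -
    have X: "X \<in> T" "small_presheaf C X" "X' \<in> T" "small_presheaf C X'" "nt X X' h" using h unfolding Hom_subPSh by blast+
    note Lh = LD(4)[OF h]
    have "final C X X' h \<longleftrightarrow> final C X (Y (fo L X')) (ntcomp X X' (Y (fo L X')) (\<eta> X') h)"
      using final_comp[OF _ final_\<eta>[OF X(3,4)]] final_cancel_left[OF X(5,2) final_\<eta>[OF X(3,4)]] by blast
    also have "\<dots> \<longleftrightarrow> final C (Y (fo L X)) (Y (fo L X')) (fa (yoneda C) (fo L X) (fo L X') (fa L X X' h))"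
      unfolding \<eta>nat[OF h, symmetric]
      using final_comp[OF final_\<eta>[OF X(1,2)]] final_cancel_right[OF nt_yoneda[OF Lh] small_presheaf_Y[OF cod[OF Lh]] final_\<eta>[OF X(1,2)]] by blast
    finally show ?thesis unfolding final_yoneda_iff[OF Lh] .
  qed
  \<comment> \<open>\<open>L\<close> carries the square to a pullback in \<open>C\<close>, where the
    reflection of \<open>f\<close> is invertible and hence so is that of \<open>q\<close>.\<close>
  have stable: "final C P H q"
    if f: "final C F G f" "F \<in> T" "G \<in> T" and g: "nt H G g" "H \<in> T" "small_presheaf C H"
      and P: "pullback F H f g P p q" "small_presheaf C P" for F G H f g P p q
  proof -
    note s = finalD[OF f(1)]
    have isP: "is_pullback (PSh C) F H G f g P p q"
      unfolding is_pullback_iff[OF s(1) g(3) s(2) P(2) s(3) g(1)] by (rule P(1))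
    have PT: "P \<in> T" by (rule Tlim[OF f(2) g(2) f(3) isP])
    have hom: "f \<in> Hom (subPSh T) F G" "g \<in> Hom (subPSh T) H G" "q \<in> Hom (subPSh T) P H"
      unfolding Hom_subPSh using s f g P PT pullbackD(2)[OF P(1)] by blast+
    let ?S = "cospan_fctr (subPSh T) F H G f g"
    let ?\<pi> = "\<lambda>i :: nat. if i = 0 then p else if i = 1 then q else ntcomp P F G f p"
    have "is_pullback (subPSh T) F H G f g P p q" by (rule pullback_imp_is_pullback[OF P PT hom(1,2)])
    then have "is_limit cospan (subPSh T) ?S P ?\<pi>" unfolding is_limit_cospan[OF category_subPSh hom(1,2)] by simp
    then have lim: "is_limit cospan C (fcomp L ?S) (fo L P) (\<lambda>j. fa L P (fo ?S j) (?\<pi> j))"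
      using lex finite_category_cospan is_functor_cospan[OF category_subPSh hom(1,2)]
      unfolding preserves_finite_limits_def by blast
    have catc: "category cospan" using finite_category_cospan finite_category_def by blast
    note Lf = LD(4)[OF hom(1)] and Lg = LD(4)[OF hom(2)]
    have "is_limit cospan C (cospan_fctr C (fo L F) (fo L H) (fo L G) (fa L F G f) (fa L H G g)) (fo L P) (\<lambda>j. fa L P (fo ?S j) (?\<pi> j))"
    proof (rule is_limit_cong[OF catc, THEN iffD1, OF _ _ lim])
      fix j assume "j \<in> Ob cospan"
      then show "fo (fcomp L ?S) j = fo (cospan_fctr C (fo L F) (fo L H) (fo L G) (fa L F G f) (fa L H G g)) j"
        by (auto simp: cospan_fctr_Ob)
    next
      fix i j u assume u: "u \<in> Hom cospan i j"
      have F: "F \<in> Ob (subPSh T)" "H \<in> Ob (subPSh T)" "G \<in> Ob (subPSh T)" using s f g by auto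
      show "fa (fcomp L ?S) i j u = fa (cospan_fctr C (fo L F) (fo L H) (fo L G) (fa L F G f) (fa L H G g)) i j u"
        using u LD(5)[OF F(1)] LD(5)[OF F(2)] LD(5)[OF F(3)] unfolding cospan_Hom
        by (auto simp: cospan_fctr_fa cospan_fctr_fa[unfolded One_nat_def] cospan_fctr_Ob)
    qed
    then have "is_pullback C (fo L F) (fo L H) (fo L G) (fa L F G f) (fa L H G g) (fo L P) (fa L P F p) (fa L P H q)"
      unfolding is_limit_cospan[OF cat Lf Lg] by (simp add: cospan_fctr_Ob)
    from iso_pullback[OF this] have "iso (fo L P) (fo L H) (fa L P H q)" using L_iso[OF hom(1)] f(1) by blast
    then show ?thesis using L_iso[OF hom(3)] by blast
  qed
  note s = finalD[OF f(1)]
  have cov: "cover A (im_sieve F G f A y)"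
    if f: "final C F G f" "F \<in> T" "G \<in> T" and A: "A \<in> Ob C" "y \<in> fo G A" for F G f A y
  proof (rule cover_im_sieveI[OF finalD(3,1,2)[OF f(1)] _ A])
    fix B y P p q assume B: "B \<in> Ob C" "y \<in> fo G B" and P: "pullback F (Y B) f (yo G B y) P p q" "small_presheaf C P"
    show "final C P (Y B) q"
      by (rule stable[OF f nt_yo[OF ntD(2)[OF finalD(3)[OF f(1)]] B] T[OF B(1)] small_presheaf_Y[OF B(1)] P])
  qed
  obtain R p q where R: "small_presheaf C R" "pullback F F f f R p q" by (rule pullback_exists[OF s(1,1,2) s(3,3)])
  have isR: "is_pullback (PSh C) F F G f f R p q"
    unfolding is_pullback_iff[OF s(1,1,2) R(1) s(3,3)] by (rule R(2))
  have RT: "R \<in> T" by (rule Tlim[OF f(2,2,3) isR])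
  note D = pullbackD[OF R(2)]
  \<comment> \<open>\<open>q\<close> is the pullback of \<open>f\<close> along itself. The diagonal
    is a section of it, hence final by cancellation, so that its image sieves are covers
    too.\<close>
  have q: "final C R F q" by (rule stable[OF f s(3) f(2) s(1) R(2,1)])
  have "ntid F \<in> Hom (PSh C) F F" using s nt_id[OF ntD(1)[OF s(3)]] by simp
  then have "\<exists>\<delta>. \<delta> \<in> Hom (PSh C) F R \<and> Cmp (PSh C) F R F p \<delta> = ntid F \<and> Cmp (PSh C) F R F q \<delta> = ntid F"
    using isR s(1) unfolding is_pullback_def by (metis PSh_simps(1))
  then obtain \<delta> where \<delta>: "nt F R \<delta>" "ntcomp F R F p \<delta> = ntid F" "ntcomp F R F q \<delta> = ntid F" by auto
  have \<delta>': "p A (\<delta> A x) = x" "q A (\<delta> A x) = x" if "A \<in> Ob C" "x \<in> fo F A" for A x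
    using fun_cong[OF fun_cong[OF \<delta>(2), of A], of x] fun_cong[OF fun_cong[OF \<delta>(3), of A], of x] that by simp_all
  have "final C F F (ntid F)"
    using bicovering_imp_final[OF bicovering_id[OF ntD(1)[OF s(3)]] s(1,1)] .
  then have \<delta>f: "final C F R \<delta>" by (intro final_cancel_left[OF \<delta>(1) s(1) q]) (simp only: \<delta>(3))
  show ?thesis unfolding bicovering_def
  proof (intro conjI ballI impI s(3) cov[OF f])
    fix A x x' assume A: "A \<in> Ob C" and x: "x \<in> fo F A" "x' \<in> fo F A" "f A x = f A x'"
    obtain r where r: "r \<in> fo R A" "p A r = x" "q A r = x'" using D(4)[OF A x] by blast
    show "cover A (eq_sieve F A x x')"
      using cov[OF \<delta>f f(2) RT A r(1)] diagonal_im_sieve[OF R(2) \<delta>(1) \<delta>' A r(1)] r(2,3) by simp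
  qed
qed

end

text \<open>By the Yoneda lemma, weighted cocones under the diagram of representables are cocones in
  the sense of Kan extensions. This is how the source of a \<Phi>-lex-colimit morphism is seen to
  lie in \<open>lex_closure \<Phi> C\<close>.\<close>

lemma (in weighted_diagram) lan_weighted_colimit:
  assumes X: "lan X \<epsilon>"
  shows "is_weighted_colimit K \<phi> (PSh C) (fcomp (yoneda C) D) X (\<lambda>k p. yo X (fo D k) (\<epsilon> k p))"
proof -
  have small: "small_presheaf C X" by (rule lan_small_presheaf[OF X])
  have X': "psh X" and \<epsilon>: "\<And>k p. k \<in> Ob K \<Longrightarrow> p \<in> fo \<phi> k \<Longrightarrow> \<epsilon> k p \<in> fo X (fo D k)"
    "\<And>k l g q. g \<in> Hom K k l \<Longrightarrow> q \<in> fo \<phi> l \<Longrightarrow> \<epsilon> k (fa \<phi> l k g q) = fa X (fo D l) (fo D k) (fa D k l g) (\<epsilon> l q)"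
    using X unfolding lan_def cocone_def by blast+
  have yo: "nt (Y (fo D k)) X (yo X (fo D k) (\<epsilon> k p))" if "k \<in> Ob K" "p \<in> fo \<phi> k" for k p
    by (rule nt_yo[OF X' D_Ob[OF that(1)] \<epsilon>(1)[OF that]])
  show ?thesis unfolding is_weighted_colimit_def
  proof (intro conjI allI impI)
    show "weighted_cocone K \<phi> (PSh C) (fcomp (yoneda C) D) X (\<lambda>k p. yo X (fo D k) (\<epsilon> k p))"
      unfolding weighted_cocone_def
    proof (intro conjI ballI)
      show "X \<in> Ob (PSh C)" using small by simp
      fix k p assume "k \<in> Ob K" "p \<in> fo \<phi> k"
      then show "yo X (fo D k) (\<epsilon> k p) \<in> Hom (PSh C) (fo (fcomp (yoneda C) D) k) X"
        using small small_presheaf_Y yo by simp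
    next
      fix k l f q assume kl: "k \<in> Ob K" "l \<in> Ob K" and f: "f \<in> Hom K k l" and q: "q \<in> fo \<phi> l"
      note Df = D_Hom[OF f]
      have "yo X (fo D k) (\<epsilon> k (fa \<phi> l k f q)) =
        ntcomp (Y (fo D k)) (Y (fo D l)) X (yo X (fo D l) (\<epsilon> l q)) (fa (yoneda C) (fo D k) (fo D l) (fa D k l f))"
      proof (rule nt_eqI[OF yo[OF kl(1) \<phi>_in[OF f q]] nt_comp[OF nt_yoneda[OF Df] yo[OF kl(2) q]]])
        fix A u assume A: "A \<in> Ob C" and "u \<in> fo (Y (fo D k)) A"
        then have u: "u \<in> Hom C A (fo D k)" by simp
        show "yo X (fo D k) (\<epsilon> k (fa \<phi> l k f q)) A u =
          ntcomp (Y (fo D k)) (Y (fo D l)) X (yo X (fo D l) (\<epsilon> l q)) (fa (yoneda C) (fo D k) (fo D l) (fa D k l f)) A u"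
          using A u \<epsilon>(2)[OF f q] psh_comp[OF X' Df u \<epsilon>(1)[OF kl(2) q]] yoneda_apply[OF Df u] compC[OF u Df] by simp
      qed
      then show "yo X (fo D k) (\<epsilon> k (fa \<phi> l k f q)) = Cmp (PSh C) (fo (fcomp (yoneda C) D) k) (fo (fcomp (yoneda C) D) l) X
         (yo X (fo D l) (\<epsilon> l q)) (fa (fcomp (yoneda C) D) k l f)" by simp
    qed
  next
    fix G \<sigma> assume c: "weighted_cocone K \<phi> (PSh C) (fcomp (yoneda C) D) G \<sigma>"
    then have G: "small_presheaf C G" and \<sigma>: "\<And>k p. k \<in> Ob K \<Longrightarrow> p \<in> fo \<phi> k \<Longrightarrow> nt (Y (fo D k)) G (\<sigma> k p)"
      "\<And>k l f q. k \<in> Ob K \<Longrightarrow> l \<in> Ob K \<Longrightarrow> f \<in> Hom K k l \<Longrightarrow> q \<in> fo \<phi> l \<Longrightarrow> \<sigma> k (fa \<phi> l k f q) =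
         ntcomp (Y (fo D k)) (Y (fo D l)) G (\<sigma> l q) (fa (yoneda C) (fo D k) (fo D l) (fa D k l f))"
      unfolding weighted_cocone_def by simp_all
    define \<tau> where "\<tau> k p = \<sigma> k p (fo D k) (Ide C (fo D k))" for k p
    have \<tau>: "\<tau> k p \<in> fo G (fo D k)" "\<sigma> k p = yo G (fo D k) (\<tau> k p)" if "k \<in> Ob K" "p \<in> fo \<phi> k" for k p
      using ntD(4)[OF \<sigma>(1)[OF that] D_Ob[OF that(1)], of "Ide C (fo D k)"] nt_Y[OF D_Ob[OF that(1)] \<sigma>(1)[OF that]] that(1)
      unfolding \<tau>_def by simp_all
    have "cocone G \<tau>" unfolding cocone_def
    proof (intro conjI ballI allI impI small_presheaf_psh[OF G] \<tau>(1))
      fix k l g q assume g: "g \<in> Hom K k l" and q: "q \<in> fo \<phi> l"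
      note k = domK[OF g] and l = codK[OF g] and Dg = D_Hom[OF g]
      have "\<tau> k (fa \<phi> l k g q) = \<sigma> l q (fo D k) (fa D k l g)"
        unfolding \<tau>_def \<sigma>(2)[OF k l g q] using k yoneda_apply[OF Dg idC[OF D_Ob[OF k]]] comp_idC[OF Dg] by simp
      also have "\<dots> = fa G (fo D l) (fo D k) (fa D k l g) (\<tau> l q)" unfolding \<tau>(2)[OF l q] using Dg by simp
      finally show "\<tau> k (fa \<phi> l k g q) = fa G (fo D l) (fo D k) (fa D k l g) (\<tau> l q)" .
    qed
    then have "\<exists>!t. nt X G t \<and> (\<forall>k\<in>Ob K. \<forall>p\<in>fo \<phi> k. t (fo D k) (\<epsilon> k p) = \<tau> k p)"
      using X by (simp only: lan_def)
    moreover have "ntcomp (Y (fo D k)) X G t (yo X (fo D k) (\<epsilon> k p)) = \<sigma> k p \<longleftrightarrow> t (fo D k) (\<epsilon> k p) = \<tau> k p"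
      if t: "nt X G t" and k: "k \<in> Ob K" "p \<in> fo \<phi> k" for t k p
    proof
      assume e: "ntcomp (Y (fo D k)) X G t (yo X (fo D k) (\<epsilon> k p)) = \<sigma> k p"
      show "t (fo D k) (\<epsilon> k p) = \<tau> k p"
        unfolding \<tau>_def e[symmetric] using k \<epsilon>(1)[OF k] psh_id[OF X'] by simp
    next
      assume e: "t (fo D k) (\<epsilon> k p) = \<tau> k p"
      show "ntcomp (Y (fo D k)) X G t (yo X (fo D k) (\<epsilon> k p)) = \<sigma> k p"
      proof (rule nt_eqI[OF nt_comp[OF yo[OF k] t] \<sigma>(1)[OF k]])
        fix A u assume A: "A \<in> Ob C" and "u \<in> fo (Y (fo D k)) A"
        then have u: "u \<in> Hom C A (fo D k)" by simp
        show "ntcomp (Y (fo D k)) X G t (yo X (fo D k) (\<epsilon> k p)) A u = \<sigma> k p A u"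
          unfolding \<tau>(2)[OF k] using A u ntD(5)[OF t u \<epsilon>(1)[OF k]] e by simp
      qed
    qed
    then have "(nt X G t \<and> (\<forall>k\<in>Ob K. \<forall>p\<in>fo \<phi> k. t (fo D k) (\<epsilon> k p) = \<tau> k p)) \<longleftrightarrow>
      (t \<in> Hom (PSh C) X G \<and> (\<forall>k\<in>Ob K. \<forall>p\<in>fo \<phi> k. Cmp (PSh C) (fo (fcomp (yoneda C) D) k) X G t (yo X (fo D k) (\<epsilon> k p)) = \<sigma> k p))" for t
      using small G by auto
    ultimately show "\<exists>!t. t \<in> Hom (PSh C) X G \<and> (\<forall>k\<in>Ob K. \<forall>p\<in>fo \<phi> k.
        Cmp (PSh C) (fo (fcomp (yoneda C) D) k) X G t (yo X (fo D k) (\<epsilon> k p)) = \<sigma> k p)" by simp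
  qed
qed

section \<open>\<Phi>-lex-colimit morphisms as morphisms of the lex-cocompletion\<close>

context site
begin

lemma weighted_diagram_of_weight:
  assumes "lex_weight (K, \<phi>)" "lex_functor K C D"
  shows "weighted_diagram C K \<phi> D"
proof (rule weighted_diagram.intro[OF site_axioms weighted_diagram_axioms.intro])
  show "is_functor K C D" using assms(2) unfolding lex_functor_def by blast
  show "is_functor (opp K) Set_cat \<phi>" "small TYPE('u) (Ob K)" using assms(1) unfolding lex_weight_def by auto
  fix k l assume "k \<in> Ob K" "l \<in> Ob K"
  then show "small TYPE('u) (Hom K k l)" using assms(1) unfolding lex_weight_def locally_small_def by auto
qed

lemma lex_closure_Y: "A \<in> Ob C \<Longrightarrow> Y A \<in> lex_closure \<Phi> C"
  by (rule lex_closure.representable)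

lemma lex_closure_pullback:
  assumes "F \<in> lex_closure \<Phi> C" "H \<in> lex_closure \<Phi> C" "G \<in> lex_closure \<Phi> C"
    and P: "is_pullback (PSh C) F H G f g P p q"
  shows "P \<in> lex_closure \<Phi> C"
proof -
  have f: "f \<in> Hom (PSh C) F G" "g \<in> Hom (PSh C) H G" using P unfolding is_pullback_def by blast+
  let ?\<pi> = "\<lambda>i :: nat. if i = 0 then p else if i = 1 then q else Cmp (PSh C) P F G f p"
  show ?thesis
  proof (rule lex_closure.finite_limit[OF finite_category_cospan is_functor_cospan[OF category_PSh f]])
    fix j assume "j \<in> Ob cospan"
    then show "fo (cospan_fctr (PSh C) F H G f g) j \<in> lex_closure \<Phi> C" using assms by (auto simp: cospan_fctr_Ob)
  next
    show "is_limit cospan (PSh C) (cospan_fctr (PSh C) F H G f g) P ?\<pi>"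
      unfolding is_limit_cospan[OF category_PSh f] using P by simp
  qed
qed

text \<open>The source of a \<Phi>-lex-colimit morphism is a \<Phi>-lex-colimit of representables,
  since the Yoneda embedding is lex, and the target is representable. So the morphism is a final
  morphism of the lex-cocompletion, to which the reflector applies.\<close>

lemma lex_exact_imp_postulated:
  assumes \<Phi>: "\<forall>w\<in>\<Phi>. lex_weight w" and ex: "lex_exact \<Phi> C"
  shows "lex_colimits_postulated \<Phi> C"
  unfolding lex_colimits_postulated_def
proof (intro allI impI)
  fix X Z f assume "lex_colimit_morphism \<Phi> C X Z f"
  then obtain K \<phi> D \<eta> A \<sigma> where f: "final C X Z f" and K: "(K, \<phi>) \<in> \<Phi>" and lexD: "lex_functor K C D"
    and \<eta>: "is_lan (opp K) (opp C) Set_cat (fop D) \<phi> X \<eta>"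
    and A: "is_weighted_colimit K \<phi> C D A \<sigma>" "Z = Y A"
    unfolding lex_colimit_morphism_def by blast
  obtain L where L: "left_adjoint C (subPSh (lex_closure \<Phi> C)) L (yoneda C)"
    "preserves_finite_limits (subPSh (lex_closure \<Phi> C)) C L"
    using ex unfolding lex_exact_def lex_cocompletion_def by blast
  interpret weighted_diagram C K \<phi> D
    by (rule weighted_diagram_of_weight[OF _ lexD]) (use \<Phi> K in blast)
  have "X \<in> lex_closure \<Phi> C"
  proof (rule lex_closure.lex_colimit[OF K lex_functor_fcomp[OF lexD lex_yoneda] _ lan_weighted_colimit[OF is_lan_imp_lan[OF \<eta>]]])
    fix k assume "k \<in> Ob K"
    then show "fo (fcomp (yoneda C) D) k \<in> lex_closure \<Phi> C" using lex_closure_Y by simp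
  qed
  moreover have "A \<in> Ob C" using A unfolding is_weighted_colimit_def weighted_cocone_def by blast
  ultimately have XZ: "X \<in> lex_closure \<Phi> C" "Z \<in> lex_closure \<Phi> C" using lex_closure_Y A(2) by simp_all
  have "bicovering X Z f"
  proof (rule lex_reflector_final_bicovering[OF _ _ L f XZ])
    fix A assume "A \<in> Ob C" then show "Y A \<in> lex_closure \<Phi> C" by (rule lex_closure_Y)
  next
    fix F H G f g P p q
    assume "F \<in> lex_closure \<Phi> C" "H \<in> lex_closure \<Phi> C" "G \<in> lex_closure \<Phi> C" "is_pullback (PSh C) F H G f g P p q"
    then show "P \<in> lex_closure \<Phi> C" by (rule lex_closure_pullback)
  qed
  then show "postulated C X Z f" by (rule bicovering_imp_postulated[OF _ finalD(1,2)[OF f]])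
qed

section \<open>Presheaves that are bicovered by a representable\<close>

definition bicovered :: "('o, 'u) presheaf set" where
  "bicovered = {F. small_presheaf C F \<and> (\<exists>A f. A \<in> Ob C \<and> bicovering F (Y A) f)}"

definition refl_ob :: "('o, 'u) presheaf \<Rightarrow> 'o" where
  "refl_ob F = (SOME A. A \<in> Ob C \<and> (\<exists>f. bicovering F (Y A) f))"

definition unit :: "('o, 'u) presheaf \<Rightarrow> 'o \<Rightarrow> 'u \<Rightarrow> 'u" where
  "unit F = (SOME f. bicovering F (Y (refl_ob F)) f)"

text \<open>On arrows, the unique filler of the naturality square of the units. It is meaningful on
  all of \<open>bicovered\<close>, so it is available while \<open>lex_closure \<Phi> C\<close> is
  being shown to lie there.\<close>

definition reflector :: "(('o, 'u) presheaf, 'o \<Rightarrow> 'u \<Rightarrow> 'u, 'o, 'u) fctr" where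
  "reflector = \<lparr>fo = refl_ob, fa = (\<lambda>F G h. SOME k. k \<in> Hom C (refl_ob F) (refl_ob G) \<and>
     ntcomp F (Y (refl_ob F)) (Y (refl_ob G)) (fa (yoneda C) (refl_ob F) (refl_ob G) k) (unit F) = ntcomp F G (Y (refl_ob G)) (unit G) h)\<rparr>"

lemma bicoveredI: "small_presheaf C F \<Longrightarrow> A \<in> Ob C \<Longrightarrow> bicovering F (Y A) f \<Longrightarrow> F \<in> bicovered"
  unfolding bicovered_def by blast

lemma bicovered_small: "F \<in> bicovered \<Longrightarrow> small_presheaf C F" unfolding bicovered_def by blast

lemma Y_bicovered: "A \<in> Ob C \<Longrightarrow> Y A \<in> bicovered"
  by (rule bicoveredI[OF small_presheaf_Y _ bicovering_id[OF psh_Y]])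

lemma
  assumes "F \<in> bicovered"
  shows refl_ob: "refl_ob F \<in> Ob C" and unit_bicovering: "bicovering F (Y (refl_ob F)) (unit F)"
proof -
  have "\<exists>A. A \<in> Ob C \<and> (\<exists>f. bicovering F (Y A) f)" using assms unfolding bicovered_def by blast
  from someI_ex[OF this] have r: "refl_ob F \<in> Ob C \<and> (\<exists>f. bicovering F (Y (refl_ob F)) f)" unfolding refl_ob_def .
  then show "refl_ob F \<in> Ob C" by blast
  show "bicovering F (Y (refl_ob F)) (unit F)" unfolding unit_def using someI_ex[OF conjunct2[OF r]] .
qed

lemma nt_unit: "F \<in> bicovered \<Longrightarrow> nt F (Y (refl_ob F)) (unit F)"
  using unit_bicovering bicoveringD(1) by blast

lemma final_unit: "F \<in> bicovered \<Longrightarrow> final C F (Y (refl_ob F)) (unit F)"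
  by (rule bicovering_imp_final[OF unit_bicovering bicovered_small small_presheaf_Y[OF refl_ob]])

lemma unit_ex:
  assumes F: "F \<in> bicovered" and g: "nt F (Y D) g" "D \<in> Ob C"
  shows "\<exists>k. k \<in> Hom C (refl_ob F) D \<and> ntcomp F (Y (refl_ob F)) (Y D) (fa (yoneda C) (refl_ob F) D k) (unit F) = g"
proof -
  obtain h where h: "nt (Y (refl_ob F)) (Y D) h" "ntcomp F (Y (refl_ob F)) (Y D) h (unit F) = g"
    using final_ex[OF final_unit[OF F] g(2,1)] by blast
  then show ?thesis using nt_Y_Y[OF refl_ob[OF F] h(1)] by metis
qed

lemma unit_unique:
  assumes F: "F \<in> bicovered" and k: "k \<in> Hom C (refl_ob F) D" "k' \<in> Hom C (refl_ob F) D"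
    and e: "ntcomp F (Y (refl_ob F)) (Y D) (fa (yoneda C) (refl_ob F) D k) (unit F) =
      ntcomp F (Y (refl_ob F)) (Y D) (fa (yoneda C) (refl_ob F) D k') (unit F)"
  shows "k = k'"
  by (rule yoneda_inj[OF k])
    (rule final_unique[OF final_unit[OF F] cod[OF k(1)] nt_yoneda[OF k(1)] nt_yoneda[OF k(2)] e])

lemma fo_reflector [simp]: "fo reflector F = refl_ob F" by (simp add: reflector_def)

lemma fa_reflector:
  assumes "F \<in> bicovered" "G \<in> bicovered" "nt F G h"
  shows "fa reflector F G h \<in> Hom C (refl_ob F) (refl_ob G)"
    "ntcomp F (Y (refl_ob F)) (Y (refl_ob G)) (fa (yoneda C) (refl_ob F) (refl_ob G) (fa reflector F G h)) (unit F) =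
      ntcomp F G (Y (refl_ob G)) (unit G) h"
proof -
  have "\<exists>k. k \<in> Hom C (refl_ob F) (refl_ob G) \<and>
     ntcomp F (Y (refl_ob F)) (Y (refl_ob G)) (fa (yoneda C) (refl_ob F) (refl_ob G) k) (unit F) = ntcomp F G (Y (refl_ob G)) (unit G) h"
    by (rule unit_ex[OF assms(1) nt_comp[OF assms(3) nt_unit[OF assms(2)]] refl_ob[OF assms(2)]])
  from someI_ex[OF this]
  show "fa reflector F G h \<in> Hom C (refl_ob F) (refl_ob G)"
    "ntcomp F (Y (refl_ob F)) (Y (refl_ob G)) (fa (yoneda C) (refl_ob F) (refl_ob G) (fa reflector F G h)) (unit F) =
      ntcomp F G (Y (refl_ob G)) (unit G) h"
    unfolding reflector_def by simp_all
qed

lemma fa_reflector_apply: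
  assumes "F \<in> bicovered" "G \<in> bicovered" "nt F G h" "A \<in> Ob C" "x \<in> fo F A"
  shows "Cmp C A (refl_ob F) (refl_ob G) (fa reflector F G h) (unit F A x) = unit G A (h A x)"
proof -
  have "unit F A x \<in> Hom C A (refl_ob F)" using ntD(4)[OF nt_unit[OF assms(1)] assms(4,5)] by simp
  then show ?thesis
    using fun_cong[OF fun_cong[OF fa_reflector(2)[OF assms(1-3)], of A], of x] assms(4,5)
      yoneda_apply[OF fa_reflector(1)[OF assms(1-3)]] by simp
qed

section \<open>The reflector is a functor and preserves finite limits\<close>

lemma is_functor_reflector: "is_functor (subPSh bicovered) C reflector"
proof (rule is_functorI[OF category_subPSh cat])
  fix F assume "F \<in> Ob (subPSh bicovered)"
  then have F: "F \<in> bicovered" by simp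
  note r = refl_ob[OF F] and u = nt_unit[OF F] and i = nt_id[OF ntD(1)[OF nt_unit[OF F]]]
  show "fo reflector F \<in> Ob C" using r by simp
  have "fa reflector F F (ntid F) = Ide C (refl_ob F)"
  proof (rule unit_unique[OF F fa_reflector(1)[OF F F i] idC[OF r]])
    show "ntcomp F (Y (refl_ob F)) (Y (refl_ob F)) (fa (yoneda C) (refl_ob F) (refl_ob F) (fa reflector F F (ntid F))) (unit F) =
      ntcomp F (Y (refl_ob F)) (Y (refl_ob F)) (fa (yoneda C) (refl_ob F) (refl_ob F) (Ide C (refl_ob F))) (unit F)"
      unfolding fa_reflector(2)[OF F F i] yoneda_id[OF r] ntid_comp(1)[OF u] by (rule ntid_comp(2)[OF u])
  qed
  then show "fa reflector F F (Ide (subPSh bicovered) F) = Ide C (fo reflector F)" by simp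
next
  fix F G h assume "h \<in> Hom (subPSh bicovered) F G"
  then have h: "F \<in> bicovered" "G \<in> bicovered" "nt F G h" unfolding Hom_subPSh by blast+
  show "fa reflector F G h \<in> Hom C (fo reflector F) (fo reflector G)" using fa_reflector(1)[OF h] by simp
next
  fix F G H f g assume "f \<in> Hom (subPSh bicovered) F G" "g \<in> Hom (subPSh bicovered) G H"
  then have h: "F \<in> bicovered" "G \<in> bicovered" "H \<in> bicovered" "nt F G f" "nt G H g" unfolding Hom_subPSh by blast+
  note rf = fa_reflector[OF h(1,2,4)] and rg = fa_reflector[OF h(2,3,5)]
  note yf = nt_yoneda[OF rf(1)] and yg = nt_yoneda[OF rg(1)]
  have "fa reflector F H (ntcomp F G H g f) = Cmp C (refl_ob F) (refl_ob G) (refl_ob H) (fa reflector G H g) (fa reflector F G f)"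
  proof (rule unit_unique[OF h(1) fa_reflector(1)[OF h(1,3) nt_comp[OF h(4,5)]] compC[OF rf(1) rg(1)]])
    show "ntcomp F (Y (refl_ob F)) (Y (refl_ob H)) (fa (yoneda C) (refl_ob F) (refl_ob H) (fa reflector F H (ntcomp F G H g f))) (unit F) =
      ntcomp F (Y (refl_ob F)) (Y (refl_ob H)) (fa (yoneda C) (refl_ob F) (refl_ob H)
        (Cmp C (refl_ob F) (refl_ob G) (refl_ob H) (fa reflector G H g) (fa reflector F G f))) (unit F)"
      unfolding fa_reflector(2)[OF h(1,3) nt_comp[OF h(4,5)]] yoneda_comp[OF rf(1) rg(1)] ntassoc[OF nt_unit[OF h(1)] yf yg] rf(2)
        ntassoc[OF h(4,5) nt_unit[OF h(3)], symmetric] ntassoc[OF h(4) nt_unit[OF h(2)] yg, symmetric] rg(2) ..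
  qed
  then show "fa reflector F H (Cmp (subPSh bicovered) F G H g f) = Cmp C (fo reflector F) (fo reflector G) (fo reflector H) (fa reflector G H g) (fa reflector F G f)"
    by simp
qed

text \<open>Let \<open>M\<close> be the limit in \<open>C\<close> of the reflected diagram. The
  units induce \<open>h\<close> from \<open>P\<close> to \<open>Y M\<close>, the pointwise limit of
  their targets, and \<open>h\<close> is bicovering as a finite limit of bicovering morphisms. So
  \<open>P\<close> has a reflection at \<open>M\<close>; it agrees with the chosen one up to an
  isomorphism over the diagram, which is preservation of the limit.\<close>

lemma plim_bicovered:
  fixes J :: "(nat, nat) cat"
  assumes J: "finite_category J" and G: "is_functor J (subPSh bicovered) G" and P: "plim J G P \<pi>"
  shows "P \<in> bicovered" and "is_limit J C (fcomp reflector G) (refl_ob P) (\<lambda>j. fa reflector P (fo G j) (\<pi> j))"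
proof -
  note PD = plimD[OF P]
  have G': "is_functor J (PSh C) G" by (rule is_functor_of_full_sub[OF G category_PSh])
  have sP: "small_presheaf C P" using plim_small_generated[OF J G' P] small_presheaf_iff by blast
  have Gn: "fo G j \<in> bicovered" if "j \<in> Ob J" for j using is_functorD(3)[OF G that] by simp
  have Ga: "nt (fo G i) (fo G j) (fa G i j u)" "i \<in> Ob J" "j \<in> Ob J" if "u \<in> Hom J i j" for i j u
    using is_functorD(4)[OF G' that] category.Hom_Ob[OF is_functorD(1)[OF G'] that] by auto
  have S: "is_functor J C (fcomp reflector G)" by (rule is_functor_fcomp[OF G is_functor_reflector])
  obtain M \<mu> where M: "is_limit J C (fcomp reflector G) M \<mu>"
    using fin_complete J S unfolding finitely_complete_def by blast
  have YM: "plim J (fcomp (yoneda C) (fcomp reflector G)) (Y M) (\<lambda>j. fa (yoneda C) M (fo (fcomp reflector G) j) (\<mu> j))"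
    by (rule limit_yoneda_plim[OF S M])
  have M_Ob: "M \<in> Ob C" and \<mu>: "\<And>j. j \<in> Ob J \<Longrightarrow> \<mu> j \<in> Hom C M (refl_ob (fo G j))"
    using M unfolding is_limit_def is_cone_def by simp_all
  have u\<pi>: "nt P (Y (refl_ob (fo G j))) (ntcomp P (fo G j) (Y (refl_ob (fo G j))) (unit (fo G j)) (\<pi> j))" if "j \<in> Ob J" for j
    by (rule nt_comp[OF PD(2)[OF that] nt_unit[OF Gn[OF that]]])
  have nat: "unit (fo G j) A (fa G i j u A x) = fa (fcomp (yoneda C) (fcomp reflector G)) i j u A (unit (fo G i) A x)"
    if u: "u \<in> Hom J i j" and A: "A \<in> Ob C" "x \<in> fo (fo G i) A" for i j u A x
  proof -
    note n = Gn[OF Ga(2)[OF u]] Gn[OF Ga(3)[OF u]] Ga(1)[OF u]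
    have "unit (fo G i) A x \<in> Hom C A (refl_ob (fo G i))" using ntD(4)[OF nt_unit[OF n(1)] A] by simp
    then show ?thesis using fa_reflector_apply[OF n A] yoneda_apply[OF fa_reflector(1)[OF n]] by simp
  qed
  obtain h where h: "nt P (Y M) h" "\<And>j A x. j \<in> Ob J \<Longrightarrow> A \<in> Ob C \<Longrightarrow> x \<in> fo P A \<Longrightarrow>
      fa (yoneda C) M (refl_ob (fo G j)) (\<mu> j) A (h A x) = unit (fo G j) A (\<pi> j A x)"
  proof (rule plim_map[OF YM PD(1), where \<sigma> = "\<lambda>j. ntcomp P (fo G j) (Y (refl_ob (fo G j))) (unit (fo G j)) (\<pi> j)"])
    fix j assume "j \<in> Ob J"
    then show "nt P (fo (fcomp (yoneda C) (fcomp reflector G)) j) (ntcomp P (fo G j) (Y (refl_ob (fo G j))) (unit (fo G j)) (\<pi> j))"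
      using u\<pi> by simp
  next
    fix i j u A x assume u: "u \<in> Hom J i j" and A: "A \<in> Ob C" "x \<in> fo P A"
    have "\<pi> i A x \<in> fo (fo G i) A" by (rule ntD(4)[OF PD(2)[OF Ga(2)[OF u]] A])
    then show "fa (fcomp (yoneda C) (fcomp reflector G)) i j u A (ntcomp P (fo G i) (Y (refl_ob (fo G i))) (unit (fo G i)) (\<pi> i) A x) =
       ntcomp P (fo G j) (Y (refl_ob (fo G j))) (unit (fo G j)) (\<pi> j) A x"
      unfolding ntcomp_apply[where F=P, OF A] by (simp only: nat[OF u A(1), symmetric] PD(3)[OF u A])
  next
    fix h assume h: "nt P (Y M) h" "\<And>j A x. j \<in> Ob J \<Longrightarrow> A \<in> Ob C \<Longrightarrow> x \<in> fo P A \<Longrightarrow>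
      fa (yoneda C) M (fo (fcomp reflector G) j) (\<mu> j) A (h A x) = ntcomp P (fo G j) (Y (refl_ob (fo G j))) (unit (fo G j)) (\<pi> j) A x"
    show thesis by (rule that[OF h(1)]) (use h(2) in simp)
  qed
  have bic: "bicovering P (Y M) h"
  proof (rule bicovering_plim[OF J G' is_functor_fcomp[OF S is_functor_yoneda_PSh] _ nat P YM h(1)])
    fix j assume "j \<in> Ob J"
    then show "bicovering (fo G j) (fo (fcomp (yoneda C) (fcomp reflector G)) j) (unit (fo G j))" using unit_bicovering[OF Gn] by simp
  qed (use h(2) in simp_all)
  show Pn: "P \<in> bicovered" by (rule bicoveredI[OF sP M_Ob bic])
  \<comment> \<open>\<open>k\<close> compares the chosen unit of \<open>P\<close> with
    \<open>h\<close>; as both are final, it is invertible.\<close>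
  obtain k where k: "k \<in> Hom C (refl_ob P) M" "ntcomp P (Y (refl_ob P)) (Y M) (fa (yoneda C) (refl_ob P) M k) (unit P) = h"
    using unit_ex[OF Pn h(1) M_Ob] by blast
  have "final C (Y (refl_ob P)) (Y M) (fa (yoneda C) (refl_ob P) M k)"
    by (rule final_cancel_right[OF nt_yoneda[OF k(1)] small_presheaf_Y[OF M_Ob] final_unit[OF Pn]])
      (simp only: k(2) bicovering_imp_final[OF bic sP small_presheaf_Y[OF M_Ob]])
  then obtain k' where k': "k' \<in> Hom C M (refl_ob P)" "Cmp C (refl_ob P) M (refl_ob P) k' k = Ide C (refl_ob P)" "Cmp C M (refl_ob P) M k k' = Ide C M"
    unfolding final_yoneda_iff[OF k(1)] iso_def by blast
  have lim: "is_limit J C (fcomp reflector G) (refl_ob P) (\<lambda>j. Cmp C (refl_ob P) M (fo (fcomp reflector G) j) (\<mu> j) k)"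
    by (rule is_limit_iso[OF cat S M k(1) k'])
  have e: "Cmp C (refl_ob P) M (refl_ob (fo G j)) (\<mu> j) k = fa reflector P (fo G j) (\<pi> j)" if j: "j \<in> Ob J" for j
  proof (rule unit_unique[OF Pn compC[OF k(1) \<mu>[OF j]] fa_reflector(1)[OF Pn Gn[OF j] PD(2)[OF j]]])
    have "ntcomp P (Y (refl_ob P)) (Y (refl_ob (fo G j))) (fa (yoneda C) (refl_ob P) (refl_ob (fo G j)) (Cmp C (refl_ob P) M (refl_ob (fo G j)) (\<mu> j) k)) (unit P)
      = ntcomp P (Y M) (Y (refl_ob (fo G j))) (fa (yoneda C) M (refl_ob (fo G j)) (\<mu> j)) h"
      unfolding yoneda_comp[OF k(1) \<mu>[OF j]] ntassoc[OF nt_unit[OF Pn] nt_yoneda[OF k(1)] nt_yoneda[OF \<mu>[OF j]]] k(2) ..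
    also have "\<dots> = ntcomp P (fo G j) (Y (refl_ob (fo G j))) (unit (fo G j)) (\<pi> j)"
      by (rule nt_eqI[OF nt_comp[OF h(1) nt_yoneda[OF \<mu>[OF j]]] u\<pi>[OF j]]) (simp add: h(2)[OF j])
    finally show "ntcomp P (Y (refl_ob P)) (Y (refl_ob (fo G j))) (fa (yoneda C) (refl_ob P) (refl_ob (fo G j)) (Cmp C (refl_ob P) M (refl_ob (fo G j)) (\<mu> j) k)) (unit P)
      = ntcomp P (Y (refl_ob P)) (Y (refl_ob (fo G j))) (fa (yoneda C) (refl_ob P) (refl_ob (fo G j)) (fa reflector P (fo G j) (\<pi> j))) (unit P)"
      unfolding fa_reflector(2)[OF Pn Gn[OF j] PD(2)[OF j]] .
  qed
  have cone_cong: "is_limit J C (fcomp reflector G) (refl_ob P) \<rho> \<longleftrightarrow> is_limit J C (fcomp reflector G) (refl_ob P) \<rho>'"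
    if "\<And>j. j \<in> Ob J \<Longrightarrow> \<rho> j = \<rho>' j" for \<rho> \<rho>'
    unfolding is_limit_def is_cone_def using that by (simp cong: ball_cong)
  show "is_limit J C (fcomp reflector G) (refl_ob P) (\<lambda>j. fa reflector P (fo G j) (\<pi> j))"
    by (rule cone_cong[THEN iffD1, OF _ lim]) (simp add: e)
qed

end

context weighted_diagram
begin

section \<open>Lex-colimits of bicovering morphisms\<close>

lemma weighted_cocone_PSh_iff:
  assumes E: "is_functor K (PSh C) E"
  shows "weighted_cocone K \<phi> (PSh C) E X \<sigma> \<longleftrightarrow> small_presheaf C X \<and>
     (\<forall>k\<in>Ob K. \<forall>p\<in>fo \<phi> k. nt (fo E k) X (\<sigma> k p)) \<and>
     (\<forall>k l f q A x. f \<in> Hom K k l \<longrightarrow> q \<in> fo \<phi> l \<longrightarrow> A \<in> Ob C \<longrightarrow> x \<in> fo (fo E k) A \<longrightarrow>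
        \<sigma> k (fa \<phi> l k f q) A x = \<sigma> l q A (fa E k l f A x))" (is "?l \<longleftrightarrow> ?r")
proof
  assume ?l
  then have l: "small_presheaf C X" "\<And>k p. k \<in> Ob K \<Longrightarrow> p \<in> fo \<phi> k \<Longrightarrow> nt (fo E k) X (\<sigma> k p)"
    "\<And>k l f q. f \<in> Hom K k l \<Longrightarrow> q \<in> fo \<phi> l \<Longrightarrow>
       \<sigma> k (fa \<phi> l k f q) = ntcomp (fo E k) (fo E l) X (\<sigma> l q) (fa E k l f)"
    unfolding weighted_cocone_def using domK codK by simp_all
  show ?r
  proof (intro conjI ballI allI impI l(1,2))
    fix k l' f q A x assume "f \<in> Hom K k l'" "q \<in> fo \<phi> l'" "A \<in> Ob C" "x \<in> fo (fo E k) A"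
    then show "\<sigma> k (fa \<phi> l' k f q) A x = \<sigma> l' q A (fa E k l' f A x)" using l(3) by simp
  qed
next
  assume r: ?r
  show ?l unfolding weighted_cocone_def
  proof (intro conjI ballI)
    show "X \<in> Ob (PSh C)" using r by simp
    fix k p assume "k \<in> Ob K" "p \<in> fo \<phi> k"
    then show "\<sigma> k p \<in> Hom (PSh C) (fo E k) X" using r is_functorD(3)[OF E] by simp
  next
    fix k l f q assume k: "k \<in> Ob K" "l \<in> Ob K" "f \<in> Hom K k l" "q \<in> fo \<phi> l"
    have Ef: "nt (fo E k) (fo E l) (fa E k l f)" using is_functorD(4)[OF E k(3)] by simp
    have "nt (fo E k) X (\<sigma> k (fa \<phi> l k f q))" "nt (fo E l) X (\<sigma> l q)" using r k \<phi>_in[OF k(3,4)] by blast+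
    then have "\<sigma> k (fa \<phi> l k f q) = ntcomp (fo E k) (fo E l) X (\<sigma> l q) (fa E k l f)"
      by (intro nt_eqI[OF _ nt_comp[OF Ef]]) (use r k in simp_all)
    then show "\<sigma> k (fa \<phi> l k f q) = Cmp (PSh C) (fo E k) (fo E l) X (\<sigma> l q) (fa E k l f)" by simp
  qed
qed

lemma colimit_PSh_map:
  assumes E: "is_functor K (PSh C) E" and X: "is_weighted_colimit K \<phi> (PSh C) E X \<xi>"
    and \<sigma>: "weighted_cocone K \<phi> (PSh C) E G \<sigma>"
  shows "\<exists>t. nt X G t \<and> (\<forall>k\<in>Ob K. \<forall>p\<in>fo \<phi> k. \<forall>A\<in>Ob C. \<forall>x\<in>fo (fo E k) A. t A (\<xi> k p A x) = \<sigma> k p A x)"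
proof -
  obtain t where t: "t \<in> Hom (PSh C) X G" "\<forall>k\<in>Ob K. \<forall>p\<in>fo \<phi> k. Cmp (PSh C) (fo E k) X G t (\<xi> k p) = \<sigma> k p"
    using X \<sigma> unfolding is_weighted_colimit_def by blast
  show ?thesis
  proof (intro exI[of _ t] conjI ballI)
    show "nt X G t" using t by simp
    fix k p A x assume k: "k \<in> Ob K" "p \<in> fo \<phi> k" "A \<in> Ob C" "x \<in> fo (fo E k) A"
    then have "ntcomp (fo E k) X G t (\<xi> k p) = \<sigma> k p" using t(2) by simp
    then have "ntcomp (fo E k) X G t (\<xi> k p) A x = \<sigma> k p A x" by simp
    then show "t A (\<xi> k p A x) = \<sigma> k p A x" using k by simp
  qed
qed

lemma colimit_PSh_unique:
  assumes E: "is_functor K (PSh C) E" and X: "is_weighted_colimit K \<phi> (PSh C) E X \<xi>"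
    and st: "nt X G s" "nt X G t" and G: "small_presheaf C G"
    and e: "\<And>k p A x. k \<in> Ob K \<Longrightarrow> p \<in> fo \<phi> k \<Longrightarrow> A \<in> Ob C \<Longrightarrow> x \<in> fo (fo E k) A \<Longrightarrow> s A (\<xi> k p A x) = t A (\<xi> k p A x)"
  shows "s = t"
proof -
  have c: "weighted_cocone K \<phi> (PSh C) E X \<xi>" using X unfolding is_weighted_colimit_def by blast
  then have \<xi>: "small_presheaf C X" "\<And>k p. k \<in> Ob K \<Longrightarrow> p \<in> fo \<phi> k \<Longrightarrow> nt (fo E k) X (\<xi> k p)"
    "\<And>k l f q A x. f \<in> Hom K k l \<Longrightarrow> q \<in> fo \<phi> l \<Longrightarrow> A \<in> Ob C \<Longrightarrow> x \<in> fo (fo E k) A \<Longrightarrow>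
        \<xi> k (fa \<phi> l k f q) A x = \<xi> l q A (fa E k l f A x)"
    unfolding weighted_cocone_PSh_iff[OF E] by blast+
  let ?\<sigma> = "\<lambda>k p. ntcomp (fo E k) X G t (\<xi> k p)"
  have "weighted_cocone K \<phi> (PSh C) E G ?\<sigma>" unfolding weighted_cocone_PSh_iff[OF E]
  proof (intro conjI ballI allI impI G nt_comp[OF \<xi>(2) st(2)])
    fix k l f q A x assume f: "f \<in> Hom K k l" "q \<in> fo \<phi> l" "A \<in> Ob C" "x \<in> fo (fo E k) A"
    have "fa E k l f A x \<in> fo (fo E l) A" using ntD(4)[where F="fo E k" and G="fo E l" and t="fa E k l f"] is_functorD(4)[OF E f(1)] f(3,4) by simp
    then show "ntcomp (fo E k) X G t (\<xi> k (fa \<phi> l k f q)) A x = ntcomp (fo E l) X G t (\<xi> l q) A (fa E k l f A x)"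
      using f \<xi>(3)[OF f] by simp
  qed
  then have "\<exists>!h. h \<in> Hom (PSh C) X G \<and> (\<forall>k\<in>Ob K. \<forall>p\<in>fo \<phi> k. Cmp (PSh C) (fo E k) X G h (\<xi> k p) = ?\<sigma> k p)"
    using X unfolding is_weighted_colimit_def by blast
  then obtain w where w: "\<And>h. h \<in> Hom (PSh C) X G \<Longrightarrow> (\<forall>k\<in>Ob K. \<forall>p\<in>fo \<phi> k. Cmp (PSh C) (fo E k) X G h (\<xi> k p) = ?\<sigma> k p) \<Longrightarrow> h = w"
    by (elim ex1E) blast
  have "ntcomp (fo E k) X G s (\<xi> k p) = ?\<sigma> k p" if k: "k \<in> Ob K" "p \<in> fo \<phi> k" for k p
    by (rule nt_eqI[OF nt_comp[OF \<xi>(2)[OF k] st(1)] nt_comp[OF \<xi>(2)[OF k] st(2)]]) (simp add: e k)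
  then show ?thesis using w[of s] w[of t] st \<xi>(1) G by simp
qed

text \<open>The union of the images of a colimit cocone is a subpresheaf through which the cocone factors;
  hence it is everything.\<close>

lemma colimit_PSh_surj:
  assumes E: "is_functor K (PSh C) E" and X: "is_weighted_colimit K \<phi> (PSh C) E X \<xi>"
    and x: "A \<in> Ob C" "x \<in> fo X A"
  obtains k p a where "k \<in> Ob K" "p \<in> fo \<phi> k" "a \<in> fo (fo E k) A" "x = \<xi> k p A a"
proof -
  have c: "weighted_cocone K \<phi> (PSh C) E X \<xi>" using X unfolding is_weighted_colimit_def by blast
  then have \<xi>: "small_presheaf C X" "\<And>k p. k \<in> Ob K \<Longrightarrow> p \<in> fo \<phi> k \<Longrightarrow> nt (fo E k) X (\<xi> k p)"
    "\<And>k l f q A x. f \<in> Hom K k l \<Longrightarrow> q \<in> fo \<phi> l \<Longrightarrow> A \<in> Ob C \<Longrightarrow> x \<in> fo (fo E k) A \<Longrightarrow>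
        \<xi> k (fa \<phi> l k f q) A x = \<xi> l q A (fa E k l f A x)"
    unfolding weighted_cocone_PSh_iff[OF E] by blast+
  have Es: "small_presheaf C (fo E k)" if "k \<in> Ob K" for k using is_functorD(3)[OF E that] by simp
  define I where "I A = (\<Union>kp\<in>(SIGMA k : Ob K. fo \<phi> k). \<xi> (fst kp) (snd kp) A ` fo (fo E (fst kp)) A)" for A
  have gen: "generated X I" unfolding I_def
  proof (rule generated_UN)
    show "small TYPE('u) (SIGMA k : Ob K. fo \<phi> k)" by (intro small_Sigma univ small_Ob \<phi>_small)
    fix kp assume "kp \<in> (SIGMA k : Ob K. fo \<phi> k)"
    then have k: "fst kp \<in> Ob K" "snd kp \<in> fo \<phi> (fst kp)" by auto
    have "generated (fo E (fst kp)) (fo (fo E (fst kp)))"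
      using Es[OF k(1)] unfolding small_presheaf_iff small_generated_def by blast
    then show "generated X (\<lambda>A. \<xi> (fst kp) (snd kp) A ` fo (fo E (fst kp)) A)"
      by (rule generated_image_nt[OF \<xi>(2)[OF k]])
  qed
  have sub: "subfamily X I" unfolding subfamily_def
  proof (intro conjI ballI allI impI)
    show "psh X" by (rule small_presheaf_psh[OF \<xi>(1)])
    fix A assume "A \<in> Ob C"
    then show "I A \<subseteq> fo X A" unfolding I_def using ntD(4)[OF \<xi>(2)] by auto
  next
    fix A B u y assume u: "u \<in> Hom C B A" and "y \<in> I A"
    then obtain k p a where k: "k \<in> Ob K" "p \<in> fo \<phi> k" "a \<in> fo (fo E k) A" "y = \<xi> k p A a" unfolding I_def by auto
    have "fa X A B u y = \<xi> k p B (fa (fo E k) A B u a)" unfolding k(4) by (rule ntD(5)[OF \<xi>(2)[OF k(1,2)] u k(3), symmetric])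
    moreover have "fa (fo E k) A B u a \<in> fo (fo E k) B" by (rule psh_in[OF ntD(1)[OF \<xi>(2)[OF k(1,2)]] u k(3)])
    ultimately show "fa X A B u y \<in> I B" unfolding I_def using k(1,2) by (intro UN_I[of "(k, p)"]) auto
  qed
  let ?I = "subp X I"
  have sI: "small_presheaf C ?I" by (rule small_subp[OF sub \<xi>(1) gen])
  have in_I: "\<xi> k p A a \<in> I A" if "k \<in> Ob K" "p \<in> fo \<phi> k" "a \<in> fo (fo E k) A" for k p A a
    unfolding I_def using that by (intro UN_I[of "(k, p)"]) auto
  have cocone: "weighted_cocone K \<phi> (PSh C) E ?I (\<lambda>k p. mknt (fo E k) (\<xi> k p))"
    unfolding weighted_cocone_PSh_iff[OF E]
  proof (intro conjI ballI allI impI sI)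
    fix k p assume k: "k \<in> Ob K" "p \<in> fo \<phi> k"
    show "nt (fo E k) ?I (mknt (fo E k) (\<xi> k p))"
      by (rule nt_mknt[OF ntD(1)[OF \<xi>(2)[OF k]] psh_subp[OF sub]])
        (use in_I[OF k] ntD(5)[OF \<xi>(2)[OF k]] in auto)
  next
    fix k l f q A x assume f: "f \<in> Hom K k l" "q \<in> fo \<phi> l" "A \<in> Ob C" "x \<in> fo (fo E k) A"
    have "fa E k l f A x \<in> fo (fo E l) A" using ntD(4)[where F="fo E k" and G="fo E l" and t="fa E k l f"] is_functorD(4)[OF E f(1)] f(3,4) by simp
    then show "mknt (fo E k) (\<xi> k (fa \<phi> l k f q)) A x = mknt (fo E l) (\<xi> l q) A (fa E k l f A x)"
      using f \<xi>(3)[OF f] by simp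
  qed
  obtain t where t: "nt X ?I t" "\<And>k p A x. k \<in> Ob K \<Longrightarrow> p \<in> fo \<phi> k \<Longrightarrow> A \<in> Ob C \<Longrightarrow> x \<in> fo (fo E k) A \<Longrightarrow>
    t A (\<xi> k p A x) = mknt (fo E k) (\<xi> k p) A x"
    using colimit_PSh_map[OF E X cocone] by blast
  let ?i = "mknt ?I (\<lambda>A x. x)"
  \<comment> \<open>Both sides agree on the colimit cocone, so the inclusion of the union has a
    section.\<close>
  have "ntcomp X ?I X ?i t = ntid X"
  proof (rule colimit_PSh_unique[OF E X nt_comp[OF t(1) nt_incl[OF sub]] nt_id[OF small_presheaf_psh[OF \<xi>(1)]] \<xi>(1)])
    fix k p A a assume k: "k \<in> Ob K" "p \<in> fo \<phi> k" "A \<in> Ob C" "a \<in> fo (fo E k) A"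
    have "\<xi> k p A a \<in> fo X A" using ntD(4)[OF \<xi>(2)[OF k(1,2)] k(3,4)] .
    then show "ntcomp X ?I X ?i t A (\<xi> k p A a) = ntid X A (\<xi> k p A a)" using k t(2)[OF k] in_I[OF k(1,2,4)] by simp
  qed
  then have "ntcomp X ?I X ?i t A x = ntid X A x" by simp
  moreover have "t A x \<in> I A" using ntD(4)[OF t(1) x] by simp
  ultimately have "x \<in> I A" using x by simp
  then show thesis using that unfolding I_def by auto
qed

text \<open>The induced map \<open>r\<close> sends \<open>\<xi> k p A a\<close> to the class of
  \<open>(k, p, \<eta> k A a)\<close>. It is locally surjective because the third component of a
  triple lifts locally along \<open>\<eta> k\<close>. For local injectivity, an equality in
  \<open>Z\<close> is a zigzag of triples, which has to be lifted to \<open>X\<close>.\<close>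

lemma bicovering_colimit:
  assumes E: "is_functor K (PSh C) E" and X: "is_weighted_colimit K \<phi> (PSh C) E X \<xi>" and Z: "coend Z e"
    and \<eta>: "\<And>k. k \<in> Ob K \<Longrightarrow> bicovering (fo E k) (Y (fo D k)) (\<eta> k)"
    and nat: "\<And>k l g A x. g \<in> Hom K k l \<Longrightarrow> A \<in> Ob C \<Longrightarrow> x \<in> fo (fo E k) A \<Longrightarrow>
      \<eta> l A (fa E k l g A x) = Cmp C A (fo D k) (fo D l) (fa D k l g) (\<eta> k A x)"
  obtains r where "bicovering X Z r"
proof -
  have c: "weighted_cocone K \<phi> (PSh C) E X \<xi>" using X unfolding is_weighted_colimit_def by blast
  then have \<xi>: "small_presheaf C X" "\<And>k p. k \<in> Ob K \<Longrightarrow> p \<in> fo \<phi> k \<Longrightarrow> nt (fo E k) X (\<xi> k p)"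
    "\<And>k l f q A x. f \<in> Hom K k l \<Longrightarrow> q \<in> fo \<phi> l \<Longrightarrow> A \<in> Ob C \<Longrightarrow> x \<in> fo (fo E k) A \<Longrightarrow>
        \<xi> k (fa \<phi> l k f q) A x = \<xi> l q A (fa E k l f A x)"
    unfolding weighted_cocone_PSh_iff[OF E] by blast+
  have pX: "psh X" by (rule small_presheaf_psh[OF \<xi>(1)])
  have Zp: "psh Z" "\<And>X. X \<in> Ob C \<Longrightarrow> fo Z X = e X ` triples X"
    "\<And>X s t. X \<in> Ob C \<Longrightarrow> s \<in> triples X \<Longrightarrow> t \<in> triples X \<Longrightarrow> e X s = e X t \<longleftrightarrow> zigzag X s t"
    "\<And>X W v t. v \<in> Hom C W X \<Longrightarrow> t \<in> triples X \<Longrightarrow> fa Z X W v (e X t) = e W (act X W v t)"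
    using Z unfolding coend_def by blast+
  have sZ: "small_presheaf C Z" by (rule lan_small_presheaf[OF coend_lan[OF Z]])
  have Ea: "fa E k l g A x \<in> fo (fo E l) A" if "g \<in> Hom K k l" "A \<in> Ob C" "x \<in> fo (fo E k) A" for k l g A x
    using ntD(4)[where F="fo E k" and G="fo E l" and t="fa E k l g"] is_functorD(4)[OF E that(1)] that(2,3) by simp
  have \<eta>A: "\<eta> k A x \<in> Hom C A (fo D k)" if "k \<in> Ob K" "A \<in> Ob C" "x \<in> fo (fo E k) A" for k A x
    using ntD(4)[OF bicoveringD(1)[OF \<eta>[OF that(1)]] that(2,3)] by simp
  have \<eta>u: "\<eta> k B (fa (fo E k) A B u x) = Cmp C B A (fo D k) (\<eta> k A x) u"
    if "k \<in> Ob K" "u \<in> Hom C B A" "x \<in> fo (fo E k) A" for k A B u x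
    using ntD(5)[OF bicoveringD(1)[OF \<eta>[OF that(1)]] that(2,3)] \<eta>A[OF that(1) cod[OF that(2)] that(3)] by simp
  have tri: "(k, p, \<eta> k A x) \<in> triples A" if "k \<in> Ob K" "p \<in> fo \<phi> k" "A \<in> Ob C" "x \<in> fo (fo E k) A" for k p A x
    unfolding triples_def using that \<eta>A by simp
  have e_in: "e A t \<in> fo Z A" if "A \<in> Ob C" "t \<in> triples A" for A t using Zp(2) that by blast
  let ?\<zeta> = "\<lambda>k p. mknt (fo E k) (\<lambda>A x. e A (k, p, \<eta> k A x))"
  have cocone: "weighted_cocone K \<phi> (PSh C) E Z ?\<zeta>" unfolding weighted_cocone_PSh_iff[OF E]
  proof (intro conjI ballI allI impI sZ)
    fix k p assume k: "k \<in> Ob K" "p \<in> fo \<phi> k"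
    show "nt (fo E k) Z (?\<zeta> k p)"
    proof (rule nt_mknt[OF ntD(1)[OF \<xi>(2)[OF k]] Zp(1)])
      fix A x assume "A \<in> Ob C" "x \<in> fo (fo E k) A"
      then show "e A (k, p, \<eta> k A x) \<in> fo Z A" using e_in tri k by blast
    next
      fix A B u x assume u: "u \<in> Hom C B A" "x \<in> fo (fo E k) A"
      show "e B (k, p, \<eta> k B (fa (fo E k) A B u x)) = fa Z A B u (e A (k, p, \<eta> k A x))"
        unfolding Zp(4)[OF u(1) tri[OF k cod[OF u(1)] u(2)]] act_def using \<eta>u[OF k(1) u] by simp
    qed
  next
    fix k l f q A x assume f: "f \<in> Hom K k l" and q: "q \<in> fo \<phi> l" and A: "A \<in> Ob C" and x: "x \<in> fo (fo E k) A"
    note k = domK[OF f] and l = codK[OF f]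
    have "step A (k, fa \<phi> l k f q, \<eta> k A x) (l, q, \<eta> l A (fa E k l f A x))"
      unfolding step_def using f q \<eta>A[OF k A x] nat[OF f A x] by auto
    then have "e A (k, fa \<phi> l k f q, \<eta> k A x) = e A (l, q, \<eta> l A (fa E k l f A x))"
      using Zp(3)[OF A] step_triples zigzag_step by blast
    then show "?\<zeta> k (fa \<phi> l k f q) A x = ?\<zeta> l q A (fa E k l f A x)" using A x Ea[OF f A x] by simp
  qed
  obtain r where r: "nt X Z r" "\<And>k p A x. k \<in> Ob K \<Longrightarrow> p \<in> fo \<phi> k \<Longrightarrow> A \<in> Ob C \<Longrightarrow> x \<in> fo (fo E k) A \<Longrightarrow>
    r A (\<xi> k p A x) = ?\<zeta> k p A x"
    using colimit_PSh_map[OF E X cocone] by blast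
  \<comment> \<open>\<open>x\<close> is represented by some \<open>a\<close> that lies over the
    third component of \<open>s\<close>. Two lifts of the same triple agree only locally.\<close>
  define lift where "lift A s x \<longleftrightarrow> (\<exists>k p a. k \<in> Ob K \<and> p \<in> fo \<phi> k \<and> a \<in> fo (fo E k) A \<and>
      s = (k, p, \<eta> k A a) \<and> x = \<xi> k p A a)" for A s x
  have lift_in: "x \<in> fo X A" "s \<in> triples A" "r A x = e A s" if "lift A s x" "A \<in> Ob C" for A s x
    using that ntD(4)[OF \<xi>(2)] tri r(2) unfolding lift_def by auto
  have lift_act: "lift B (act A B u s) (fa X A B u x)" if x: "lift A s x" and u: "u \<in> Hom C B A" for A B u s x
  proof -
    obtain k p a where k: "k \<in> Ob K" "p \<in> fo \<phi> k" "a \<in> fo (fo E k) A" "s = (k, p, \<eta> k A a)" "x = \<xi> k p A a"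
      using x unfolding lift_def by blast
    have "act A B u s = (k, p, \<eta> k B (fa (fo E k) A B u a))" unfolding k(4) act_def using \<eta>u[OF k(1) u k(3)] by simp
    moreover have "fa X A B u x = \<xi> k p B (fa (fo E k) A B u a)"
      unfolding k(5) by (rule ntD(5)[OF \<xi>(2)[OF k(1,2)] u k(3), symmetric])
    moreover have "fa (fo E k) A B u a \<in> fo (fo E k) B" by (rule psh_in[OF ntD(1)[OF \<xi>(2)[OF k(1,2)]] u k(3)])
    ultimately show ?thesis unfolding lift_def using k(1,2) by blast
  qed
  \<comment> \<open>The sieve on which \<open>s\<close> has a lift; it is a cover by local
    surjectivity of the \<open>\<eta> k\<close>.\<close>
  define L where "L A s W = {u \<in> Hom C W A. \<exists>x. lift W (act A W u s) x}" for A s W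
  have L: "cover A (L A s)" if A: "A \<in> Ob C" and s: "s \<in> triples A" for A s
  proof -
    obtain k p y where k: "s = (k, p, y)" "k \<in> Ob K" "p \<in> fo \<phi> k" "y \<in> Hom C A (fo D k)" using s unfolding triples_def by blast
    have sv: "sieve A (L A s)" unfolding sieve_def L_def
    proof (intro conjI allI impI A)
      fix X' W u v assume "u \<in> {u \<in> Hom C X' A. \<exists>x. lift X' (act A X' u s) x}" and v: "v \<in> Hom C W X'"
      then obtain x where u: "u \<in> Hom C X' A" "lift X' (act A X' u s) x" by blast
      have "lift W (act A W (Cmp C W X' A u v) s) (fa X X' W v x)"
        unfolding act_comp[OF s u(1) v] by (rule lift_act[OF u(2) v])
      then show "Cmp C W X' A u v \<in> {u \<in> Hom C W A. \<exists>x. lift W (act A W u s) x}"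
        using compC[OF v u(1)] by blast
    qed auto
    have y: "y \<in> fo (Y (fo D k)) A" using k(4) by simp
    show ?thesis
    proof (rule cover_mono[OF bicoveringD(2)[OF \<eta>[OF k(2)] A y] sv])
      fix W u assume "u \<in> im_sieve (fo E k) (Y (fo D k)) (\<eta> k) A y W"
      then obtain a where a: "u \<in> Hom C W A" "Cmp C W A (fo D k) y u = \<eta> k W a" "a \<in> fo (fo E k) W"
        unfolding im_sieve_def using k(4) by auto
      have "lift W (act A W u s) (\<xi> k p W a)" unfolding lift_def k(1) act_def using a k by auto
      then show "u \<in> L A s W" unfolding L_def using a(1) by blast
    qed
  qed
  have lift_unique: "cover A (eq_sieve X A x x')" if A: "A \<in> Ob C" and x: "lift A s x" "lift A s x'" for A s x x'
  proof -
    obtain k p a where k: "k \<in> Ob K" "p \<in> fo \<phi> k" "a \<in> fo (fo E k) A" "s = (k, p, \<eta> k A a)" "x = \<xi> k p A a"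
      using x(1) unfolding lift_def by blast
    obtain a' where a': "a' \<in> fo (fo E k) A" "\<eta> k A a = \<eta> k A a'" "x' = \<xi> k p A a'"
      using x(2) unfolding lift_def k(4) by auto
    note n = ntD[OF \<xi>(2)[OF k(1,2)]]
    show ?thesis
    proof (rule cover_mono[OF bicoveringD(3)[OF \<eta>[OF k(1)] A k(3) a'(1,2)]])
      show "sieve A (eq_sieve X A x x')" by (rule sieve_eq_sieve[OF pX A]) (use lift_in(1) x A in blast)+
      fix W u assume "u \<in> eq_sieve (fo E k) A a a' W"
      then have u: "u \<in> Hom C W A" "fa (fo E k) A W u a = fa (fo E k) A W u a'" unfolding eq_sieve_def by blast+
      then show "u \<in> eq_sieve X A x x' W"
        unfolding eq_sieve_def k(5) a'(3) using n(5)[OF u(1) k(3)] n(5)[OF u(1) a'(1)] by simp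
    qed
  qed
  \<comment> \<open>The representative \<open>a\<close> is pushed forward along
    \<open>fa E k l g\<close>: by naturality of \<open>\<eta>\<close> and the cocone equation, the
    same \<open>x\<close> lifts the target.\<close>
  have lift_step: "lift A t x" if st: "step A s t" and A: "A \<in> Ob C" and x: "lift A s x" for A s t x
  proof -
    obtain k p a where k: "k \<in> Ob K" "p \<in> fo \<phi> k" "a \<in> fo (fo E k) A" "s = (k, p, \<eta> k A a)" "x = \<xi> k p A a"
      using x unfolding lift_def by blast
    obtain l q g where l: "q \<in> fo \<phi> l" "g \<in> Hom K k l" "p = fa \<phi> l k g q" "t = (l, q, Cmp C A (fo D k) (fo D l) (fa D k l g) (\<eta> k A a))"
      using st unfolding step_def k(4) by auto
    have "x = \<xi> l q A (fa E k l g A a)" unfolding k(5) l(3) by (rule \<xi>(3)[OF l(2,1) A k(3)])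
    then show ?thesis unfolding lift_def l(4) using nat[OF l(2) A k(3)] Ea[OF l(2) A k(3)] codK[OF l(2)] l(1) by metis
  qed
  have lift_symstep: "cover A (eq_sieve X A x x')" if st: "symstep A s t" and A: "A \<in> Ob C" and x: "lift A s x" "lift A t x'" for A s t x x'
    using st lift_step[OF _ A x(1)] lift_step[OF _ A x(2)] lift_unique[OF A] x unfolding symstep_def by blast
  have eq_sieve_trans: "cover A (eq_sieve X A x z)"
    if "cover A (eq_sieve X A x y)" "cover A (eq_sieve X A y z)" "A \<in> Ob C" "x \<in> fo X A" "z \<in> fo X A" for A x y z
    by (rule cover_mono[OF cover_Int[OF that(1,2)] sieve_eq_sieve[OF pX that(3-5)]]) (auto simp: eq_sieve_def)
  text \<open>The intermediate triples of a zigzag lift only locally.\<close>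
  have lift_zigzag: "\<forall>W u z. u \<in> Hom C W A \<longrightarrow> lift W (act A W u t) z \<longrightarrow> cover W (eq_sieve X W (fa X A W u x) z)"
    if zz: "zigzag A s t" and A: "A \<in> Ob C" and x: "lift A s x" for A s t x
    using zz unfolding zigzag_def
  proof (induction rule: rtranclp_induct)
    case base
    show ?case
    proof (intro allI impI)
      fix W u z assume u: "u \<in> Hom C W A" "lift W (act A W u s) z"
      show "cover W (eq_sieve X W (fa X A W u x) z)" by (rule lift_unique[OF dom[OF u(1)] lift_act[OF x u(1)] u(2)])
    qed
  next
    case (step m t)
    have m: "m \<in> triples A" "t \<in> triples A" using step.hyps(2) step_triples unfolding symstep_def by blast+
    show ?case
    proof (intro allI impI)
      fix W u z assume u: "u \<in> Hom C W A" and z: "lift W (act A W u t) z"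
      note W = dom[OF u]
      note xX = lift_in(1)[OF x A] and zX = lift_in(1)[OF z W]
      have ux: "fa X A W u x \<in> fo X W" by (rule psh_in[OF pX u xX])
      show "cover W (eq_sieve X W (fa X A W u x) z)"
      \<comment> \<open>The claim quantifies over all restrictions so that the induction hypothesis
        reaches the local lift \<open>y\<close> of \<open>m\<close>, through which \<open>x\<close>
        and \<open>z\<close> are compared.\<close>
      proof (rule cover_local[OF sieve_eq_sieve[OF pX W ux zX] L[OF W act_triples[OF m(1) u]]])
        fix V v assume "v \<in> L W (act A W u m) V"
        then obtain y where v: "v \<in> Hom C V W" and y: "lift V (act W V v (act A W u m)) y" unfolding L_def by blast
        note uv = compC[OF v u] and V = dom[OF v]
        have y': "lift V (act A V (Cmp C V W A u v) m) y" using y unfolding act_comp[OF m(1) u v] .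
        have 1: "cover V (eq_sieve X V (fa X W V v (fa X A W u x)) y)"
          using step.IH uv y' psh_comp[OF pX u v xX] by metis
        have "lift V (act A V (Cmp C V W A u v) t) (fa X W V v z)"
          using lift_act[OF z v] unfolding act_comp[OF m(2) u v] .
        then have 2: "cover V (eq_sieve X V y (fa X W V v z))"
          using lift_symstep[OF symstep_act[OF step.hyps(2) uv] V y'] by blast
        show "cover V (pull W V v (eq_sieve X W (fa X A W u x) z))"
          unfolding pull_eq_sieve[OF pX v ux zX]
          by (rule eq_sieve_trans[OF 1 2 V psh_in[OF pX v ux] psh_in[OF pX v zX]])
      qed
    qed
  qed
  have "bicovering X Z r" unfolding bicovering_def
  proof (intro conjI ballI impI r(1))
    fix A z assume A: "A \<in> Ob C" and z: "z \<in> fo Z A"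
    have "z \<in> e A ` triples A" using z Zp(2)[OF A] by simp
    then obtain s where s: "s \<in> triples A" "z = e A s" by blast
    show "cover A (im_sieve X Z r A z)"
    proof (rule cover_mono[OF L[OF A s(1)] sieve_im_sieve[OF r(1) A z]])
      fix W u assume "u \<in> L A s W"
      then obtain x where u: "u \<in> Hom C W A" "lift W (act A W u s) x" unfolding L_def by blast
      have "fa Z A W u z = r W x" unfolding s(2) Zp(4)[OF u(1) s(1)] lift_in(3)[OF u(2) dom[OF u(1)]] ..
      then show "u \<in> im_sieve X Z r A z W" unfolding im_sieve_def using u(1) lift_in(1)[OF u(2) dom[OF u(1)]] by blast
    qed
  next
    fix A x x' assume A: "A \<in> Ob C" and x: "x \<in> fo X A" "x' \<in> fo X A" "r A x = r A x'"
    have "\<exists>s. lift A s y" if "y \<in> fo X A" for y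
      by (rule colimit_PSh_surj[OF E X A that]) (use lift_def in blast)
    then obtain s s' where s: "lift A s x" "lift A s' x'" using x by blast
    have "e A s = e A s'" using lift_in(3)[OF s(1) A] lift_in(3)[OF s(2) A] x(3) by simp
    then have "zigzag A s s'" using Zp(3)[OF A lift_in(2)[OF s(1) A] lift_in(2)[OF s(2) A]] by blast
    from lift_zigzag[OF this A s(1)] have "cover A (eq_sieve X A (fa X A A (Ide C A) x) x')"
      using idC[OF A] s(2) act_id[OF lift_in(2)[OF s(2) A] A] by simp
    then show "cover A (eq_sieve X A x x')" unfolding psh_id[OF pX A x(1)] .
  qed
  then show thesis by (rule that)
qed

end

context site
begin

section \<open>Postulatedness implies exactness\<close>

text \<open>Limits of presheaves are pointwise, and the reflector preserves pointwise finite limits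
  of bicovered presheaves. This makes the hypothesis on \<Phi>-lex-colimits in \<open>C\<close>
  applicable to diagrams of presheaves.\<close>

lemma lex_functor_reflector:
  assumes E: "lex_functor K (PSh C) E" and bicovered: "\<And>k. k \<in> Ob K \<Longrightarrow> fo E k \<in> bicovered"
  shows "lex_functor K C (fcomp reflector E)"
  unfolding lex_functor_def preserves_finite_limits_def
proof (intro conjI allI impI)
  have E': "is_functor K (subPSh bicovered) E"
    using is_functor_full_sub[OF _ bicovered] E unfolding lex_functor_def by blast
  show "finitely_complete K" "finitely_complete C" "is_functor K C (fcomp reflector E)"
    using E fin_complete is_functor_fcomp[OF E' is_functor_reflector] unfolding lex_functor_def by blast+
  fix J :: "(nat, nat) cat" and G L \<pi>
  assume a: "finite_category J \<and> is_functor J K G \<and> is_limit J K G L \<pi>"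
  then have lim: "is_limit J (subPSh UNIV) (fcomp E G) (fo E L) (\<lambda>j. fa E L (fo G j) (\<pi> j))"
    and G: "is_functor J (subPSh UNIV) (fcomp E G)" "is_functor J (subPSh bicovered) (fcomp E G)"
    using E E' is_functor_fcomp unfolding lex_functor_def preserves_finite_limits_def full_sub_UNIV by blast+
  have "plim J (fcomp E G) (fo E L) (\<lambda>j. fa E L (fo G j) (\<pi> j))"
    by (rule limit_imp_plim[OF G(1) lim]) simp
  from plim_bicovered(2)[OF conjunct1[OF a] G(2) this]
  show "is_limit J C (fcomp (fcomp reflector E) G) (fo (fcomp reflector E) L) (\<lambda>j. fa (fcomp reflector E) L (fo G j) (\<pi> j))"
    by (simp add: fcomp_def)
qed

text \<open>Two bicovering morphisms are composed. The first goes from \<open>X\<close> to the Kan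
  extension \<open>Z\<close> of \<open>\<phi>\<close> along the reflected diagram and is a colimit
  of units; the second goes from \<open>Z\<close> to the representable on the colimit in
  \<open>C\<close>, and is a \<Phi>-lex-colimit morphism, hence postulated.\<close>

lemma lex_colimit_bicovered:
  assumes w: "lex_weight (K, \<phi>)" "(K, \<phi>) \<in> \<Phi>" and cocomplete: "lex_cocomplete \<Phi> C"
    and post: "lex_colimits_postulated \<Phi> C"
    and E: "lex_functor K (PSh C) E" and bicovered: "\<And>k. k \<in> Ob K \<Longrightarrow> fo E k \<in> bicovered"
    and X: "is_weighted_colimit K \<phi> (PSh C) E X \<xi>"
  shows "X \<in> bicovered"
proof -
  let ?D = "fcomp reflector E"
  have lexD: "lex_functor K C ?D" by (rule lex_functor_reflector[OF E bicovered])
  have E': "is_functor K (PSh C) E" using E unfolding lex_functor_def by blast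
  interpret weighted_diagram C K \<phi> ?D by (rule weighted_diagram_of_weight[OF w(1) lexD])
  obtain A \<sigma> where A: "is_weighted_colimit K \<phi> C ?D A \<sigma>"
    using cocomplete w(2) lexD unfolding lex_cocomplete_def by blast
  then have A_Ob: "A \<in> Ob C" and \<sigma>: "weighted_cocone K \<phi> C ?D A \<sigma>"
    unfolding is_weighted_colimit_def weighted_cocone_def by blast+
  obtain Z e where Z: "coend Z e" by (rule coend_exists)
  define \<epsilon> where "\<epsilon> k = (\<lambda>p\<in>fo \<phi> k. e (fo ?D k) (k, p, Ide C (fo ?D k)))" for k
  have "lan Z \<epsilon>" using coend_lan[OF Z] unfolding lan_def \<epsilon>_def cocone_restrict by simp
  then have lanZ: "lan Z \<epsilon>" "is_lan (opp K) (opp C) Set_cat (fop ?D) \<phi> Z \<epsilon>"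
    using lan_imp_is_lan unfolding \<epsilon>_def by blast+
  then have \<epsilon>: "cocone Z \<epsilon>" unfolding lan_def by blast
  have sZ: "small_presheaf C Z" by (rule lan_small_presheaf[OF lanZ(1)])
  \<comment> \<open>Both are families of arrows into \<open>B\<close>. Hence maps from
    \<open>Z\<close> to \<open>Y B\<close> correspond to arrows from the colimit \<open>A\<close> to
    \<open>B\<close>, which yields the finality of \<open>f\<close> below.\<close>
  have cocone_iff_weighted: "cocone (Y B) \<tau> \<longleftrightarrow> weighted_cocone K \<phi> C ?D B \<tau>" if B: "B \<in> Ob C" for B \<tau>
  proof -
    have "(\<forall>k l g q. g \<in> Hom K k l \<longrightarrow> q \<in> fo \<phi> l \<longrightarrow> \<tau> k (fa \<phi> l k g q) = fa (Y B) (fo ?D l) (fo ?D k) (fa ?D k l g) (\<tau> l q)) \<longleftrightarrow>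
      (\<forall>k\<in>Ob K. \<forall>l\<in>Ob K. \<forall>g\<in>Hom K k l. \<forall>q\<in>fo \<phi> l. \<tau> k (fa \<phi> l k g q) = Cmp C (fo ?D k) (fo ?D l) B (\<tau> l q) (fa ?D k l g))"
      if "\<forall>k\<in>Ob K. \<forall>p\<in>fo \<phi> k. \<tau> k p \<in> Hom C (fo ?D k) B"
      using that domK codK by (auto simp del: fcomp_simps)
    then show ?thesis unfolding cocone_def weighted_cocone_def using psh_Y[OF B] B by (auto simp del: fcomp_simps)
  qed
  obtain f where f: "nt Z (Y A) f" "\<And>k p. k \<in> Ob K \<Longrightarrow> p \<in> fo \<phi> k \<Longrightarrow> f (fo ?D k) (\<epsilon> k p) = \<sigma> k p"
    using lan_map[OF lanZ(1), of "Y A" \<sigma>] \<sigma> cocone_iff_weighted[OF A_Ob] by blast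
  have \<sigma>A: "\<sigma> k p \<in> Hom C (fo ?D k) A" if "k \<in> Ob K" "p \<in> fo \<phi> k" for k p
    using \<sigma> that unfolding weighted_cocone_def by blast
  have \<epsilon>Z: "\<epsilon> k p \<in> fo Z (fo ?D k)" if "k \<in> Ob K" "p \<in> fo \<phi> k" for k p
    using \<epsilon> that unfolding cocone_def by blast
  have comp_\<epsilon>: "ntcomp Z (Y A) (Y B) (fa (yoneda C) A B h) f (fo ?D k) (\<epsilon> k p) = Cmp C (fo ?D k) A B h (\<sigma> k p)"
    if "h \<in> Hom C A B" "k \<in> Ob K" "p \<in> fo \<phi> k" for B h k p
    unfolding ntcomp_apply[where F=Z, OF D_Ob[OF that(2)] \<epsilon>Z[OF that(2,3)]] f(2)[OF that(2,3)]
    by (rule yoneda_apply[OF that(1) \<sigma>A[OF that(2,3)]])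
  have "final C Z (Y A) f"
  proof (rule finalI[OF sZ small_presheaf_Y[OF A_Ob] f(1)])
    fix B g assume B: "B \<in> Ob C" and g: "nt Z (Y B) g"
    have "cocone (Y B) (\<lambda>k p. g (fo ?D k) (\<epsilon> k p))"
      using \<epsilon> ntD(2)[OF g] ntD(4,5)[OF g] domK codK D_Hom D_Ob unfolding cocone_def by (simp del: fcomp_simps Y_simps)
    then have "weighted_cocone K \<phi> C ?D B (\<lambda>k p. g (fo ?D k) (\<epsilon> k p))" using cocone_iff_weighted[OF B] by blast
    then obtain h where h: "h \<in> Hom C A B" "\<forall>k\<in>Ob K. \<forall>p\<in>fo \<phi> k. Cmp C (fo ?D k) A B h (\<sigma> k p) = g (fo ?D k) (\<epsilon> k p)"
      using A unfolding is_weighted_colimit_def by blast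
    have "ntcomp Z (Y A) (Y B) (fa (yoneda C) A B h) f = g"
      by (rule lan_unique[OF lanZ(1) nt_comp[OF f(1) nt_yoneda[OF h(1)]] g]) (use comp_\<epsilon>[OF h(1)] h(2) in simp)
    then show "\<exists>h. nt (Y A) (Y B) h \<and> ntcomp Z (Y A) (Y B) h f = g" using nt_yoneda[OF h(1)] by blast
  next
    fix B h h' assume B: "B \<in> Ob C" and h: "nt (Y A) (Y B) h" "nt (Y A) (Y B) h'"
      and eq: "ntcomp Z (Y A) (Y B) h f = ntcomp Z (Y A) (Y B) h' f"
    obtain m where m: "m \<in> Hom C A B" "h = fa (yoneda C) A B m" using nt_Y_Y[OF A_Ob h(1)] by blast
    obtain m' where m': "m' \<in> Hom C A B" "h' = fa (yoneda C) A B m'" using nt_Y_Y[OF A_Ob h(2)] by blast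
    have e: "Cmp C (fo ?D k) A B m (\<sigma> k p) = Cmp C (fo ?D k) A B m' (\<sigma> k p)" if "k \<in> Ob K" "p \<in> fo \<phi> k" for k p
      using comp_\<epsilon>[OF m(1) that] comp_\<epsilon>[OF m'(1) that] eq unfolding m(2) m'(2) by simp
    have "weighted_cocone K \<phi> C ?D B (\<lambda>k p. Cmp C (fo ?D k) A B m (\<sigma> k p))"
      unfolding weighted_cocone_def
    proof (intro conjI ballI B)
      fix k p assume "k \<in> Ob K" "p \<in> fo \<phi> k"
      then show "Cmp C (fo ?D k) A B m (\<sigma> k p) \<in> Hom C (fo ?D k) B" by (intro compC[OF \<sigma>A m(1)])
    next
      fix k l g q assume k: "k \<in> Ob K" "l \<in> Ob K" "g \<in> Hom K k l" "q \<in> fo \<phi> l"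
      have "\<sigma> k (fa \<phi> l k g q) = Cmp C (fo ?D k) (fo ?D l) A (\<sigma> l q) (fa ?D k l g)"
        using \<sigma> k unfolding weighted_cocone_def by blast
      then show "Cmp C (fo ?D k) A B m (\<sigma> k (fa \<phi> l k g q)) =
         Cmp C (fo ?D k) (fo ?D l) B (Cmp C (fo ?D l) A B m (\<sigma> l q)) (fa ?D k l g)"
        using assocC[OF D_Hom[OF k(3)] \<sigma>A[OF k(2,4)] m(1)] by (simp del: fcomp_simps)
    qed
    then have "\<exists>!h. h \<in> Hom C A B \<and> (\<forall>k\<in>Ob K. \<forall>p\<in>fo \<phi> k. Cmp C (fo ?D k) A B h (\<sigma> k p) = Cmp C (fo ?D k) A B m (\<sigma> k p))"
      using A unfolding is_weighted_colimit_def by blast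
    then have "m = m'" using m(1) m'(1) e by (elim ex1E) (metis (no_types, lifting))
    then show "h = h'" using m m' by simp
  qed
  then have "lex_colimit_morphism \<Phi> C Z (Y A) f"
    unfolding lex_colimit_morphism_def using w(2) lexD lanZ(2) A by blast
  then have "postulated C Z (Y A) f" using post unfolding lex_colimits_postulated_def by blast
  then have bf: "bicovering Z (Y A) f" by (rule postulated_imp_bicovering[OF f(1) sZ small_presheaf_Y[OF A_Ob]])
  have Ehom: "nt (fo E k) (fo E l) (fa E k l g)" if "g \<in> Hom K k l" for k l g
    using is_functorD(4)[OF E' that] by simp
  obtain r where r: "bicovering X Z r"
  proof (rule bicovering_colimit[OF E' X Z, where \<eta> = "\<lambda>k. unit (fo E k)"])
    fix k assume "k \<in> Ob K"
    then show "bicovering (fo E k) (Y (fo ?D k)) (unit (fo E k))" using unit_bicovering[OF bicovered] by simp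
  next
    fix k l g B x assume g: "g \<in> Hom K k l" and B: "B \<in> Ob C" "x \<in> fo (fo E k) B"
    show "unit (fo E l) B (fa E k l g B x) = Cmp C B (fo ?D k) (fo ?D l) (fa ?D k l g) (unit (fo E k) B x)"
      using fa_reflector_apply[OF bicovered[OF domK[OF g]] bicovered[OF codK[OF g]] Ehom[OF g] B] by simp
  qed
  have "small_presheaf C X" using X unfolding is_weighted_colimit_def weighted_cocone_def by simp
  then show "X \<in> bicovered" by (rule bicoveredI[OF _ A_Ob bicovering_comp[OF r bf]])
qed

text \<open>The inverse isomorphism is bicovering, and it is composed with the unit of
  \<open>F\<close>.\<close>

lemma isomorphic_bicovered:
  assumes F: "F \<in> bicovered" and iso: "isomorphic (PSh C) F G"
  shows "G \<in> bicovered"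
proof -
  obtain f g where fg: "f \<in> Hom (PSh C) F G" "g \<in> Hom (PSh C) G F" "ntcomp F G F g f = ntid F" "ntcomp G F G f g = ntid G"
    using iso unfolding isomorphic_def by auto
  then have n: "nt F G f" "nt G F g" "small_presheaf C G" by simp_all
  have gf: "g A (f A x) = x" if "A \<in> Ob C" "x \<in> fo F A" for A x
    using fun_cong[OF fun_cong[OF fg(3), of A], of x] that by simp
  have fg': "f A (g A y) = y" if "A \<in> Ob C" "y \<in> fo G A" for A y
    using fun_cong[OF fun_cong[OF fg(4), of A], of y] that by simp
  have "bicovering G F g"
  proof (rule injective_bicovering[OF n(2)])
    fix A y y' assume A: "A \<in> Ob C" and y: "y \<in> fo G A" "y' \<in> fo G A" "g A y = g A y'"
    show "y = y'" using arg_cong[OF y(3), of "f A"] unfolding fg'[OF A y(1)] fg'[OF A y(2)] .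
  next
    fix A x assume A: "A \<in> Ob C" "x \<in> fo F A"
    have "x \<in> g A ` fo G A" using gf[OF A] ntD(4)[OF n(1) A] by (intro image_eqI[of _ _ "f A x"]) simp_all
    then show "cover A (im_sieve G F g A x)"
      using A psh_id[OF ntD(1)[OF n(1)] A] by (intro cover_of_id[OF sieve_im_sieve[OF n(2) A]]) (simp add: im_sieve_def)
  qed
  then show ?thesis by (rule bicoveredI[OF n(3) refl_ob[OF F] bicovering_comp[OF _ unit_bicovering[OF F]]])
qed

lemma lex_closure_bicovered:
  assumes \<Phi>: "\<forall>w\<in>\<Phi>. lex_weight w" and cocomplete: "lex_cocomplete \<Phi> C" and post: "lex_colimits_postulated \<Phi> C"
    and F: "F \<in> lex_closure \<Phi> C"
  shows "F \<in> bicovered"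
  using F
proof (induction rule: lex_closure.induct)
  case (representable A)
  then show ?case by (rule Y_bicovered)
next
  case (replete X Y')
  then show ?case by (blast intro: isomorphic_bicovered)
next
  case (finite_limit J G L \<pi>)
  have G: "is_functor J (subPSh bicovered) G" by (rule is_functor_full_sub) (use finite_limit in auto)
  have "plim J G L \<pi>" using limit_imp_plim[of J UNIV G L \<pi>] finite_limit by simp
  then show ?case by (rule plim_bicovered(1)[OF finite_limit(1) G])
next
  case (lex_colimit K \<phi> D X \<eta>)
  have "lex_weight (K, \<phi>)" using \<Phi> lex_colimit(1) by blast
  then show ?case
    by (rule lex_colimit_bicovered[OF _ lex_colimit(1) cocomplete post lex_colimit(2) lex_colimit.IH
      \<open>is_weighted_colimit K \<phi> (PSh C) D X \<eta>\<close>])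
qed

text \<open>Transposition is composition with the unit: it is bijective because units are final, and
  its naturality is that of the unit. Since units have representable targets, the adjunction
  restricts to any \<open>T\<close> between the representables and \<open>bicovered\<close>.\<close>

lemma left_adjoint_reflector:
  assumes T: "T \<subseteq> bicovered" "\<And>A. A \<in> Ob C \<Longrightarrow> Y A \<in> T"
  shows "left_adjoint C (subPSh T) reflector (yoneda C)"
  unfolding left_adjoint_def
proof (intro conjI exI ballI)
  have "is_functor (subPSh T) (subPSh bicovered) inclusion"
    by (rule is_functorI[OF category_subPSh category_subPSh]) (use T in \<open>auto split: if_splits\<close>)
  from is_functor_fcomp[OF this is_functor_reflector] show "is_functor (subPSh T) C reflector" unfolding fcomp_inclusion .
  show "is_functor C (subPSh T) (yoneda C)" by (rule is_functor_yoneda[OF T(2)])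
  let ?\<theta> = "\<lambda>X A k. ntcomp X (Y (refl_ob X)) (Y A) (fa (yoneda C) (refl_ob X) A k) (unit X)"
  fix X assume "X \<in> Ob (subPSh T)"
  then have X: "X \<in> T" "X \<in> bicovered" "small_presheaf C X" using T by auto
  note uX = nt_unit[OF X(2)]
  show "bij_betw (?\<theta> X A) (Hom C (fo reflector X) A) (Hom (subPSh T) X (Y A))" if A: "A \<in> Ob C" for A
    unfolding bij_betw_def fo_reflector
  proof (intro conjI equalityI subsetI)
    show "inj_on (?\<theta> X A) (Hom C (refl_ob X) A)" by (rule inj_onI) (rule unit_unique[OF X(2)])
    fix t assume "t \<in> Hom (subPSh T) X (Y A)"
    then have "nt X (Y A) t" unfolding Hom_subPSh by blast
    from unit_ex[OF X(2) this A] show "t \<in> ?\<theta> X A ` Hom C (refl_ob X) A" by blast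
  next
    fix t assume "t \<in> ?\<theta> X A ` Hom C (refl_ob X) A"
    then obtain k where k: "k \<in> Hom C (refl_ob X) A" "t = ?\<theta> X A k" by blast
    then show "t \<in> Hom (subPSh T) X (Y A)"
      unfolding Hom_subPSh using X T(2)[OF A] small_presheaf_Y[OF A] nt_comp[OF uX nt_yoneda[OF k(1)]] by blast
  qed
  fix X' A A' h k g
  assume X'': "X' \<in> Ob (subPSh T)" and A: "A \<in> Ob C" "A' \<in> Ob C" and h: "h \<in> Hom (subPSh T) X' X"
    and k: "k \<in> Hom C (fo reflector X) A" and g: "g \<in> Hom C A A'"
  have X': "X' \<in> bicovered" using X'' T by auto
  have nh: "nt X' X h" using h unfolding Hom_subPSh by blast
  note uX' = nt_unit[OF X'] and rh = fa_reflector[OF X' X(2) nh]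
  have k: "k \<in> Hom C (refl_ob X) A" using k by simp
  note yk = nt_yoneda[OF k] and yg = nt_yoneda[OF g] and yr = nt_yoneda[OF rh(1)]
  have "?\<theta> X' A' (Cmp C (refl_ob X') A A' g (Cmp C (refl_ob X') (refl_ob X) A k (fa reflector X' X h))) =
     ntcomp X' (Y A) (Y A') (fa (yoneda C) A A' g) (ntcomp X' X (Y A) (?\<theta> X A k) h)"
    unfolding yoneda_comp[OF compC[OF rh(1) k] g] yoneda_comp[OF rh(1) k]
      ntassoc[OF uX' nt_comp[OF yr yk] yg] ntassoc[OF uX' yr yk] rh(2) ntassoc[OF nh uX yk] ..
  then show "?\<theta> X' A' (Cmp C (fo reflector X') A A' g (Cmp C (fo reflector X') (fo reflector X) A k (fa reflector X' X h))) =
     Cmp (subPSh T) X' (Y A) (Y A') (fa (yoneda C) A A' g) (Cmp (subPSh T) X' X (Y A) (?\<theta> X A k) h)"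
    by simp
qed

text \<open>\<open>lex_closure \<Phi> C\<close> contains the representables, so limits computed in
  it are pointwise, and the reflector on \<open>bicovered\<close> preserves those.\<close>

lemma postulated_imp_lex_exact:
  assumes \<Phi>: "\<forall>w\<in>\<Phi>. lex_weight w" and cocomplete: "lex_cocomplete \<Phi> C" and post: "lex_colimits_postulated \<Phi> C"
  shows "lex_exact \<Phi> C"
  unfolding lex_exact_def lex_cocompletion_def
proof (intro conjI exI fin_complete)
  let ?T = "lex_closure \<Phi> C"
  have T: "?T \<subseteq> bicovered" using lex_closure_bicovered[OF assms] by blast
  show "left_adjoint C (subPSh ?T) reflector (yoneda C)" by (rule left_adjoint_reflector[OF T lex_closure_Y])
  show "preserves_finite_limits (subPSh ?T) C reflector"
    unfolding preserves_finite_limits_def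
  proof (intro allI impI)
    fix J :: "(nat, nat) cat" and G L \<pi>
    assume a: "finite_category J \<and> is_functor J (subPSh ?T) G \<and> is_limit J (subPSh ?T) G L \<pi>"
    have pl: "plim J G L \<pi>" by (rule limit_imp_plim[OF _ _ lex_closure_Y]) (use a in auto)
    have G: "is_functor J (subPSh bicovered) G"
    proof (rule is_functor_full_sub[OF is_functor_of_full_sub[OF _ category_PSh]])
      show "is_functor J (subPSh ?T) G" using a by blast
      fix j assume "j \<in> Ob J"
      then have "fo G j \<in> Ob (subPSh ?T)" using a is_functorD(3)[of J "subPSh ?T" G j] by blast
      then show "fo G j \<in> bicovered" using T by auto
    qed
    show "is_limit J C (fcomp reflector G) (fo reflector L) (\<lambda>j. fa reflector L (fo G j) (\<pi> j))"
      using plim_bicovered(2)[OF conjunct1[OF a] G pl] by simp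
  qed
qed

end

theorem theorem6p4:
  fixes \<Phi> :: "'u weight set" and C :: "('o, 'u) cat"
  assumes "universe TYPE('u)"
    and "\<forall>w\<in>\<Phi>. lex_weight w"
    and "locally_small C" and "finitely_complete C" and "lex_cocomplete \<Phi> C"
  shows "lex_exact \<Phi> C \<longleftrightarrow> lex_colimits_postulated \<Phi> C"
proof -
  interpret site C by (rule site.intro) (fact assms)+
  show ?thesis
    using lex_exact_imp_postulated[OF assms(2)] postulated_imp_lex_exact[OF assms(2,5)] by blast
qed

end
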